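(* Let $j\ge 2$ be an integer, let $\lambda\ge 1$, let $s\ge -j+\frac12$, and let $u_0$ be $2\pi\lambda$-periodic. Then the Cauchy problem $$u_t+(-1)^{j+1}\partial_x^{2j+1}u+\tfrac12\partial_x(u^2)=0,\qquad u(x,0)=u_0(x),\qquad x\in\mathbf{T}=[0,2\pi\lambda),$$ is locally well-posed in $H^s(\mathbf{T})$.
   Context: $\mathbf{T}=[0,2\pi\lambda)$ with periodic boundary conditions. Write $\dot Z_\lambda=\{m/\lambda: m\in\mathbb{Z}\setminus\{0\}\}$ and let $(dk)_\lambda$ be the normalized counting measure on it, $\int a(k)(dk)_\lambda=\frac1\lambda\sum_{k\in\dot Z_\lambda}a(k)$. For a $2\pi\lambda$-periodic $f$, $\mathscr{F}_xf(k)=\int_0^{2\pi\lambda}e^{-ikx}f(x)\,dx$. Throughout, only nonzero frequencies $k\in\dot Z_\lambda$ occur (periodic functions have mean zero). $H^s(\mathbf{T})$ is the Sobolev space of such (mean-zero) periodic distributions with norm $\|f\|_{H^s(\mathbf{T})}=\|\langle k\rangle^s\mathscr{F}_xf(k)\|_{L^2((dk)_\lambda)}$, where $\langle k\rangle=(1+|k|^2)^{1/2}$. "Locally well-posed in $H^s(\mathbf{T})$" has the standard meaning: for each $u_0\in H^s(\mathbf{T})$ there are $T>0$ and a solution $u$ on $[0,T]$ (in the sense of the Duhamel integral equation), unique in a suitable function space continuously embedded in $C([0,T];H^s(\mathbf{T}))$, and the solution depends continuously on the initial data. *)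

theory Defs
  imports "HOL-Analysis.Analysis"
begin

section \<open>Periodic distributions and Sobolev spaces\<close>

text \<open>Complex-valued distributions on the circle of length \<open>2 \<pi> lam\<close> are continuous linear
  functionals on the space of smooth \<open>2 \<pi> lam\<close>-periodic functions of one real variable.
  As HOL functions are total, they are taken to be zero on all other functions, so that equality
  of distributions is equality in HOL.\<close>

definition vderiv :: "(real \<Rightarrow> complex) \<Rightarrow> real \<Rightarrow> complex" where
  "vderiv \<phi> = (\<lambda>x. vector_derivative \<phi> (at x))"

definition test_fun :: "real \<Rightarrow> (real \<Rightarrow> complex) \<Rightarrow> bool" where
  "test_fun lam \<phi> \<longleftrightarrow>
     (\<forall>n. (vderiv ^^ n) \<phi> differentiable_on UNIV) \<and> (\<forall>x. \<phi> (x + 2 * pi * lam) = \<phi> x)"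

type_synonym distr = "(real \<Rightarrow> complex) \<Rightarrow> complex"

text \<open>The last clause is continuity in the Frechet topology of the test functions, given by
  uniform convergence of all derivatives.\<close>

definition periodic_distr :: "real \<Rightarrow> distr \<Rightarrow> bool" where
  "periodic_distr lam f \<longleftrightarrow>
     (\<forall>\<phi>. \<not> test_fun lam \<phi> \<longrightarrow> f \<phi> = 0) \<and>
     (\<forall>\<phi> \<psi>. test_fun lam \<phi> \<longrightarrow> test_fun lam \<psi> \<longrightarrow> f (\<lambda>x. \<phi> x + \<psi> x) = f \<phi> + f \<psi>) \<and>
     (\<forall>c \<phi>. test_fun lam \<phi> \<longrightarrow> f (\<lambda>x. c * \<phi> x) = c * f \<phi>) \<and>
     (\<exists>C N. \<forall>\<phi> B. test_fun lam \<phi> \<longrightarrow> (\<forall>n\<le>N. \<forall>x. norm ((vderiv ^^ n) \<phi> x) \<le> B)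
              \<longrightarrow> norm (f \<phi>) \<le> C * B)"

definition distr_of_fun :: "real \<Rightarrow> (real \<Rightarrow> complex) \<Rightarrow> distr" where
  "distr_of_fun lam g =
     (\<lambda>\<phi>. if test_fun lam \<phi> then integral {0..2 * pi * lam} (\<lambda>x. g x * \<phi> x) else 0)"

definition distr_add :: "distr \<Rightarrow> distr \<Rightarrow> distr" where
  "distr_add f g = (\<lambda>\<phi>. f \<phi> + g \<phi>)"

definition distr_diff :: "distr \<Rightarrow> distr \<Rightarrow> distr" where
  "distr_diff f g = (\<lambda>\<phi>. f \<phi> - g \<phi>)"

definition distr_scale :: "complex \<Rightarrow> distr \<Rightarrow> distr" where
  "distr_scale c f = (\<lambda>\<phi>. c * f \<phi>)"

definition freqs :: "real \<Rightarrow> real set" where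
  "freqs lam = {of_int m / lam | m :: int. m \<noteq> 0}"

definition fourier_fun :: "real \<Rightarrow> (real \<Rightarrow> complex) \<Rightarrow> real \<Rightarrow> complex" where
  "fourier_fun lam g k =
     integral {0..2 * pi * lam} (\<lambda>x. exp (- \<i> * of_real k * of_real x) * g x)"

definition fourier :: "distr \<Rightarrow> real \<Rightarrow> complex" where
  "fourier f k = f (\<lambda>x. exp (- \<i> * of_real k * of_real x))"

definition jbracket :: "real \<Rightarrow> real" where
  "jbracket k = sqrt (1 + \<bar>k\<bar>\<^sup>2)"

text \<open>The second clause says that the mean (the Fourier coefficient at frequency zero)
  vanishes.\<close>

definition Hs :: "real \<Rightarrow> real \<Rightarrow> distr set" where
  "Hs lam s = {f. periodic_distr lam f \<and> fourier f 0 = 0 \<and>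
     (\<lambda>k. (jbracket k powr s * norm (fourier f k))\<^sup>2) summable_on freqs lam}"

definition Hs_norm :: "real \<Rightarrow> real \<Rightarrow> distr \<Rightarrow> real" where
  "Hs_norm lam s f =
     sqrt (1 / lam * (\<Sum>\<^sub>\<infinity>k\<in>freqs lam. (jbracket k powr s * norm (fourier f k))\<^sup>2))"

section \<open>Functions of time\<close>

text \<open>A function on the time interval \<open>[0, T]\<close> is represented by a total function of time whose
  values outside \<open>[0, T]\<close> are irrelevant.\<close>

definition CHs :: "real \<Rightarrow> real \<Rightarrow> real \<Rightarrow> (real \<Rightarrow> distr) set" where
  "CHs lam s T = {u. (\<forall>t\<in>{0..T}. u t \<in> Hs lam s) \<and>
     (\<forall>t\<in>{0..T}. ((\<lambda>r. Hs_norm lam s (distr_diff (u r) (u t))) \<longlongrightarrow> 0) (at t within {0..T}))}"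

text \<open>Smooth functions on the product of the time axis and the circle, with mean zero in space;
  \<open>D m l\<close> is the mixed derivative of order \<open>m\<close> in time and \<open>l\<close> in space.\<close>

definition smooth_spacetime :: "real \<Rightarrow> (real \<Rightarrow> real \<Rightarrow> complex) \<Rightarrow> bool" where
  "smooth_spacetime lam g \<longleftrightarrow>
     (\<exists>D :: nat \<Rightarrow> nat \<Rightarrow> real \<Rightarrow> real \<Rightarrow> complex. D 0 0 = g \<and>
        (\<forall>m l. continuous_on UNIV (\<lambda>(t, x). D m l t x)) \<and>
        (\<forall>m l t x. ((\<lambda>r. D m l r x) has_vector_derivative D (Suc m) l t x) (at t)) \<and>
        (\<forall>m l t x. ((\<lambda>y. D m l t y) has_vector_derivative D m (Suc l) t x) (at x))) \<and>
     (\<forall>t x. g t (x + 2 * pi * lam) = g t x) \<and>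
     (\<forall>t. integral {0..2 * pi * lam} (g t) = 0)"

text \<open>The function spaces admitted as uniqueness classes: Banach spaces \<open>(Y, nrm)\<close> of functions on
  \<open>[0, T]\<close>, continuously embedded in \<open>C([0, T]; H^s)\<close>, that contain the smooth functions. The last
  requirement ensures that uniqueness in \<open>Y\<close> also covers the classical smooth solutions; without
  it \<open>Y\<close> could be shrunk artificially around selected solutions. Functions that agree on
  \<open>[0, T]\<close> are identified: \<open>Y\<close> and \<open>nrm\<close> depend on the restriction to \<open>[0, T]\<close> only.\<close>

definition solution_space ::
  "real \<Rightarrow> real \<Rightarrow> real \<Rightarrow> (real \<Rightarrow> distr) set \<Rightarrow> ((real \<Rightarrow> distr) \<Rightarrow> real) \<Rightarrow> bool" where
  "solution_space lam s T Y nrm \<longleftrightarrow>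
     \<comment> \<open>functions on the time interval\<close>
     (\<forall>u\<in>Y. \<forall>v. (\<forall>t\<in>{0..T}. v t = u t) \<longrightarrow> v \<in> Y \<and> nrm v = nrm u) \<and>
     \<comment> \<open>normed vector space\<close>
     (\<lambda>t \<phi>. 0) \<in> Y \<and>
     (\<forall>u\<in>Y. \<forall>v\<in>Y. (\<lambda>t. distr_add (u t) (v t)) \<in> Y \<and>
        nrm (\<lambda>t. distr_add (u t) (v t)) \<le> nrm u + nrm v) \<and>
     (\<forall>c. \<forall>u\<in>Y. (\<lambda>t. distr_scale c (u t)) \<in> Y \<and>
        nrm (\<lambda>t. distr_scale c (u t)) = norm c * nrm u) \<and>
     (\<forall>u\<in>Y. 0 \<le> nrm u \<and> (nrm u = 0 \<longleftrightarrow> (\<forall>t\<in>{0..T}. u t = (\<lambda>\<phi>. 0)))) \<and>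
     \<comment> \<open>completeness\<close>
     (\<forall>U :: nat \<Rightarrow> real \<Rightarrow> distr. (\<forall>n. U n \<in> Y) \<longrightarrow>
        (\<forall>e>0. \<exists>M. \<forall>m\<ge>M. \<forall>n\<ge>M. nrm (\<lambda>t. distr_diff (U m t) (U n t)) < e) \<longrightarrow>
        (\<exists>u\<in>Y. (\<lambda>n. nrm (\<lambda>t. distr_diff (U n t) (u t))) \<longlonglongrightarrow> 0)) \<and>
     \<comment> \<open>continuous embedding\<close>
     Y \<subseteq> CHs lam s T \<and>
     (\<exists>C. \<forall>u\<in>Y. \<forall>t\<in>{0..T}. Hs_norm lam s (u t) \<le> C * nrm u) \<and>
     \<comment> \<open>smooth functions\<close>
     (\<forall>g. smooth_spacetime lam g \<longrightarrow> (\<lambda>t. distr_of_fun lam (g t)) \<in> Y)"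

section \<open>The Cauchy problem\<close>

text \<open>The Fourier symbol of the linear operator \<open>(-1)^(j+1) (d/dx)^(2j+1)\<close>.\<close>

definition lin_symbol :: "nat \<Rightarrow> real \<Rightarrow> complex" where
  "lin_symbol j k = (-1) ^ (j + 1) * (\<i> * of_real k) ^ (2 * j + 1)"

text \<open>Fourier truncation to the frequencies of size at most \<open>N\<close>, by the inversion formula
  \<open>f(x) = 1/(2 pi) \<integral> e^(ikx) F f(k) (dk)_lam\<close>.\<close>

definition trunc :: "real \<Rightarrow> nat \<Rightarrow> distr \<Rightarrow> real \<Rightarrow> complex" where
  "trunc lam N f x = of_real (1 / (2 * pi * lam)) *
     (\<Sum>k\<in>{k \<in> freqs lam. \<bar>k\<bar> \<le> real N}. fourier f k * exp (\<i> * of_real k * of_real x))"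

text \<open>The Duhamel equation
  \<open>u(t) = S(t) u0 - 1/2 \<integral>_0^t S(t - r) \<partial>_x (u(r)^2) dr\<close> on \<open>[0, T]\<close>, written for the Fourier
  coefficients, which determine an element of \<open>H^s\<close>. For negative \<open>s\<close> the square of an element of
  \<open>H^s\<close> is in general not defined; the nonlinear term is understood as the limit of the terms
  with the Fourier truncation of \<open>u\<close> in place of \<open>u\<close>. If \<open>u \<in> C([0, T]; L^2)\<close>, in particular if
  \<open>s \<ge> 0\<close>, then the squares converge in \<open>C([0, T]; L^1)\<close>, and the limit is the Duhamel integral
  with the pointwise square.\<close>

definition duhamel_solution ::
  "nat \<Rightarrow> real \<Rightarrow> real \<Rightarrow> real \<Rightarrow> distr \<Rightarrow> (real \<Rightarrow> distr) \<Rightarrow> bool" where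
  "duhamel_solution j lam s T u0 u \<longleftrightarrow> u \<in> CHs lam s T \<and>
     (\<forall>t\<in>{0..T}. \<forall>k\<in>freqs lam.
        (\<lambda>N. exp (- of_real t * lin_symbol j k) * fourier u0 k
             - 1 / 2 * integral {0..t} (\<lambda>r. exp (- of_real (t - r) * lin_symbol j k) *
                 (\<i> * of_real k) * fourier_fun lam (\<lambda>x. (trunc lam N (u r) x)\<^sup>2) k))
        \<longlonglongrightarrow> fourier (u t) k)"

text \<open>The spaces \<open>Y T\<close> do not depend on the initial datum. The existence time \<open>T\<close> is uniform for
  data near a given \<open>u0\<close>, as is needed to compare solutions when stating that the data-to-solution
  map \<open>\<Phi>\<close> into \<open>C([0, T]; H^s)\<close> is continuous.\<close>

definition locally_well_posed :: "nat \<Rightarrow> real \<Rightarrow> real \<Rightarrow> bool" where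
  "locally_well_posed j lam s \<longleftrightarrow>
     (\<exists>(Y :: real \<Rightarrow> (real \<Rightarrow> distr) set) (nrm :: real \<Rightarrow> (real \<Rightarrow> distr) \<Rightarrow> real).
        (\<forall>T>0. solution_space lam s T (Y T) (nrm T)) \<and>
        (\<forall>u0\<in>Hs lam s. \<exists>T>0. \<exists>R>0. \<exists>\<Phi> :: distr \<Rightarrow> real \<Rightarrow> distr.
           let V = {v0 \<in> Hs lam s. Hs_norm lam s (distr_diff v0 u0) < R} in
           (\<forall>v0\<in>V. \<Phi> v0 \<in> Y T \<and> duhamel_solution j lam s T v0 (\<Phi> v0) \<and>
              (\<forall>w\<in>Y T. duhamel_solution j lam s T v0 w \<longrightarrow> (\<forall>t\<in>{0..T}. w t = \<Phi> v0 t))) \<and>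
           (\<forall>v0\<in>V. \<forall>e>0. \<exists>d>0. \<forall>w0\<in>V. Hs_norm lam s (distr_diff w0 v0) < d \<longrightarrow>
              (\<forall>t\<in>{0..T}. Hs_norm lam s (distr_diff (\<Phi> w0 t) (\<Phi> v0 t)) < e))))"

end

theory Submission
  imports Defs
begin

text \<open>Let \<open>v(t, m) = e^(-i t K(m)) F u(t)(m / lam)\<close> with \<open>K(m) = (m / lam)^(2 j + 1)\<close>. The Duhamel
  equation becomes \<open>v(t, m) = v(0, m) - kap m \<Sum>_n \<integral>_0^t e^(-i r Om(m, n)) v(r, n) v(r, m - n) dr\<close>
  with the phase \<open>Om(m, n) = K(m) - K(n) - K(m - n)\<close>, which is an odd function of each of
  \<open>m\<close>, \<open>n\<close>, \<open>m - n\<close> with a positive expansion, and therefore at least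
  \<open>c |m| |n| |m - n| max(|m|, |n|, |m - n|)^(2 j - 2)\<close> in modulus. Integrating by parts in time
  gains \<open>1 / Om\<close>, which pays for the derivative and for \<open>s \<ge> 1/2 - j\<close>.

  The boundary term of this integration is small but oscillates as fast as \<open>Om\<close>. The solution
  space therefore consists of the sums \<open>v(t, m) = f_m(t) + \<Sum>_n g_(m,n)(t) e^(-i t Om(m, n))\<close>, where
  \<open>f_m\<close> has a Hoelder modulus of continuity of order about \<open>1 - 1/(2 j)\<close>, and \<open>g_(m,n)\<close>, carrying a
  factor \<open>1 / Om\<close>, one of order \<open>1/2\<close>. The product of two functions \<open>f\<close> is averaged at the time
  scale of the oscillation before integrating by parts; this gives a new function \<open>g\<close> and a remainder
  that is again of type \<open>f\<close>. When a factor is of type \<open>g\<close>, the phases add up to a quadrilinear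
  resonance function, a multiple of \<open>(p + q) (q + r) (p + r)\<close> for frequencies \<open>p, q, r\<close>, and the
  result is of type \<open>f\<close>. On short time intervals the bilinear operator has small norm, so Picard
  iteration gives solutions that depend Lipschitz continuously on the data, and uniqueness follows
  step by step in time, without any restriction on the size of the solutions. Smooth functions are
  of type \<open>f\<close>. Periodic distributions are recovered from their coefficients because the Fourier
  series of a test function converges with all its derivatives.\<close>

section \<open>The resonance function\<close>

text \<open>The usual normal form integrates by parts in time and substitutes the equation for the
  time derivative of \<open>v\<close>. At this regularity the derivative is not controlled, so a
  Hoelder modulus has to replace it, and its order is forced. When two frequencies of size M produce
  one of size 1, the weights at \<open>s = 1/2 - j\<close> grow like M^(2j-1), the phase like
  M^(2j). The remainder carries the phase to the power minus the Hoelder order, which therefore has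
  to be at least (2j-1)/(2j), with nothing to spare. As no power of the frequency is left over at
  the endpoint, smallness has four other sources: a factor \<open>\<delta>\<close> in the norm of
  the modulated part, a factor \<open>\<eta>\<close> in front of the modulus of continuity, a
  threshold \<open>R\<close> below which phases count as slow, and the length of the time interval,
  chosen in this order. They allow data of any size without rescaling the equation.\<close>

lemma odd_power_cubic_lower:
  fixes X Y Z :: real
  assumes "X \<ge> 0" "Y \<ge> 0" "Z \<ge> 0" "odd d" "d \<ge> 3"
  shows "(X + Y + Z)^d - (X + Z - Y)^d - (X + Y - Z)^d - (Y + Z - X)^d \<ge> 8 * X * Y * Z * Z^(d-3)"
proof -
  define S where "S = X + Y"
  define D where "D = X - Y"
  \<comment> \<open>Odd \<open>i\<close> cancel and even \<open>i\<close> are nonnegative because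
    \<open>\<bar>D\<bar> \<le> S\<close>, so any single term bounds the sum from below. The term
    \<open>i = 2\<close> is kept: its bracket \<open>2 * S^2 - 2 * D^2\<close> equals
    \<open>8 * X * Y\<close>.\<close>
  define h where "h i = of_nat (d choose i) * Z^(d-i) * (S^i + (-S)^i - D^i - (-D)^i)" for i
  have SD: "\<bar>D\<bar> \<le> S" "S \<ge> 0" using assms unfolding S_def D_def by auto
  have e1: "(X + Y - Z)^d = - ((Z - S)^d)"
    using \<open>odd d\<close> unfolding S_def by (metis minus_diff_eq power_minus_odd)
  have "(X + Y + Z)^d - (X + Z - Y)^d - (X + Y - Z)^d - (Y + Z - X)^d
     = (S + Z)^d + (-S + Z)^d - (D + Z)^d - (-D + Z)^d"
    unfolding e1 by (simp add: S_def D_def algebra_simps)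
  also have "\<dots> = (\<Sum>i\<le>d. h i)"
    unfolding binomial_ring h_def sum.distrib[symmetric] sum_subtractf[symmetric]
    by (intro sum.cong refl) (simp only: ring_distribs mult.commute mult.left_commute mult.assoc)
  also have "\<dots> \<ge> (\<Sum>i\<in>{2}. h i)"
  proof (rule sum_mono2)
    fix i assume "i \<in> {..d} - {2}"
    have "D^i + (-D)^i \<le> S^i + (-S)^i"
    proof (cases "even i")
      case True
      have "D^i \<le> S^i" using SD True by (metis power_even_abs power_mono abs_ge_zero)
      then show ?thesis using True by simp
    next
      case False
      then show ?thesis by simp
    qed
    then show "0 \<le> h i" unfolding h_def using assms by (intro mult_nonneg_nonneg) auto
  qed (use assms in auto)
  finally have 1: "(X + Y + Z)^d - (X + Z - Y)^d - (X + Y - Z)^d - (Y + Z - X)^d \<ge> h 2" by simp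
  have "S^2 + (-S)^2 - D^2 - (-D)^2 = 8 * X * Y"
    unfolding S_def D_def by (simp add: power2_eq_square algebra_simps)
  then have "h 2 = of_nat (d choose 2) * Z^(d-2) * (8 * X * Y)" unfolding h_def by simp
  moreover have "Z^(d-2) = Z * Z^(d-3)"
    using assms by (metis Suc_diff_le diff_Suc_Suc eval_nat_numeral(3) power_Suc)
  moreover have "(1::real) \<le> of_nat (d choose 2)"
    using assms by (simp add: Suc_leI)
  moreover have "0 \<le> 8 * X * Y * Z * Z^(d-3)" using assms by simp
  ultimately have "h 2 \<ge> 8 * X * Y * Z * Z^(d-3)"
    using mult_right_mono[of 1 "of_nat (d choose 2)" "8 * X * Y * Z * Z^(d-3)"]
    by (simp add: mult_ac)
  with 1 show ?thesis by linarith
qed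

text \<open>This is \<open>2^d\<close> times the resonance function
  \<open>(p + q + r)^d - p^d - q^d - r^d\<close>, written in the pair sums \<open>X = p + q\<close>,
  \<open>Y = q + r\<close>, \<open>Z = p + r\<close>, at whose zeros it vanishes.\<close>

definition cubic_form :: "nat \<Rightarrow> real \<Rightarrow> real \<Rightarrow> real \<Rightarrow> real" where
  "cubic_form d X Y Z = (X + Y + Z)^d - (X + Z - Y)^d - (X + Y - Z)^d - (Y + Z - X)^d"

text \<open>A sign change permutes the four powers up to sign, as \<open>d\<close> is odd. This
  reduces the lower bound to nonnegative arguments.\<close>

lemma cubic_form_minus:
  assumes "odd d"
  shows "cubic_form d (-X) Y Z = - cubic_form d X Y Z"
    "cubic_form d X (-Y) Z = - cubic_form d X Y Z"
    "cubic_form d X Y (-Z) = - cubic_form d X Y Z"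
proof -
  have *: "(-(b::real))^d = - (b^d)" for b
    using assms by (simp add: power_minus_odd)
  have n: "-X+Y+Z = Y+Z-X" "-X+Z-Y = -(X+Y-Z)" "-X+Y-Z = -(X+Z-Y)" "Y+Z-(-X) = X+Y+Z"
    "X+(-Y)+Z = X+Z-Y" "X+Z-(-Y) = X+Y+Z" "X+(-Y)-Z = -(Y+Z-X)" "-Y+Z-X = -(X+Y-Z)"
    "X+Y+(-Z) = X+Y-Z" "X+(-Z)-Y = -(Y+Z-X)" "X+Y-(-Z) = X+Y+Z" "Y+(-Z)-X = -(X+Z-Y)"
    by simp_all
  show "cubic_form d (-X) Y Z = - cubic_form d X Y Z"
    "cubic_form d X (-Y) Z = - cubic_form d X Y Z"
    "cubic_form d X Y (-Z) = - cubic_form d X Y Z"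
    unfolding cubic_form_def n * by linarith+
qed

lemma cubic_form_lower_third:
  assumes "odd d" "d \<ge> 3"
  shows "\<bar>cubic_form d X Y Z\<bar> \<ge> 8 * \<bar>X\<bar> * \<bar>Y\<bar> * \<bar>Z\<bar> * \<bar>Z\<bar>^(d-3)"
proof -
  have s: "\<bar>cubic_form d X Y Z\<bar> = \<bar>cubic_form d \<bar>X\<bar> \<bar>Y\<bar> \<bar>Z\<bar>\<bar>"
    by (auto simp: abs_if cubic_form_minus[OF assms(1)])
  show ?thesis
    unfolding s using odd_power_cubic_lower[of "\<bar>X\<bar>" "\<bar>Y\<bar>" "\<bar>Z\<bar>" d] assms
    unfolding cubic_form_def by linarith
qed

lemma cubic_form_lower:
  assumes "odd d" "d \<ge> 3" "W = \<bar>X\<bar> \<or> W = \<bar>Y\<bar> \<or> W = \<bar>Z\<bar>"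
  shows "\<bar>cubic_form d X Y Z\<bar> \<ge> 8 * \<bar>X\<bar> * \<bar>Y\<bar> * \<bar>Z\<bar> * W^(d-3)"
proof -
  have 1: "cubic_form d X Y Z = cubic_form d Y Z X"
    and 2: "cubic_form d X Y Z = cubic_form d Z X Y"
    unfolding cubic_form_def by (simp_all add: algebra_simps)
  have 3: "8 * \<bar>Y\<bar> * \<bar>Z\<bar> * \<bar>X\<bar> = 8 * \<bar>X\<bar> * \<bar>Y\<bar> * \<bar>Z\<bar>"
    "8 * \<bar>Z\<bar> * \<bar>X\<bar> * \<bar>Y\<bar> = 8 * \<bar>X\<bar> * \<bar>Y\<bar> * \<bar>Z\<bar>" by simp_all
  show ?thesis
    using assms(3) cubic_form_lower_third[OF assms(1,2), of X Y Z]
      cubic_form_lower_third[OF assms(1,2), of Y Z X] cubic_form_lower_third[OF assms(1,2), of Z X Y]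
    unfolding 1[symmetric] 2[symmetric] 3 by blast
qed

text \<open>\<open>p\<close>, \<open>q\<close>, \<open>r\<close> are half sums of signed
  \<open>X\<close>, \<open>Y\<close>, \<open>Z\<close>, hence at most twice the largest of these.
  This costs \<open>2^(d-3)\<close> and lets the power be taken of whichever frequency is
  convenient.\<close>

lemma resonance_lower:
  fixes p q r :: real
  assumes "odd d" "d \<ge> 3" "X = p + q" "Y = q + r" "Z = p + r"
    and W: "W \<in> {\<bar>X\<bar>, \<bar>Y\<bar>, \<bar>Z\<bar>, \<bar>p\<bar>, \<bar>q\<bar>, \<bar>r\<bar>}"
  shows "\<bar>(p + q + r)^d - p^d - q^d - r^d\<bar> \<ge> 8 / 2^d / 2^(d-3) * (\<bar>X\<bar> * \<bar>Y\<bar> * \<bar>Z\<bar> * W^(d-3))"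
proof -
  have pq: "p + q + r = (X+Y+Z)/2" "p = (X+Z-Y)/2" "q = (X+Y-Z)/2" "r = (Y+Z-X)/2"
    using assms by auto
  have eq: "(p + q + r)^d - p^d - q^d - r^d = cubic_form d X Y Z / 2^d"
  proof -
    have "(p + q + r)^d = (X+Y+Z)^d / 2^d" by (simp only: pq(1) power_divide)
    moreover have "p^d = (X+Z-Y)^d / 2^d" by (subst pq(2)) (simp only: power_divide)
    moreover have "q^d = (X+Y-Z)^d / 2^d" by (subst pq(3)) (simp only: power_divide)
    moreover have "r^d = (Y+Z-X)^d / 2^d" by (subst pq(4)) (simp only: power_divide)
    ultimately show ?thesis unfolding cubic_form_def by (simp add: diff_divide_distrib)
  qed
  obtain V where V: "V = \<bar>X\<bar> \<or> V = \<bar>Y\<bar> \<or> V = \<bar>Z\<bar>" "\<bar>X\<bar> \<le> V" "\<bar>Y\<bar> \<le> V" "\<bar>Z\<bar> \<le> V"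
    by (metis linorder_linear order_trans)
  have "\<bar>p\<bar> \<le> 2 * V" using V(2-4) pq(2) unfolding abs_le_iff by (simp add: field_simps)
  moreover have "\<bar>q\<bar> \<le> 2 * V" using V(2-4) pq(3) unfolding abs_le_iff by (simp add: field_simps)
  moreover have "\<bar>r\<bar> \<le> 2 * V" using V(2-4) pq(4) unfolding abs_le_iff by (simp add: field_simps)
  moreover have "V \<le> 2 * V" using V(2) abs_ge_zero[of X] by linarith
  ultimately have "W \<le> 2 * V" using W V(2-4) by (auto simp del: abs_le_iff intro: order_trans)
  have "0 \<le> W" using W by auto
  with \<open>W \<le> 2 * V\<close> have "W^(d-3) \<le> (2*V)^(d-3)" by (intro power_mono)
  then have Wb: "W^(d-3) / 2^(d-3) \<le> V^(d-3)" by (simp add: power_mult_distrib field_simps)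
  have "8 * \<bar>X\<bar> * \<bar>Y\<bar> * \<bar>Z\<bar> * (W^(d-3) / 2^(d-3)) \<le> 8 * \<bar>X\<bar> * \<bar>Y\<bar> * \<bar>Z\<bar> * V^(d-3)"
    by (intro mult_left_mono Wb) auto
  also have "\<dots> \<le> \<bar>cubic_form d X Y Z\<bar>" by (rule cubic_form_lower[OF assms(1,2) V(1)])
  finally have f: "8 * \<bar>X\<bar> * \<bar>Y\<bar> * \<bar>Z\<bar> * (W^(d-3) / 2^(d-3)) \<le> \<bar>cubic_form d X Y Z\<bar>" .
  have "8 / 2^d / 2^(d-3) * (\<bar>X\<bar> * \<bar>Y\<bar> * \<bar>Z\<bar> * W^(d-3)) = 8 * \<bar>X\<bar> * \<bar>Y\<bar> * \<bar>Z\<bar> * (W^(d-3) / 2^(d-3)) / 2^d"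
    by (simp only: times_divide_eq_left times_divide_eq_right divide_divide_eq_left mult.assoc mult.commute[of "2^d"])
  also have "\<dots> \<le> \<bar>cubic_form d X Y Z\<bar> / 2^d" by (intro divide_right_mono f) auto
  also have "\<dots> = \<bar>(p + q + r)^d - p^d - q^d - r^d\<bar>" unfolding eq by simp
  finally show ?thesis .
qed

section \<open>Exponents and phases of the equation in integer frequencies\<close>

locale hkdv =
  fixes j :: nat and lam s :: real
  assumes j2: "j \<ge> 2" and lam1: "lam \<ge> 1" and s_ge: "s \<ge> - real j + 1 / 2"
begin

definition J :: real where "J = real j"
definition gam :: real where "gam = J - 1/2"
text \<open>\<open>bet = gam / J\<close> balances the interaction of two frequencies M into
  frequency 1 at \<open>s = - gam\<close>: the input weights give \<open>M powr (2 * gam)\<close>,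
  and the phase, of size \<open>M powr (2 * J)\<close>, enters with the power \<open>- bet\<close>.
  The complementary exponent \<open>ex\<close> is what remains as a gain in time.\<close>

definition ex :: real where "ex = 1 / (2 * J)"
definition bet :: real where "bet = 1 - ex"
definition D :: real where "D = s + gam"
definition K :: "int \<Rightarrow> real" where "K m = (of_int m / lam)^(2*j+1)"
definition Om :: "int \<Rightarrow> int \<Rightarrow> real" where "Om m n = K m - K n - K (m - n)"
definition c0 :: real where "c0 = 8 / 2^(2*j+1) / 2^(2*j-2) / lam^(2*j+1)"

lemma J2: "J \<ge> 2" using j2 unfolding J_def by simp
lemma c0_pos: "c0 > 0" using lam1 unfolding c0_def by simp
lemma D0: "D \<ge> 0" using s_ge unfolding D_def gam_def J_def by simp
lemma ex_pos: "ex > 0" "ex \<le> 1/4" using J2 unfolding ex_def by (auto simp: field_simps)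
lemma Jex: "J * ex = 1/2" using J2 unfolding ex_def by simp
lemma bet_bounds: "1/2 \<le> bet" "0 < bet" "bet < 1" using ex_pos unfolding bet_def by auto

text \<open>The intermediate \<open>K (q + r)\<close> telescopes. A modulated input adds its own
  phase to the outer one, which is how the resonance function of three frequencies arises.\<close>

lemma Om_triple:
  fixes p q r :: int
  shows "Om (p + q + r) (q + r) + Om (q + r) q
    = (of_int (p + q + r)^(2*j+1) - of_int p^(2*j+1) - of_int q^(2*j+1) - of_int r^(2*j+1)) / lam^(2*j+1)"
proof -
  have e: "p + q + r - (q + r) = p" "q + r - q = r" by simp_all
  show ?thesis unfolding Om_def e unfolding K_def power_divide diff_divide_distrib by simp
qed

lemma Om3_lower:
  fixes p q r :: int
  assumes "W \<in> {\<bar>p + q\<bar>, \<bar>q + r\<bar>, \<bar>p + r\<bar>, \<bar>p\<bar>, \<bar>q\<bar>, \<bar>r\<bar>}" "W > 0"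
  shows "\<bar>Om (p + q + r) (q + r) + Om (q + r) q\<bar>
    \<ge> c0 * (of_int \<bar>p + q\<bar> * of_int \<bar>q + r\<bar> * of_int \<bar>p + r\<bar> * of_int W powr (2*J-2))"
proof -
  have d: "odd (2*j+1)" "2*j+1 \<ge> 3" "2*j+1-3 = 2*j-2" using j2 by auto
  have W: "real_of_int W \<in> {\<bar>of_int p + of_int q\<bar>, \<bar>of_int q + of_int r\<bar>, \<bar>of_int p + of_int r\<bar>, \<bar>of_int p\<bar>, \<bar>of_int q\<bar>, \<bar>of_int r\<bar>}"
    using assms(1) by auto
  have pw: "real_of_int W powr (2*J-2) = of_int W^(2*j-2)"
    using assms(2) j2 powr_realpow[of "real_of_int W" "2*j-2"] unfolding J_def by (simp add: of_nat_diff)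
  have "8 / 2^(2*j+1) / 2^(2*j-2) * (\<bar>of_int p + of_int q\<bar> * \<bar>of_int q + of_int r\<bar> * \<bar>of_int p + of_int r\<bar> * of_int W^(2*j-2))
     \<le> \<bar>(of_int p + of_int q + of_int r)^(2*j+1) - of_int p^(2*j+1) - of_int q^(2*j+1) - (of_int r::real)^(2*j+1)\<bar>"
    using resonance_lower[OF d(1,2) refl refl refl W] unfolding d(3) .
  then have "8 / 2^(2*j+1) / 2^(2*j-2) * (\<bar>of_int p + of_int q\<bar> * \<bar>of_int q + of_int r\<bar> * \<bar>of_int p + of_int r\<bar> * of_int W^(2*j-2)) / lam^(2*j+1)
     \<le> \<bar>(of_int p + of_int q + of_int r)^(2*j+1) - of_int p^(2*j+1) - of_int q^(2*j+1) - (of_int r::real)^(2*j+1)\<bar> / lam^(2*j+1)"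
    using lam1 by (intro divide_right_mono) auto
  then show ?thesis
    unfolding Om_triple pw c0_def using lam1 by (simp add: field_simps)
qed

lemma Om_lower:
  fixes m n :: int
  assumes "W \<in> {\<bar>m\<bar>, \<bar>n\<bar>, \<bar>m - n\<bar>}" "W > 0"
  shows "\<bar>Om m n\<bar> \<ge> c0 * (of_int \<bar>m\<bar> * of_int \<bar>n\<bar> * of_int \<bar>m - n\<bar> * of_int W powr (2*J-2))"
proof -
  \<comment> \<open>The case of a vanishing third frequency: with \<open>p = m - n\<close>,
    \<open>q = n\<close>, \<open>r = 0\<close> the pair sums are \<open>m\<close>, \<open>n\<close>
    and \<open>m - n\<close>.\<close>
  have "Om n n = 0" unfolding Om_def K_def by simp
  then show ?thesis using Om3_lower[of W "m - n" n 0] assms by (auto simp: mult_ac)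
qed

end

section \<open>Kernel estimates\<close>

context hkdv
begin

text \<open>In logarithmic variables the kernel estimates become linear inequalities, and a power of
  the phase contributes a combination of the logarithms in its lower bound.\<close>

lemma powr_lower_neg:
  fixes O' x y z W t :: real
  assumes "x \<ge> 1" "y \<ge> 1" "z \<ge> 1" "W \<ge> 1" "t \<ge> 0"
    and "O' \<ge> c0 * (x * y * z * W powr (2*J-2))"
  shows "O' powr (-t) \<le> c0 powr (-t) * exp (- t * (ln x + ln y + ln z + (2*J-2) * ln W))"
proof -
  have "O' powr (-t) \<le> (c0 * (x * y * z * W powr (2*J-2))) powr (-t)"
    using assms c0_pos by (intro powr_mono2') auto
  also have "\<dots> = c0 powr (-t) * (x powr (-t) * y powr (-t) * z powr (-t) * (W powr (2*J-2)) powr (-t))"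
    using assms c0_pos by (simp add: powr_mult)
  also have "\<dots> = c0 powr (-t) * exp (- t * (ln x + ln y + ln z + (2*J-2) * ln W))"
    using assms unfolding powr_powr by (simp add: powr_def exp_add[symmetric] algebra_simps)
  finally show ?thesis .
qed

text \<open>This treats the part \<open>h powr bet\<close> of the moduli of the inputs, taken at
  \<open>h = 1 / O'\<close>. The surplus \<open>1 / x\<close> in the output frequency is square
  summable, which makes up for a sum over the inputs that is bounded only uniformly in the
  output.\<close>

lemma kernel_FF_fast:
  fixes O' x y z M :: real
  assumes "x \<ge> 1" "y \<ge> 1" "z \<ge> 1" "x \<le> M" "y \<le> M" "z \<le> M"
    and "O' \<ge> c0 * (x * y * z * M powr (2*J-2))"
  shows "x powr (1 - gam) * y powr gam * z powr gam * O' powr (-bet) \<le> c0 powr (-bet) * (1 / x)"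
proof -
  define a b c \<mu> where "a = ln x" "b = ln y" "c = ln z" "\<mu> = ln M"
  note d = this
  have pos: "0 \<le> a" "0 \<le> b" "0 \<le> c" "b \<le> \<mu>" "c \<le> \<mu>" using assms by (auto simp: d)
  \<comment> \<open>The identity in the middle expresses the choice of \<open>bet\<close>: the
    inputs at size \<open>M\<close> are absorbed exactly by the power of \<open>M\<close> in the
    phase. The last inequality rests on \<open>j \<ge> 2\<close>.\<close>
  have gb: "gam - bet \<ge> 0" "2 * gam - 2 * bet = (2*J-2) * bet" "2 - gam - bet \<le> 0"
    using J2 ex_pos Jex unfolding gam_def bet_def by (auto simp: algebra_simps)
  have "O' powr (-bet) \<le> c0 powr (-bet) * exp (- bet * (a + b + c + (2*J-2) * \<mu>))"
    using assms bet_bounds unfolding d by (intro powr_lower_neg) auto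
  then have "x powr (1 - gam) * y powr gam * z powr gam * O' powr (-bet)
    \<le> exp ((1-gam) * a) * exp (gam * b) * exp (gam * c) * (c0 powr (-bet) * exp (- bet * (a + b + c + (2*J-2) * \<mu>)))"
    using assms by (intro mult_mono) (auto simp: powr_def d)
  also have "\<dots> = c0 powr (-bet) * exp ((1-gam) * a + gam * b + gam * c - bet * (a + b + c + (2*J-2) * \<mu>))"
    by (simp only: mult.left_commute[of _ "c0 powr (-bet)"]) (simp add: exp_add[symmetric] algebra_simps)
  also have "\<dots> \<le> c0 powr (-bet) * exp (- a)"
  proof -
    have "(gam - bet) * (b + c) \<le> (gam - bet) * (2 * \<mu>)" using gb pos by (intro mult_left_mono) auto
    also have "\<dots> = (2*J-2) * bet * \<mu>" using gb(2) by (simp add: algebra_simps)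
    finally have 1: "(gam - bet) * (b + c) \<le> (2*J-2) * bet * \<mu>" .
    have 2: "(2 - gam - bet) * a \<le> 0" using gb pos by (simp add: mult_nonpos_nonneg)
    show ?thesis using 1 2 by (intro mult_left_mono) (auto simp: algebra_simps)
  qed
  also have "exp (- a) = 1 / x" using assms by (simp add: d exp_minus field_simps)
  finally show ?thesis .
qed

text \<open>This treats the part of a modulus that has order 1/2; the factor
  \<open>y powr (-(J-1))\<close> makes up for the lost power of the phase.\<close>

lemma kernel_FF_slow:
  fixes O' x y z M :: real
  assumes "x \<ge> 1" "y \<ge> 1" "z \<ge> 1" "x \<le> M" "y \<le> M" "z \<le> M"
    and "O' \<ge> c0 * (x * y * z * M powr (2*J-2))"
  shows "x powr (1 - gam) * y powr gam * z powr gam * (y powr (-(J-1)) * O' powr (-(1/2))) \<le> c0 powr (-(1/2)) * (1 / x)"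
proof -
  define a b c \<mu> where "a = ln x" "b = ln y" "c = ln z" "\<mu> = ln M"
  note d = this
  have pos: "0 \<le> a" "0 \<le> b" "0 \<le> c" "b \<le> \<mu>" "c \<le> \<mu>" using assms by (auto simp: d)
  have "O' powr (-(1/2)) \<le> c0 powr (-(1/2)) * exp (- (1/2) * (a + b + c + (2*J-2) * \<mu>))"
    using assms unfolding d by (intro powr_lower_neg) auto
  then have "x powr (1 - gam) * y powr gam * z powr gam * (y powr (-(J-1)) * O' powr (-(1/2)))
    \<le> exp ((1-gam) * a) * exp (gam * b) * exp (gam * c) * (exp (-(J-1) * b) * (c0 powr (-(1/2)) * exp (- (1/2) * (a + b + c + (2*J-2) * \<mu>))))"
    using assms by (intro mult_mono) (auto simp: powr_def d)
  also have "\<dots> = c0 powr (-(1/2)) * exp ((1-gam) * a + gam * b + gam * c -(J-1) * b - (1/2) * (a + b + c + (2*J-2) * \<mu>))"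
    by (simp only: mult.left_commute[of _ "c0 powr (-(1/2))"]) (simp add: exp_add[symmetric] algebra_simps)
  also have "\<dots> \<le> c0 powr (-(1/2)) * exp (- a)"
  proof -
    have 1: "(J-1) * c \<le> (J-1) * \<mu>" using J2 pos by (intro mult_left_mono) auto
    have 2: "0 \<le> (J-2) * a" using J2 pos by simp
    show ?thesis using 1 2 by (intro mult_left_mono) (auto simp: algebra_simps gam_def)
  qed
  also have "exp (- a) = 1 / x" using assms by (simp add: d exp_minus field_simps)
  finally show ?thesis .
qed

text \<open>Only the power \<open>- gam\<close> stays on the output. The excess \<open>D\<close> is
  moved to the inputs, whose product dominates the output frequency, and cancels there, so the
  kernel estimates reduce to \<open>s = - gam\<close>.\<close>

lemma weight_prod:
  fixes x y k :: real
  assumes "x \<ge> 1" "y \<ge> 1" "x \<le> k * y" "k \<ge> 1"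
  shows "x powr s \<le> k powr D * (x powr (-gam) * y powr D)"
proof -
  have "x powr s = x powr (-gam) * x powr D" unfolding D_def by (simp add: powr_add[symmetric])
  also have "x powr D \<le> (k * y) powr D" using assms D0 by (intro powr_mono2) auto
  also have "\<dots> = k powr D * y powr D" using assms by (simp add: powr_mult)
  finally show ?thesis using assms by (simp add: mult_ac)
qed

text \<open>Size of a boundary term after integration by parts: the derivative, the weights of the
  two inputs and one inverse phase.\<close>

definition A :: "int \<Rightarrow> int \<Rightarrow> real" where
  "A m n = \<bar>of_int m\<bar> * \<bar>of_int n\<bar> powr (-s) * \<bar>of_int (m - n)\<bar> powr (-s) / \<bar>Om m n\<bar>"

lemma A_nonneg: "A m n \<ge> 0" unfolding A_def by simp

text \<open>Because \<open>0 powr a = 0\<close> for every exponent, the weight discards the zero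
  frequency by itself, also for positive \<open>s\<close>.\<close>

lemma A_zero [simp]: "A 0 n = 0" "A m 0 = 0" "A m m = 0" unfolding A_def by auto

lemma Om_nonzero: "m \<noteq> 0 \<Longrightarrow> n \<noteq> 0 \<Longrightarrow> m \<noteq> n \<Longrightarrow> Om m n \<noteq> 0"
  using Om_lower[of "\<bar>m\<bar>" m n] c0_pos by (auto simp: mult_le_0_iff)

text \<open>The factors \<open>D\<close> carry the excess regularity \<open>s - (1/2 - j)\<close>.\<close>

lemma A_bound:
  fixes m n :: int and M :: real
  assumes "m \<noteq> 0" "n \<noteq> 0" "m \<noteq> n" "M = max \<bar>of_int n\<bar> \<bar>of_int (m - n)\<bar>"
  defines "y \<equiv> \<bar>of_int n\<bar>" and "z \<equiv> \<bar>of_int (m - n)\<bar>"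
  shows "A m n \<le> inverse c0 * ((y * z) powr (gam - 1) * M powr (-(2*J-2)) * (y * z) powr (-D))"
proof -
  define W where "W = max \<bar>n\<bar> \<bar>m - n\<bar>"
  have "of_int W = M"
    unfolding W_def assms(4) by (simp only: max_def of_int_abs[symmetric] of_int_le_iff if_distrib[of of_int])
  then have W: "W \<in> {\<bar>m\<bar>, \<bar>n\<bar>, \<bar>m - n\<bar>}" "of_int W = M" "W > 0"
    using assms(2) unfolding W_def by (auto simp: max_def)
  have y: "y \<ge> 1" "z \<ge> 1" unfolding y_def z_def using assms(2,3) by linarith+
  have M: "M \<ge> 1" using W by (metis of_int_1_le_iff int_one_le_iff_zero_less)
  have O': "c0 * (\<bar>of_int m\<bar> * y * z * M powr (2*J-2)) \<le> \<bar>Om m n\<bar>"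
    using Om_lower[OF W(1,3)] W(2) unfolding y_def z_def by simp
  have pos: "0 < c0 * (\<bar>of_int m\<bar> * y * z * M powr (2*J-2))" using c0_pos y M assms by simp
  have "A m n = \<bar>of_int m\<bar> * y powr (-s) * z powr (-s) / \<bar>Om m n\<bar>" unfolding A_def y_def z_def ..
  also have "\<dots> \<le> \<bar>of_int m\<bar> * y powr (-s) * z powr (-s) / (c0 * (\<bar>of_int m\<bar> * y * z * M powr (2*J-2)))"
    using O' pos by (intro divide_left_mono) (auto intro!: mult_pos_pos)
  also have "\<dots> = inverse c0 * ((y powr (-s) * y powr (-1)) * (z powr (-s) * z powr (-1)) * M powr (-(2*J-2)))"
  proof -
    have "x * Y * Z / (c0 * (x * y * z * P)) = inverse c0 * ((Y * inverse y) * (Z * inverse z) * inverse P)"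
      if "x > 0" "P > 0" for x Y Z P :: real
      using that y c0_pos by (simp add: field_simps)
    from this[of "\<bar>of_int m\<bar>" "M powr (2*J-2)" "y powr (-s)" "z powr (-s)"]
    show ?thesis using assms(1) M y by (simp only: powr_minus[of M "2*J-2"] powr_minus[of y 1] powr_minus[of z 1]) simp
  qed
  also have "\<dots> = inverse c0 * ((y * z) powr (gam - 1) * M powr (-(2*J-2)) * (y * z) powr (-D))"
  proof -
    have "w powr (-s) * w powr (-1) = w powr (gam - 1) * w powr (-D)" if "w \<ge> 1" for w :: real
      using that unfolding powr_add[symmetric] D_def by (simp add: algebra_simps)
    then show ?thesis using y by (simp add: powr_mult mult_ac)
  qed
  finally show ?thesis .
qed

text \<open>Since \<open>gam \<ge> 1\<close>, both inputs can be replaced by the larger one, of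
  which exactly the power \<open>-1\<close> remains. \<open>kernel_GF\<close>,
  \<open>kernel_G\<close> and \<open>kernel_GG\<close> use the modulated part only through this
  decay.\<close>

lemma A_bound_max:
  fixes m n :: int and M :: real
  assumes "m \<noteq> 0" "n \<noteq> 0" "m \<noteq> n" "M = max \<bar>of_int n\<bar> \<bar>of_int (m - n)\<bar>"
  defines "y \<equiv> \<bar>of_int n\<bar>" and "z \<equiv> \<bar>of_int (m - n)\<bar>"
  shows "A m n \<le> inverse c0 * (M powr (-1) * (y * z) powr (-D))"
proof -
  have y: "y \<ge> 1" "z \<ge> 1" "y \<le> M" "z \<le> M" unfolding y_def z_def assms(4) using assms(2,3) by linarith+
  have "(y * z) powr (gam - 1) \<le> (M * M) powr (gam - 1)"
    using y J2 by (intro powr_mono2 mult_mono) (auto simp: gam_def)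
  also have "\<dots> = M powr (2 * gam - 2)" using y by (simp add: powr_mult powr_add[symmetric])
  finally have "(y * z) powr (gam - 1) * M powr (-(2*J-2)) \<le> M powr (2 * gam - 2) * M powr (-(2*J-2))"
    by (intro mult_right_mono) auto
  also have "\<dots> = M powr (-1)" unfolding powr_add[symmetric] gam_def by simp
  finally have "(y * z) powr (gam - 1) * M powr (-(2*J-2)) * (y * z) powr (-D) \<le> M powr (-1) * (y * z) powr (-D)"
    by (intro mult_right_mono) auto
  then have "inverse c0 * ((y * z) powr (gam - 1) * M powr (-(2*J-2)) * (y * z) powr (-D))
      \<le> inverse c0 * (M powr (-1) * (y * z) powr (-D))"
    using c0_pos by (intro mult_left_mono) auto
  then show ?thesis
    using A_bound[OF assms(1-4)] unfolding y_def z_def by (rule order_trans[rotated])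
qed

text \<open>Resonant triples: \<open>m = p + q + r\<close> with \<open>q = m\<close> (or \<open>r = m\<close>).\<close>

lemma kernel_res:
  fixes m p :: int
  assumes "m \<noteq> 0" "p \<noteq> 0" "m \<noteq> p"
  shows "\<bar>of_int m\<bar> powr (1+s) * \<bar>of_int p\<bar> powr (-s) * A (m - p) m \<le> inverse c0"
    and "\<bar>of_int m\<bar> powr (1+s) * \<bar>of_int p\<bar> powr (-s) * A (m - p) (-p) \<le> inverse c0"
proof -
  define x where "x = \<bar>real_of_int m\<bar>"
  define z where "z = \<bar>real_of_int p\<bar>"
  define M where "M = max x z"
  have x: "x \<ge> 1" "z \<ge> 1" "x \<le> M" "z \<le> M" unfolding x_def z_def M_def using assms by linarith+
  have sym: "A (m - p) (-p) = A (m - p) m" unfolding A_def Om_def by (simp add: algebra_simps)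
  have xz: "\<bar>real_of_int m\<bar> = x" "\<bar>real_of_int (m - p - m)\<bar> = z" unfolding x_def z_def by auto
  have "A (m - p) m \<le> inverse c0 * ((x * z) powr (gam - 1) * M powr (-(2*J-2)) * (x * z) powr (-D))"
    using A_bound[of "m - p" m M] assms unfolding xz M_def by simp
  then have "x powr (1+s) * z powr (-s) * A (m - p) m
    \<le> x powr (1+s) * z powr (-s) * (inverse c0 * ((x * z) powr (gam - 1) * M powr (-(2*J-2)) * (x * z) powr (-D)))"
    by (intro mult_left_mono) auto
  also have "\<dots> = inverse c0 * (z powr (2*J-2) * M powr (-(2*J-2)) * z powr (-2*D))"
  proof -
    \<comment> \<open>No power of \<open>x\<close> is left for any \<open>s\<close>, and none of
      \<open>z\<close> either if \<open>z\<close> is the larger frequency and \<open>D = 0\<close>.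
      The estimate gains nothing, so smallness of the resonant terms has to come from the length of
      the time interval.\<close>
    have 1: "x powr (1+s) * x powr (gam - 1) * x powr (-D) = 1"
      using x unfolding powr_add[symmetric] D_def by simp
    have 2: "z powr (-s) * z powr (gam - 1) * z powr (-D) = z powr (2*J-2) * z powr (-2*D)"
      unfolding powr_add[symmetric] D_def gam_def by (simp add: algebra_simps)
    have "x powr (1+s) * z powr (-s) * (inverse c0 * ((x * z) powr (gam - 1) * M powr (-(2*J-2)) * (x * z) powr (-D)))
      = inverse c0 * ((x powr (1+s) * x powr (gam - 1) * x powr (-D)) * (z powr (-s) * z powr (gam - 1) * z powr (-D)) * M powr (-(2*J-2)))"
      using x by (simp only: powr_mult mult_ac)
    also have "\<dots> = inverse c0 * (z powr (2*J-2) * M powr (-(2*J-2)) * z powr (-2*D))"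
      unfolding 1 2 by (simp only: mult_ac mult_1_left mult_1_right)
    finally show ?thesis .
  qed
  also have "\<dots> \<le> inverse c0 * (M powr (2*J-2) * M powr (-(2*J-2)) * 1)"
  proof -
    have "z powr (2*J-2) \<le> M powr (2*J-2)" using x J2 by (intro powr_mono2) auto
    moreover have "z powr (-2*D) \<le> 1" using x D0 powr_mono[of "-2*D" 0 z] by simp
    ultimately show ?thesis using c0_pos by (intro mult_left_mono mult_mono) auto
  qed
  also have "\<dots> = inverse c0" using x by (simp add: powr_add[symmetric])
  finally show "\<bar>of_int m\<bar> powr (1+s) * \<bar>of_int p\<bar> powr (-s) * A (m - p) m \<le> inverse c0"
    unfolding x_def z_def .
  then show "\<bar>of_int m\<bar> powr (1+s) * \<bar>of_int p\<bar> powr (-s) * A (m - p) (-p) \<le> inverse c0"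
    unfolding sym .
qed

section \<open>Kernels with modulated inputs\<close>

lemma kernel_GF_fast:
  fixes O' x p y X Y Z M W :: real
  assumes "x \<ge> 1" "p \<ge> 1" "M \<ge> 1" "X \<ge> 1" "Y \<ge> 1" "Z \<ge> 1" "W \<ge> 1"
    and "O' \<ge> c0 * (X * Y * Z * W powr (2*J-2))"
  shows "x powr (1 - gam) * p powr gam * M powr (-1) * O' powr (-ex)
    \<le> c0 powr (-ex) * exp ((1 - gam) * ln x + gam * ln p - ln M - ex * (ln X + ln Y + ln Z + (2*J-2) * ln W))"
proof -
  have "O' powr (-ex) \<le> c0 powr (-ex) * exp (- ex * (ln X + ln Y + ln Z + (2*J-2) * ln W))"
    using assms ex_pos by (intro powr_lower_neg) auto
  then have "x powr (1 - gam) * p powr gam * M powr (-1) * O' powr (-ex)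
    \<le> exp ((1 - gam) * ln x) * exp (gam * ln p) * exp (- ln M) * (c0 powr (-ex) * exp (- ex * (ln X + ln Y + ln Z + (2*J-2) * ln W)))"
    using assms by (intro mult_mono) (auto simp: powr_def)
  also have "\<dots> = c0 powr (-ex) * exp ((1 - gam) * ln x + gam * ln p - ln M - ex * (ln X + ln Y + ln Z + (2*J-2) * ln W))"
    by (simp only: mult.left_commute[of _ "c0 powr (-ex)"]) (simp add: exp_add[symmetric] algebra_simps)
  finally show ?thesis .
qed

lemma kernel_GF_slow:
  fixes O' x p y X Y Z M W :: real
  assumes "x \<ge> 1" "p \<ge> 1" "M \<ge> 1" "X \<ge> 1" "Y \<ge> 1" "Z \<ge> 1" "W \<ge> 1"
    and "O' \<ge> c0 * (X * Y * Z * W powr (2*J-2))"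
  shows "x powr (1 - gam) * p powr gam * M powr (-1) * (x powr (J-1) * O' powr (-(1/2)))
    \<le> c0 powr (-(1/2)) * exp ((1/2) * ln x + gam * ln p - ln M - (1/2) * (ln X + ln Y + ln Z + (2*J-2) * ln W))"
proof -
  have "O' powr (-(1/2)) \<le> c0 powr (-(1/2)) * exp (- (1/2) * (ln X + ln Y + ln Z + (2*J-2) * ln W))"
    using assms by (intro powr_lower_neg) auto
  then have "x powr (1 - gam) * p powr gam * M powr (-1) * (x powr (J-1) * O' powr (-(1/2)))
    \<le> exp ((1 - gam) * ln x) * exp (gam * ln p) * exp (- ln M) * (exp ((J-1) * ln x) * (c0 powr (-(1/2)) * exp (- (1/2) * (ln X + ln Y + ln Z + (2*J-2) * ln W))))"
    using assms by (intro mult_mono) (auto simp: powr_def)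
  also have "\<dots> = c0 powr (-(1/2)) * exp ((1/2) * ln x + gam * ln p - ln M - (1/2) * (ln X + ln Y + ln Z + (2*J-2) * ln W))"
    by (simp only: mult.left_commute[of _ "c0 powr (-(1/2))"]) (simp add: exp_add[symmetric] algebra_simps gam_def)
  finally show ?thesis .
qed

text \<open>Summable over the integers because \<open>ex > 0\<close>. A kernel whose square is at
  most a product of two such weights in independent variables therefore has square summable
  rows.\<close>

definition hw :: "real \<Rightarrow> real" where "hw x = x powr (-(1+ex))"

text \<open>Each comparison of frequencies up to a factor 5 costs a multiple of \<open>ln 5\<close>
  in the exponent; the power of 5 pays for all of them at once.\<close>

definition CGF :: real where "CGF = (c0 powr (-ex) + c0 powr (-(1/2))) * exp (4 * (J + 1) * ln 5)"

lemma CGF_pos: "CGF > 0" unfolding CGF_def using c0_pos by (intro mult_pos_pos add_pos_pos) auto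

lemma exp_pair_square:
  fixes U V k L c :: real
  assumes "U \<ge> 1" "V \<ge> 1" "0 \<le> k" "k \<le> c * exp L" "L \<le> 4 * (J + 1) * ln 5 - (1+ex)/2 * (ln U + ln V)"
    "0 \<le> c" "c \<le> c0 powr (-ex) + c0 powr (-(1/2))"
  shows "k^2 \<le> CGF^2 * (hw U * hw V)"
proof -
  have "c * exp L \<le> (c0 powr (-ex) + c0 powr (-(1/2))) * exp (4 * (J + 1) * ln 5 - (1+ex)/2 * (ln U + ln V))"
    using assms by (intro mult_mono) auto
  also have "\<dots> = CGF * exp (- (1+ex)/2 * (ln U + ln V))"
    unfolding CGF_def mult.assoc mult_exp_exp by (simp add: field_simps)
  finally have "k \<le> CGF * exp (- (1+ex)/2 * (ln U + ln V))" using assms(4) by linarith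
  then have "k^2 \<le> (CGF * exp (- (1+ex)/2 * (ln U + ln V)))^2" using assms(3) by (rule power_mono)
  also have "\<dots> = CGF^2 * (exp (- (1+ex)/2 * (ln U + ln V)))^2" by (simp add: power_mult_distrib)
  also have "(exp (- (1+ex)/2 * (ln U + ln V)))^2 = hw U * hw V"
    unfolding hw_def power2_eq_square using assms(1,2)
    by (simp add: powr_def exp_add[symmetric] field_simps)
  finally show ?thesis .
qed

text \<open>Here \<open>x\<close> is the output, \<open>p\<close> the plain input, and
  \<open>q\<close>, \<open>r\<close> are the frequencies inside the modulated one, whose weight
  contributes \<open>1 / max q r\<close>. The position of \<open>p\<close> decides which entry of
  the minimum and which \<open>W\<close> in the lower bound of the phase are used, and which two
  frequencies keep summable weights.\<close>

lemma kernel_GF_real: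
  fixes O' x p q r X Y Z :: real
  assumes ge1: "x \<ge> 1" "p \<ge> 1" "q \<ge> 1" "r \<ge> 1" "X \<ge> 1" "Y \<ge> 1" "Z \<ge> 1"
    and tri: "x \<le> p + Y" "p \<le> x + Y" "Y \<le> q + r" "X \<le> p + q" "Z \<le> p + r" "p \<le> X + q" "p \<le> Z + r"
    and O': "\<And>W. W \<in> {X, Y, Z, p, q, r} \<Longrightarrow> O' \<ge> c0 * (X * Y * Z * W powr (2*J-2))"
  shows "(x powr (1 - gam) * p powr gam * (max q r) powr (-1) * min (O' powr (-ex)) (x powr (J-1) * O' powr (-(1/2))))^2
    \<le> CGF^2 * (hw X * hw Y + hw Y * hw Z + hw X * hw Z + hw q * hw Y)"
proof -
  define M where "M = max q r"
  define k where "k = x powr (1 - gam) * p powr gam * M powr (-1) * min (O' powr (-ex)) (x powr (J-1) * O' powr (-(1/2)))"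
  have M: "M \<ge> 1" "q \<le> M" "r \<le> M" "M \<in> {X, Y, Z, p, q, r}" "Y \<le> 2 * M" using ge1 tri unfolding M_def by (auto simp: max_def)
  have k0: "k \<ge> 0" unfolding k_def by (intro mult_nonneg_nonneg) (auto simp: min_def)
  have kf: "k \<le> x powr (1 - gam) * p powr gam * M powr (-1) * O' powr (-ex)"
    "k \<le> x powr (1 - gam) * p powr gam * M powr (-1) * (x powr (J-1) * O' powr (-(1/2)))"
    unfolding k_def by (intro mult_left_mono; simp)+
  have fast: "k \<le> c0 powr (-ex) * exp ((1 - gam) * ln x + gam * ln p - ln M - ex * (ln X + ln Y + ln Z + (2*J-2) * ln W))"
    if "W \<in> {X, Y, Z, p, q, r}" for W
  proof (rule order_trans[OF kf(1) kernel_GF_fast])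
    show "1 \<le> W" using that ge1 by auto
  qed (use ge1 M O'[OF that] in auto)
  have slow: "k \<le> c0 powr (-(1/2)) * exp ((1/2) * ln x + gam * ln p - ln M - (1/2) * (ln X + ln Y + ln Z + (2*J-2) * ln M))"
    by (rule order_trans[OF kf(2) kernel_GF_slow]) (use ge1 M O'[OF M(4)] in auto)
  define a P \<mu> ch up ze lq l5 where "a = ln x" "P = ln p" "\<mu> = ln M" "ch = ln X" "up = ln Y" "ze = ln Z" "lq = ln q" "l5 = ln (5::real)"
  note d = this
  have pos: "0 \<le> a" "0 \<le> P" "0 \<le> \<mu>" "0 \<le> ch" "0 \<le> up" "0 \<le> ze" "0 \<le> lq" "lq \<le> \<mu>" "0 \<le> l5" using ge1 M by (auto simp: d)
  have lnle: "ln u \<le> ln v + l5" if "1 \<le> u" "1 \<le> v" "u \<le> 5 * v" for u v :: real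
  proof -
    have "ln u \<le> ln (5 * v)" using that by (intro ln_mono) auto
    then show ?thesis using that by (simp add: ln_mult d)
  qed
  have Y\<mu>: "up \<le> \<mu> + l5" unfolding d(1-7) by (rule lnle) (use ge1 M in auto)
  have Jl: "J * l5 \<ge> 0" "ex * l5 \<ge> 0" "ex * l5 \<le> l5" "J * l5 \<ge> 2 * l5" using J2 pos ex_pos by (auto simp: mult_left_le_one_le intro!: mult_right_mono)
  have pair: "k^2 \<le> CGF^2 * (hw U * hw V)"
    if "1 \<le> U" "1 \<le> V" "k \<le> c * exp L" "L \<le> 4 * (J + 1) * l5 - (1+ex)/2 * (ln U + ln V)"
      "c = c0 powr (-ex) \<or> c = c0 powr (-(1/2))" for U V c L
    by (rule exp_pair_square[OF that(1,2) k0 that(3) that(4)[unfolded d]]) (use that(5) in auto)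
  have nn: "0 \<le> hw u * hw v" for u v unfolding hw_def by simp
  have any: ?thesis if "k^2 \<le> CGF^2 * (hw U * hw V)" "(U, V) \<in> {(X, Y), (Y, Z), (X, Z), (q, Y)}" for U V
  proof -
    have "hw U * hw V \<le> hw X * hw Y + hw Y * hw Z + hw X * hw Z + hw q * hw Y"
      using that(2) nn[of X Y] nn[of Y Z] nn[of X Z] nn[of q Y] by auto
    then have "CGF^2 * (hw U * hw V) \<le> CGF^2 * (hw X * hw Y + hw Y * hw Z + hw X * hw Z + hw q * hw Y)"
      by (intro mult_left_mono) auto
    with that(1) show ?thesis unfolding k_def M_def by linarith
  qed
  have e2: "ex * (2*J-2) = 1 - 2 * ex" using Jex by (simp add: algebra_simps)
  consider "p > 4 * x" | "p \<le> 4 * x" "x \<le> 4 * M" | "p \<le> 4 * x" "x > 4 * M" by linarith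
  then show ?thesis
  proof cases
    case 1
    \<comment> \<open>\<open>p\<close> is much larger than the output, so \<open>Y\<close> and
      \<open>max q r\<close> are at least comparable to \<open>p\<close>. With the entry of order
      1/2, \<open>X\<close> and \<open>Z\<close> retain the exponent 3/4, more than the required
      \<open>(1 + ex) / 2 \<le> 5/8\<close>.\<close>
    have 2: "a \<le> P" unfolding d(1-7) using 1 ge1 by simp
    have 3: "P \<le> up + l5" unfolding d(1-7) by (rule lnle) (use 1 ge1 tri in auto)
    have 4: "P \<le> \<mu> + l5" unfolding d(1-7) by (rule lnle) (use 1 ge1 M tri in auto)
    have 5: "ch \<le> \<mu> + l5" "ze \<le> \<mu> + l5" unfolding d(1-7) by (rule lnle; use 1 ge1 M tri in auto)+
    have "(J - 1/2) * P \<le> (J-1/2) * (\<mu> + l5)" using 4 J2 by (intro mult_left_mono) auto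
    then have "(1/2) * a + gam * P - \<mu> - (1/2) * (ch + up + ze + (2*J-2) * \<mu>)
       \<le> 4 * (J + 1) * l5 - (3/4) * (ch + ze)"
      using 2 3 5 pos Jl unfolding gam_def by (simp only: ring_distribs; linarith?)
    also have "\<dots> \<le> 4 * (J + 1) * l5 - (1+ex)/2 * (ch + ze)"
      using pos ex_pos by (intro diff_left_mono mult_right_mono) auto
    finally have "k^2 \<le> CGF^2 * (hw X * hw Z)"
      using slow ge1 unfolding d(1-7) by (intro pair) auto
    then show ?thesis by (rule any) auto
  next
    case 2
    \<comment> \<open>Now \<open>x\<close> and \<open>p\<close> are bounded by multiples of
      \<open>max q r\<close>, which cancels the derivative. The largest pair sum serves as
      \<open>W\<close>, and its power \<open>1 - 2 * ex\<close> is distributed over the other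
      two.\<close>
    have 3: "P \<le> a + l5" unfolding d(1-7) by (rule lnle) (use 2 ge1 in auto)
    have 4: "a \<le> \<mu> + l5" unfolding d(1-7) by (rule lnle) (use 2 ge1 M in auto)
    have "gam * P \<le> gam * (a + l5)" using 3 J2 unfolding gam_def by (intro mult_left_mono) auto
    then have 5: "(1-gam) * a + gam * P - \<mu> - ex * (ch + up + ze + (2*J-2) * w)
       \<le> 4 * (J + 1) * l5 - ex * (ch + up + ze) - (1 - 2*ex) * w" for w
      unfolding e2[symmetric] using 4 pos Jl unfolding gam_def by (simp only: ring_distribs; linarith?)
    have 6: "- ex * (u + v + w) - (1-2*ex) * w \<le> - (1+ex)/2 * (u + v)" if "u \<le> w" "v \<le> w" for u v w
    proof -
      have "(1-ex)/2 * (u+v) \<le> (1-ex)/2 * (2 * w)" using that ex_pos by (intro mult_left_mono) auto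
      then show ?thesis by (simp add: field_simps)
    qed
    have 7: "(1-gam) * a + gam * P - \<mu> - ex * (ch + up + ze + (2*J-2) * w) \<le> 4 * (J + 1) * l5 - (1+ex)/2 * (u + v)"
      if "u \<le> w" "v \<le> w" "u + v + w = ch + up + ze" for u v w
      using 5[of w] 6[OF that(1,2)] unfolding that(3)[symmetric] by linarith
    consider "ch \<le> ze" "up \<le> ze" | "ch \<le> up" "ze \<le> up" | "up \<le> ch" "ze \<le> ch" by linarith
    then show ?thesis
    proof cases
      case 1
      have "k^2 \<le> CGF^2 * (hw X * hw Y)"
        by (rule pair[OF _ _ fast[of Z, folded d(1-7)]]) (use ge1 7[OF 1] in \<open>auto simp flip: d\<close>)
      then show ?thesis by (rule any) auto
    next
      case 2
      have "k^2 \<le> CGF^2 * (hw X * hw Z)"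
        by (rule pair[OF _ _ fast[of Y, folded d(1-7)]]) (use ge1 7[OF 2] in \<open>auto simp flip: d\<close>)
      then show ?thesis by (rule any) auto
    next
      case 3
      have "k^2 \<le> CGF^2 * (hw Y * hw Z)"
        by (rule pair[OF _ _ fast[of X, folded d(1-7)]]) (use ge1 7[OF 3] in \<open>auto simp flip: d\<close>)
      then show ?thesis by (rule any) auto
    qed
  next
    case 3
    \<comment> \<open>The modulated input is small compared to the output, so \<open>p\<close>,
      \<open>X\<close> and \<open>Z\<close> are at least comparable to \<open>x\<close> and, with
      \<open>W = p\<close>, cancel the derivative through the phase. The decay comes from
      \<open>1 / max q r\<close>, shared between \<open>q\<close> and \<open>Y\<close>.\<close>
    have 4: "P \<le> a + l5" "a \<le> P + l5" "a \<le> ch + l5" "a \<le> ze + l5"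
      unfolding d(1-7) by (rule lnle; use 3 ge1 M tri in auto)+
    have "gam * P \<le> gam * (a + l5)" using 4 J2 unfolding gam_def by (intro mult_left_mono) auto
    then have 5: "(1-gam) * a + gam * P \<le> a + J * l5" using pos unfolding gam_def by (simp only: ring_distribs; linarith?)
    have e3: "ex * ((2*J-2) * P) = (1 - 2*ex) * P" unfolding e2[symmetric] by simp
    have "(1 - 2*ex) * P \<ge> (1 - 2 * ex) * (a - l5)" using 4 ex_pos by (intro mult_left_mono) auto
    moreover have "ex * ch \<ge> ex * (a - l5)" "ex * ze \<ge> ex * (a - l5)" using 4 ex_pos by (auto intro!: mult_left_mono)
    ultimately have 6: "ex * (ch + up + ze + (2*J-2) * P) \<ge> ex * up + a - l5"
      unfolding distrib_left[of ex] e3 by (simp only: ring_distribs; linarith?)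
    have "(1-ex)/2 * (up - l5) \<le> (1-ex)/2 * \<mu>" "(1+ex)/2 * lq \<le> (1+ex)/2 * \<mu>"
      using Y\<mu> pos ex_pos by (auto intro!: mult_left_mono divide_right_mono)
    then have "- \<mu> - ex * up \<le> l5 - (1+ex)/2 * (lq + up)"
      using Jl pos by (simp add: field_simps)
    with 5 6 have "(1-gam) * a + gam * P - \<mu> - ex * (ch + up + ze + (2*J-2) * P) \<le> 4 * (J + 1) * l5 - (1+ex)/2 * (lq + up)"
      using Jl pos by (simp only: ring_distribs; linarith?)
    then have "k^2 \<le> CGF^2 * (hw q * hw Y)"
      using fast[of p] ge1 unfolding d(1-7) by (intro pair) auto
    then show ?thesis by (rule any) auto
  qed
qed

lemma abs_int_ge1: "m \<noteq> 0 \<Longrightarrow> 1 \<le> \<bar>real_of_int m\<bar>" for m :: int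
  by linarith

lemma mult_ge1: "1 \<le> x \<Longrightarrow> 1 \<le> y \<Longrightarrow> 1 \<le> x * y" for x y :: real
  using mult_mono[of 1 x 1 y] by simp

lemma weight_split: "y \<ge> 1 \<Longrightarrow> y powr (-s) = y powr gam * y powr (-D)" for y :: real
  unfolding powr_add[symmetric] D_def by simp

lemma weight_prod1:
  fixes x y k :: real
  assumes "x \<ge> 1" "y \<ge> 1" "x \<le> k * y" "k \<ge> 1"
  shows "x powr (1 + s) \<le> k powr D * (x powr (1 - gam) * y powr D)"
proof -
  have "x powr (1 + s) = x * x powr s" using assms by (simp add: powr_add)
  also have "\<dots> \<le> x * (k powr D * (x powr (-gam) * y powr D))"
    using weight_prod[OF assms] assms by (intro mult_left_mono) auto
  also have "\<dots> = k powr D * ((x powr 1 * x powr (-gam)) * y powr D)"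
    using assms by (simp only: powr_one mult_ac)
  also have "x powr 1 * x powr (-gam) = x powr (1 - gam)" unfolding powr_add[symmetric] by simp
  finally show ?thesis .
qed

lemma sum_le_prod2:
  fixes x y :: real
  assumes "1 \<le> x" "1 \<le> y"
  shows "x + y \<le> 2 * (x * y)"
proof -
  have "0 \<le> (x - 1) * (y - 1)" "1 \<le> x * y" using assms by (auto intro: mult_ge1)
  then show ?thesis by (simp add: algebra_simps)
qed

lemma powr_D_cancel: "y > 0 \<Longrightarrow> y powr D * y powr (-D) = 1" for y :: real
  by (simp add: powr_add[symmetric])

definition CFF :: real where "CFF = 2 powr D * (c0 powr (-bet) + c0 powr (-(1/2)))"

lemma kernel_FF:
  fixes m n :: int
  assumes "m \<noteq> 0" "n \<noteq> 0" "m \<noteq> n"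
  defines "x \<equiv> \<bar>real_of_int m\<bar>" and "y \<equiv> \<bar>real_of_int n\<bar>" and "z \<equiv> \<bar>real_of_int (m - n)\<bar>"
  shows "x powr (1+s) * y powr (-s) * z powr (-s) * \<bar>Om m n\<bar> powr (-bet) \<le> CFF * (1 / x)"
    and "x powr (1+s) * y powr (-s) * z powr (-s) * (y powr (-(J-1)) * \<bar>Om m n\<bar> powr (-(1/2))) \<le> CFF * (1 / x)"
    and "x powr (1+s) * y powr (-s) * z powr (-s) * (z powr (-(J-1)) * \<bar>Om m n\<bar> powr (-(1/2))) \<le> CFF * (1 / x)"
proof -
  have ge: "x \<ge> 1" "y \<ge> 1" "z \<ge> 1" unfolding x_def y_def z_def using assms(1-3) by (auto intro!: abs_int_ge1 simp del: of_int_diff)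
  obtain W :: int where W: "W \<in> {\<bar>m\<bar>, \<bar>n\<bar>, \<bar>m - n\<bar>}" "\<bar>m\<bar> \<le> W" "\<bar>n\<bar> \<le> W" "\<bar>m - n\<bar> \<le> W"
    by (metis insertCI linorder_linear order_trans)
  have W': "x \<le> of_int W" "y \<le> of_int W" "z \<le> of_int W"
    using W(2-4) unfolding x_def y_def z_def by (simp_all only: of_int_abs[symmetric] of_int_le_iff)
  have "W > 0" using W assms(1) by linarith
  have O': "c0 * (x * y * z * of_int W powr (2*J-2)) \<le> \<bar>Om m n\<bar>"
    using Om_lower[OF W(1) \<open>W > 0\<close>] unfolding x_def y_def z_def by simp
  then have O'': "c0 * (x * z * y * of_int W powr (2*J-2)) \<le> \<bar>Om m n\<bar>" by (simp add: mult_ac)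
  have "x \<le> y + z" unfolding x_def y_def z_def by simp
  then have xyz: "x \<le> 2 * (y * z)" using sum_le_prod2 ge by fastforce
  have base: "x powr (1+s) * y powr (-s) * z powr (-s) \<le> 2 powr D * (x powr (1-gam) * y powr gam * z powr gam)"
  proof -
    have "x powr (1+s) * y powr (-s) * z powr (-s) \<le> 2 powr D * (x powr (1-gam) * (y * z) powr D) * y powr (-s) * z powr (-s)"
      using ge mult_ge1[of y z] by (intro mult_right_mono weight_prod1 xyz) auto
    also have "\<dots> = 2 powr D * (x powr (1-gam) * y powr gam * z powr gam) * ((y powr D * y powr (-D)) * (z powr D * z powr (-D)))"
      using ge by (simp only: weight_split powr_mult mult_ac)
    finally show ?thesis using ge by (simp add: powr_D_cancel)
  qed
  have main: "x powr (1+s) * y powr (-s) * z powr (-s) * r \<le> CFF * (1/x)"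
    if "x powr (1-gam) * y powr gam * z powr gam * r \<le> k * (1/x)" "r \<ge> 0" "k = c0 powr (-bet) \<or> k = c0 powr (-(1/2))" for r k
  proof -
    have "x powr (1+s) * y powr (-s) * z powr (-s) * r \<le> 2 powr D * (x powr (1-gam) * y powr gam * z powr gam) * r"
      using base that by (intro mult_right_mono)
    also have "\<dots> \<le> 2 powr D * (k * (1/x))" unfolding mult.assoc[of "2 powr D"] using that by (intro mult_left_mono) auto
    also have "\<dots> \<le> CFF * (1/x)" unfolding CFF_def mult.assoc using that(3) ge by (intro mult_left_mono mult_right_mono) auto
    finally show ?thesis .
  qed
  show "x powr (1+s) * y powr (-s) * z powr (-s) * \<bar>Om m n\<bar> powr (-bet) \<le> CFF * (1 / x)"
    by (rule main[OF kernel_FF_fast[OF ge W' O']]) auto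
  show "x powr (1+s) * y powr (-s) * z powr (-s) * (y powr (-(J-1)) * \<bar>Om m n\<bar> powr (-(1/2))) \<le> CFF * (1 / x)"
    by (rule main[OF kernel_FF_slow[OF ge W' O']]) auto
  have "x powr (1 - gam) * y powr gam * z powr gam * (z powr (-(J-1)) * \<bar>Om m n\<bar> powr (-(1/2))) \<le> c0 powr (-(1/2)) * (1 / x)"
    using kernel_FF_slow[OF ge(1,3,2) W'(1,3,2) O''] by (simp only: mult_ac)
  from main[OF this] show "x powr (1+s) * y powr (-s) * z powr (-s) * (z powr (-(J-1)) * \<bar>Om m n\<bar> powr (-(1/2))) \<le> CFF * (1 / x)"
    by auto
qed

text \<open>The constant with which a jump of size \<open>min h (1 / O')\<close> fits into the
  modulus \<open>mu m\<close>, one entry for each of the two terms of \<open>mu\<close>; see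
  \<open>min_le_gw\<close>.\<close>

definition gw :: "int \<Rightarrow> real \<Rightarrow> real" where
  "gw m O' = min (O' powr (-ex)) (\<bar>of_int m\<bar> powr (J-1) * O' powr (-(1/2)))"

lemma gw_nonneg: "gw m O' \<ge> 0" unfolding gw_def by auto

definition hi :: "int \<Rightarrow> real" where "hi m = hw \<bar>of_int m\<bar>"

lemma kernel_GF:
  fixes p q r :: int
  assumes nz: "p + q + r \<noteq> 0" "p \<noteq> 0" "q \<noteq> 0" "r \<noteq> 0" "q + r \<noteq> 0" "p + q \<noteq> 0" "p + r \<noteq> 0"
  shows "(\<bar>of_int (p+q+r)\<bar> powr (1+s) * \<bar>of_int p\<bar> powr (-s) * A (q+r) q * gw (p+q+r) \<bar>Om (p+q+r) (q+r) + Om (q+r) q\<bar>)^2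
    \<le> (3 powr D * inverse c0 * CGF)^2 * (hi (p+q) * hi (q+r) + hi (q+r) * hi (p+r) + hi (p+q) * hi (p+r) + hi q * hi (q+r))"
proof -
  define x y z w where "x = \<bar>real_of_int (p+q+r)\<bar>" "y = \<bar>real_of_int p\<bar>" "z = \<bar>real_of_int q\<bar>" "w = \<bar>real_of_int r\<bar>"
  note d = this
  define X Y Z where "X = \<bar>real_of_int (p+q)\<bar>" "Y = \<bar>real_of_int (q+r)\<bar>" "Z = \<bar>real_of_int (p+r)\<bar>"
  note d' = this
  define O' where "O' = \<bar>Om (p+q+r) (q+r) + Om (q+r) q\<bar>"
  define g where "g = min (O' powr (-ex)) (x powr (J-1) * O' powr (-(1/2)))"
  have ge: "x \<ge> 1" "y \<ge> 1" "z \<ge> 1" "w \<ge> 1" "X \<ge> 1" "Y \<ge> 1" "Z \<ge> 1" unfolding d d' using nz by (auto intro!: abs_int_ge1 simp del: of_int_add)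
  have zw1: "1 \<le> z * w" using ge by (intro mult_ge1)
  have yzw1: "1 \<le> y * (z * w)" using ge zw1 by (intro mult_ge1)
  have tri: "x \<le> y + Y" "y \<le> x + Y" "Y \<le> z + w" "X \<le> y + z" "Z \<le> y + w" "y \<le> X + z" "y \<le> Z + w"
    unfolding d d' by simp_all
  have lower: "O' \<ge> c0 * (X * Y * Z * W powr (2*J-2))" if "W \<in> {X, Y, Z, y, z, w}" for W
  proof -
    have "W \<in> of_int ` {\<bar>p + q\<bar>, \<bar>q + r\<bar>, \<bar>p + r\<bar>, \<bar>p\<bar>, \<bar>q\<bar>, \<bar>r\<bar>}"
      using that unfolding d d' by (simp only: image_insert image_empty of_int_abs)
    then obtain V :: int where V: "V \<in> {\<bar>p + q\<bar>, \<bar>q + r\<bar>, \<bar>p + r\<bar>, \<bar>p\<bar>, \<bar>q\<bar>, \<bar>r\<bar>}" "W = of_int V"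
      by blast
    moreover have "V > 0" using V nz by auto
    ultimately show ?thesis using Om3_lower[OF V(1)] unfolding O'_def d d' by simp
  qed
  have "x \<le> y + (z + w)" using tri by linarith
  also have "\<dots> \<le> y * (z * w) + (y * (z * w) + y * (z * w))"
  proof (intro add_mono)
    show "y \<le> y * (z * w)" using ge zw1 mult_left_mono[of 1 "z*w" y] by simp
    have yw: "1 \<le> y * w" "1 \<le> y * z" using ge by (auto intro: mult_ge1)
    show "z \<le> y * (z * w)" using ge mult_left_mono[OF yw(1), of z] by (simp add: mult_ac)
    show "w \<le> y * (z * w)" using ge mult_left_mono[OF yw(2), of w] by (simp add: mult_ac)
  qed
  finally have x3: "x \<le> 3 * (y * (z * w))" by linarith
  have A': "A (q+r) q \<le> inverse c0 * ((max z w) powr (-1) * (z * w) powr (-D))"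
    using A_bound_max[of "q+r" q "max z w"] nz unfolding d by simp
  define k where "k = x powr (1 - gam) * y powr gam * (max z w) powr (-1) * g"
  have k2: "k^2 \<le> CGF^2 * (hw X * hw Y + hw Y * hw Z + hw X * hw Z + hw z * hw Y)"
    unfolding k_def g_def by (rule kernel_GF_real[OF ge tri lower])
  have g0: "0 \<le> g" unfolding g_def by auto
  have "x powr (1+s) * y powr (-s) * A (q+r) q * g
    \<le> (3 powr D * (x powr (1-gam) * (y * (z * w)) powr D)) * (y powr gam * y powr (-D)) * (inverse c0 * ((max z w) powr (-1) * (z * w) powr (-D))) * g"
    unfolding weight_split[OF ge(2)] using ge yzw1 x3 A' g0 A_nonneg
    by (intro mult_right_mono mult_mono weight_prod1) auto
  also have "\<dots> = 3 powr D * inverse c0 * k * ((y powr D * y powr (-D)) * ((z * w) powr D * (z * w) powr (-D)))"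
    unfolding k_def using ge by (simp only: powr_mult mult_ac)
  also have "\<dots> = 3 powr D * inverse c0 * k"
    using powr_D_cancel[of y] powr_D_cancel[of "z*w"] ge zw1 by simp
  finally have "(x powr (1+s) * y powr (-s) * A (q+r) q * g)^2 \<le> (3 powr D * inverse c0 * k)^2"
    using g0 A_nonneg by (intro power_mono) auto
  also have "\<dots> = (3 powr D * inverse c0)^2 * k^2" by (simp add: power_mult_distrib)
  also have "\<dots> \<le> (3 powr D * inverse c0)^2 * (CGF^2 * (hw X * hw Y + hw Y * hw Z + hw X * hw Z + hw z * hw Y))"
    by (intro mult_left_mono k2) auto
  also have "\<dots> = (3 powr D * inverse c0 * CGF)^2 * (hw X * hw Y + hw Y * hw Z + hw X * hw Z + hw z * hw Y)"
    by (simp add: power_mult_distrib)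
  finally show ?thesis unfolding g_def O'_def gw_def d d' hi_def .
qed

text \<open>The decay \<open>1 / \<bar>n\<bar>\<close> is what Cauchy-Schwarz needs for the sum over
  \<open>n\<close>; it places the modulated part in the same Sobolev space.\<close>

lemma kernel_G:
  fixes m n :: int
  shows "\<bar>of_int m\<bar> powr s * A m n \<le> 2 powr D * inverse c0 * \<bar>of_int n\<bar> powr (-1)"
proof (cases "m \<noteq> 0 \<and> n \<noteq> 0 \<and> m \<noteq> n")
  case True
  define x y z where "x = \<bar>real_of_int m\<bar>" "y = \<bar>real_of_int n\<bar>" "z = \<bar>real_of_int (m - n)\<bar>"
  note d = this
  have ge: "x \<ge> 1" "y \<ge> 1" "z \<ge> 1" unfolding d using True by (auto intro!: abs_int_ge1 simp del: of_int_diff)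
  have yz1: "1 \<le> y * z" using ge by (intro mult_ge1)
  have "x \<le> y + z" unfolding d by simp
  then have xyz: "x \<le> 2 * (y * z)" using sum_le_prod2 ge by fastforce
  have A': "A m n \<le> inverse c0 * (max y z powr (-1) * (y * z) powr (-D))"
    using A_bound_max[of m n] True unfolding d by blast
  have "x powr s * A m n \<le> (2 powr D * (x powr (-gam) * (y * z) powr D)) * (inverse c0 * (max y z powr (-1) * (y * z) powr (-D)))"
    using ge yz1 xyz A' A_nonneg by (intro mult_mono weight_prod) auto
  also have "\<dots> = 2 powr D * inverse c0 * (x powr (-gam) * max y z powr (-1)) * ((y * z) powr D * (y * z) powr (-D))"
    by (simp only: mult_ac)
  also have "\<dots> = 2 powr D * inverse c0 * (x powr (-gam) * max y z powr (-1))" using powr_D_cancel[of "y*z"] yz1 by simp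
  also have "\<dots> \<le> 2 powr D * inverse c0 * (1 * y powr (-1))"
    using ge J2 c0_pos powr_mono[of "-gam" 0 x] by (intro mult_left_mono mult_mono powr_mono2') (auto simp: gam_def)
  finally show ?thesis unfolding d by simp
qed (use c0_pos in auto)

definition CGG :: real where "CGG = 4 powr D * (inverse c0)^2 * 4"

text \<open>Two inverse phases pay for the derivative without any oscillation. Each factor
  \<open>1 / M\<close> is split into the power 5/8 of an inner frequency and the power 3/8 of the
  outer one: after squaring, the inner sums converge as 5/4 > 1, and the sum over \<open>n\<close>
  converges by Cauchy-Schwarz as 3/4 + 3/4 > 1.\<close>

lemma kernel_GG:
  fixes m n k l :: int
  shows "(\<bar>of_int m\<bar> powr (1+s) * A n k * A (m - n) l)^2
    \<le> CGG^2 * (\<bar>of_int k\<bar> powr (-5/4) * \<bar>of_int l\<bar> powr (-5/4) * (\<bar>of_int n\<bar> powr (-3/4) * \<bar>of_int (m - n)\<bar> powr (-3/4)))"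
proof (cases "m \<noteq> 0 \<and> n \<noteq> 0 \<and> m \<noteq> n \<and> k \<noteq> 0 \<and> k \<noteq> n \<and> l \<noteq> 0 \<and> l \<noteq> m - n")
  case True
  define x y z where "x = \<bar>real_of_int m\<bar>" "y = \<bar>real_of_int n\<bar>" "z = \<bar>real_of_int (m - n)\<bar>"
  note d = this
  define a a' b b' where "a = \<bar>real_of_int k\<bar>" "a' = \<bar>real_of_int (n - k)\<bar>" "b = \<bar>real_of_int l\<bar>" "b' = \<bar>real_of_int (m - n - l)\<bar>"
  note d' = this
  have ge: "x \<ge> 1" "y \<ge> 1" "z \<ge> 1" "a \<ge> 1" "a' \<ge> 1" "b \<ge> 1" "b' \<ge> 1" unfolding d d' using True by (auto intro!: abs_int_ge1 simp del: of_int_diff)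
  have p1: "1 \<le> a * a'" "1 \<le> b * b'" using ge by (auto intro: mult_ge1)
  have p2: "1 \<le> (a * a') * (b * b')" by (rule mult_ge1[OF p1])
  have tri: "x \<le> y + z" "y \<le> a + a'" "z \<le> b + b'" unfolding d d' by simp_all
  have "x \<le> 2 * (a * a') + 2 * (b * b')" using tri sum_le_prod2[of a a'] sum_le_prod2[of b b'] ge by linarith
  then have x4: "x \<le> 4 * ((a * a') * (b * b'))" using sum_le_prod2[OF p1] by linarith
  have half: "M powr (-1) \<le> 2 * (u powr (-5/8) * v powr (-3/8))" if "1 \<le> u" "u \<le> M" "1 \<le> v" "v \<le> 2 * M" for M u v :: real
  proof -
    have "(v / 2) powr (-(3/8)) = v powr (-(3/8)) * 2 powr (3/8)" using that by (simp add: powr_divide powr_minus field_simps)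
    also have "\<dots> \<le> v powr (-(3/8)) * 2 powr 1" by (intro mult_left_mono powr_mono) auto
    finally have v: "(v / 2) powr (-(3/8)) \<le> 2 * v powr (-(3/8))" by simp
    have "M powr (-1) = M powr (-(5/8)) * M powr (-(3/8))" unfolding powr_add[symmetric] by simp
    also have "\<dots> \<le> u powr (-(5/8)) * (v / 2) powr (-(3/8))" using that by (intro mult_mono powr_mono2') auto
    also have "\<dots> \<le> u powr (-(5/8)) * (2 * v powr (-(3/8)))" by (intro mult_left_mono v) auto
    finally show ?thesis by (simp only: mult_ac minus_divide_left)
  qed
  have A1: "A n k \<le> inverse c0 * (max a a' powr (-1) * (a * a') powr (-D))"
    using A_bound_max[of n k] True unfolding d' by blast
  have A2: "A (m-n) l \<le> inverse c0 * (max b b' powr (-1) * (b * b') powr (-D))"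
    using A_bound_max[of "m-n" l] True unfolding d' by auto
  have nn: "0 \<le> inverse c0" using c0_pos by simp
  have "x powr (1+s) * A n k * A (m - n) l \<le> (4 powr D * (x powr (1-gam) * ((a * a') * (b * b')) powr D))
     * (inverse c0 * (max a a' powr (-1) * (a * a') powr (-D))) * (inverse c0 * (max b b' powr (-1) * (b * b') powr (-D)))"
    using ge p2 x4 A1 A2 A_nonneg nn by (intro mult_mono weight_prod1) auto
  also have "\<dots> = 4 powr D * (inverse c0)^2 * x powr (1-gam) * (max a a' powr (-1) * max b b' powr (-1))
     * (((a * a') powr D * (a * a') powr (-D)) * ((b * b') powr D * (b * b') powr (-D)))"
    unfolding powr_mult[of "a * a'" "b * b'"] power2_eq_square by (simp only: mult_ac)
  also have "\<dots> = 4 powr D * (inverse c0)^2 * x powr (1-gam) * (max a a' powr (-1) * max b b' powr (-1))"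
    using powr_D_cancel[of "a*a'"] powr_D_cancel[of "b*b'"] p1 by simp
  also have "\<dots> \<le> 4 powr D * (inverse c0)^2 * 1 * ((2 * (a powr (-5/8) * y powr (-3/8))) * (2 * (b powr (-5/8) * z powr (-3/8))))"
    using ge J2 powr_mono[of "1-gam" 0 x] tri by (intro mult_mono half) (auto simp: gam_def)
  finally have "(x powr (1+s) * A n k * A (m - n) l)^2 \<le> (4 powr D * (inverse c0)^2 * 1 * ((2 * (a powr (-5/8) * y powr (-3/8))) * (2 * (b powr (-5/8) * z powr (-3/8)))))^2"
    using A_nonneg by (intro power_mono) auto
  also have "\<dots> = CGG^2 * ((a powr (-5/8) * a powr (-5/8)) * (b powr (-5/8) * b powr (-5/8)) * ((y powr (-3/8) * y powr (-3/8)) * (z powr (-3/8) * z powr (-3/8))))"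
    unfolding CGG_def power2_eq_square by (simp only: mult_ac mult_1_right)
  also have "\<dots> = CGG^2 * (a powr (-5/4) * b powr (-5/4) * (y powr (-3/4) * z powr (-3/4)))"
    unfolding powr_add[symmetric] by simp
  finally show ?thesis unfolding d d' .
qed auto

end

section \<open>Oscillatory integrals in time\<close>

lemma norm_diff_le_of_vector_derivative:
  fixes f :: "real \<Rightarrow> complex"
  assumes d: "\<And>x. x \<in> {a..b} \<Longrightarrow> (f has_vector_derivative f' x) (at x within {a..b})"
    and B: "\<And>x. x \<in> {a..b} \<Longrightarrow> norm (f' x) \<le> B"
    and ts: "t \<in> {a..b}" "u \<in> {a..b}"
  shows "norm (f t - f u) \<le> B * \<bar>t - u\<bar>"
proof -
  have *: "norm (f t - f u) \<le> B * (t - u)" if "u \<le> t" "t \<in> {a..b}" "u \<in> {a..b}" for t u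
  proof -
    have sub: "{u..t} \<subseteq> {a..b}" using that by auto
    have "(f' has_integral (f t - f u)) {u..t}"
      by (rule fundamental_theorem_of_calculus)
        (use that sub in \<open>auto intro!: has_vector_derivative_within_subset[OF d sub]\<close>)
    moreover have "0 \<le> B" using B[OF that(2)] norm_ge_zero order_trans by blast
    ultimately have "norm (f t - f u) \<le> B * measure lborel (cbox u t)"
      using B sub by (intro has_integral_bound[of B f']) auto
    then show ?thesis using that by simp
  qed
  show ?thesis
  proof (cases "u \<le> t")
    case True
    then show ?thesis using *[of u t] ts by simp
  next
    case False
    then show ?thesis using *[of t u] ts by (simp add: norm_minus_commute)
  qed
qed

section \<open>Integration by parts against an oscillating factor\<close>

definition ph :: "real \<Rightarrow> real \<Rightarrow> complex" where "ph \<theta> t = cis (\<theta> * t)"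

lemma norm_ph [simp]: "norm (ph \<theta> t) = 1" unfolding ph_def by simp

lemma ph_add: "ph (\<theta> + \<theta>') t = ph \<theta> t * ph \<theta>' t"
  unfolding ph_def by (simp add: cis_mult distrib_right)

lemma ph_0 [simp]: "ph 0 t = 1" unfolding ph_def by simp

lemma ph_minus: "ph \<theta> t * ph (-\<theta>) t = 1" using ph_add[of \<theta> "-\<theta>" t] by simp

lemma ph_deriv: "(ph \<theta> has_vector_derivative (\<i> * of_real \<theta> * ph \<theta> t)) (at t within S)"
proof -
  have e: "ph \<theta> = (\<lambda>t. exp (\<i> * of_real \<theta> * of_real t))"
    unfolding ph_def by (auto simp: cis_conv_exp mult_ac)
  have "((\<lambda>z. exp (\<i> * of_real \<theta> * z)) has_field_derivative (\<i> * of_real \<theta> * exp (\<i> * of_real \<theta> * of_real t))) (at (of_real t))"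
    by (auto intro!: derivative_eq_intros)
  from has_vector_derivative_real_field[OF this] show ?thesis
    unfolding e by (auto intro: has_vector_derivative_at_within)
qed

lemma continuous_on_ph [continuous_intros]: "continuous_on S (ph \<theta>)"
  unfolding ph_def by (intro continuous_intros)

text \<open>Functions on \<open>[a, b]\<close> are continued by their end values, so that bounds and
  moduli of continuity can be stated for all real times.\<close>

definition cl :: "real \<Rightarrow> real \<Rightarrow> real \<Rightarrow> real" where "cl a b t = max a (min t b)"

lemma cl_in: "a \<le> b \<Longrightarrow> cl a b t \<in> {a..b}" unfolding cl_def by auto
lemma cl_id: "t \<in> {a..b} \<Longrightarrow> cl a b t = t" unfolding cl_def by auto
lemma cl_diff: "a \<le> b \<Longrightarrow> \<bar>cl a b t - cl a b u\<bar> \<le> min \<bar>t - u\<bar> (b - a)" unfolding cl_def by (auto simp: min_def max_def)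

definition osc_int :: "real \<Rightarrow> real \<Rightarrow> (real \<Rightarrow> complex) \<Rightarrow> real \<Rightarrow> complex" where
  "osc_int a \<theta> \<phi> t = integral {a..t} (\<lambda>r. ph \<theta> r * \<phi> r)"

lemma osc_int_deriv:
  assumes "continuous_on UNIV \<phi>" "t \<in> {a..b}"
  shows "(osc_int a \<theta> \<phi> has_vector_derivative ph \<theta> t * \<phi> t) (at t within {a..b})"
  unfolding osc_int_def
  by (rule integral_has_vector_derivative)
    (use assms in \<open>auto intro!: continuous_intros intro: continuous_on_subset\<close>)

lemma osc_int_triv:
  assumes c: "continuous_on UNIV \<phi>" and P: "\<And>t. norm (\<phi> t) \<le> P" and ab: "a \<le> b"
  shows "norm (osc_int a \<theta> \<phi> (cl a b t)) \<le> P * (b - a)"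
    and "norm (osc_int a \<theta> \<phi> (cl a b t) - osc_int a \<theta> \<phi> (cl a b u)) \<le> P * min \<bar>t - u\<bar> (b - a)"
proof -
  have P0: "0 \<le> P" using P[of 0] norm_ge_zero order_trans by blast
  have L: "norm (osc_int a \<theta> \<phi> t - osc_int a \<theta> \<phi> u) \<le> P * \<bar>t - u\<bar>" if "t \<in> {a..b}" "u \<in> {a..b}" for t u
    by (rule norm_diff_le_of_vector_derivative[OF osc_int_deriv[OF c] _ that]) (auto simp: norm_mult P)
  have "norm (osc_int a \<theta> \<phi> (cl a b t) - osc_int a \<theta> \<phi> a) \<le> P * \<bar>cl a b t - a\<bar>"
    by (intro L) (use cl_in[OF ab, of t] ab in auto)
  also have "\<dots> \<le> P * (b - a)" using cl_in[OF ab, of t] P0 by (intro mult_left_mono) auto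
  finally show "norm (osc_int a \<theta> \<phi> (cl a b t)) \<le> P * (b - a)" by (simp add: osc_int_def)
  have "norm (osc_int a \<theta> \<phi> (cl a b t) - osc_int a \<theta> \<phi> (cl a b u)) \<le> P * \<bar>cl a b t - cl a b u\<bar>"
    by (intro L cl_in ab)
  also have "\<dots> \<le> P * min \<bar>t - u\<bar> (b - a)" by (intro mult_left_mono cl_diff ab P0)
  finally show "norm (osc_int a \<theta> \<phi> (cl a b t) - osc_int a \<theta> \<phi> (cl a b u)) \<le> P * min \<bar>t - u\<bar> (b - a)" .
qed

text \<open>The average of \<open>\<phi>\<close> over \<open>[t, t + h]\<close>: a mollification at the scale of the oscillation.\<close>

definition low :: "real \<Rightarrow> (real \<Rightarrow> complex) \<Rightarrow> real \<Rightarrow> complex" where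
  "low h \<phi> t = of_real (1/h) * integral {0..h} (\<lambda>r. \<phi> (t + r))"

lemma low_bounds:
  assumes c: "continuous_on UNIV \<phi>" and h: "h > 0"
  shows "(\<And>r. norm (\<phi> r) \<le> P) \<Longrightarrow> norm (low h \<phi> t) \<le> P"
    and "(\<And>r. norm (\<phi> (t + r) - \<phi> (u + r)) \<le> P) \<Longrightarrow> norm (low h \<phi> t - low h \<phi> u) \<le> P"
    and "(\<And>r. 0 \<le> r \<Longrightarrow> r \<le> h \<Longrightarrow> norm (\<phi> (t + r) - \<phi> t) \<le> P) \<Longrightarrow> norm (low h \<phi> t - \<phi> t) \<le> P"
proof -
  have cc: "continuous_on {0..h} (\<lambda>r. \<phi> (x + r))" for x
    by (rule continuous_on_compose2[OF c]) (auto intro!: continuous_intros)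
  note i = integrable_continuous_real[OF cc]
  have gen: "norm (of_real (1/h) * integral {0..h} \<psi>) \<le> P"
    if "continuous_on {0..h} \<psi>" "\<And>r. r \<in> {0..h} \<Longrightarrow> norm (\<psi> r) \<le> P" for \<psi> :: "real \<Rightarrow> complex"
  proof -
    have "norm (integral {0..h} \<psi>) \<le> P * (h - 0)" using h that by (intro integral_bound) auto
    then show ?thesis using h by (simp add: norm_mult norm_divide field_simps)
  qed
  show "norm (low h \<phi> t) \<le> P" if "\<And>r. norm (\<phi> r) \<le> P"
    unfolding low_def using that by (intro gen cc) auto
  show "norm (low h \<phi> t - low h \<phi> u) \<le> P" if "\<And>r. norm (\<phi> (t + r) - \<phi> (u + r)) \<le> P"
  proof -
    have "low h \<phi> t - low h \<phi> u = of_real (1/h) * integral {0..h} (\<lambda>r. \<phi> (t + r) - \<phi> (u + r))"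
      unfolding low_def integral_diff[OF i i] by (simp add: right_diff_distrib)
    also have "norm \<dots> \<le> P" using that by (intro gen continuous_intros cc) auto
    finally show ?thesis .
  qed
  show "norm (low h \<phi> t - \<phi> t) \<le> P" if "\<And>r. 0 \<le> r \<Longrightarrow> r \<le> h \<Longrightarrow> norm (\<phi> (t + r) - \<phi> t) \<le> P"
  proof -
    have "low h \<phi> t - \<phi> t = of_real (1/h) * integral {0..h} (\<lambda>r. \<phi> (t + r) - \<phi> t)"
      unfolding low_def integral_diff[OF i integrable_const_ivl] using h by (simp add: right_diff_distrib scaleR_conv_of_real)
    also have "norm \<dots> \<le> P" using that by (intro gen continuous_intros cc) auto
    finally show ?thesis .
  qed
qed

lemma low_deriv:
  assumes c: "continuous_on UNIV \<phi>" and h: "h > 0" and t: "t \<in> {a..b}"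
  shows "(low h \<phi> has_vector_derivative (of_real (1/h) * (\<phi> (t + h) - \<phi> t))) (at t within {a..b})"
proof -
  define \<Phi> where "\<Phi> x = integral {a..x} \<phi>" for x
  have c': "continuous_on A \<phi>" for A using c by (rule continuous_on_subset) auto
  have d: "(\<Phi> has_vector_derivative \<phi> x) (at x within {a..b+h})" if "x \<in> {a..b+h}" for x
    unfolding \<Phi>_def by (rule integral_has_vector_derivative[OF c' that])
  have eq: "low h \<phi> x = of_real (1/h) * (\<Phi> (x + h) - \<Phi> x)" if "x \<in> {a..b}" for x
  proof -
    have "integral {0..h} (\<lambda>r. \<phi> (x + r)) = integral {x..x+h} \<phi>"
      using integral_shift_Icc_real[of 0 h \<phi> x] by (simp add: o_def add.commute)
    also have "\<dots> = \<Phi> (x + h) - \<Phi> x"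
      using Henstock_Kurzweil_Integration.integral_combine[of a x "x+h" \<phi>] that h c'
      unfolding \<Phi>_def by (simp add: integrable_continuous_real algebra_simps)
    finally show ?thesis unfolding low_def by simp
  qed
  have 1: "(\<Phi> has_vector_derivative \<phi> t) (at t within {a..b})"
    by (rule has_vector_derivative_within_subset[OF d]) (use t h in auto)
  have "((\<Phi> \<circ> (\<lambda>x. x + h)) has_vector_derivative (1 *\<^sub>R \<phi> (t + h))) (at t within {a..b})"
  proof (rule vector_diff_chain_within)
    show "((\<lambda>x. x + h) has_vector_derivative 1) (at t within {a..b})"
      by (auto intro!: derivative_eq_intros)
    show "(\<Phi> has_vector_derivative \<phi> (t + h)) (at (t + h) within (\<lambda>x. x + h) ` {a..b})"
      by (rule has_vector_derivative_within_subset[OF d]) (use t h in auto)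
  qed
  then have "((\<lambda>x. of_real (1/h) * (\<Phi> (x + h) - \<Phi> x)) has_vector_derivative (of_real (1/h) * (\<phi> (t + h) - \<phi> t))) (at t within {a..b})"
    using 1 by (auto intro!: derivative_eq_intros simp: o_def)
  then show ?thesis
    by (rule has_vector_derivative_transform[OF t, rotated]) (simp add: eq)
qed

text \<open>Amplitude of an approximate primitive of \<open>ph \<theta> t * \<phi> t\<close>:
  division by \<open>\<i> * \<theta>\<close> integrates the phase exactly, and the averaging length
  is one period up to the factor \<open>2 * pi\<close>.\<close>

definition prim :: "real \<Rightarrow> (real \<Rightarrow> complex) \<Rightarrow> real \<Rightarrow> complex" where
  "prim \<theta> \<phi> t = low (1 / (abs \<theta>)) \<phi> t / (\<i> * of_real \<theta>)"

text \<open>The derivative of the remainder consists of \<open>\<phi>\<close> minus its average and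
  of the derivative of the average divided by \<open>\<theta>\<close>. At the scale
  \<open>1 / \<bar>\<theta>\<bar>\<close> each is at most the oscillation \<open>D\<close> of
  \<open>\<phi>\<close> over that time, hence \<open>2 * D\<close>. The term
  \<open>P / \<bar>\<theta>\<bar>\<close> is the boundary value at \<open>a\<close>.\<close>

lemma osc_int_low:
  fixes \<theta> :: real
  assumes c: "continuous_on UNIV \<phi>" and P: "\<And>t. norm (\<phi> t) \<le> P" and ab: "a \<le> b" and \<theta>: "\<theta> \<noteq> 0"
    and D: "\<And>t u. \<bar>t - u\<bar> \<le> 1 / \<bar>\<theta>\<bar> \<Longrightarrow> norm (\<phi> t - \<phi> u) \<le> D"
  defines "q \<equiv> \<lambda>t. osc_int a \<theta> \<phi> t - ph \<theta> t * prim \<theta> \<phi> t"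
  shows "norm (q (cl a b t)) \<le> P / \<bar>\<theta>\<bar> + 2 * D * (b - a)"
    and "norm (q (cl a b t) - q (cl a b u)) \<le> 2 * D * min \<bar>t - u\<bar> (b - a)"
proof -
  define h where "h = 1/\<bar>\<theta>\<bar>"
  have h: "h > 0" "h * \<bar>\<theta>\<bar> = 1" using \<theta> by (auto simp: h_def)
  have D0: "0 \<le> D" using D[of 0 0] by simp
  define q' where "q' t = ph \<theta> t * \<phi> t - (ph \<theta> t * (of_real (1/h) * (\<phi> (t + h) - \<phi> t) / (\<i> * of_real \<theta>)) + \<i> * of_real \<theta> * ph \<theta> t * (low h \<phi> t / (\<i> * of_real \<theta>)))" for t
  have dq: "(q has_vector_derivative q' t) (at t within {a..b})" if "t \<in> {a..b}" for t
    unfolding q_def prim_def q'_def h_def[symmetric]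
    by (intro has_vector_derivative_diff has_vector_derivative_mult osc_int_deriv ph_deriv has_vector_derivative_divide low_deriv c h that)
  have q'b: "norm (q' t) \<le> 2 * D" for t
  proof -
    have "q' t = ph \<theta> t * (\<phi> t - low h \<phi> t) - ph \<theta> t * (of_real (1/h) * (\<phi> (t + h) - \<phi> t) / (\<i> * of_real \<theta>))"
      unfolding q'_def using \<theta> by (simp add: field_simps)
    also have "norm \<dots> \<le> norm (\<phi> t - low h \<phi> t) + norm (of_real (1/h) * (\<phi> (t + h) - \<phi> t) / (\<i> * of_real \<theta>))"
      by (rule order_trans[OF norm_triangle_ineq4]) (simp only: norm_mult norm_ph mult_1_left order_refl)
    also have "norm (of_real (1/h) * (\<phi> (t + h) - \<phi> t) / (\<i> * of_real \<theta>)) = norm (\<phi> (t + h) - \<phi> t)"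
      using h \<theta> by (simp add: norm_mult norm_divide h_def)
    also have "\<dots> \<le> D" using h by (intro D) (simp add: h_def)
    also have "norm (\<phi> t - low h \<phi> t) \<le> D"
      unfolding norm_minus_commute[of "\<phi> t"] using h
      by (intro low_bounds(3)[OF c h(1)] D) (auto simp: h_def)
    finally show ?thesis by simp
  qed
  have L: "norm (q t - q u) \<le> 2 * D * \<bar>t - u\<bar>" if "t \<in> {a..b}" "u \<in> {a..b}" for t u
    by (rule norm_diff_le_of_vector_derivative[OF dq q'b that])
  have "q a = - (ph \<theta> a * (low h \<phi> a / (\<i> * of_real \<theta>)))" unfolding q_def prim_def h_def osc_int_def by simp
  then have "norm (q a) = norm (low h \<phi> a) / \<bar>\<theta>\<bar>" by (simp add: norm_mult norm_divide)
  also have "\<dots> \<le> P / \<bar>\<theta>\<bar>" by (intro divide_right_mono low_bounds(1)[OF c h(1)] P) auto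
  finally have qa: "norm (q a) \<le> P / \<bar>\<theta>\<bar>" .
  have "norm (q (cl a b t)) \<le> norm (q a) + norm (q (cl a b t) - q a)"
    using norm_triangle_ineq[of "q a" "q (cl a b t) - q a"] by simp
  also have "norm (q (cl a b t) - q a) \<le> 2 * D * \<bar>cl a b t - a\<bar>" by (intro L) (use cl_in[OF ab, of t] ab in auto)
  also have "\<dots> \<le> 2 * D * (b - a)" using cl_in[OF ab, of t] D0 by (intro mult_left_mono) auto
  finally show "norm (q (cl a b t)) \<le> P / \<bar>\<theta>\<bar> + 2 * D * (b - a)" using qa by simp
  have "norm (q (cl a b t) - q (cl a b u)) \<le> 2 * D * \<bar>cl a b t - cl a b u\<bar>"
    by (intro L cl_in ab)
  also have "\<dots> \<le> 2 * D * min \<bar>t - u\<bar> (b - a)" using D0 by (intro mult_left_mono cl_diff ab) auto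
  finally show "norm (q (cl a b t) - q (cl a b u)) \<le> 2 * D * min \<bar>t - u\<bar> (b - a)" .
qed

text \<open>The factor \<open>\<eta>\<close> weights the modulus of continuity \<open>\<mu>\<close> against the supremum norm. Small
  \<open>\<eta>\<close>, chosen before the time step, makes the constant of the bilinear estimate small.\<close>

definition hold :: "real \<Rightarrow> (real \<Rightarrow> real) \<Rightarrow> real \<Rightarrow> (real \<Rightarrow> complex) \<Rightarrow> bool" where
  "hold \<eta> \<mu> M f \<longleftrightarrow> (\<forall>t. norm (f t) \<le> M) \<and> (\<forall>t u. \<bar>t - u\<bar> \<le> 1 \<longrightarrow> \<eta> * norm (f t - f u) \<le> M * \<mu> \<bar>t - u\<bar>)"

lemma hold_mono:
  assumes "hold \<eta> \<mu> M f" "M \<le> M'" "\<And>h. 0 \<le> h \<Longrightarrow> h \<le> 1 \<Longrightarrow> 0 \<le> \<mu> h"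
  shows "hold \<eta> \<mu> M' f"
proof -
  have "M * \<mu> \<bar>t - u\<bar> \<le> M' * \<mu> \<bar>t - u\<bar>" if "\<bar>t - u\<bar> \<le> 1" for t u :: real
    using assms that by (intro mult_right_mono) auto
  then show ?thesis using assms unfolding hold_def by (meson order_trans)
qed

lemma hold_nonneg: "hold \<eta> \<mu> M f \<Longrightarrow> 0 \<le> M"
  unfolding hold_def by (meson norm_ge_zero order_trans)

lemma hold_norm: "hold \<eta> \<mu> M f \<Longrightarrow> norm (f t) \<le> M" unfolding hold_def by blast

lemma hold_0 [simp]: "hold \<eta> \<mu> 0 (\<lambda>t. 0)" unfolding hold_def by simp

lemma hold_const: "0 \<le> norm c * 1 \<Longrightarrow> (\<And>h. 0 \<le> h \<Longrightarrow> h \<le> 1 \<Longrightarrow> 0 \<le> \<mu> h) \<Longrightarrow> hold \<eta> \<mu> (norm c) (\<lambda>t. c)"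
  unfolding hold_def by simp

lemma hold_add:
  assumes "hold \<eta> \<mu> M f" "hold \<eta> \<mu> N g" "0 \<le> \<eta>"
  shows "hold \<eta> \<mu> (M + N) (\<lambda>t. f t + g t)"
proof -
  have "\<eta> * norm (f t + g t - (f u + g u)) \<le> (M + N) * \<mu> \<bar>t - u\<bar>" if "\<bar>t - u\<bar> \<le> 1" for t u
  proof -
    have "norm (f t + g t - (f u + g u)) \<le> norm (f t - f u) + norm (g t - g u)"
      by (metis add_diff_add norm_triangle_ineq)
    then have "\<eta> * norm (f t + g t - (f u + g u)) \<le> \<eta> * norm (f t - f u) + \<eta> * norm (g t - g u)"
      using assms(3) by (metis distrib_left mult_left_mono)
    also have "\<dots> \<le> M * \<mu> \<bar>t - u\<bar> + N * \<mu> \<bar>t - u\<bar>" using assms that unfolding hold_def by (intro add_mono) auto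
    finally show ?thesis by (simp add: distrib_right)
  qed
  moreover have "norm (f t + g t) \<le> M + N" for t
    using hold_norm[OF assms(1)] hold_norm[OF assms(2)] by (metis add_mono norm_triangle_le)
  ultimately show ?thesis unfolding hold_def by blast
qed

lemma hold_cmult:
  assumes "hold \<eta> \<mu> M f"
  shows "hold \<eta> \<mu> (norm c * M) (\<lambda>t. c * f t)"
  unfolding hold_def
proof (intro conjI allI impI)
  show "norm (c * f t) \<le> norm c * M" for t
    using hold_norm[OF assms] by (simp add: norm_mult mult_left_mono)
  fix t u :: real assume "\<bar>t - u\<bar> \<le> 1"
  then have "\<eta> * norm (f t - f u) \<le> M * \<mu> \<bar>t - u\<bar>" using assms unfolding hold_def by blast
  then have "norm c * (\<eta> * norm (f t - f u)) \<le> norm c * (M * \<mu> \<bar>t - u\<bar>)" by (intro mult_left_mono) auto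
  then show "\<eta> * norm (c * f t - c * f u) \<le> norm c * M * \<mu> \<bar>t - u\<bar>"
    by (simp add: norm_mult right_diff_distrib[symmetric] mult_ac)
qed

lemma hold_weaken:
  assumes "hold \<eta> \<mu> M f" "\<eta>' \<le> \<eta>"
  shows "hold \<eta>' \<mu> M f"
  unfolding hold_def
proof (intro conjI allI impI)
  show "norm (f t) \<le> M" for t using hold_norm[OF assms(1)] .
  fix t u :: real assume "\<bar>t - u\<bar> \<le> 1"
  then have "\<eta> * norm (f t - f u) \<le> M * \<mu> \<bar>t - u\<bar>" using assms unfolding hold_def by blast
  moreover have "\<eta>' * norm (f t - f u) \<le> \<eta> * norm (f t - f u)" using assms by (intro mult_right_mono) auto
  ultimately show "\<eta>' * norm (f t - f u) \<le> M * \<mu> \<bar>t - u\<bar>" by linarith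
qed

lemma hold_strengthen:
  assumes "hold \<eta> \<mu> M f" "0 < \<eta>" "\<eta> \<le> 1" "\<And>h. 0 \<le> h \<Longrightarrow> h \<le> 1 \<Longrightarrow> 0 \<le> \<mu> h"
  shows "hold 1 \<mu> (M / \<eta>) f"
  unfolding hold_def
proof (intro conjI allI impI)
  show "norm (f t) \<le> M / \<eta>" for t
  proof -
    have "\<eta> * norm (f t) \<le> 1 * norm (f t)" using assms(3) by (intro mult_right_mono) auto
    then show ?thesis using hold_norm[OF assms(1), of t] assms(2) by (simp add: field_simps)
  qed
  fix t u :: real assume "\<bar>t - u\<bar> \<le> 1"
  then have "\<eta> * norm (f t - f u) \<le> M * \<mu> \<bar>t - u\<bar>" using assms unfolding hold_def by blast
  then show "1 * norm (f t - f u) \<le> M / \<eta> * \<mu> \<bar>t - u\<bar>" using assms(2) by (simp add: field_simps)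
qed

lemma has_sum_minus:
  fixes f g :: "'a \<Rightarrow> 'b :: real_normed_vector"
  assumes "(f has_sum a) A" "(g has_sum b) A"
  shows "((\<lambda>x. f x - g x) has_sum (a - b)) A"
proof -
  have "((\<lambda>x. - g x) has_sum (- b)) A" using assms(2) by (simp add: has_sum_uminus)
  from has_sum_add[OF assms(1) this] show ?thesis by simp
qed

text \<open>The bounds add up, so an absolutely convergent series inherits its modulus of continuity
  term by term. The double series of the bilinear estimate become functions of a given type in this
  way.\<close>

lemma hold_infsum:
  fixes f :: "'i \<Rightarrow> real \<Rightarrow> complex"
  assumes h: "\<And>i. i \<in> I \<Longrightarrow> hold \<eta> \<mu> (M i) (f i)" and s: "M summable_on I" and \<eta>: "0 \<le> \<eta>"
  shows "hold \<eta> \<mu> (infsum M I) (\<lambda>t. infsum (\<lambda>i. f i t) I)" and "(\<lambda>i. norm (f i t)) summable_on I"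
proof -
  have abs: "(\<lambda>i. norm (f i t)) summable_on I" for t
    by (rule summable_on_comparison_test[OF s]) (use h in \<open>auto dest: hold_norm\<close>)
  then show "(\<lambda>i. norm (f i t)) summable_on I" .
  have sm: "(\<lambda>i. f i t) summable_on I" for t by (rule Infinite_Sum.abs_summable_summable[OF abs])
  show "hold \<eta> \<mu> (infsum M I) (\<lambda>t. infsum (\<lambda>i. f i t) I)"
    unfolding hold_def
  proof (intro conjI allI impI)
    show "norm (infsum (\<lambda>i. f i t) I) \<le> infsum M I" for t
      by (rule order_trans[OF norm_infsum_bound[OF abs]], rule infsum_mono[OF abs s]) (use h in \<open>auto dest: hold_norm\<close>)
    fix t u :: real assume tu: "\<bar>t - u\<bar> \<le> 1"
    have ad: "(\<lambda>i. norm (f i t - f i u)) summable_on I"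
    proof (rule summable_on_comparison_test)
      show "(\<lambda>i. norm (f i t) + norm (f i u)) summable_on I" by (intro summable_on_add abs)
    qed (simp_all add: norm_triangle_ineq4)
    have "infsum (\<lambda>i. f i t) I - infsum (\<lambda>i. f i u) I = infsum (\<lambda>i. f i t - f i u) I"
      using infsumI[OF has_sum_minus[OF has_sum_infsum[OF sm] has_sum_infsum[OF sm]]] by simp
    then have "\<eta> * norm (infsum (\<lambda>i. f i t) I - infsum (\<lambda>i. f i u) I) \<le> \<eta> * infsum (\<lambda>i. norm (f i t - f i u)) I"
      using norm_infsum_bound[OF ad] \<eta> by (simp add: mult_left_mono)
    also have "\<dots> = infsum (\<lambda>i. \<eta> * norm (f i t - f i u)) I" by (simp add: infsum_cmult_right')
    also have "\<dots> \<le> infsum (\<lambda>i. M i * \<mu> \<bar>t - u\<bar>) I"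
    proof (rule infsum_mono)
      show "(\<lambda>i. \<eta> * norm (f i t - f i u)) summable_on I" using ad by (rule summable_on_cmult_right)
      show "(\<lambda>i. M i * \<mu> \<bar>t - u\<bar>) summable_on I" using s by (rule summable_on_cmult_left)
    qed (use h tu in \<open>auto simp: hold_def\<close>)
    also have "\<dots> = infsum M I * \<mu> \<bar>t - u\<bar>" by (simp add: infsum_cmult_left')
    finally show "\<eta> * norm (infsum (\<lambda>i. f i t) I - infsum (\<lambda>i. f i u) I) \<le> infsum M I * \<mu> \<bar>t - u\<bar>" .
  qed
qed

lemma hold_continuous:
  assumes "hold \<eta> \<mu> M f" "0 < \<eta>" "((\<lambda>h. \<mu> h) \<longlongrightarrow> 0) (at_right 0)"
  shows "continuous_on UNIV f"
  unfolding continuous_on_iff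
proof (intro ballI allI impI)
  fix t e :: real assume e: "0 < e"
  have "((\<lambda>h. M / \<eta> * \<mu> h) \<longlongrightarrow> M / \<eta> * 0) (at_right 0)" by (intro tendsto_intros assms)
  then have "eventually (\<lambda>h. M / \<eta> * \<mu> h < e) (at_right 0)"
    using order_tendstoD(2)[of "\<lambda>h. M / \<eta> * \<mu> h" 0] e by simp
  then obtain d where d: "d > 0" "\<And>h. 0 < h \<Longrightarrow> h < d \<Longrightarrow> M / \<eta> * \<mu> h < e"
    unfolding eventually_at_right_field by auto
  show "\<exists>d>0. \<forall>x'\<in>UNIV. dist x' t < d \<longrightarrow> dist (f x') (f t) < e"
  proof (intro exI conjI ballI impI)
    show "min d 1 > 0" using d by simp
    fix x' assume x: "dist x' t < min d 1"
    show "dist (f x') (f t) < e"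
    proof (cases "x' = t")
      case False
      have "\<eta> * norm (f x' - f t) \<le> M * \<mu> \<bar>x' - t\<bar>" using assms(1) x unfolding hold_def dist_real_def by auto
      then have "norm (f x' - f t) \<le> M / \<eta> * \<mu> \<bar>x' - t\<bar>" using assms(2) by (simp add: field_simps)
      also have "\<dots> < e" using False x by (intro d) (auto simp: dist_real_def)
      finally show ?thesis by (simp add: dist_norm)
    qed (use e in auto)
  qed
qed

lemma hold_mult:
  assumes "hold \<eta> \<mu> M f" "hold \<eta> \<nu> N g" "0 \<le> \<eta>"
  shows "hold \<eta> (\<lambda>h. \<mu> h + \<nu> h) (M * N) (\<lambda>t. f t * g t)"
  unfolding hold_def
proof (intro conjI allI impI)
  have MN: "0 \<le> M" "0 \<le> N" using assms hold_nonneg by auto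
  show "norm (f t * g t) \<le> M * N" for t
    unfolding norm_mult by (intro mult_mono hold_norm[OF assms(1)] hold_norm[OF assms(2)] MN norm_ge_zero)
  fix t u :: real assume tu: "\<bar>t - u\<bar> \<le> 1"
  have "f t * g t - f u * g u = (f t - f u) * g t + f u * (g t - g u)" by (simp add: algebra_simps)
  then have "norm (f t * g t - f u * g u) \<le> norm (f t - f u) * norm (g t) + norm (f u) * norm (g t - g u)"
    by (metis norm_mult norm_triangle_ineq)
  then have "\<eta> * norm (f t * g t - f u * g u) \<le> \<eta> * (norm (f t - f u) * norm (g t) + norm (f u) * norm (g t - g u))"
    using assms(3) by (rule mult_left_mono)
  also have "\<dots> = (\<eta> * norm (f t - f u)) * norm (g t) + norm (f u) * (\<eta> * norm (g t - g u))"
    by (simp add: algebra_simps)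
  also have "\<dots> \<le> (M * \<mu> \<bar>t - u\<bar>) * N + M * (N * \<nu> \<bar>t - u\<bar>)"
  proof (rule add_mono)
    have a: "\<eta> * norm (f t - f u) \<le> M * \<mu> \<bar>t - u\<bar>" using assms(1) tu unfolding hold_def by blast
    have b: "\<eta> * norm (g t - g u) \<le> N * \<nu> \<bar>t - u\<bar>" using assms(2) tu unfolding hold_def by blast
    have "0 \<le> M * \<mu> \<bar>t - u\<bar>" using a assms(3) by (meson mult_nonneg_nonneg norm_ge_zero order_trans)
    then show "(\<eta> * norm (f t - f u)) * norm (g t) \<le> (M * \<mu> \<bar>t - u\<bar>) * N"
      by (rule mult_mono[OF a hold_norm[OF assms(2)]]) simp
    show "norm (f u) * (\<eta> * norm (g t - g u)) \<le> M * (N * \<nu> \<bar>t - u\<bar>)"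
      by (rule mult_mono[OF hold_norm[OF assms(1)] b MN(1)]) (simp add: assms(3))
  qed
  also have "\<dots> = M * N * (\<mu> \<bar>t - u\<bar> + \<nu> \<bar>t - u\<bar>)" by (simp add: algebra_simps)
  finally show "\<eta> * norm (f t * g t - f u * g u) \<le> M * N * (\<mu> \<bar>t - u\<bar> + \<nu> \<bar>t - u\<bar>)" .
qed

lemma hold_dom:
  assumes "hold \<eta> \<mu> M f" "1 \<le> C" "\<And>h. 0 \<le> h \<Longrightarrow> h \<le> 1 \<Longrightarrow> \<mu> h \<le> C * \<nu> h"
  shows "hold \<eta> \<nu> (C * M) f"
  unfolding hold_def
proof (intro conjI allI impI)
  have M: "0 \<le> M" using assms hold_nonneg by auto
  show "norm (f t) \<le> C * M" for t
    using hold_norm[OF assms(1), of t] mult_right_mono[OF assms(2) M] by linarith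
  fix t u :: real assume tu: "\<bar>t - u\<bar> \<le> 1"
  have "\<eta> * norm (f t - f u) \<le> M * \<mu> \<bar>t - u\<bar>" using assms(1) tu unfolding hold_def by simp
  also have "\<dots> \<le> M * (C * \<nu> \<bar>t - u\<bar>)" using M assms(3) tu by (intro mult_left_mono) auto
  finally show "\<eta> * norm (f t - f u) \<le> C * M * \<nu> \<bar>t - u\<bar>" by (simp add: mult_ac)
qed

text \<open>Averaging commutes with translations in time and therefore preserves every modulus of
  continuity.\<close>

lemma hold_low:
  assumes f: "hold \<eta> \<mu> M f" and c: "continuous_on UNIV f" and h: "h > 0" and \<eta>: "\<eta> > 0"
  shows "hold \<eta> \<mu> M (low h f)"
  unfolding hold_def
proof (intro conjI allI impI)
  show "norm (low h f t) \<le> M" for t by (intro low_bounds(1)[OF c h] hold_norm[OF f])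
  fix t u :: real assume tu: "\<bar>t - u\<bar> \<le> 1"
  have "norm (low h f t - low h f u) \<le> M * \<mu> \<bar>t - u\<bar> / \<eta>"
  proof (rule low_bounds(2)[OF c h])
    fix r :: real
    have "\<eta> * norm (f (t + r) - f (u + r)) \<le> M * \<mu> \<bar>(t + r) - (u + r)\<bar>" using f tu unfolding hold_def by (metis add_diff_cancel_right)
    then show "norm (f (t + r) - f (u + r)) \<le> M * \<mu> \<bar>t - u\<bar> / \<eta>" using \<eta> by (simp add: field_simps)
  qed
  then show "\<eta> * norm (low h f t - low h f u) \<le> M * \<mu> \<bar>t - u\<bar>" using \<eta> by (simp add: field_simps)
qed

lemma powr_tendsto_0_right: "a > 0 \<Longrightarrow> ((\<lambda>h::real. h powr a) \<longlongrightarrow> 0) (at_right 0)"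
  by (rule tendsto_zero_powrI[of _ _ _ a])
    (auto intro: eventually_mono[OF eventually_at_right_less])

text \<open>The minimum is the product of its powers \<open>1 - a\<close> and \<open>a\<close>, and
  each entry bounds one of them.\<close>

lemma min_le_powr:
  fixes h k a :: real
  assumes "0 \<le> h" "0 \<le> k" "0 < a" "a < 1"
  shows "min h k \<le> k powr (1 - a) * h powr a"
proof (cases "h = 0 \<or> k = 0")
  case False
  then have hk: "h > 0" "k > 0" using assms by auto
  have "min h k = min h k powr (1 - a) * min h k powr a"
    unfolding powr_add[symmetric] using hk by simp
  also have "\<dots> \<le> k powr (1 - a) * h powr a" using hk assms by (intro mult_mono powr_mono2) auto
  finally show ?thesis .
qed (use assms in auto)

section \<open>Moduli of continuity of the two types of functions\<close>

context hkdv
begin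

text \<open>The first term has the order that products of two plain inputs require. The second, of
  lower order but decaying in the frequency, admits the boundary terms of mixed products.\<close>

definition mu :: "int \<Rightarrow> real \<Rightarrow> real" where
  "mu m h = h powr bet + \<bar>of_int m\<bar> powr (-(J-1)) * h powr (1/2)"

text \<open>The order to which both terms of \<open>mu m\<close> reduce at a nonzero frequency,
  hence the one inherited by the amplitude of a boundary term.\<close>

definition mug :: "real \<Rightarrow> real" where "mug h = h powr (1/2)"

lemma mu_nonneg: "0 \<le> mu m h" unfolding mu_def by simp
lemma mug_nonneg: "0 \<le> mug h" unfolding mug_def by simp

lemma mu_mono: "0 \<le> h \<Longrightarrow> h \<le> k \<Longrightarrow> mu m h \<le> mu m k"
  unfolding mu_def using bet_bounds by (intro add_mono mult_left_mono powr_mono2) auto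
lemma mug_mono: "0 \<le> h \<Longrightarrow> h \<le> k \<Longrightarrow> mug h \<le> mug k"
  unfolding mug_def by (intro powr_mono2) auto

lemma mu_le_mug: "m \<noteq> 0 \<Longrightarrow> 0 \<le> h \<Longrightarrow> h \<le> 1 \<Longrightarrow> mu m h \<le> 2 * mug h"
proof -
  assume m: "m \<noteq> 0" and h: "0 \<le> h" "h \<le> 1"
  have "h powr bet \<le> h powr (1/2)" using h bet_bounds by (intro powr_mono') auto
  moreover have "\<bar>of_int m\<bar> powr (-(J-1)) \<le> (1::real)"
    using powr_mono[of "-(J-1)" 0 "\<bar>of_int m\<bar>"] abs_int_ge1[OF m] J2 m by simp
  then have "\<bar>of_int m\<bar> powr (-(J-1)) * h powr (1/2) \<le> 1 * h powr (1/2)" by (intro mult_right_mono) auto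
  ultimately show ?thesis unfolding mu_def mug_def by linarith
qed

lemma mu_tendsto: "(mu m \<longlongrightarrow> 0) (at_right 0)"
proof -
  have "((\<lambda>h. h powr bet + \<bar>of_int m\<bar> powr (-(J-1)) * h powr (1/2)) \<longlongrightarrow> 0 + \<bar>of_int m\<bar> powr (-(J-1)) * 0) (at_right 0)"
    using bet_bounds by (intro tendsto_intros powr_tendsto_0_right) auto
  then show ?thesis unfolding mu_def by simp
qed

lemma mug_tendsto: "(mug \<longlongrightarrow> 0) (at_right 0)"
  unfolding mug_def by (rule powr_tendsto_0_right) simp

lemma hold_mu_continuous: "hold \<eta> (mu m) M f \<Longrightarrow> 0 < \<eta> \<Longrightarrow> continuous_on S f"
  by (rule continuous_on_subset[OF hold_continuous[OF _ _ mu_tendsto]]) auto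
lemma hold_mug_continuous: "hold \<eta> mug M f \<Longrightarrow> 0 < \<eta> \<Longrightarrow> continuous_on S f"
  by (rule continuous_on_subset[OF hold_continuous[OF _ _ mug_tendsto]]) auto

lemma min_le_mu: "0 \<le> h \<Longrightarrow> 0 \<le> \<tau> \<Longrightarrow> min h \<tau> \<le> \<tau> powr ex * mu m h"
proof -
  assume h: "0 \<le> h" "0 \<le> \<tau>"
  have "min h \<tau> \<le> \<tau> powr (1 - bet) * h powr bet" using h bet_bounds by (intro min_le_powr) auto
  also have "\<dots> \<le> \<tau> powr ex * mu m h" unfolding mu_def bet_def by (intro mult_mono) auto
  finally show ?thesis .
qed

lemma min_le_gw: "m \<noteq> 0 \<Longrightarrow> 0 \<le> h \<Longrightarrow> 0 < \<sigma> \<Longrightarrow> min h (1/\<sigma>) \<le> gw m \<sigma> * mu m h"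
proof -
  assume m: "m \<noteq> 0" and h: "0 \<le> h" "0 < \<sigma>"
  have p: "(1/\<sigma>) powr a = \<sigma> powr (-a)" for a using h by (simp add: powr_minus powr_divide field_simps)
  have 1: "min h (1/\<sigma>) \<le> \<sigma> powr (-ex) * mu m h" using min_le_mu[of h "1/\<sigma>" m] h unfolding p by simp
  have "min h (1/\<sigma>) \<le> \<sigma> powr (-(1/2)) * h powr (1/2)" using min_le_powr[of h "1/\<sigma>" "1/2"] h unfolding p by simp
  also have "\<dots> = (\<bar>of_int m\<bar> powr (J-1) * \<sigma> powr (-(1/2))) * (\<bar>of_int m\<bar> powr (-(J-1)) * h powr (1/2))"
  proof -
    have "\<bar>real_of_int m\<bar> powr (J-1) * \<bar>of_int m\<bar> powr (-(J-1)) = 1" using m by (simp add: powr_add[symmetric])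
    then show ?thesis by (simp add: mult_ac)
  qed
  also have "\<dots> \<le> (\<bar>of_int m\<bar> powr (J-1) * \<sigma> powr (-(1/2))) * mu m h" unfolding mu_def by (intro mult_left_mono) auto
  finally show ?thesis using 1 unfolding gw_def by (auto simp: min_def)
qed

text \<open>Without using the oscillation, the integral is Lipschitz in time. This exceeds the order
  \<open>bet\<close> by \<open>ex\<close>, and the surplus becomes the factor
  \<open>(b - a) powr ex\<close>.\<close>

lemma osc_hold_triv:
  assumes c: "continuous_on UNIV \<phi>" and P: "\<And>t. norm (\<phi> t) \<le> P" and ab: "a \<le> b" "b - a \<le> 1" and \<eta>: "0 \<le> \<eta>" "\<eta> \<le> 1"
  shows "hold \<eta> (mu m) (P * (b - a) powr ex) (\<lambda>t. osc_int a \<theta> \<phi> (cl a b t))"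
  unfolding hold_def
proof (intro conjI allI impI)
  have P0: "0 \<le> P" using P[of 0] norm_ge_zero order_trans by blast
  have "b - a \<le> (b - a) powr ex"
    using powr_mono'[of ex 1 "b-a"] ab ex_pos by (cases "a = b") auto
  then show "norm (osc_int a \<theta> \<phi> (cl a b t)) \<le> P * (b - a) powr ex" for t
    by (rule order_trans[OF osc_int_triv(1)[OF c P ab(1)] mult_left_mono[OF _ P0]])
  fix t u :: real
  have "\<eta> * norm (osc_int a \<theta> \<phi> (cl a b t) - osc_int a \<theta> \<phi> (cl a b u)) \<le> 1 * (P * min (abs (t - u)) (b - a))"
    using \<eta> P0 ab by (intro mult_mono osc_int_triv(2)[OF c P ab(1)]) auto
  also have "\<dots> \<le> P * ((b - a) powr ex * mu m (abs (t - u)))"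
    unfolding mult_1_left using ab P0 by (intro mult_left_mono min_le_mu) auto
  finally show "\<eta> * norm (osc_int a \<theta> \<phi> (cl a b t) - osc_int a \<theta> \<phi> (cl a b u)) \<le> P * (b - a) powr ex * mu m (abs (t - u))"
    by (simp add: mult_ac)
qed

text \<open>The boundary term is either subtracted, to become a modulated function, or kept. If it
  is kept, its contribution to the modulus of continuity is measured by \<open>gw\<close>, and the
  weight \<open>\<eta>\<close> supplies the smallness.\<close>

lemma osc_hold_low:
  assumes c: "continuous_on UNIV \<phi>" and P: "\<And>t. norm (\<phi> t) \<le> P" and ab: "a \<le> b" "b - a \<le> 1" and \<theta>: "\<theta> \<noteq> 0"
    and E: "\<And>t u. abs (t - u) \<le> 1 / (abs \<theta>) \<Longrightarrow> norm (\<phi> t - \<phi> u) \<le> E" and \<eta>: "0 \<le> \<eta>" "\<eta> \<le> 1"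
  shows "hold \<eta> (mu m) (P / (abs \<theta>) + 2 * E * (b - a) powr ex)
      (\<lambda>t. osc_int a \<theta> \<phi> (cl a b t) - ph \<theta> (cl a b t) * prim \<theta> \<phi> (cl a b t))"
    (is "hold _ _ ?M ?q")
    and "m \<noteq> 0 \<Longrightarrow> hold \<eta> (mu m) (2 * P / (abs \<theta>) + 2 * E * (b - a) powr ex + 2 * \<eta> * P * gw m (abs \<theta>))
      (\<lambda>t. osc_int a \<theta> \<phi> (cl a b t))"
proof -
  have P0: "0 \<le> P" using P[of 0] norm_ge_zero order_trans by blast
  have E0: "0 \<le> E" using E[of 0 0] by simp
  have ba: "b - a \<le> (b - a) powr ex"
    using powr_mono'[of ex 1 "b-a"] ab ex_pos by (cases "a = b") auto
  have q1: "norm (?q t) \<le> ?M" for t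
    using osc_int_low(1)[OF c P ab(1) \<theta> E, of t] mult_left_mono[OF ba, of "2*E"] E0 by simp
  have q2: "norm (?q t - ?q u) \<le> 2 * E * min (abs (t - u)) (b - a)" for t u
    by (rule osc_int_low(2)[OF c P ab(1) \<theta> E])
  have Em: "2 * E * min (abs (t - u)) (b - a) \<le> 2 * E * (b - a) powr ex * mu m (abs (t - u))" for t u
    unfolding mult.assoc[of "2*E"] using E0 ab by (intro mult_left_mono min_le_mu) auto
  have \<eta>q: "\<eta> * norm (?q t - ?q u) \<le> 2 * E * (b - a) powr ex * mu m (abs (t - u))" for t u
  proof -
    have "\<eta> * norm (?q t - ?q u) \<le> 1 * (2 * E * min (abs (t - u)) (b - a))"
      using \<eta> by (intro mult_mono q2) auto
    then show ?thesis using Em[of t u] by linarith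
  qed
  show "hold \<eta> (mu m) ?M ?q" unfolding hold_def
  proof (intro conjI allI impI q1)
    fix t u :: real
    have "2 * E * (b - a) powr ex * mu m (abs (t - u)) \<le> ?M * mu m (abs (t - u))"
      using P0 mu_nonneg by (intro mult_right_mono) auto
    then show "\<eta> * norm (?q t - ?q u) \<le> ?M * mu m (abs (t - u))" using \<eta>q[of t u] by linarith
  qed
  define p where "p t = ph \<theta> (cl a b t) * prim \<theta> \<phi> (cl a b t)" for t
  have p: "norm (p t) \<le> P / (abs \<theta>)" for t
    unfolding p_def prim_def using low_bounds(1)[OF c _ P, of "1/(abs \<theta>)" "cl a b t"] \<theta>
    by (simp add: norm_mult norm_divide divide_right_mono)
  define q where "q = ?q"
  have I: "osc_int a \<theta> \<phi> (cl a b t) = q t + p t" for t unfolding p_def q_def by simp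
  have q1': "norm (q t) \<le> ?M" for t unfolding q_def by (rule q1)
  have q2': "norm (q t - q u) \<le> 2 * E * min (abs (t - u)) (b - a)" for t u unfolding q_def by (rule q2)
  assume m: "m \<noteq> 0"
  show "hold \<eta> (mu m) (2 * P / (abs \<theta>) + 2 * E * (b - a) powr ex + 2 * \<eta> * P * gw m (abs \<theta>)) (\<lambda>t. osc_int a \<theta> \<phi> (cl a b t))"
    unfolding hold_def
  proof (intro conjI allI impI)
    fix t
    have "norm (osc_int a \<theta> \<phi> (cl a b t)) \<le> norm (q t) + norm (p t)" unfolding I by (rule norm_triangle_ineq)
    also have "\<dots> \<le> 2 * P / (abs \<theta>) + 2 * E * (b - a) powr ex" using q1'[of t] p[of t] by simp
    finally show "norm (osc_int a \<theta> \<phi> (cl a b t)) \<le> 2 * P / (abs \<theta>) + 2 * E * (b - a) powr ex + 2 * \<eta> * P * gw m (abs \<theta>)"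
      using mult_nonneg_nonneg[OF mult_nonneg_nonneg[OF \<eta>(1) P0] gw_nonneg[of m "abs \<theta>"]] by simp
  next
    fix t u :: real
    define I' where "I' = norm (osc_int a \<theta> \<phi> (cl a b t) - osc_int a \<theta> \<phi> (cl a b u))"
    have 1: "I' \<le> P * abs (t - u)"
      using order_trans[OF osc_int_triv(2)[OF c P ab(1), of \<theta> t u]] P0 unfolding I'_def by (simp add: mult_left_mono)
    have "I' = norm ((q t - q u) + (p t - p u))" unfolding I'_def I by (simp add: algebra_simps)
    also have "\<dots> \<le> norm (q t - q u) + (norm (p t) + norm (p u))"
      by (meson add_mono norm_triangle_ineq norm_triangle_ineq4 order_refl order_trans)
    also have "\<dots> \<le> 2 * E * min (abs (t - u)) (b - a) + 2 * P / (abs \<theta>)" using q2'[of t u] p[of t] p[of u] by simp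
    finally have 2: "I' \<le> 2 * E * min (abs (t - u)) (b - a) + 2 * P / (abs \<theta>)" .
    have E0': "0 \<le> 2 * E * min (abs (t - u)) (b - a)" using E0 ab by simp
    \<comment> \<open>Up to time differences \<open>1 / \<bar>\<theta>\<bar>\<close> the integral
      itself is Lipschitz with constant \<open>P\<close>. Beyond that, the size
      \<open>P / \<bar>\<theta>\<bar>\<close> of the boundary term at both times is the better
      bound.\<close>
    have "I' \<le> 2 * E * min (abs (t - u)) (b - a) + 2 * P * min (abs (t - u)) (1/(abs \<theta>))"
    proof (cases "abs (t - u) \<le> 1/(abs \<theta>)")
      case True
      have "P * abs (t - u) \<le> 2 * P * abs (t - u)" using P0 by (intro mult_right_mono) auto
      moreover have "min (abs (t - u)) (1/(abs \<theta>)) = abs (t - u)" using True by (rule min_absorb1)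
      ultimately show ?thesis using 1 E0' by linarith
    next
      case False
      then have "min (abs (t - u)) (1/(abs \<theta>)) = 1/(abs \<theta>)" by (intro min_absorb2) simp
      then show ?thesis using 2 by simp
    qed
    also have "\<dots> \<le> 2 * E * (b - a) powr ex * mu m (abs (t - u)) + 2 * P * (gw m (abs \<theta>) * mu m (abs (t - u)))"
      using P0 \<theta> m by (intro add_mono Em mult_left_mono min_le_gw) auto
    finally have "\<eta> * I' \<le> \<eta> * (2 * E * (b - a) powr ex * mu m (abs (t - u))) + \<eta> * (2 * P * (gw m (abs \<theta>) * mu m (abs (t - u))))"
      using \<eta> by (metis distrib_left mult_left_mono)
    also have "\<eta> * (2 * E * (b - a) powr ex * mu m (abs (t - u))) \<le> 1 * (2 * E * (b - a) powr ex * mu m (abs (t - u)))"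
      using \<eta> E0 mu_nonneg by (intro mult_right_mono) auto
    also have "1 * (2 * E * (b - a) powr ex * mu m (abs (t - u))) + \<eta> * (2 * P * (gw m (abs \<theta>) * mu m (abs (t - u))))
       = (2 * E * (b - a) powr ex + 2 * \<eta> * P * gw m (abs \<theta>)) * mu m (abs (t - u))" by (simp add: algebra_simps)
    also have "\<dots> \<le> (2 * P / (abs \<theta>) + 2 * E * (b - a) powr ex + 2 * \<eta> * P * gw m (abs \<theta>)) * mu m (abs (t - u))"
      using P0 mu_nonneg by (intro mult_right_mono) auto
    finally show "\<eta> * norm (osc_int a \<theta> \<phi> (cl a b t) - osc_int a \<theta> \<phi> (cl a b u)) \<le> (2 * P / (abs \<theta>) + 2 * E * (b - a) powr ex + 2 * \<eta> * P * gw m (abs \<theta>)) * mu m (abs (t - u))"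
      unfolding I'_def by simp
  qed
qed

end

section \<open>Square summable families\<close>

text \<open>The norm is bounded over all finite subsets: index sets need no order, and comparisons
  and limits preserve the bound without summability arguments.\<close>

definition l2 :: "('i \<Rightarrow> real) \<Rightarrow> real \<Rightarrow> bool" where
  "l2 c N \<longleftrightarrow> (\<forall>i. 0 \<le> c i) \<and> 0 \<le> N \<and> (\<forall>F. finite F \<longrightarrow> L2_set c F \<le> N)"

lemma l2_nonneg: "l2 c N \<Longrightarrow> 0 \<le> c i" "l2 c N \<Longrightarrow> 0 \<le> N"
  unfolding l2_def by auto

lemma l2_fin: "l2 c N \<Longrightarrow> finite F \<Longrightarrow> L2_set c F \<le> N"
  unfolding l2_def by auto

lemma L2_set_sq: "(L2_set c F)\<^sup>2 = (\<Sum>i\<in>F. (c i)\<^sup>2)"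
  unfolding L2_set_def by (simp add: sum_nonneg)

lemma l2_fin_sq: "l2 c N \<Longrightarrow> finite F \<Longrightarrow> (\<Sum>i\<in>F. (c i)\<^sup>2) \<le> N\<^sup>2"
  unfolding L2_set_sq[symmetric] by (intro power_mono l2_fin L2_set_nonneg)

lemma l2I_sq:
  assumes "\<And>i. 0 \<le> c i" "0 \<le> N" "\<And>F. finite F \<Longrightarrow> (\<Sum>i\<in>F. (c i)\<^sup>2) \<le> N\<^sup>2"
  shows "l2 c N"
  unfolding l2_def L2_set_def using assms real_sqrt_le_mono[OF assms(3)] by simp

lemma summable_on_bounded:
  fixes f :: "'i \<Rightarrow> real"
  assumes "\<And>i. 0 \<le> f i" "\<And>F. finite F \<Longrightarrow> sum f F \<le> B"
  shows "f summable_on UNIV" "infsum f UNIV \<le> B"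
proof -
  show s: "f summable_on UNIV"
    by (rule nonneg_bdd_above_summable_on) (use assms in \<open>auto intro!: bdd_aboveI[where M=B]\<close>)
  show "infsum f UNIV \<le> B" by (rule infsum_le_finite_sums[OF s]) (use assms in auto)
qed

lemma l2_summable: "l2 c N \<Longrightarrow> (\<lambda>i. (c i)\<^sup>2) summable_on UNIV"
  and l2_infsum: "l2 c N \<Longrightarrow> infsum (\<lambda>i. (c i)\<^sup>2) UNIV \<le> N\<^sup>2"
  using summable_on_bounded[of "\<lambda>i. (c i)\<^sup>2" "N\<^sup>2"] l2_fin_sq by fastforce+

lemma l2I_infsum:
  assumes "\<And>i. 0 \<le> c i" "0 \<le> N" "(\<lambda>i. (c i)\<^sup>2) summable_on UNIV" "infsum (\<lambda>i. (c i)\<^sup>2) UNIV \<le> N\<^sup>2"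
  shows "l2 c N"
proof (rule l2I_sq)
  fix F :: "'a set" assume "finite F"
  then show "(\<Sum>i\<in>F. (c i)\<^sup>2) \<le> N\<^sup>2"
    using finite_sum_le_infsum[OF assms(3), of F] assms(4) by auto
qed (use assms in auto)

lemma l2_le: "l2 c N \<Longrightarrow> c i \<le> N"
  using l2_fin[of c N "{i}"] l2_nonneg(1)[of c N i] by simp

lemma l2_0: "0 \<le> N \<Longrightarrow> l2 (\<lambda>i. 0) N"
  unfolding l2_def by (auto simp: L2_set_def)

lemma l2_mono:
  assumes "l2 c N" "\<And>i. 0 \<le> d i" "\<And>i. d i \<le> c i" "N \<le> M"
  shows "l2 d M"
  unfolding l2_def
proof (intro conjI allI impI)
  show "0 \<le> d i" for i by (rule assms(2))
  show "0 \<le> M" using assms l2_nonneg(2) by (meson order_trans)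
  fix F :: "'a set" assume F: "finite F"
  have "L2_set d F \<le> L2_set c F" using assms by (intro L2_set_mono) auto
  then show "L2_set d F \<le> M" using l2_fin[OF assms(1) F] assms(4) by linarith
qed

lemma l2_add:
  assumes "l2 c N" "l2 d M"
  shows "l2 (\<lambda>i. c i + d i) (N + M)"
  unfolding l2_def
proof (intro conjI allI impI)
  show "0 \<le> c i + d i" for i using l2_nonneg(1)[OF assms(1)] l2_nonneg(1)[OF assms(2)] by (metis add_nonneg_nonneg)
  show "0 \<le> N + M" using assms l2_nonneg(2) by (metis add_nonneg_nonneg)
  fix F :: "'a set" assume F: "finite F"
  show "L2_set (\<lambda>i. c i + d i) F \<le> N + M"
    using L2_set_triangle_ineq[of c d F] l2_fin[OF assms(1) F] l2_fin[OF assms(2) F] by linarith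
qed

lemma l2_cmult:
  assumes "l2 c N" "0 \<le> k"
  shows "l2 (\<lambda>i. k * c i) (k * N)"
proof (rule l2I_sq)
  fix F :: "'a set" assume F: "finite F"
  have "(\<Sum>i\<in>F. (k * c i)\<^sup>2) = k\<^sup>2 * (\<Sum>i\<in>F. (c i)\<^sup>2)" by (simp add: power_mult_distrib sum_distrib_left)
  also have "\<dots> \<le> k\<^sup>2 * N\<^sup>2" by (intro mult_left_mono l2_fin_sq assms F) auto
  finally show "(\<Sum>i\<in>F. (k * c i)\<^sup>2) \<le> (k * N)\<^sup>2" by (simp add: power_mult_distrib)
qed (auto intro!: mult_nonneg_nonneg l2_nonneg(1)[OF assms(1)] l2_nonneg(2)[OF assms(1)] assms(2))

lemma l2_reindex:
  assumes "l2 c N" "inj g"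
  shows "l2 (\<lambda>i. c (g i)) N"
proof (rule l2I_sq)
  fix F :: "'b set" assume F: "finite F"
  have "(\<Sum>i\<in>F. (c (g i))\<^sup>2) = (\<Sum>i\<in>g`F. (c i)\<^sup>2)"
    by (rule sum.reindex_cong[symmetric, of g]) (use assms(2) in \<open>auto intro: inj_on_subset\<close>)
  also have "\<dots> \<le> N\<^sup>2" using F by (intro l2_fin_sq[OF assms(1)]) auto
  finally show "(\<Sum>i\<in>F. (c (g i))\<^sup>2) \<le> N\<^sup>2" .
qed (auto intro!: l2_nonneg(1)[OF assms(1)] l2_nonneg(2)[OF assms(1)])

lemma l2_prod:
  assumes "l2 c N" "l2 d M"
  shows "l2 (\<lambda>p. c (fst p) * d (snd p)) (N * M)"
proof (rule l2I_sq)
  fix F :: "('a \<times> 'b) set" assume F: "finite F"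
  have "(\<Sum>p\<in>F. (c (fst p) * d (snd p))\<^sup>2) \<le> (\<Sum>p\<in>fst`F \<times> snd`F. (c (fst p) * d (snd p))\<^sup>2)"
    using F by (intro sum_mono2) (auto simp: rev_image_eqI)
  also have "\<dots> = (\<Sum>i\<in>fst`F. (c i)\<^sup>2) * (\<Sum>k\<in>snd`F. (d k)\<^sup>2)"
    by (simp add: sum_product sum.cartesian_product power_mult_distrib case_prod_unfold)
  also have "\<dots> \<le> N\<^sup>2 * M\<^sup>2" using F assms by (intro mult_mono l2_fin_sq) (auto intro: sum_nonneg)
  finally show "(\<Sum>p\<in>F. (c (fst p) * d (snd p))\<^sup>2) \<le> (N * M)\<^sup>2" by (simp add: power_mult_distrib)
qed (auto intro!: mult_nonneg_nonneg l2_nonneg(1)[OF assms(1)] l2_nonneg(2)[OF assms(1)] l2_nonneg(1)[OF assms(2)] l2_nonneg(2)[OF assms(2)])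

lemma l2_cs:
  assumes "l2 c N" "l2 d M"
  shows "(\<lambda>i. c i * d i) summable_on UNIV" "infsum (\<lambda>i. c i * d i) UNIV \<le> N * M"
proof -
  have "(\<Sum>i\<in>F. c i * d i) \<le> N * M" if "finite F" for F
  proof -
    have "(\<Sum>i\<in>F. c i * d i) = (\<Sum>i\<in>F. \<bar>c i\<bar> * \<bar>d i\<bar>)" using l2_nonneg(1)[OF assms(1)] l2_nonneg(1)[OF assms(2)] by (intro sum.cong) (auto simp: abs_of_nonneg)
    also have "\<dots> \<le> L2_set c F * L2_set d F" by (rule L2_set_mult_ineq)
    also have "\<dots> \<le> N * M" by (intro mult_mono l2_fin[OF assms(1) that] l2_fin[OF assms(2) that] l2_nonneg(2)[OF assms(1)] L2_set_nonneg)
    finally show ?thesis .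
  qed
  moreover have "0 \<le> c i * d i" for i using l2_nonneg(1)[OF assms(1)] l2_nonneg(1)[OF assms(2)] by (metis mult_nonneg_nonneg)
  ultimately show "(\<lambda>i. c i * d i) summable_on UNIV" "infsum (\<lambda>i. c i * d i) UNIV \<le> N * M"
    using summable_on_bounded[of "\<lambda>i. c i * d i" "N * M"] by auto
qed

text \<open>Schur-type bound: rows of the kernel bounded in \<open>l2\<close>, acting on \<open>x\<close> row by row.\<close>

lemma l2_kernel:
  fixes k :: "'m \<Rightarrow> 'i \<Rightarrow> real"
  assumes k: "\<And>m. l2 (k m) C" and x: "l2 (\<lambda>p. x (fst p) (snd p)) N"
  shows "(\<lambda>i. k m i * x m i) summable_on UNIV"
    and "l2 (\<lambda>m. infsum (\<lambda>i. k m i * x m i) UNIV) (C * N)"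
proof -
  have row: "l2 (x m) N" for m
    using l2_reindex[OF x, of "\<lambda>i. (m, i)"] by (simp add: inj_on_def)
  show "(\<lambda>i. k m i * x m i) summable_on UNIV" by (rule l2_cs[OF k row])
  define S where "S m = infsum (\<lambda>i. (x m i)\<^sup>2) UNIV" for m
  have S0: "0 \<le> S m" for m unfolding S_def by (simp add: infsum_nonneg)
  \<comment> \<open>Cauchy-Schwarz is applied with the norm of the single row instead of
    \<open>N\<close>; the squares of these row norms then add up to at most
    \<open>N^2\<close>.\<close>
  have rowS: "l2 (x m) (sqrt (S m))" for m
    by (rule l2I_infsum) (use l2_nonneg[OF row] l2_summable[OF row] S0 in \<open>auto simp: S_def\<close>)
  show "l2 (\<lambda>m. infsum (\<lambda>i. k m i * x m i) UNIV) (C * N)"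
  proof (rule l2I_sq)
    show "0 \<le> infsum (\<lambda>i. k m i * x m i) UNIV" for m
      using l2_nonneg(1)[OF k] l2_nonneg(1)[OF row] by (auto intro!: infsum_nonneg)
    show "0 \<le> C * N" using l2_nonneg(2)[OF k] l2_nonneg(2)[OF x] by simp
    fix F :: "'m set" assume F: "finite F"
    have "(\<Sum>m\<in>F. (infsum (\<lambda>i. k m i * x m i) UNIV)\<^sup>2) \<le> (\<Sum>m\<in>F. C\<^sup>2 * S m)"
    proof (rule sum_mono)
      fix m
      have "(infsum (\<lambda>i. k m i * x m i) UNIV)\<^sup>2 \<le> (C * sqrt (S m))\<^sup>2"
        using l2_nonneg(1)[OF k] l2_nonneg(1)[OF row] by (intro power_mono l2_cs(2)[OF k rowS]) (auto intro!: infsum_nonneg)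
      then show "(infsum (\<lambda>i. k m i * x m i) UNIV)\<^sup>2 \<le> C\<^sup>2 * S m" using S0 by (simp add: power_mult_distrib)
    qed
    also have "\<dots> = C\<^sup>2 * (\<Sum>m\<in>F. S m)" by (simp add: sum_distrib_left)
    also have "(\<Sum>m\<in>F. S m) \<le> N\<^sup>2"
    proof -
      have sm: "(\<lambda>p. (x (fst p) (snd p))\<^sup>2) summable_on F \<times> UNIV"
        by (rule summable_on_subset_banach[OF l2_summable[OF x]]) auto
      have "(\<Sum>m\<in>F. S m) = infsum (\<lambda>m. infsum (\<lambda>i. (x m i)\<^sup>2) UNIV) F" using F unfolding S_def by simp
      also have "\<dots> = infsum (\<lambda>p. (x (fst p) (snd p))\<^sup>2) (F \<times> UNIV)"
        using infsum_Sigma_banach[OF sm] by simp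
      also have "\<dots> \<le> infsum (\<lambda>p. (x (fst p) (snd p))\<^sup>2) UNIV"
        by (rule infsum_mono2[OF sm l2_summable[OF x]]) auto
      also have "\<dots> \<le> N\<^sup>2" by (rule l2_infsum[OF x])
      finally show ?thesis .
    qed
    then have "C\<^sup>2 * (\<Sum>m\<in>F. S m) \<le> C\<^sup>2 * N\<^sup>2" by (rule mult_left_mono) simp
    finally show "(\<Sum>m\<in>F. (infsum (\<lambda>i. k m i * x m i) UNIV)\<^sup>2) \<le> (C * N)\<^sup>2" by (simp add: power_mult_distrib)
  qed
qed

lemma l2_series:
  fixes c :: "nat \<Rightarrow> 'i \<Rightarrow> real"
  assumes c: "\<And>n. l2 (c n) (N n)" and N: "summable N"
  shows "summable (\<lambda>n. c n i)" "l2 (\<lambda>i. \<Sum>n. c n i) (\<Sum>n. N n)"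
proof -
  have sm: "summable (\<lambda>n. c n i)" for i
    by (rule summable_comparison_test'[OF N, of 0]) (use l2_le[OF c] l2_nonneg[OF c] in auto)
  then show "summable (\<lambda>n. c n i)" .
  have part: "l2 (\<lambda>i. \<Sum>n<k. c n i) (\<Sum>n<k. N n)" for k
    by (induction k) (auto intro: l2_0 l2_add c)
  show "l2 (\<lambda>i. \<Sum>n. c n i) (\<Sum>n. N n)"
    unfolding l2_def
  proof (intro conjI allI impI)
    show "0 \<le> (\<Sum>n. c n i)" for i using l2_nonneg(1)[OF c] sm by (intro suminf_nonneg) auto
    show "0 \<le> (\<Sum>n. N n)" using l2_nonneg(2)[OF c] N by (intro suminf_nonneg) auto
    fix F :: "'i set" assume F: "finite F"
    have "(\<lambda>k. L2_set (\<lambda>i. \<Sum>n<k. c n i) F) \<longlonglongrightarrow> L2_set (\<lambda>i. \<Sum>n. c n i) F"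
      unfolding L2_set_def by (intro tendsto_intros summable_LIMSEQ sm)
    moreover have "L2_set (\<lambda>i. \<Sum>n<k. c n i) F \<le> (\<Sum>n. N n)" for k
      by (rule order_trans[OF l2_fin[OF part F]]) (use l2_nonneg(2)[OF c] N in \<open>auto intro: sum_le_suminf\<close>)
    ultimately show "L2_set (\<lambda>i. \<Sum>n. c n i) F \<le> (\<Sum>n. N n)" by (intro LIMSEQ_le_const2) auto
  qed
qed

section \<open>Series of functions\<close>

text \<open>The Weierstrass test for unordered sums: the tail of the majorant bounds all tails at
  once.\<close>

lemma uniform_limit_infsum:
  fixes \<phi> :: "'i \<Rightarrow> 'x \<Rightarrow> complex"
  assumes B: "\<And>i x. norm (\<phi> i x) \<le> B i" and s: "B summable_on UNIV"
  shows "uniform_limit X (\<lambda>F x. \<Sum>i\<in>F. \<phi> i x) (\<lambda>x. infsum (\<lambda>i. \<phi> i x) UNIV) (finite_subsets_at_top UNIV)"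
proof (rule uniform_limitI)
  fix e :: real assume e: "e > 0"
  have B0: "0 \<le> B i" for i using B[of i] norm_ge_zero order_trans by blast
  have "(sum B \<longlongrightarrow> infsum B UNIV) (finite_subsets_at_top UNIV)" by (rule infsum_tendsto[OF s])
  then have "eventually (\<lambda>F. dist (sum B F) (infsum B UNIV) < e) (finite_subsets_at_top UNIV)" using e by (rule tendstoD)
  moreover have "eventually (\<lambda>F::'i set. finite F) (finite_subsets_at_top UNIV)" by (rule eventually_finite_subsets_at_top_weakI) auto
  ultimately show "\<forall>\<^sub>F F in finite_subsets_at_top UNIV. \<forall>x\<in>X. dist (\<Sum>i\<in>F. \<phi> i x) (infsum (\<lambda>i. \<phi> i x) UNIV) < e"
  proof eventually_elim
    case (elim F)
    show ?case
    proof
      fix x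
      have a: "(\<lambda>i. norm (\<phi> i x)) summable_on UNIV" by (rule summable_on_comparison_test[OF s]) (use B in auto)
      then have sx: "(\<lambda>i. \<phi> i x) summable_on UNIV" by (rule Infinite_Sum.abs_summable_summable)
      have aF: "(\<lambda>i. norm (\<phi> i x)) summable_on (UNIV - F)" by (rule summable_on_subset_banach[OF a]) auto
      have sF: "B summable_on (UNIV - F)" by (rule summable_on_subset_banach[OF s]) auto
      have "infsum (\<lambda>i. \<phi> i x) (UNIV - F) = infsum (\<lambda>i. \<phi> i x) UNIV - (\<Sum>i\<in>F. \<phi> i x)"
        using infsum_Diff[OF sx, of F] elim by simp
      then have "dist (\<Sum>i\<in>F. \<phi> i x) (infsum (\<lambda>i. \<phi> i x) UNIV) = norm (infsum (\<lambda>i. \<phi> i x) (UNIV - F))"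
        by (simp add: dist_norm norm_minus_commute)
      also have "\<dots> \<le> infsum (\<lambda>i. norm (\<phi> i x)) (UNIV - F)" by (rule norm_infsum_bound[OF aF])
      also have "\<dots> \<le> infsum B (UNIV - F)" by (rule infsum_mono[OF aF sF B])
      also have "\<dots> = infsum B UNIV - sum B F" using infsum_Diff[OF s, of F] elim by simp
      also have "\<dots> < e" using elim(1) unfolding dist_real_def by linarith
      finally show "dist (\<Sum>i\<in>F. \<phi> i x) (infsum (\<lambda>i. \<phi> i x) UNIV) < e" .
    qed
  qed
qed

lemma summable_of_bound:
  fixes \<phi> :: "'i \<Rightarrow> 'b :: banach"
  assumes B: "\<And>i. norm (\<phi> i) \<le> B i" and s: "B summable_on UNIV"
  shows "\<phi> summable_on UNIV" "norm (infsum \<phi> UNIV) \<le> infsum B UNIV"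
proof -
  have a: "(\<lambda>i. norm (\<phi> i)) summable_on UNIV" by (rule summable_on_comparison_test[OF s]) (use B in auto)
  then show "\<phi> summable_on UNIV" by (rule Infinite_Sum.abs_summable_summable)
  show "norm (infsum \<phi> UNIV) \<le> infsum B UNIV"
    by (rule order_trans[OF norm_infsum_bound[OF a] infsum_mono[OF a s B]])
qed

lemma continuous_on_infsum:
  fixes \<phi> :: "'i \<Rightarrow> real \<Rightarrow> complex"
  assumes B: "\<And>i x. norm (\<phi> i x) \<le> B i" and s: "B summable_on UNIV" and c: "\<And>i. continuous_on X (\<phi> i)"
  shows "continuous_on X (\<lambda>x. infsum (\<lambda>i. \<phi> i x) UNIV)"
  by (rule uniform_limit_theorem[OF _ uniform_limit_infsum[OF B s]])
    (auto intro!: always_eventually continuous_on_sum c)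

text \<open>Uniform convergence allows integration term by term. The phase of each modulated summand
  merges with the outer one, so every term is again an oscillatory integral with a single
  phase.\<close>

lemma osc_int_infsum:
  fixes \<phi> :: "'i \<Rightarrow> real \<Rightarrow> complex"
  assumes B: "\<And>i x. norm (\<phi> i x) \<le> B i" and s: "B summable_on UNIV" and c: "\<And>i. continuous_on UNIV (\<phi> i)"
  shows "((\<lambda>i. osc_int a (\<theta> + \<theta>' i) (\<phi> i) t) has_sum
     osc_int a \<theta> (\<lambda>r. infsum (\<lambda>i. \<phi> i r * ph (\<theta>' i) r) UNIV) t) UNIV"
proof -
  define \<psi> where "\<psi> i r = ph \<theta> r * (\<phi> i r * ph (\<theta>' i) r)" for i r
  have c': "continuous_on X (\<psi> i)" for i X
    unfolding \<psi>_def by (intro continuous_intros continuous_on_subset[OF c]) auto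
  have B': "norm (\<psi> i r) \<le> B i" for i r unfolding \<psi>_def using B by (simp add: norm_mult)
  obtain I L where I: "\<And>F. ((\<lambda>r. \<Sum>i\<in>F. \<psi> i r) has_integral I F) {a..t}"
    and L: "((\<lambda>r. infsum (\<lambda>i. \<psi> i r) UNIV) has_integral L) {a..t}"
    and IL: "(I \<longlongrightarrow> L) (finite_subsets_at_top UNIV)"
    by (rule uniform_limit_integral[OF uniform_limit_infsum[OF B' s, where X="{a..t}"]])
      (auto intro!: continuous_on_sum c')
  have e: "osc_int a (\<theta> + \<theta>' i) (\<phi> i) t = integral {a..t} (\<psi> i)" for i
    unfolding osc_int_def \<psi>_def ph_add by (simp add: mult_ac)
  have "I F = (\<Sum>i\<in>F. osc_int a (\<theta> + \<theta>' i) (\<phi> i) t)" if "finite F" for F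
  proof -
    have "((\<lambda>r. \<Sum>i\<in>F. \<psi> i r) has_integral (\<Sum>i\<in>F. integral {a..t} (\<psi> i))) {a..t}"
      using that by (intro has_integral_sum integrable_integral integrable_continuous_real c') auto
    then show ?thesis unfolding e using I has_integral_unique by blast
  qed
  then have "((\<lambda>F. \<Sum>i\<in>F. osc_int a (\<theta> + \<theta>' i) (\<phi> i) t) \<longlongrightarrow> L) (finite_subsets_at_top UNIV)"
    by (intro tendsto_cong[THEN iffD1, OF _ IL] eventually_finite_subsets_at_top_weakI) auto
  moreover have "L = osc_int a \<theta> (\<lambda>r. infsum (\<lambda>i. \<phi> i r * ph (\<theta>' i) r) UNIV) t"
    using integral_unique[OF L] unfolding osc_int_def \<psi>_def by (simp add: infsum_cmult_right')
  ultimately show ?thesis unfolding has_sum_def by simp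
qed

lemma has_sum_mult_pair:
  fixes f :: "'i \<Rightarrow> complex" and g :: "'k \<Rightarrow> complex"
  assumes F: "\<And>i. norm (f i) \<le> F i" "F summable_on UNIV" and G: "\<And>k. norm (g k) \<le> G k" "G summable_on UNIV"
  shows "infsum (\<lambda>p. f (fst p) * g (snd p)) UNIV = infsum f UNIV * infsum g UNIV"
    and "(\<lambda>p. F (fst p) * G (snd p)) summable_on UNIV"
proof -
  have F0: "0 \<le> F i" for i using F(1)[of i] norm_ge_zero order_trans by blast
  have G0: "0 \<le> G i" for i using G(1)[of i] norm_ge_zero order_trans by blast
  have "(\<lambda>p. F (fst p) * G (snd p)) summable_on Sigma UNIV (\<lambda>_. UNIV)"
    by (rule summable_on_SigmaI[where g="\<lambda>x. F x * infsum G UNIV"])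
      (use F0 G0 F(2) G(2) in \<open>auto intro!: has_sum_cmult_right summable_on_cmult_left\<close>)
  then show s: "(\<lambda>p. F (fst p) * G (snd p)) summable_on UNIV" by simp
  have "(\<lambda>p. f (fst p) * g (snd p)) summable_on UNIV"
    by (rule summable_of_bound(1)[OF _ s]) (auto simp: norm_mult intro!: mult_mono F G F0)
  then have "infsum (\<lambda>p. f (fst p) * g (snd p)) (UNIV \<times> UNIV) = infsum (\<lambda>i. infsum (\<lambda>k. f i * g k) UNIV) UNIV"
    using infsum_Sigma_banach[of "\<lambda>p. f (fst p) * g (snd p)" UNIV "\<lambda>_. UNIV"] by simp
  then show "infsum (\<lambda>p. f (fst p) * g (snd p)) UNIV = infsum f UNIV * infsum g UNIV"
    by (simp add: infsum_cmult_right' infsum_cmult_left')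
qed

lemma summable_int_powr:
  assumes "a < -1"
  shows "(\<lambda>m::int. \<bar>real_of_int m\<bar> powr a) summable_on UNIV"
proof -
  have "(\<lambda>n::nat. real n powr a) summable_on UNIV"
    using assms by (intro summable_nonneg_imp_summable_on) (auto simp: summable_real_powr_iff)
  then have 1: "(\<lambda>m::int. \<bar>real_of_int m\<bar> powr a) summable_on range int"
    by (subst summable_on_reindex) (auto simp: o_def)
  then have 2: "(\<lambda>m::int. \<bar>real_of_int m\<bar> powr a) summable_on (uminus ` range int)"
    by (subst summable_on_reindex) (auto simp: o_def)
  have "(UNIV::int set) = range int \<union> (uminus ` range int - range int)"
    by (auto simp: image_iff) (metis int_cases2)
  moreover have "(\<lambda>m::int. \<bar>real_of_int m\<bar> powr a) summable_on (uminus ` range int - range int)"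
    by (rule summable_on_subset_banach[OF 2]) auto
  ultimately show ?thesis using summable_on_Un_disjoint[OF 1] by (metis Diff_disjoint)
qed

section \<open>The bilinear estimate\<close>

context hkdv
begin

text \<open>Coefficients in the Sobolev space are \<open>wt\<close> times a square summable
  sequence. Since \<open>0 powr (-s) = 0\<close>, the vanishing mean is built into every bound by
  \<open>wt m\<close>.\<close>

definition wt :: "int \<Rightarrow> real" where "wt m = \<bar>of_int m\<bar> powr (-s)"

lemma wt_nonneg: "0 \<le> wt m" unfolding wt_def by simp
lemma wt_0 [simp]: "wt 0 = 0" unfolding wt_def by simp
lemma wt_cancel: "m \<noteq> 0 \<Longrightarrow> wt m * \<bar>of_int m\<bar> powr s = 1"
  unfolding wt_def by (simp add: powr_add[symmetric])
lemma wt_cancel1: "m \<noteq> 0 \<Longrightarrow> wt m * \<bar>of_int m\<bar> powr (1 + s) = \<bar>of_int m\<bar>"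
  unfolding wt_def by (simp add: powr_add[symmetric])

text \<open>A solution is sought as a sum of \<open>f m t\<close>, with the temporal modulus of continuity \<open>mu m\<close>, and of
  terms \<open>g m n t\<close> modulated by the phase \<open>- Om m n\<close>. The latter absorb the boundary terms of an
  integration by parts in time, whence their weight \<open>A m n\<close> with the denominator \<open>Om m n\<close>; the
  factor \<open>1 / \<delta>\<close> makes their interactions small.\<close>

definition frep :: "real \<Rightarrow> real \<Rightarrow> (int \<Rightarrow> real \<Rightarrow> complex) \<Rightarrow> bool" where
  "frep \<eta> N f \<longleftrightarrow> (\<exists>a. l2 a N \<and> (\<forall>m. hold \<eta> (mu m) (wt m * a m) (f m)))"

definition grep :: "real \<Rightarrow> real \<Rightarrow> real \<Rightarrow> (int \<Rightarrow> int \<Rightarrow> real \<Rightarrow> complex) \<Rightarrow> bool" where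
  "grep \<eta> \<delta> N g \<longleftrightarrow> (\<exists>c. l2 c N \<and> (\<forall>m n. hold \<eta> mug (A m n * c (m, n) / \<delta>) (g m n)))"

definition Vg :: "(int \<Rightarrow> int \<Rightarrow> real \<Rightarrow> complex) \<Rightarrow> real \<Rightarrow> int \<Rightarrow> complex" where
  "Vg g t m = infsum (\<lambda>n. g m n t * ph (- Om m n) t) UNIV"

definition Vf :: "(int \<Rightarrow> real \<Rightarrow> complex) \<Rightarrow> real \<Rightarrow> int \<Rightarrow> complex" where
  "Vf f t m = f m t"

definition Bint :: "real \<Rightarrow> (real \<Rightarrow> int \<Rightarrow> complex) \<Rightarrow> (real \<Rightarrow> int \<Rightarrow> complex) \<Rightarrow> real \<Rightarrow> int \<Rightarrow> int \<Rightarrow> complex" where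
  "Bint a v w t m n = of_int m * osc_int a (- Om m n) (\<lambda>r. v r n * w r (m - n)) t"

lemma l2_int_powr:
  assumes "a < -1/2"
  shows "\<exists>Z>0. l2 (\<lambda>m::int. \<bar>real_of_int m\<bar> powr a) Z"
proof -
  define S where "S = infsum (\<lambda>m::int. (\<bar>real_of_int m\<bar> powr a)\<^sup>2) UNIV"
  have sq: "(\<bar>real_of_int m\<bar> powr a)\<^sup>2 = \<bar>real_of_int m\<bar> powr (2 * a)" for m
    unfolding power2_eq_square powr_add[symmetric] by simp
  have s: "(\<lambda>m::int. (\<bar>real_of_int m\<bar> powr a)\<^sup>2) summable_on UNIV"
    unfolding sq by (rule summable_int_powr) (use assms in simp)
  have S0: "0 \<le> S" unfolding S_def by (simp add: infsum_nonneg)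
  have "l2 (\<lambda>m::int. \<bar>real_of_int m\<bar> powr a) (sqrt S + 1)"
  proof (rule l2I_infsum[OF _ _ s])
    have "S \<le> (sqrt S + 1)\<^sup>2" using S0 by (simp add: power2_eq_square algebra_simps)
    then show "infsum (\<lambda>m::int. (\<bar>real_of_int m\<bar> powr a)\<^sup>2) UNIV \<le> (sqrt S + 1)\<^sup>2" unfolding S_def .
  qed (use S0 in auto)
  moreover have "sqrt S + 1 > 0" using S0 by (simp add: add_nonneg_pos)
  ultimately show ?thesis by blast
qed

definition Zinv :: real where "Zinv = (SOME Z. Z > 0 \<and> l2 (\<lambda>m::int. \<bar>real_of_int m\<bar> powr (-1)) Z)"

lemma Zinv: "Zinv > 0" "l2 (\<lambda>m::int. \<bar>real_of_int m\<bar> powr (-1)) Zinv"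
proof -
  have "\<exists>Z. Z > 0 \<and> l2 (\<lambda>m::int. \<bar>real_of_int m\<bar> powr (-1)) Z" using l2_int_powr[of "-1"] by simp
  from someI_ex[OF this] show "Zinv > 0" "l2 (\<lambda>m::int. \<bar>real_of_int m\<bar> powr (-1)) Zinv"
    unfolding Zinv_def by auto
qed

definition CG :: real where "CG = 2 powr D * inverse c0"

lemma CG_pos: "CG > 0" unfolding CG_def using c0_pos by simp

lemma A_le_wt: "A m n \<le> wt m * (CG * \<bar>of_int n\<bar> powr (-1))"
proof (cases "m = 0")
  case False
  have "A m n = wt m * (\<bar>of_int m\<bar> powr s * A m n)" using wt_cancel[OF False] by (simp add: mult.assoc[symmetric])
  also have "\<dots> \<le> wt m * (CG * \<bar>of_int n\<bar> powr (-1))"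
    using kernel_G[of m n] unfolding CG_def by (intro mult_left_mono wt_nonneg)
  finally show ?thesis .
qed simp

text \<open>\<open>A_le_wt\<close> leaves the square summable factor
  \<open>1 / \<bar>n\<bar>\<close>, so Cauchy-Schwarz in \<open>n\<close> turns a square summable
  family in \<open>(m, n)\<close> into a square summable sequence in \<open>m\<close>.\<close>

lemma grep_row:
  assumes c: "l2 c N" and \<delta>: "0 < \<delta>"
  shows "(\<lambda>n. A m n * c (m, n) / \<delta>) summable_on UNIV"
    and "\<exists>d. l2 d (CG * Zinv / \<delta> * N) \<and> (\<forall>m. infsum (\<lambda>n. A m n * c (m, n) / \<delta>) UNIV \<le> wt m * d m)"
proof -
  have k: "l2 (\<lambda>n::int. CG / \<delta> * \<bar>of_int n\<bar> powr (-1)) (CG / \<delta> * Zinv)"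
    using CG_pos \<delta> by (intro l2_cmult Zinv) auto
  have x: "l2 (\<lambda>p. c (fst p, snd p)) N" using c by simp
  note K = l2_kernel[OF k x]
  have c0: "0 \<le> c i" for i by (rule l2_nonneg(1)[OF c])
  have le: "A m n * c (m, n) / \<delta> \<le> wt m * (CG / \<delta> * \<bar>of_int n\<bar> powr (-1) * c (m, n))" for m n
  proof -
    have "A m n * (c (m, n) / \<delta>) \<le> wt m * (CG * \<bar>of_int n\<bar> powr (-1)) * (c (m, n) / \<delta>)"
      using c0 \<delta> by (intro mult_right_mono A_le_wt) auto
    then show ?thesis by (simp add: mult_ac)
  qed
  have s2: "(\<lambda>n. wt m * (CG / \<delta> * \<bar>of_int n\<bar> powr (-1) * c (m, n))) summable_on UNIV" for m
    by (rule summable_on_cmult_right[OF K(1)])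
  have s1: "(\<lambda>n. A m n * c (m, n) / \<delta>) summable_on UNIV" for m
    by (rule summable_on_comparison_test[OF s2[of m]]) (use le c0 A_nonneg \<delta> in auto)
  then show "(\<lambda>n. A m n * c (m, n) / \<delta>) summable_on UNIV" .
  have "infsum (\<lambda>n. A m n * c (m, n) / \<delta>) UNIV \<le> wt m * infsum (\<lambda>n. CG / \<delta> * \<bar>of_int n\<bar> powr (-1) * c (m, n)) UNIV" for m
    using infsum_mono[OF s1[of m] s2[of m] le] unfolding infsum_cmult_right' .
  then show "\<exists>d. l2 d (CG * Zinv / \<delta> * N) \<and> (\<forall>m. infsum (\<lambda>n. A m n * c (m, n) / \<delta>) UNIV \<le> wt m * d m)"
    using K(2) by (intro exI[of _ "\<lambda>m. infsum (\<lambda>n. CG / \<delta> * \<bar>of_int n\<bar> powr (-1) * c (m, n)) UNIV"]) (auto simp: mult_ac)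
qed

section \<open>Uniform bounds on the rows of the interaction kernels\<close>

definition hh :: "int \<Rightarrow> real" where "hh m = \<bar>of_int m\<bar> powr (-(1+ex)/2)"

lemma hh_sq: "(hh m)\<^sup>2 = hi m" unfolding hh_def hi_def hw_def power2_eq_square powr_add[symmetric] by simp
lemma hh_nonneg: "0 \<le> hh m" unfolding hh_def by simp

lemma le_sum_of_sq:
  fixes k C u1 u2 u3 u4 :: real
  assumes "0 \<le> k" "0 \<le> C" "0 \<le> u1" "0 \<le> u2" "0 \<le> u3" "0 \<le> u4" "k\<^sup>2 \<le> C\<^sup>2 * (u1\<^sup>2 + u2\<^sup>2 + u3\<^sup>2 + u4\<^sup>2)"
  shows "k \<le> C * (u1 + u2 + u3 + u4)"
proof (rule power2_le_imp_le)
  have "u1\<^sup>2 + u2\<^sup>2 + u3\<^sup>2 + u4\<^sup>2 \<le> (u1 + u2 + u3 + u4)\<^sup>2"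
    using assms by (simp add: power2_eq_square algebra_simps)
  then show "k\<^sup>2 \<le> (C * (u1 + u2 + u3 + u4))\<^sup>2"
    using assms(7) mult_left_mono[of _ _ "C\<^sup>2"] by (fastforce simp: power_mult_distrib)
qed (use assms in auto)

text \<open>At the pairs \<open>(n, l)\<close> with \<open>l = m\<close> or \<open>n - l = m\<close> the phases \<open>Om m n\<close> and \<open>Om n l\<close> cancel, so that
  nothing is gained from the oscillation.\<close>

definition resn :: "int \<Rightarrow> int \<times> int \<Rightarrow> bool" where
  "resn m i \<longleftrightarrow> snd i = m \<or> snd i = fst i - m"

definition kGF :: "int \<Rightarrow> int \<times> int \<Rightarrow> real" where
  "kGF m i = (if resn m i then 0 else
     \<bar>of_int m\<bar> powr (1+s) * wt (m - fst i) * A (fst i) (snd i) * gw m \<bar>Om m (fst i) + Om (fst i) (snd i)\<bar>)"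

lemma kGF_nonneg: "0 \<le> kGF m i"
  unfolding kGF_def using A_nonneg gw_nonneg wt_nonneg by auto

text \<open>By \<open>kernel_GF\<close> the square of the kernel is at most a sum of four products
  of \<open>hi\<close> at two linear forms of the pair. For fixed \<open>m\<close> each two forms
  determine the pair, so the row norms are bounded uniformly in \<open>m\<close>.\<close>

lemma kGF_l2: "\<exists>C>0. \<forall>m. l2 (kGF m) C"
proof -
  obtain Z where Z: "Z > 0" "l2 hh Z" using l2_int_powr[of "-(1+ex)/2"] ex_pos unfolding hh_def by auto
  define C where "C = 3 powr D * inverse c0 * CGF"
  have C: "C > 0" unfolding C_def using c0_pos CGF_pos by simp
  define U where "U m i = C * (hh (m - fst i + snd i) * hh (fst i) + hh (fst i) * hh (m - snd i)
      + hh (m - fst i + snd i) * hh (m - snd i) + hh (snd i) * hh (fst i))" for m and i :: "int \<times> int"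
  have le: "kGF m i \<le> U m i" for m i
  proof -
    obtain n l where i: "i = (n, l)" by fastforce
    have U0: "0 \<le> U m i" unfolding U_def using C hh_nonneg by simp
    show ?thesis
    proof (cases "resn m i \<or> m = 0 \<or> m = n \<or> n = 0 \<or> l = 0 \<or> l = n")
      case True
      then have "kGF m i = 0" unfolding kGF_def i by auto
      then show ?thesis using U0 by simp
    next
      case False
      then have nz: "(m-n) + l + (n-l) \<noteq> 0" "m-n \<noteq> 0" "l \<noteq> 0" "n-l \<noteq> 0" "l + (n-l) \<noteq> 0" "(m-n) + l \<noteq> 0" "(m-n) + (n-l) \<noteq> 0"
        unfolding resn_def i by auto
      have "(kGF m i)\<^sup>2 \<le> C\<^sup>2 * (hi (m-n+l) * hi n + hi n * hi (m-l) + hi (m-n+l) * hi (m-l) + hi l * hi n)"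
        using kernel_GF[OF nz] False unfolding kGF_def i C_def wt_def by (simp add: mult.assoc)
      then have "(kGF m i)\<^sup>2 \<le> C\<^sup>2 * ((hh (m-n+l) * hh n)\<^sup>2 + (hh n * hh (m-l))\<^sup>2 + (hh (m-n+l) * hh (m-l))\<^sup>2 + (hh l * hh n)\<^sup>2)"
        by (simp only: power_mult_distrib hh_sq)
      then have "kGF m i \<le> C * (hh (m-n+l) * hh n + hh n * hh (m-l) + hh (m-n+l) * hh (m-l) + hh l * hh n)"
        by (rule le_sum_of_sq[rotated -1]) (simp_all add: kGF_nonneg hh_nonneg less_imp_le[OF C])
      then show ?thesis unfolding U_def i fst_conv snd_conv .
    qed
  qed
  have inj: "inj (\<lambda>i::int\<times>int. (m - fst i + snd i, fst i))" "inj (\<lambda>i::int\<times>int. (fst i, m - snd i))"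
      "inj (\<lambda>i::int\<times>int. (m - fst i + snd i, m - snd i))" "inj (\<lambda>i::int\<times>int. (snd i, fst i))" for m
    by (auto simp: inj_on_def)
  note P = l2_prod[OF Z(2) Z(2)]
  have "l2 (U m) (C * (Z*Z + Z*Z + Z*Z + Z*Z))" for m
    unfolding U_def
    using l2_reindex[OF P inj(1), of m] l2_reindex[OF P inj(2), of m] l2_reindex[OF P inj(3), of m] l2_reindex[OF P inj(4)] C
    by (intro l2_cmult l2_add) (auto simp only: fst_conv snd_conv)
  then have "l2 (kGF m) (C * (Z*Z + Z*Z + Z*Z + Z*Z))" for m
    by (rule l2_mono) (auto intro: le kGF_nonneg)
  moreover have "C * (Z*Z + Z*Z + Z*Z + Z*Z) > 0" using C Z by simp
  ultimately show ?thesis by blast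
qed

definition kGG :: "int \<Rightarrow> int \<times> int \<times> int \<Rightarrow> real" where
  "kGG m i = \<bar>of_int m\<bar> powr (1+s) * A (fst i) (fst (snd i)) * A (m - fst i) (snd (snd i))"

lemma kGG_nonneg: "0 \<le> kGG m i"
  unfolding kGG_def using A_nonneg by auto

lemma kGG_l2: "\<exists>C>0. \<forall>m. l2 (kGG m) C"
proof -
  obtain Z where Z: "Z > 0" "l2 (\<lambda>m::int. \<bar>real_of_int m\<bar> powr (-5/8)) Z" using l2_int_powr[of "-5/8"] by auto
  obtain Y where Y: "Y > 0" "l2 (\<lambda>m::int. \<bar>real_of_int m\<bar> powr (-3/4)) Y" using l2_int_powr[of "-3/4"] by auto
  \<comment> \<open>The square of \<open>v m\<close> is a product of two square summable sequences,
    so Cauchy-Schwarz bounds its sum independently of \<open>m\<close>.\<close>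
  define v where "v m n = \<bar>real_of_int n\<bar> powr (-3/8) * \<bar>real_of_int (m - n)\<bar> powr (-3/8)" for m n :: int
  have v: "l2 (v m) Y" for m
  proof (rule l2I_sq)
    fix F :: "int set" assume F: "finite F"
    have Y': "l2 (\<lambda>n. \<bar>real_of_int (m - n)\<bar> powr (-3/4)) Y"
      using l2_reindex[OF Y(2), of "\<lambda>n. m - n"] by (simp add: inj_on_def)
    have "(\<Sum>n\<in>F. (v m n)\<^sup>2) = (\<Sum>n\<in>F. \<bar>\<bar>real_of_int n\<bar> powr (-3/4)\<bar> * \<bar>\<bar>real_of_int (m - n)\<bar> powr (-3/4)\<bar>)"
    proof (rule sum.cong[OF refl])
      fix n
      have "(v m n)\<^sup>2 = (\<bar>real_of_int n\<bar> powr (-3/8) * \<bar>real_of_int n\<bar> powr (-3/8)) * (\<bar>real_of_int (m-n)\<bar> powr (-3/8) * \<bar>real_of_int (m-n)\<bar> powr (-3/8))"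
        unfolding v_def power2_eq_square by (simp only: mult_ac)
      then show "(v m n)\<^sup>2 = \<bar>\<bar>real_of_int n\<bar> powr (-3/4)\<bar> * \<bar>\<bar>real_of_int (m - n)\<bar> powr (-3/4)\<bar>"
        unfolding powr_add[symmetric] by simp
    qed
    also have "\<dots> \<le> L2_set (\<lambda>n. \<bar>real_of_int n\<bar> powr (-3/4)) F * L2_set (\<lambda>n. \<bar>real_of_int (m - n)\<bar> powr (-3/4)) F"
      by (rule L2_set_mult_ineq)
    also have "\<dots> \<le> Y * Y" by (intro mult_mono l2_fin[OF Y(2) F] l2_fin[OF Y' F] L2_set_nonneg) (use Y in auto)
    finally show "(\<Sum>n\<in>F. (v m n)\<^sup>2) \<le> Y\<^sup>2" by (simp add: power2_eq_square)
  qed (use Y in \<open>auto simp: v_def\<close>)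
  define U where "U m i = CGG * (v m (fst i) * (\<bar>real_of_int (fst (snd i))\<bar> powr (-5/8) * \<bar>real_of_int (snd (snd i))\<bar> powr (-5/8)))"
    for m and i :: "int \<times> int \<times> int"
  have CGG: "CGG > 0" unfolding CGG_def using c0_pos by simp
  have le: "kGG m i \<le> U m i" for m i
  proof (rule power2_le_imp_le)
    show "0 \<le> U m i" unfolding U_def v_def using CGG by simp
    have sq: "(\<bar>x\<bar> powr a)\<^sup>2 = \<bar>x\<bar> powr (2*a)" for x a :: real
      unfolding power2_eq_square powr_add[symmetric] by simp
    show "(kGG m i)\<^sup>2 \<le> (U m i)\<^sup>2"
      unfolding kGG_def U_def v_def power_mult_distrib[of CGG] power_mult_distrib[of "_ powr _"] power_mult_distrib[of "_ * _ powr _"] sq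
      using kernel_GG[of m "fst i" "fst (snd i)" "snd (snd i)"] by (simp add: power_mult_distrib sq mult_ac)
  qed
  have "l2 (U m) (CGG * (Y * (Z * Z)))" for m
    unfolding U_def using CGG l2_prod[OF v[of m] l2_prod[OF Z(2) Z(2)]] by (intro l2_cmult) auto
  then have "l2 (kGG m) (CGG * (Y * (Z * Z)))" for m
    by (rule l2_mono) (auto intro: le kGG_nonneg)
  moreover have "CGG * (Y * (Z * Z)) > 0" using CGG Z Y by simp
  ultimately show ?thesis by blast
qed

section \<open>Bilinear estimate with modulated inputs\<close>

definition CT :: real where "CT = max 1 (c0 powr (-(1/2-ex)))"

text \<open>A phase bounded below by \<open>c0\<close> has its power \<open>-1/2\<close> at most a
  constant times its power \<open>- ex\<close>, so both entries of \<open>gw\<close> dominate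
  it.\<close>

lemma powr_half_le_gw:
  assumes "m \<noteq> 0" "c0 \<le> \<sigma>"
  shows "\<sigma> powr (-(1/2)) \<le> CT * gw m \<sigma>"
proof -
  have \<sigma>: "\<sigma> > 0" using assms c0_pos by simp
  have "\<sigma> powr (-(1/2)) = \<sigma> powr (-(1/2-ex)) * \<sigma> powr (-ex)" unfolding powr_add[symmetric] by simp
  also have "\<dots> \<le> c0 powr (-(1/2-ex)) * \<sigma> powr (-ex)"
    using assms c0_pos ex_pos by (intro mult_right_mono powr_mono2') auto
  also have "\<dots> \<le> CT * \<sigma> powr (-ex)" unfolding CT_def by (intro mult_right_mono) auto
  finally have 1: "\<sigma> powr (-(1/2)) \<le> CT * \<sigma> powr (-ex)" .
  have "1 * 1 \<le> CT * \<bar>of_int m\<bar> powr (J-1)"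
    using ge_one_powr_ge_zero[OF abs_int_ge1[OF assms(1)], of "J-1"] J2 unfolding CT_def by (intro mult_mono) auto
  then have "1 * \<sigma> powr (-(1/2)) \<le> CT * \<bar>of_int m\<bar> powr (J-1) * \<sigma> powr (-(1/2))" by (intro mult_right_mono) auto
  with 1 show ?thesis unfolding gw_def by (auto simp: min_def mult.assoc)
qed

text \<open>Phases up to \<open>R\<close> contribute \<open>\<tau> powr ex * R powr (1/2)\<close>.
  For faster ones \<open>2 * R powr (-(1/2))\<close> is the size of the boundary terms,
  \<open>6 * \<tau> powr ex / \<eta>\<close> the remainder after averaging, and
  \<open>2 * \<eta>\<close> the modulus of continuity of the boundary term.\<close>

definition eps1 :: "real \<Rightarrow> real \<Rightarrow> real \<Rightarrow> real" where
  "eps1 \<eta> R \<tau> = CT * (2 * R powr (-(1/2)) + 6 * \<tau> powr ex / \<eta> + \<tau> powr ex * R powr (1/2)) + 2 * \<eta>"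

lemma osc_GF:
  assumes g: "hold \<eta> mug P1 g" and f: "hold \<eta> (mu p) P2 f" and p: "p \<noteq> 0" and m: "m \<noteq> 0"
    and ab: "a \<le> b" "b - a \<le> 1" and \<theta>: "c0 \<le> \<bar>\<theta>\<bar>" and \<eta>: "0 < \<eta>" "\<eta> \<le> 1" and R: "1 \<le> R"
  shows "hold \<eta> (mu m) (P1 * P2 * (eps1 \<eta> R (b - a) * gw m \<bar>\<theta>\<bar>)) (\<lambda>t. osc_int a \<theta> (\<lambda>r. g r * f r) (cl a b t))"
proof -
  define \<phi> where "\<phi> = (\<lambda>r. g r * f r)"
  define P where "P = P1 * P2"
  define \<sigma> where "\<sigma> = \<bar>\<theta>\<bar>"
  have \<sigma>: "\<sigma> > 0" "c0 \<le> \<sigma>" using \<theta> c0_pos unfolding \<sigma>_def by auto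
  have h: "hold \<eta> (\<lambda>h. mug h + mu p h) P \<phi>" unfolding P_def \<phi>_def by (rule hold_mult[OF g f]) (use \<eta> in simp)
  have P: "norm (\<phi> t) \<le> P" for t by (rule hold_norm[OF h])
  have P0: "0 \<le> P" by (rule hold_nonneg[OF h])
  have c: "continuous_on UNIV \<phi>" unfolding \<phi>_def
    by (intro continuous_on_mult hold_mug_continuous[OF g \<eta>(1)] hold_mu_continuous[OF f \<eta>(1)])
  define T where "T = (b - a) powr ex"
  have T0: "0 \<le> T" unfolding T_def by simp
  have half: "\<sigma> powr (-(1/2)) \<le> CT * gw m \<sigma>" by (rule powr_half_le_gw[OF m \<sigma>(2)])
  have CT0: "CT \<ge> 1" unfolding CT_def by simp
  have gw0: "0 \<le> gw m \<sigma>" by (rule gw_nonneg)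
  define S where "S = 2 * R powr (-(1/2)) + 6 * T / \<eta> + T * R powr (1/2)"
  have e1: "eps1 \<eta> R (b - a) * gw m \<sigma> = S * (CT * gw m \<sigma>) + 2 * \<eta> * gw m \<sigma>"
    unfolding eps1_def S_def T_def by (simp add: algebra_simps)
  have S0: "0 \<le> S" unfolding S_def using T0 \<eta> by simp
  have fin: "hold \<eta> (mu m) (P * (eps1 \<eta> R (b - a) * gw m \<sigma>)) F" if "hold \<eta> (mu m) M F" "M \<le> P * (S * \<sigma> powr (-(1/2)) + 2 * \<eta> * gw m \<sigma>)" for M F
  proof (rule hold_mono[OF that(1) _ mu_nonneg])
    have "S * \<sigma> powr (-(1/2)) + 2 * \<eta> * gw m \<sigma> \<le> eps1 \<eta> R (b - a) * gw m \<sigma>"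
      unfolding e1 by (intro add_right_mono mult_left_mono half S0)
    then have "P * (S * \<sigma> powr (-(1/2)) + 2 * \<eta> * gw m \<sigma>) \<le> P * (eps1 \<eta> R (b - a) * gw m \<sigma>)" using P0 by (intro mult_left_mono)
    then show "M \<le> P * (eps1 \<eta> R (b - a) * gw m \<sigma>)" using that(2) by linarith
  qed
  have "hold \<eta> (mu m) (P * (eps1 \<eta> R (b - a) * gw m \<sigma>)) (\<lambda>t. osc_int a \<theta> \<phi> (cl a b t))"
  proof (cases "\<sigma> \<le> R")
    case True
    show ?thesis
    proof (rule fin[OF osc_hold_triv[OF c P ab]])
      have "R powr (-(1/2)) \<le> \<sigma> powr (-(1/2))" using True \<sigma> by (intro powr_mono2') auto
      then have "R powr (1/2) * R powr (-(1/2)) \<le> R powr (1/2) * \<sigma> powr (-(1/2))" by (intro mult_left_mono) auto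
      then have "1 \<le> R powr (1/2) * \<sigma> powr (-(1/2))" using R by (simp add: powr_add[symmetric])
      then have "T * 1 \<le> T * (R powr (1/2) * \<sigma> powr (-(1/2)))" using T0 by (intro mult_left_mono)
      also have "\<dots> = (T * R powr (1/2)) * \<sigma> powr (-(1/2))" by simp
      also have "\<dots> \<le> S * \<sigma> powr (-(1/2))" unfolding S_def using T0 \<eta> by (intro mult_right_mono) auto
      finally have "T * 1 \<le> S * \<sigma> powr (-(1/2))" .
      moreover have "0 \<le> 2 * \<eta> * gw m \<sigma>" using \<eta> gw0 by simp
      ultimately have "T \<le> S * \<sigma> powr (-(1/2)) + 2 * \<eta> * gw m \<sigma>" by linarith
      then show "P * (b - a) powr ex \<le> P * (S * \<sigma> powr (-(1/2)) + 2 * \<eta> * gw m \<sigma>)"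
        unfolding T_def[symmetric] using P0 by (rule mult_left_mono)
    qed (use \<eta> in auto)
  next
    case False
    then have \<sigma>R: "R < \<sigma>" "1 \<le> \<sigma>" using R by auto
    define E where "E = 3 * P / \<eta> * \<sigma> powr (-(1/2))"
    have sg: "(1/\<sigma>) powr (1/2) = \<sigma> powr (-(1/2))" using \<sigma> by (simp add: powr_minus powr_divide field_simps)
    have E: "norm (\<phi> t - \<phi> u) \<le> E" if "\<bar>t - u\<bar> \<le> 1 / \<bar>\<theta>\<bar>" for t u
    proof -
      have tu: "\<bar>t - u\<bar> \<le> 1/\<sigma>" "1/\<sigma> \<le> 1" "\<bar>t - u\<bar> \<le> 1" using that \<sigma>R unfolding \<sigma>_def by (auto intro: order_trans)
      have "\<eta> * norm (\<phi> t - \<phi> u) \<le> P * (mug \<bar>t - u\<bar> + mu p \<bar>t - u\<bar>)" using h tu unfolding hold_def by blast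
      also have "mug \<bar>t - u\<bar> + mu p \<bar>t - u\<bar> \<le> 3 * mug (1/\<sigma>)"
        using mug_mono[of "\<bar>t-u\<bar>" "1/\<sigma>"] mu_mono[of "\<bar>t-u\<bar>" "1/\<sigma>" p] mu_le_mug[OF p, of "1/\<sigma>"] tu \<sigma> by simp
      also have "mug (1/\<sigma>) = \<sigma> powr (-(1/2))" unfolding mug_def sg ..
      finally have "\<eta> * norm (\<phi> t - \<phi> u) \<le> P * (3 * \<sigma> powr (-(1/2)))" using P0 by (simp add: mult_left_mono)
      then show ?thesis unfolding E_def using \<eta> by (simp add: field_simps)
    qed
    show ?thesis
    proof (rule fin[OF osc_hold_low(2)[OF c P ab _ E]])
      have "1/\<sigma> = \<sigma> powr (-(1/2)) * \<sigma> powr (-(1/2))" unfolding powr_add[symmetric] using \<sigma> by (simp add: powr_minus_divide)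
      also have "\<dots> \<le> R powr (-(1/2)) * \<sigma> powr (-(1/2))" using \<sigma>R R by (intro mult_right_mono powr_mono2') auto
      finally have "2 * P * (1/\<sigma>) \<le> 2 * P * (R powr (-(1/2)) * \<sigma> powr (-(1/2)))" using P0 by (intro mult_left_mono) auto
      moreover have "0 \<le> P * (T * R powr (1/2) * \<sigma> powr (-(1/2)))" using P0 T0 by simp
      ultimately have "2 * P * (1/\<sigma>) + 2 * E * T + 2 * \<eta> * P * gw m \<sigma> \<le> P * (S * \<sigma> powr (-(1/2)) + 2 * \<eta> * gw m \<sigma>)"
        unfolding S_def E_def by (simp add: algebra_simps)
      then show "2 * P / \<bar>\<theta>\<bar> + 2 * E * (b - a) powr ex + 2 * \<eta> * P * gw m \<bar>\<theta>\<bar> \<le> P * (S * \<sigma> powr (-(1/2)) + 2 * \<eta> * gw m \<sigma>)"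
        unfolding \<sigma>_def T_def by simp
    qed (use \<eta> \<theta> c0_pos m in auto)
  qed
  then show ?thesis unfolding P_def \<phi>_def \<sigma>_def by simp
qed

text \<open>The pair sums of a nonresonant triple are nonzero integers, so the lower bound of the
  phase is at least \<open>c0\<close> and no small denominators occur.\<close>

lemma Om3_ge_c0:
  assumes "m \<noteq> 0" "m \<noteq> n" "n \<noteq> 0" "l \<noteq> 0" "l \<noteq> n" "\<not> resn m (n, l)"
  shows "c0 \<le> \<bar>- Om m n + - Om n l\<bar>"
proof -
  have W: "\<bar>l\<bar> \<in> {\<bar>(m-n) + l\<bar>, \<bar>l + (n-l)\<bar>, \<bar>(m-n) + (n-l)\<bar>, \<bar>m-n\<bar>, \<bar>l\<bar>, \<bar>n-l\<bar>}" "\<bar>l\<bar> > 0" using assms by auto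
  have "1 \<le> of_int \<bar>(m-n) + l\<bar> * of_int \<bar>l + (n-l)\<bar> * of_int \<bar>(m-n) + (n-l)\<bar> * of_int \<bar>l\<bar> powr (2*J-2)"
  proof (intro mult_ge1)
    show "1 \<le> real_of_int \<bar>(m-n) + l\<bar>" "1 \<le> real_of_int \<bar>l + (n-l)\<bar>" "1 \<le> real_of_int \<bar>(m-n) + (n-l)\<bar>"
      using assms unfolding resn_def by (auto simp: of_int_1_le_iff simp del: of_int_add of_int_diff of_int_abs)
    show "1 \<le> of_int \<bar>l\<bar> powr (2*J-2)" using abs_int_ge1[OF assms(4)] J2 by (intro ge_one_powr_ge_zero) auto
  qed
  then have "c0 * 1 \<le> c0 * (of_int \<bar>(m-n) + l\<bar> * of_int \<bar>l + (n-l)\<bar> * of_int \<bar>(m-n) + (n-l)\<bar> * of_int \<bar>l\<bar> powr (2*J-2))"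
    using c0_pos by (intro mult_left_mono) auto
  also have "\<dots> \<le> \<bar>Om m n + Om n l\<bar>" using Om3_lower[OF W] by simp
  also have "\<dots> = \<bar>- Om m n + - Om n l\<bar>" by simp
  finally show ?thesis by simp
qed

end

text \<open>The resonant pairs \<open>(n, l)\<close> form the graphs \<open>l = m\<close> and
  \<open>l = n - m\<close> over \<open>n\<close>, so their double sum is a single sum.\<close>

lemma summable_graph:
  fixes y :: "'a \<Rightarrow> real"
  assumes "y summable_on UNIV"
  shows "((\<lambda>i. if snd i = h (fst i) then y (fst i) else 0) has_sum infsum y UNIV) (UNIV :: ('a \<times> 'b) set)"
proof -
  have "((\<lambda>i. if snd i = h (fst i) then y (fst i) else 0) has_sum infsum y UNIV) (range (\<lambda>n. (n, h n)))"
    by (subst has_sum_reindex) (use assms in \<open>auto simp: inj_on_def o_def\<close>)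
  then show ?thesis
    by (rule has_sum_cong_neutral[THEN iffD1, rotated -1]) (auto simp: image_iff)
qed

context hkdv
begin

text \<open>Phases up to \<open>R\<close> contribute \<open>\<tau> powr ex * R powr bet\<close>. For
  faster ones \<open>R powr (-ex)\<close> is the boundary value at the initial time and the last
  term the remainder after averaging.\<close>

definition eps0 :: "real \<Rightarrow> real \<Rightarrow> real \<Rightarrow> real" where
  "eps0 \<eta> R \<tau> = \<tau> powr ex * R powr bet + R powr (-ex) + 4 * \<tau> powr ex / \<eta>"

text \<open>A modulated function times a plain one oscillates with the sum of two phases. Away from
  \<open>resn\<close> that sum is bounded below and \<open>osc_GF\<close> applies; on
  \<open>resn\<close> only the short time helps. The boundary term is kept inside the modulus of
  continuity, so no new modulated part arises.\<close>

lemma bilinear_GF: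
  assumes g: "grep \<eta> \<delta> N1 g" and f: "frep \<eta> N2 f"
    and ab: "a \<le> b" "b - a \<le> 1" and \<eta>: "0 < \<eta>" "\<eta> \<le> 1" and R: "1 \<le> R" and \<delta>: "0 < \<delta>"
    and CK: "\<And>m. l2 (kGF m) CK"
  shows "\<exists>F. frep \<eta> ((eps1 \<eta> R (b - a) / \<delta> * CK + (b - a) powr ex / \<delta> * inverse c0 * 2) * (N1 * N2)) F \<and>
     (\<forall>t\<in>{a..b}. \<forall>m. ((\<lambda>n. Bint a (Vg g) (Vf f) t m n) has_sum F m t) UNIV)"
proof -
  obtain c where c: "l2 c N1" and gh: "\<And>n l. hold \<eta> mug (A n l * c (n, l) / \<delta>) (g n l)"
    using g unfolding grep_def by blast
  obtain d where d: "l2 d N2" and fh: "\<And>m. hold \<eta> (mu m) (wt m * d m) (f m)"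
    using f unfolding frep_def by blast
  note c0' = l2_nonneg(1)[OF c] and d0 = l2_nonneg(1)[OF d]
  define T where "T = (b - a) powr ex"
  define e1 where "e1 = eps1 \<eta> R (b - a) / \<delta>"
  define e2 where "e2 = T / \<delta> * inverse c0"
  have T0: "0 \<le> T" unfolding T_def by simp
  have e10: "0 \<le> e1" unfolding e1_def eps1_def CT_def using \<eta> \<delta> by (auto intro!: divide_nonneg_pos add_nonneg_nonneg mult_nonneg_nonneg)
  have e20: "0 \<le> e2" unfolding e2_def using T0 \<delta> c0_pos by simp
  define \<phi> where "\<phi> m n l = (\<lambda>r. g n l r * f (m - n) r)" for m n l
  define \<theta> where "\<theta> m n l = - Om m n + - Om n l" for m n l
  define I where "I m i t = of_int m * osc_int a (\<theta> m (fst i) (snd i)) (\<phi> m (fst i) (snd i)) (cl a b t)" for m i t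
  define x where "x m i = c i * d (m - fst i)" for m :: int and i :: "int \<times> int"
  have x0: "0 \<le> x m i" for m i unfolding x_def using c0' d0 by simp
  define r1 where "r1 m i = (if snd i = m then d (m - fst i) * c (fst i, m) else 0)" for m :: int and i :: "int \<times> int"
  define r2 where "r2 m i = (if snd i = fst i - m then d (m - fst i) * c (fst i, fst i - m) else 0)" for m :: int and i :: "int \<times> int"
  have r0: "0 \<le> r1 m i" "0 \<le> r2 m i" for m i unfolding r1_def r2_def using c0' d0 by simp_all
  define M where "M m i = wt m * (e1 * (kGF m i * x m i) + e2 * (r1 m i + r2 m i))" for m i
  have M0: "0 \<le> M m i" for m i unfolding M_def using wt_nonneg e10 e20 kGF_nonneg x0 r0 by (simp add: add_nonneg_nonneg)
  have \<phi>c: "continuous_on UNIV (\<phi> m n l)" for m n l unfolding \<phi>_def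
    by (intro continuous_on_mult hold_mug_continuous[OF gh \<eta>(1)] hold_mu_continuous[OF fh \<eta>(1)])
  have \<phi>b: "norm (\<phi> m n l t) \<le> A n l * c (n, l) / \<delta> * (wt (m - n) * d (m - n))" for m n l t
    unfolding \<phi>_def norm_mult using hold_nonneg[OF gh] by (intro mult_mono hold_norm[OF gh] hold_norm[OF fh]) auto
  have hI: "hold \<eta> (mu m) (M m i) (I m i)" for m i
  proof -
    obtain n l where i: "i = (n, l)" by fastforce
    show ?thesis
    proof (cases "m = 0 \<or> n = 0 \<or> l = 0 \<or> l = n \<or> m = n")
      case True
      then have "m = 0 \<or> A n l * c (n, l) / \<delta> * (wt (m - n) * d (m - n)) = 0" by auto
      then have "I m i = (\<lambda>t. 0)"
      proof
        assume 0: "A n l * c (n, l) / \<delta> * (wt (m - n) * d (m - n)) = 0"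
        have "\<phi> m n l t = 0" for t using \<phi>b[of m n l t] unfolding 0 by simp
        then have "\<phi> m n l = (\<lambda>t. 0)" by auto
        then show ?thesis unfolding I_def i by (simp add: osc_int_def)
      qed (auto simp: I_def)
      then show ?thesis using hold_mono[OF hold_0 M0 mu_nonneg] by simp
    next
      case nz: False
      then have m: "m \<noteq> 0" and p: "m - n \<noteq> 0" by auto
      have alg: "M * (a * c / \<delta> * (v * d) * (e * g)) = w * (e / \<delta> * (Y * v * a * g * (c * d)))"
        if "w * Y = M" for M w Y a c v d e g :: real
        unfolding that[symmetric] by (simp only: divide_inverse mult_ac)
      have alg2: "M * (a * c / \<delta> * (v * d) * e) = w * (e / \<delta> * (c * d)) * (Y * v * a)"
        if "w * Y = M" for M w Y a c v d e :: real
        unfolding that[symmetric] by (simp only: divide_inverse mult_ac)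
      have nm: "norm (of_int m :: complex) = \<bar>of_int m\<bar>" by simp
      show ?thesis
      proof (cases "resn m i")
        case False
        have \<theta>: "c0 \<le> \<bar>\<theta> m n l\<bar>" unfolding \<theta>_def by (rule Om3_ge_c0) (use nz False i in auto)
        have "hold \<eta> (mu m) (A n l * c (n, l) / \<delta> * (wt (m-n) * d (m-n)) * (eps1 \<eta> R (b - a) * gw m \<bar>\<theta> m n l\<bar>)) (\<lambda>t. osc_int a (\<theta> m n l) (\<phi> m n l) (cl a b t))"
          unfolding \<phi>_def by (rule osc_GF[OF gh fh p m ab \<theta> \<eta> R])
        from hold_cmult[OF this, of "of_int m"]
        have H: "hold \<eta> (mu m) (\<bar>of_int m\<bar> * (A n l * c (n, l) / \<delta> * (wt (m-n) * d (m-n)) * (eps1 \<eta> R (b - a) * gw m \<bar>\<theta> m n l\<bar>))) (I m i)"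
          unfolding I_def i nm by simp
        have "\<bar>\<theta> m n l\<bar> = \<bar>Om m n + Om n l\<bar>" unfolding \<theta>_def by simp
        then have kk: "kGF m (n, l) = \<bar>of_int m\<bar> powr (1+s) * wt (m - n) * A n l * gw m \<bar>\<theta> m n l\<bar>"
          using False unfolding kGF_def i by simp
        have "\<bar>of_int m\<bar> * (A n l * c (n, l) / \<delta> * (wt (m-n) * d (m-n)) * (eps1 \<eta> R (b - a) * gw m \<bar>\<theta> m n l\<bar>))
          = wt m * (e1 * (kGF m i * x m i))"
          unfolding i kk e1_def x_def fst_conv by (rule alg[OF wt_cancel1[OF m]])
        also have "\<dots> \<le> M m i" unfolding M_def using e20 r0 by (intro mult_left_mono wt_nonneg) (simp add: add_nonneg_nonneg)
        finally show ?thesis by (rule hold_mono[OF H _ mu_nonneg])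
      next
        case True
        have "hold \<eta> (mu m) (A n l * c (n, l) / \<delta> * (wt (m-n) * d (m-n)) * T) (\<lambda>t. osc_int a (\<theta> m n l) (\<phi> m n l) (cl a b t))"
          unfolding T_def by (rule osc_hold_triv[OF \<phi>c \<phi>b ab]) (use \<eta> in auto)
        from hold_cmult[OF this, of "of_int m"]
        have H: "hold \<eta> (mu m) (\<bar>of_int m\<bar> * (A n l * c (n, l) / \<delta> * (wt (m-n) * d (m-n)) * T)) (I m i)"
          unfolding I_def i nm by simp
        have "\<bar>of_int m\<bar> powr (1+s) * wt (m - n) * A n l \<le> inverse c0"
          using kernel_res[of m "m - n"] m p nz True unfolding resn_def i wt_def by auto
        then have "wt m * (T / \<delta> * x m i) * (\<bar>of_int m\<bar> powr (1+s) * wt (m - n) * A n l) \<le> wt m * (T / \<delta> * x m i) * inverse c0"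
          using wt_nonneg T0 \<delta> x0 by (intro mult_left_mono) auto
        moreover have "\<bar>of_int m\<bar> * (A n l * c (n, l) / \<delta> * (wt (m-n) * d (m-n)) * T)
          = wt m * (T / \<delta> * x m i) * (\<bar>of_int m\<bar> powr (1+s) * wt (m - n) * A n l)"
          unfolding x_def i fst_conv by (rule alg2[OF wt_cancel1[OF m]])
        moreover have "wt m * (T / \<delta> * x m i) * inverse c0 = wt m * (e2 * x m i)"
          unfolding e2_def by (simp only: mult_ac)
        ultimately have le1: "\<bar>of_int m\<bar> * (A n l * c (n, l) / \<delta> * (wt (m-n) * d (m-n)) * T) \<le> wt m * (e2 * x m i)"
          by linarith
        have "x m i \<le> r1 m i + r2 m i"
        proof (cases "l = m")
          case True
          then have "r1 m i = x m i" unfolding r1_def x_def i by simp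
          then show ?thesis using r0(2)[of m i] by linarith
        next
          case False
          then have "r2 m i = x m i" using True unfolding resn_def r2_def x_def i by auto
          then show ?thesis using r0(1)[of m i] by linarith
        qed
        then have "e2 * x m i \<le> e2 * (r1 m i + r2 m i)" using e20 by (rule mult_left_mono)
        moreover have "0 \<le> e1 * (kGF m i * x m i)" using e10 kGF_nonneg[of m i] x0[of m i] by simp
        ultimately have "wt m * (e2 * x m i) \<le> M m i"
          unfolding M_def by (intro mult_left_mono wt_nonneg) linarith
        then show ?thesis using le1 by (intro hold_mono[OF H _ mu_nonneg]) linarith
      qed
    qed
  qed
  have lx: "l2 (\<lambda>p. x (fst p) (snd p)) (N1 * N2)"
    using l2_reindex[OF l2_prod[OF c d], of "\<lambda>p. (snd p, fst p - fst (snd p))"]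
    unfolding x_def by (auto simp: inj_on_def prod_eq_iff)
  define S1 where "S1 m = infsum (\<lambda>i. kGF m i * x m i) UNIV" for m
  note K1 = l2_kernel[OF CK lx]
  \<comment> \<open>On the resonant graphs the kernel is merely bounded. Here a row of
    \<open>d\<close> acts as the kernel on the values of \<open>c\<close> along the graph, which are
    square summable in \<open>(m, n)\<close>.\<close>
  have dk: "l2 (\<lambda>n. d (m - n)) N2" for m using l2_reindex[OF d, of "\<lambda>n. m - n"] by (simp add: inj_on_def)
  have c1: "l2 (\<lambda>p. c (snd p, fst p)) N1" using l2_reindex[OF c, of "\<lambda>p. (snd p, fst p)"] by (auto simp: inj_on_def)
  have c2: "l2 (\<lambda>p. c (snd p, snd p - fst p)) N1" using l2_reindex[OF c, of "\<lambda>p. (snd p, snd p - fst p)"] by (auto simp: inj_on_def)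
  note K2 = l2_kernel[where k="\<lambda>m n. d (m - n)" and x="\<lambda>m n. c (n, m)", OF dk c1]
  note K3 = l2_kernel[where k="\<lambda>m n. d (m - n)" and x="\<lambda>m n. c (n, n - m)", OF dk c2]
  define S2 where "S2 m = infsum (\<lambda>n. d (m - n) * c (n, m)) UNIV" for m
  define S3 where "S3 m = infsum (\<lambda>n. d (m - n) * c (n, n - m)) UNIV" for m
  have h2: "(r1 m has_sum S2 m) UNIV" for m
    using summable_graph[OF K2(1)[of m], of "\<lambda>_. m"] unfolding r1_def S2_def by simp
  have h3: "(r2 m has_sum S3 m) UNIV" for m
    using summable_graph[OF K3(1)[of m], of "\<lambda>n. n - m"] unfolding r2_def S3_def by simp
  have hM: "(M m has_sum wt m * (e1 * S1 m + e2 * (S2 m + S3 m))) UNIV" for m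
    unfolding M_def S1_def by (intro has_sum_cmult_right has_sum_add has_sum_infsum K1(1) h2 h3)
  define F where "F m t = infsum (\<lambda>i. I m i t) UNIV" for m t
  have sM: "M m summable_on UNIV" for m using hM by (rule has_sum_imp_summable)
  have "hold \<eta> (mu m) (wt m * (e1 * S1 m + e2 * (S2 m + S3 m))) (F m)" for m
    using hold_infsum(1)[OF hI sM, of m] \<eta> unfolding F_def infsumI[OF hM] by simp
  moreover have "l2 (\<lambda>m. e1 * S1 m + e2 * (S2 m + S3 m)) (e1 * (CK * (N1 * N2)) + e2 * (N2 * N1 + N2 * N1))"
    unfolding S1_def S2_def S3_def by (intro l2_add l2_cmult K1(2) K2(2) K3(2) e10 e20)
  moreover have "e1 * (CK * (N1 * N2)) + e2 * (N2 * N1 + N2 * N1) = (eps1 \<eta> R (b - a) / \<delta> * CK + (b - a) powr ex / \<delta> * inverse c0 * 2) * (N1 * N2)"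
    unfolding e1_def e2_def T_def by (simp add: algebra_simps)
  ultimately have "frep \<eta> ((eps1 \<eta> R (b - a) / \<delta> * CK + (b - a) powr ex / \<delta> * inverse c0 * 2) * (N1 * N2)) F"
    unfolding frep_def by (intro exI[of _ "\<lambda>m. e1 * S1 m + e2 * (S2 m + S3 m)"]) auto
  moreover have "((\<lambda>n. Bint a (Vg g) (Vf f) t m n) has_sum F m t) UNIV" if t: "t \<in> {a..b}" for t m
  proof -
    \<comment> \<open>The family over the pairs \<open>(n, l)\<close> converges absolutely, so
      summing over \<open>l\<close> first recovers the product with \<open>Vg g\<close>.\<close>
    have "(\<lambda>i. I m i t) summable_on UNIV"
      by (rule summable_of_bound(1)[OF hold_norm[OF hI] sM])
    then have "((\<lambda>i. I m i t) has_sum F m t) (UNIV \<times> UNIV)" unfolding F_def by simp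
    then show ?thesis
    proof (rule has_sum_SigmaD)
      fix n
      have "(\<lambda>l. A n l * c (n, l) / \<delta> * (wt (m - n) * d (m - n))) summable_on UNIV"
        by (rule summable_on_cmult_left[OF grep_row(1)[OF c \<delta>]])
      from osc_int_infsum[OF \<phi>b this \<phi>c, of a "- Om m n" "\<lambda>l. - Om n l" t]
      have "((\<lambda>l. osc_int a (\<theta> m n l) (\<phi> m n l) t) has_sum osc_int a (- Om m n) (\<lambda>r. infsum (\<lambda>l. \<phi> m n l r * ph (- Om n l) r) UNIV) t) UNIV"
        unfolding \<theta>_def .
      moreover have "(\<lambda>r. infsum (\<lambda>l. \<phi> m n l r * ph (- Om n l) r) UNIV) = (\<lambda>r. Vg g r n * Vf f r (m - n))"
        unfolding \<phi>_def Vg_def Vf_def infsum_cmult_left'[symmetric] by (simp add: mult_ac)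
      ultimately have "((\<lambda>l. osc_int a (\<theta> m n l) (\<phi> m n l) t) has_sum osc_int a (- Om m n) (\<lambda>r. Vg g r n * Vf f r (m - n)) t) UNIV"
        by simp
      then show "((\<lambda>l. I m (n, l) t) has_sum Bint a (Vg g) (Vf f) t m n) UNIV"
        unfolding I_def Bint_def fst_conv snd_conv cl_id[OF t] by (rule has_sum_cmult_right)
    qed
  qed
  ultimately show ?thesis by blast
qed

text \<open>Both factors carry an inverse phase, so the integral is estimated by its length alone.
  The smallness is \<open>(b - a) powr ex\<close>, against the previously fixed
  \<open>\<delta>^2\<close> in the denominator.\<close>

lemma bilinear_GG:
  assumes g: "grep \<eta> \<delta> N1 g" and g': "grep \<eta> \<delta> N2 g'"
    and ab: "a \<le> b" "b - a \<le> 1" and \<eta>: "0 < \<eta>" "\<eta> \<le> 1" and \<delta>: "0 < \<delta>"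
    and CK: "\<And>m. l2 (kGG m) CK"
  shows "\<exists>F. frep \<eta> ((b - a) powr ex / \<delta>\<^sup>2 * CK * (N1 * N2)) F \<and>
     (\<forall>t\<in>{a..b}. \<forall>m. ((\<lambda>n. Bint a (Vg g) (Vg g') t m n) has_sum F m t) UNIV)"
proof -
  obtain c where c: "l2 c N1" and gh: "\<And>n l. hold \<eta> mug (A n l * c (n, l) / \<delta>) (g n l)"
    using g unfolding grep_def by blast
  obtain d where d: "l2 d N2" and gh': "\<And>n l. hold \<eta> mug (A n l * d (n, l) / \<delta>) (g' n l)"
    using g' unfolding grep_def by blast
  note c0' = l2_nonneg(1)[OF c] and d0 = l2_nonneg(1)[OF d]
  define e1 where "e1 = (b - a) powr ex / \<delta>\<^sup>2"
  have e10: "0 \<le> e1" unfolding e1_def by simp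
  define \<phi> where "\<phi> m n p = (\<lambda>r. g n (fst p) r * g' (m - n) (snd p) r)" for m n p
  define \<theta> where "\<theta> m n p = - Om m n + (- Om n (fst p) - Om (m - n) (snd p))" for m n p
  define I where "I m i t = of_int m * osc_int a (\<theta> m (fst i) (snd i)) (\<phi> m (fst i) (snd i)) (cl a b t)" for m i t
  define x where "x m i = c (fst i, fst (snd i)) * d (m - fst i, snd (snd i))" for m :: int and i :: "int \<times> int \<times> int"
  define M where "M m i = wt m * (e1 * (kGG m i * x m i))" for m i
  have x0: "0 \<le> x m i" for m i unfolding x_def using c0' d0 by simp
  have M0: "0 \<le> M m i" for m i unfolding M_def using wt_nonneg e10 kGG_nonneg x0 by simp
  have \<phi>c: "continuous_on UNIV (\<phi> m n p)" for m n p unfolding \<phi>_def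
    by (intro continuous_on_mult hold_mug_continuous[OF gh \<eta>(1)] hold_mug_continuous[OF gh' \<eta>(1)])
  have \<phi>b: "norm (\<phi> m n p t) \<le> (A n (fst p) * c (n, fst p) / \<delta>) * (A (m - n) (snd p) * d (m - n, snd p) / \<delta>)" for m n p t
    unfolding \<phi>_def norm_mult using hold_nonneg[OF gh] by (intro mult_mono hold_norm[OF gh] hold_norm[OF gh']) auto
  have hI: "hold \<eta> (mu m) (M m i) (I m i)" for m i
  proof (cases "m = 0")
    case True
    then have "I m i = (\<lambda>t. 0)" by (auto simp: I_def)
    then show ?thesis using hold_mono[OF hold_0 M0 mu_nonneg] by simp
  next
    case m: False
    obtain n p where i: "i = (n, p)" by (rule prod.exhaust)
    have "hold \<eta> (mu m) ((A n (fst p) * c (n, fst p) / \<delta>) * (A (m - n) (snd p) * d (m - n, snd p) / \<delta>) * (b - a) powr ex) (\<lambda>t. osc_int a (\<theta> m n p) (\<phi> m n p) (cl a b t))"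
      by (rule osc_hold_triv[OF \<phi>c \<phi>b ab]) (use \<eta> in auto)
    from hold_cmult[OF this, of "of_int m"]
    have H: "hold \<eta> (mu m) (\<bar>of_int m\<bar> * ((A n (fst p) * c (n, fst p) / \<delta>) * (A (m - n) (snd p) * d (m - n, snd p) / \<delta>) * (b - a) powr ex)) (I m i)"
      unfolding I_def i by simp
    have alg: "M * ((a * c / \<delta>) * (v * d / \<delta>) * e) = w * (e / (\<delta> * \<delta>) * (Y * a * v * (c * d)))"
      if "w * Y = M" for M w Y a c v d e :: real
      unfolding that[symmetric] by (simp only: divide_inverse inverse_mult_distrib mult_ac)
    have "\<bar>of_int m\<bar> * ((A n (fst p) * c (n, fst p) / \<delta>) * (A (m - n) (snd p) * d (m - n, snd p) / \<delta>) * (b - a) powr ex) = M m i"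
      unfolding M_def kGG_def x_def e1_def i fst_conv snd_conv power2_eq_square by (rule alg[OF wt_cancel1[OF m]])
    with H show ?thesis by (simp only:)
  qed
  have lx: "l2 (\<lambda>p. x (fst p) (snd p)) (N1 * N2)"
    using l2_reindex[OF l2_prod[OF c d], of "\<lambda>p. ((fst (snd p), fst (snd (snd p))), (fst p - fst (snd p), snd (snd (snd p))))"]
    unfolding x_def by (auto simp: inj_on_def prod_eq_iff)
  define S1 where "S1 m = infsum (\<lambda>i. kGG m i * x m i) UNIV" for m
  note K1 = l2_kernel[OF CK lx]
  have hM: "(M m has_sum wt m * (e1 * S1 m)) UNIV" for m
    unfolding M_def S1_def by (intro has_sum_cmult_right has_sum_infsum K1(1))
  define F where "F m t = infsum (\<lambda>i. I m i t) UNIV" for m t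
  have sM: "M m summable_on UNIV" for m using hM by (rule has_sum_imp_summable)
  have "hold \<eta> (mu m) (wt m * (e1 * S1 m)) (F m)" for m
    using hold_infsum(1)[OF hI sM, of m] \<eta> unfolding F_def infsumI[OF hM] by simp
  moreover have "l2 (\<lambda>m. e1 * S1 m) (e1 * (CK * (N1 * N2)))"
    unfolding S1_def by (intro l2_cmult K1(2) e10)
  moreover have "e1 * (CK * (N1 * N2)) = (b - a) powr ex / \<delta>\<^sup>2 * CK * (N1 * N2)"
    unfolding e1_def by simp
  ultimately have "frep \<eta> ((b - a) powr ex / \<delta>\<^sup>2 * CK * (N1 * N2)) F"
    unfolding frep_def by (intro exI[of _ "\<lambda>m. e1 * S1 m"]) auto
  moreover have "((\<lambda>n. Bint a (Vg g) (Vg g') t m n) has_sum F m t) UNIV" if t: "t \<in> {a..b}" for t m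
  proof -
    have "(\<lambda>i. I m i t) summable_on UNIV"
      by (rule summable_of_bound(1)[OF hold_norm[OF hI] sM])
    then have "((\<lambda>i. I m i t) has_sum F m t) (UNIV \<times> UNIV)" unfolding F_def by simp
    then show ?thesis
    proof (rule has_sum_SigmaD)
      fix n
      note gs = grep_row(1)[OF c \<delta>, of n] grep_row(1)[OF d \<delta>, of "m - n"]
      have gb: "norm (g n l r * ph (- Om n l) r) \<le> A n l * c (n, l) / \<delta>" for l r
        using hold_norm[OF gh, of n l r] by (simp add: norm_mult)
      have gb': "norm (g' (m-n) l r * ph (- Om (m-n) l) r) \<le> A (m-n) l * d (m-n, l) / \<delta>" for l r
        using hold_norm[OF gh', of "m-n" l r] by (simp add: norm_mult)
      note pr = has_sum_mult_pair(2)[OF gb[of _ 0] gs(1) gb'[of _ 0] gs(2)]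
      from osc_int_infsum[OF \<phi>b pr \<phi>c, of a "- Om m n" "\<lambda>p. - Om n (fst p) - Om (m-n) (snd p)" t]
      have "((\<lambda>p. osc_int a (\<theta> m n p) (\<phi> m n p) t) has_sum osc_int a (- Om m n) (\<lambda>r. infsum (\<lambda>p. \<phi> m n p r * ph (- Om n (fst p) - Om (m-n) (snd p)) r) UNIV) t) UNIV"
        unfolding \<theta>_def .
      moreover have "(\<lambda>r. infsum (\<lambda>p. \<phi> m n p r * ph (- Om n (fst p) - Om (m-n) (snd p)) r) UNIV) = (\<lambda>r. Vg g r n * Vg g' r (m - n))"
      proof
        fix r
        have "\<phi> m n p r * ph (- Om n (fst p) - Om (m-n) (snd p)) r
          = (g n (fst p) r * ph (- Om n (fst p)) r) * (g' (m-n) (snd p) r * ph (- Om (m-n) (snd p)) r)" for p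
          unfolding \<phi>_def diff_conv_add_uminus[of "- Om n (fst p)"] ph_add by (simp add: mult_ac)
        then show "infsum (\<lambda>p. \<phi> m n p r * ph (- Om n (fst p) - Om (m-n) (snd p)) r) UNIV = Vg g r n * Vg g' r (m - n)"
          unfolding Vg_def using has_sum_mult_pair(1)[OF gb[of _ r] gs(1) gb'[of _ r] gs(2)] by simp
      qed
      ultimately have "((\<lambda>p. osc_int a (\<theta> m n p) (\<phi> m n p) t) has_sum osc_int a (- Om m n) (\<lambda>r. Vg g r n * Vg g' r (m - n)) t) UNIV"
        by simp
      then show "((\<lambda>p. I m (n, p) t) has_sum Bint a (Vg g) (Vg g') t m n) UNIV"
        unfolding I_def Bint_def fst_conv snd_conv cl_id[OF t] by (rule has_sum_cmult_right)
    qed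
  qed
  ultimately show ?thesis by blast
qed

end

section \<open>Bilinear estimate for plain inputs and for sums of both types\<close>

context hkdv
begin

lemma Om_zero: "Om m 0 = 0" "Om m m = 0" "Om 0 n = 0"
  unfolding Om_def K_def by simp_all

lemma inverse_powr_split:
  assumes "\<sigma> > R" "R \<ge> 1"
  shows "1 / \<sigma> \<le> R powr (-ex) * \<sigma> powr (-bet)"
proof -
  have "1 / \<sigma> = \<sigma> powr (-ex) * \<sigma> powr (-bet)"
    unfolding powr_add[symmetric] bet_def using assms by (simp add: powr_minus_divide)
  also have "\<dots> \<le> R powr (-ex) * \<sigma> powr (-bet)" using assms ex_pos by (intro mult_right_mono powr_mono2') auto
  finally show ?thesis .
qed

lemma inverse_le_1_powr: "0 < \<sigma> \<Longrightarrow> (1 / \<sigma>) powr a = \<sigma> powr (-a)" for \<sigma> a :: real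
  by (simp add: powr_minus powr_divide field_simps)

text \<open>For phases above \<open>R\<close> the boundary term becomes the new modulated part, and
  its amplitude has the weight \<open>A m n\<close> by construction. For slower phases
  \<open>g m n = 0\<close>; the whole integral is then of plain type and small on short
  intervals.\<close>

lemma bilinear_FF:
  assumes f1: "frep \<eta> N1 f1" and f2: "frep \<eta> N2 f2"
    and ab: "a \<le> b" "b - a \<le> 1" and \<eta>: "0 < \<eta>" "\<eta> \<le> 1" and R: "1 \<le> R" and \<delta>: "0 < \<delta>"
  shows "\<exists>F g. frep \<eta> (3 * CFF * eps0 \<eta> R (b - a) * Zinv * (N1 * N2)) F \<and> grep \<eta> \<delta> (4 * \<delta> * (N1 * N2)) g \<and>
     (\<forall>t\<in>{a..b}. \<forall>m. ((\<lambda>n. Bint a (Vf f1) (Vf f2) t m n) has_sum (F m t + Vg g t m)) UNIV)"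
proof -
  obtain c where c: "l2 c N1" and ch: "\<And>m. hold \<eta> (mu m) (wt m * c m) (f1 m)"
    using f1 unfolding frep_def by blast
  obtain d where d: "l2 d N2" and dh: "\<And>m. hold \<eta> (mu m) (wt m * d m) (f2 m)"
    using f2 unfolding frep_def by blast
  note c0' = l2_nonneg(1)[OF c] and d0 = l2_nonneg(1)[OF d]
  define T where "T = (b - a) powr ex"
  have T0: "0 \<le> T" unfolding T_def by simp
  define e0 where "e0 = eps0 \<eta> R (b - a)"
  have e0_eq: "e0 = T * R powr bet + R powr (-ex) + 4 * T / \<eta>" unfolding e0_def eps0_def T_def by simp
  have e00: "0 \<le> e0" unfolding e0_eq using T0 \<eta> by simp
  have CFF0: "0 \<le> CFF" unfolding CFF_def by simp
  define \<phi> where "\<phi> m n = (\<lambda>r. f1 n r * f2 (m - n) r)" for m n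
  define \<theta> where "\<theta> m n = - Om m n" for m n
  define P where "P m n = (wt n * c n) * (wt (m - n) * d (m - n))" for m n
  define x where "x m n = c n * d (m - n)" for m n
  have x0: "0 \<le> x m n" for m n unfolding x_def using c0' d0 by simp
  have P0: "0 \<le> P m n" for m n unfolding P_def using c0' d0 wt_nonneg by simp
  define g where "g m n = (if R < \<bar>\<theta> m n\<bar> then (\<lambda>t. of_int m * prim (\<theta> m n) (\<phi> m n) t) else (\<lambda>t. 0))" for m n
  define q where "q m n t = of_int m * osc_int a (\<theta> m n) (\<phi> m n) (cl a b t) - ph (\<theta> m n) (cl a b t) * g m n (cl a b t)" for m n t
  \<comment> \<open>The 4 comes from bounding the moduli of both inputs by \<open>mug\<close>. The
    factor \<open>\<delta>\<close> offsets the division by \<open>\<delta>\<close> in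
    \<open>grep\<close>, so the new modulated part is small with \<open>\<delta>\<close>.\<close>
  define cg where "cg p = 4 * \<delta> * x (fst p) (snd p)" for p
  have \<phi>h: "hold \<eta> (\<lambda>h. mu n h + mu (m - n) h) (P m n) (\<phi> m n)" for m n
    unfolding \<phi>_def P_def by (rule hold_mult[OF ch dh]) (use \<eta> in simp)
  have \<phi>c: "continuous_on UNIV (\<phi> m n)" for m n unfolding \<phi>_def
    by (intro continuous_on_mult hold_mu_continuous[OF ch \<eta>(1)] hold_mu_continuous[OF dh \<eta>(1)])
  have \<phi>b: "norm (\<phi> m n t) \<le> P m n" for m n t by (rule hold_norm[OF \<phi>h])
  have nz: "m \<noteq> 0 \<and> n \<noteq> 0 \<and> m \<noteq> n" if "\<theta> m n \<noteq> 0" for m n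
    using that Om_zero unfolding \<theta>_def by auto
  have nm: "norm (of_int m :: complex) = \<bar>of_int m\<bar>" for m by simp
  have gh: "hold \<eta> mug (A m n * cg (m, n) / \<delta>) (g m n)" for m n
  proof (cases "R < \<bar>\<theta> m n\<bar>")
    case True
    then have \<theta>0: "\<theta> m n \<noteq> 0" using R by auto
    note nz' = nz[OF \<theta>0]
    have "hold \<eta> mug (4 * P m n) (\<phi> m n)"
    proof (rule hold_dom[OF \<phi>h])
      fix h :: real assume "0 \<le> h" "h \<le> 1"
      then show "mu n h + mu (m - n) h \<le> 4 * mug h"
        using mu_le_mug[of n h] mu_le_mug[of "m - n" h] nz' by simp
    qed simp
    then have "hold \<eta> mug (4 * P m n) (low (1 / abs (\<theta> m n)) (\<phi> m n))"
      by (rule hold_low[OF _ \<phi>c]) (use \<theta>0 \<eta> in auto)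
    from hold_cmult[OF this, of "of_int m / (\<i> * of_real (\<theta> m n))"]
    have "hold \<eta> mug (\<bar>of_int m\<bar> / \<bar>\<theta> m n\<bar> * (4 * P m n)) (g m n)"
      unfolding g_def prim_def using True by (simp add: norm_divide norm_mult)
    moreover have "\<bar>of_int m\<bar> / \<bar>\<theta> m n\<bar> * (4 * P m n) = A m n * cg (m, n) / \<delta>"
      unfolding A_def cg_def x_def P_def \<theta>_def wt_def using \<delta> by (simp add: field_simps)
    ultimately show ?thesis by simp
  next
    case False
    have "0 \<le> A m n * cg (m, n) / \<delta>" unfolding cg_def using A_nonneg x0 \<delta> by simp
    then show ?thesis unfolding g_def using False hold_mono[OF hold_0 _ mug_nonneg] by simp
  qed
  \<comment> \<open>Three kernels enter, one of order \<open>bet\<close> and one of order 1/2 for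
    each input, hence the 3. The factor \<open>1 / \<bar>m\<bar>\<close> provides square summability
    in \<open>m\<close>, as the sum over \<open>n\<close> is bounded only uniformly in
    \<open>m\<close>.\<close>
  define k where "k m = 3 * CFF * e0 * \<bar>of_int m\<bar> powr (-1)" for m :: int
  have k0: "0 \<le> k m" for m unfolding k_def using CFF0 e00 by simp
  have M0: "0 \<le> wt m * (k m * x m n)" for m n using wt_nonneg k0 x0 by simp
  have qh: "hold \<eta> (mu m) (wt m * (k m * x m n)) (q m n)" for m n
  proof (cases "m = 0 \<or> n = 0 \<or> m = n")
    case True
    then have "\<theta> m n = 0" using Om_zero unfolding \<theta>_def by auto
    then have "g m n = (\<lambda>t. 0)" unfolding g_def using R by auto
    moreover have "of_int m * osc_int a (\<theta> m n) (\<phi> m n) t = 0" for t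
    proof (cases "m = 0")
      case False
      then have "P m n = 0" unfolding P_def using True by auto
      then have "\<phi> m n r = 0" for r using \<phi>b[of m n r] by simp
      then show ?thesis unfolding osc_int_def by simp
    qed simp
    ultimately have "q m n = (\<lambda>t. 0)" unfolding q_def by auto
    then show ?thesis using hold_mono[OF hold_0 M0 mu_nonneg] by simp
  next
    case False
    then have m: "m \<noteq> 0" and n: "n \<noteq> 0" and mn: "m \<noteq> n" by auto
    define \<sigma> where "\<sigma> = \<bar>\<theta> m n\<bar>"
    have \<theta>0: "\<theta> m n \<noteq> 0" using Om_nonzero[OF m n mn] unfolding \<theta>_def by simp
    then have \<sigma>: "0 < \<sigma>" unfolding \<sigma>_def by simp
    define un where "un = \<bar>real_of_int n\<bar> powr (-(J-1))"
    define up where "up = \<bar>real_of_int (m - n)\<bar> powr (-(J-1))"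
    have u0: "0 \<le> un" "0 \<le> up" unfolding un_def up_def by auto
    define S where "S = \<sigma> powr (-bet) + (un * \<sigma> powr (-(1/2)) + up * \<sigma> powr (-(1/2)))"
    have S0: "\<sigma> powr (-bet) \<le> S" unfolding S_def using u0 by simp
    have mPS: "\<bar>of_int m\<bar> * (P m n * S) \<le> wt m * (3 * CFF * \<bar>of_int m\<bar> powr (-1) * x m n)"
    proof -
      define X where "X = \<bar>real_of_int m\<bar> powr (1 + s) * wt n * wt (m - n)"
      have "\<sigma> = \<bar>Om m n\<bar>" unfolding \<sigma>_def \<theta>_def by simp
      then have "X * \<sigma> powr (-bet) \<le> CFF * (1 / \<bar>of_int m\<bar>)"
        "X * (un * \<sigma> powr (-(1/2))) \<le> CFF * (1 / \<bar>of_int m\<bar>)"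
        "X * (up * \<sigma> powr (-(1/2))) \<le> CFF * (1 / \<bar>of_int m\<bar>)"
        using kernel_FF[OF m n mn] unfolding X_def un_def up_def wt_def by simp_all
      then have "X * S \<le> 3 * CFF * \<bar>of_int m\<bar> powr (-1)"
        unfolding S_def using m by (simp add: distrib_left powr_minus_divide)
      then have "wt m * x m n * (X * S) \<le> wt m * x m n * (3 * CFF * \<bar>of_int m\<bar> powr (-1))"
        using wt_nonneg x0 by (intro mult_left_mono) auto
      moreover have alg: "M * (wn * a * (wp * e) * S) = w * (a * e) * (Y * wn * wp * S)" if "w * Y = M" for M w Y a e wn wp :: real
        unfolding that[symmetric] by (simp only: mult_ac)
      have "\<bar>of_int m\<bar> * (P m n * S) = wt m * x m n * (X * S)"
        unfolding P_def x_def X_def by (rule alg[OF wt_cancel1[OF m]])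
      ultimately show ?thesis by (simp only: mult_ac)
    qed
    have fin: "hold \<eta> (mu m) (wt m * (k m * x m n)) G" if "hold \<eta> (mu m) (\<bar>of_int m\<bar> * M) G" "M \<le> e0 * (P m n * S)" for M G
    proof (rule hold_mono[OF that(1) _ mu_nonneg])
      have "\<bar>of_int m\<bar> * M \<le> \<bar>of_int m\<bar> * (e0 * (P m n * S))" using that(2) by (intro mult_left_mono) auto
      also have "\<dots> = e0 * (\<bar>of_int m\<bar> * (P m n * S))" by simp
      also have "\<dots> \<le> e0 * (wt m * (3 * CFF * \<bar>of_int m\<bar> powr (-1) * x m n))" by (intro mult_left_mono mPS e00)
      also have "\<dots> = wt m * (k m * x m n)" unfolding k_def by simp
      finally show "\<bar>of_int m\<bar> * M \<le> wt m * (k m * x m n)" .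
    qed
    show ?thesis
    proof (cases "R < \<sigma>")
      case False
      then have "q m n = (\<lambda>t. of_int m * osc_int a (\<theta> m n) (\<phi> m n) (cl a b t))" unfolding q_def g_def \<sigma>_def by auto
      moreover have "hold \<eta> (mu m) (\<bar>of_int m\<bar> * (P m n * T)) (\<lambda>t. of_int m * osc_int a (\<theta> m n) (\<phi> m n) (cl a b t))"
        unfolding T_def nm[symmetric] by (rule hold_cmult[OF osc_hold_triv[OF \<phi>c \<phi>b ab]]) (use \<eta> in auto)
      moreover have "P m n * T \<le> e0 * (P m n * S)"
      proof -
        have "\<sigma> powr bet \<le> R powr bet" using False \<sigma> bet_bounds by (intro powr_mono2) auto
        then have "\<sigma> powr bet * \<sigma> powr (-bet) \<le> R powr bet * \<sigma> powr (-bet)" by (intro mult_right_mono) auto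
        then have "1 \<le> R powr bet * \<sigma> powr (-bet)" using \<sigma> by (simp add: powr_add[symmetric])
        then have "T * 1 \<le> T * (R powr bet * \<sigma> powr (-bet))" using T0 by (intro mult_left_mono)
        also have "\<dots> = (T * R powr bet) * \<sigma> powr (-bet)" by simp
        also have "\<dots> \<le> e0 * S" using e00 T0 \<eta> S0 by (intro mult_mono) (auto simp: e0_eq)
        finally have "T \<le> e0 * S" by simp
        from mult_left_mono[OF this P0[of m n]] show ?thesis by (simp add: mult_ac)
      qed
      ultimately show ?thesis using fin by simp
    next
      case True
      then have \<sigma>1: "1 \<le> \<sigma>" using R by simp
      define E where "E = P m n / \<eta> * (mu n (1/\<sigma>) + mu (m - n) (1/\<sigma>))"
      have mu_eq: "mu n (1/\<sigma>) = \<sigma> powr (-bet) + un * \<sigma> powr (-(1/2))" "mu (m-n) (1/\<sigma>) = \<sigma> powr (-bet) + up * \<sigma> powr (-(1/2))"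
        unfolding mu_def un_def up_def inverse_le_1_powr[OF \<sigma>] by simp_all
      have E: "norm (\<phi> m n t - \<phi> m n u) \<le> E" if "\<bar>t - u\<bar> \<le> 1 / \<bar>\<theta> m n\<bar>" for t u
      proof -
        have tu: "\<bar>t - u\<bar> \<le> 1/\<sigma>" "1/\<sigma> \<le> 1" using that \<sigma>1 unfolding \<sigma>_def by auto
        then have "\<eta> * norm (\<phi> m n t - \<phi> m n u) \<le> P m n * (mu n \<bar>t - u\<bar> + mu (m-n) \<bar>t - u\<bar>)"
          using \<phi>h[of n m] unfolding hold_def by (meson order_trans)
        also have "\<dots> \<le> P m n * (mu n (1/\<sigma>) + mu (m - n) (1/\<sigma>))"
          using tu by (intro mult_left_mono P0 add_mono mu_mono) auto
        finally show ?thesis unfolding E_def using \<eta> by (simp add: field_simps)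
      qed
      have gq: "q m n = (\<lambda>t. of_int m * (osc_int a (\<theta> m n) (\<phi> m n) (cl a b t) - ph (\<theta> m n) (cl a b t) * prim (\<theta> m n) (\<phi> m n) (cl a b t)))"
        unfolding q_def g_def using True unfolding \<sigma>_def by (auto simp: algebra_simps)
      have "hold \<eta> (mu m) (\<bar>of_int m\<bar> * (P m n / \<bar>\<theta> m n\<bar> + 2 * E * T)) (q m n)"
        unfolding gq T_def nm[symmetric]
        by (rule hold_cmult[OF osc_hold_low(1)[OF \<phi>c \<phi>b ab \<theta>0 E]]) (use \<eta> in auto)
      moreover have "P m n / \<bar>\<theta> m n\<bar> + 2 * E * T \<le> e0 * (P m n * S)"
      proof -
        have 1: "1 / \<sigma> \<le> R powr (-ex) * \<sigma> powr (-bet)" by (rule inverse_powr_split[OF True R])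
        have 2: "R powr (-ex) * \<sigma> powr (-bet) \<le> R powr (-ex) * S" using S0 by (intro mult_left_mono) auto
        have 3: "mu n (1/\<sigma>) + mu (m - n) (1/\<sigma>) \<le> 2 * S"
          unfolding mu_eq S_def using u0 by (simp add: algebra_simps)
        have "T / \<eta> * (mu n (1/\<sigma>) + mu (m - n) (1/\<sigma>)) \<le> T / \<eta> * (2 * S)"
          using T0 \<eta> by (intro mult_left_mono 3) auto
        moreover have "(R powr (-ex) + 4 * T / \<eta>) * S = R powr (-ex) * S + 2 * (T / \<eta> * (2 * S))"
          by (simp add: distrib_right)
        ultimately have "1 / \<sigma> + 2 * (T / \<eta> * (mu n (1/\<sigma>) + mu (m - n) (1/\<sigma>))) \<le> (R powr (-ex) + 4 * T / \<eta>) * S"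
          using 1 2 by linarith
        also have "\<dots> \<le> e0 * S" unfolding e0_eq using T0 order_trans[OF powr_ge_zero S0] by (intro mult_right_mono) auto
        finally have "P m n * (1 / \<sigma> + 2 * (T / \<eta> * (mu n (1/\<sigma>) + mu (m - n) (1/\<sigma>)))) \<le> P m n * (e0 * S)"
          by (rule mult_left_mono[OF _ P0])
        moreover have "P m n * (1 / \<sigma> + 2 * (T / \<eta> * (mu n (1/\<sigma>) + mu (m - n) (1/\<sigma>)))) = P m n / \<bar>\<theta> m n\<bar> + 2 * E * T"
          unfolding E_def \<sigma>_def[symmetric] by (simp add: divide_inverse algebra_simps)
        ultimately show ?thesis by (simp add: mult_ac)
      qed
      ultimately show ?thesis by (rule fin)
    qed
  qed
  have dk: "l2 (\<lambda>n. d (m - n)) N2" for m using l2_reindex[OF d, of "\<lambda>n. m - n"] by (simp add: inj_on_def)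
  have sx: "x m summable_on UNIV" "infsum (x m) UNIV \<le> N1 * N2" for m
    unfolding x_def by (rule l2_cs[OF c dk])+
  have sM: "(\<lambda>n. wt m * (k m * x m n)) summable_on UNIV" for m
    by (intro summable_on_cmult_right sx)
  define F where "F m t = infsum (\<lambda>n. q m n t) UNIV" for m t
  have N0: "0 \<le> N1 * N2" using l2_nonneg(2)[OF c] l2_nonneg(2)[OF d] by simp
  have "frep \<eta> (3 * CFF * e0 * Zinv * (N1 * N2)) F"
    unfolding frep_def
  proof (intro exI conjI allI)
    have "infsum (\<lambda>n. wt m * (k m * x m n)) UNIV = wt m * (k m * infsum (x m) UNIV)" for m
      by (simp add: infsum_cmult_right')
    then show "hold \<eta> (mu m) (wt m * (k m * infsum (x m) UNIV)) (F m)" for m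
      using hold_infsum(1)[OF qh sM, of m] \<eta> unfolding F_def by simp
    have "l2 (\<lambda>m. (3 * CFF * e0 * (N1 * N2)) * \<bar>real_of_int m\<bar> powr (-1)) ((3 * CFF * e0 * (N1 * N2)) * Zinv)"
      using CFF0 e00 N0 by (intro l2_cmult Zinv) simp
    then show "l2 (\<lambda>m. k m * infsum (x m) UNIV) (3 * CFF * e0 * Zinv * (N1 * N2))"
    proof (rule l2_mono)
      show "0 \<le> k m * infsum (x m) UNIV" for m using k0 x0 by (simp add: infsum_nonneg)
      show "k m * infsum (x m) UNIV \<le> (3 * CFF * e0 * (N1 * N2)) * \<bar>real_of_int m\<bar> powr (-1)" for m
        using mult_left_mono[OF sx(2)[of m] k0[of m]] unfolding k_def by (simp add: mult_ac)
    qed (simp add: mult_ac)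
  qed
  moreover have lcg: "l2 cg (4 * \<delta> * (N1 * N2))"
  proof -
    have "l2 (\<lambda>p. x (fst p) (snd p)) (N1 * N2)"
      using l2_reindex[OF l2_prod[OF c d], of "\<lambda>p. (snd p, fst p - snd p)"] unfolding x_def by (auto simp: inj_on_def prod_eq_iff)
    then show ?thesis unfolding cg_def using \<delta> by (intro l2_cmult) auto
  qed
  then have "grep \<eta> \<delta> (4 * \<delta> * (N1 * N2)) g" unfolding grep_def using gh by blast
  moreover have "((\<lambda>n. Bint a (Vf f1) (Vf f2) t m n) has_sum (F m t + Vg g t m)) UNIV" if t: "t \<in> {a..b}" for t m
  proof -
    have "((\<lambda>n. q m n t) has_sum F m t) UNIV"
      unfolding F_def by (intro has_sum_infsum summable_of_bound(1)[OF hold_norm[OF qh] sM])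
    moreover have "((\<lambda>n. g m n t * ph (- Om m n) t) has_sum Vg g t m) UNIV"
      unfolding Vg_def
      by (intro has_sum_infsum summable_of_bound(1)[OF _ grep_row(1)[OF lcg \<delta>]])
        (use hold_norm[OF gh] in \<open>auto simp: norm_mult\<close>)
    ultimately have "((\<lambda>n. q m n t + g m n t * ph (- Om m n) t) has_sum (F m t + Vg g t m)) UNIV" by (rule has_sum_add)
    moreover have "q m n t + g m n t * ph (- Om m n) t = Bint a (Vf f1) (Vf f2) t m n" for n
      unfolding q_def cl_id[OF t] Bint_def Vf_def \<phi>_def \<theta>_def by simp
    ultimately show ?thesis by simp
  qed
  ultimately show ?thesis unfolding e0_def by blast
qed

definition REP :: "real \<Rightarrow> real \<Rightarrow> real \<Rightarrow> real \<Rightarrow> real \<Rightarrow> (real \<Rightarrow> int \<Rightarrow> complex) \<Rightarrow> bool" where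
  "REP \<eta> \<delta> N a b v \<longleftrightarrow> (\<exists>f g. frep \<eta> N f \<and> grep \<eta> \<delta> N g \<and> (\<forall>t\<in>{a..b}. \<forall>m. v t m = Vf f t m + Vg g t m))"

lemma frep_add: "frep \<eta> N f \<Longrightarrow> frep \<eta> M g \<Longrightarrow> 0 \<le> \<eta> \<Longrightarrow> frep \<eta> (N + M) (\<lambda>m t. f m t + g m t)"
proof -
  assume "frep \<eta> N f" "frep \<eta> M g" and \<eta>: "0 \<le> \<eta>"
  then obtain c d where c: "l2 c N" "\<And>m. hold \<eta> (mu m) (wt m * c m) (f m)"
    and d: "l2 d M" "\<And>m. hold \<eta> (mu m) (wt m * d m) (g m)" unfolding frep_def by blast
  have "hold \<eta> (mu m) (wt m * (c m + d m)) (\<lambda>t. f m t + g m t)" for m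
    using hold_add[OF c(2) d(2) \<eta>] by (simp add: distrib_left)
  then show ?thesis unfolding frep_def using l2_add[OF c(1) d(1)] by (intro exI[of _ "\<lambda>m. c m + d m"]) auto
qed

lemma frep_mono: "frep \<eta> N f \<Longrightarrow> N \<le> M \<Longrightarrow> frep \<eta> M f"
  unfolding frep_def using l2_mono l2_nonneg(1) by (metis order_refl)

lemma grep_mono: "grep \<eta> \<delta> N f \<Longrightarrow> N \<le> M \<Longrightarrow> grep \<eta> \<delta> M f"
  unfolding grep_def using l2_mono l2_nonneg(1) by (metis order_refl)

lemma frep_continuous: "frep \<eta> N f \<Longrightarrow> 0 < \<eta> \<Longrightarrow> continuous_on S (\<lambda>t. Vf f t m)"
  unfolding frep_def Vf_def using hold_mu_continuous by blast

lemma grep_summable: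
  assumes "grep \<eta> \<delta> N g" "0 < \<eta>" "0 < \<delta>"
  shows "((\<lambda>n. g m n t * ph (- Om m n) t) has_sum Vg g t m) UNIV"
    and "continuous_on S (\<lambda>t. Vg g t m)"
proof -
  obtain c where c: "l2 c N" and gh: "\<And>n l. hold \<eta> mug (A n l * c (n, l) / \<delta>) (g n l)"
    using assms unfolding grep_def by blast
  have b: "norm (g m n t * ph (- Om m n) t) \<le> A m n * c (m, n) / \<delta>" for n t
    using hold_norm[OF gh, of m n t] by (simp add: norm_mult)
  show "((\<lambda>n. g m n t * ph (- Om m n) t) has_sum Vg g t m) UNIV"
    unfolding Vg_def by (intro has_sum_infsum summable_of_bound(1)[OF b grep_row(1)[OF c assms(3)]])
  show "continuous_on S (\<lambda>t. Vg g t m)" unfolding Vg_def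
    by (rule continuous_on_infsum[OF b grep_row(1)[OF c assms(3)]])
      (intro continuous_intros hold_mug_continuous[OF gh assms(2)])
qed

lemma osc_int_cong: "(\<And>r. r \<in> {a..t} \<Longrightarrow> \<phi> r = \<psi> r) \<Longrightarrow> osc_int a \<theta> \<phi> t = osc_int a \<theta> \<psi> t"
  unfolding osc_int_def by (intro integral_cong) auto

lemma osc_int_add:
  assumes "continuous_on UNIV \<phi>" "continuous_on UNIV \<psi>"
  shows "osc_int a \<theta> (\<lambda>r. \<phi> r + \<psi> r) t = osc_int a \<theta> \<phi> t + osc_int a \<theta> \<psi> t"
  unfolding osc_int_def distrib_left
  by (intro Henstock_Kurzweil_Integration.integral_add integrable_continuous_real continuous_intros
      continuous_on_subset[OF assms(1)] continuous_on_subset[OF assms(2)]) auto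

definition CKF :: real where "CKF = (SOME C. C > 0 \<and> (\<forall>m. l2 (kGF m) C))"
definition CKG :: real where "CKG = (SOME C. C > 0 \<and> (\<forall>m. l2 (kGG m) C))"

lemma CKF: "CKF > 0" "l2 (kGF m) CKF"
  using someI_ex[OF kGF_l2[unfolded Bex_def]] unfolding CKF_def by auto
lemma CKG: "CKG > 0" "l2 (kGG m) CKG"
  using someI_ex[OF kGG_l2[unfolded Bex_def]] unfolding CKG_def by auto

definition Ebil :: "real \<Rightarrow> real \<Rightarrow> real \<Rightarrow> real \<Rightarrow> real" where
  "Ebil \<eta> \<delta> R \<tau> = 3 * CFF * eps0 \<eta> R \<tau> * Zinv + 2 * (eps1 \<eta> R \<tau> / \<delta> * CKF + \<tau> powr ex / \<delta> * inverse c0 * 2)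
     + \<tau> powr ex / \<delta>\<^sup>2 * CKG + 4 * \<delta>"

text \<open>The phase is symmetric in \<open>n\<close> and \<open>m - n\<close>, so a mixed product
  needs to be estimated in one order only.\<close>

lemma Bint_swap: "Bint a v w t m n = Bint a w v t m (m - n)"
proof -
  have "Om m (m - n) = Om m n" unfolding Om_def by simp
  then show ?thesis unfolding Bint_def by (simp add: mult.commute)
qed

lemma has_sum_Bint_swap:
  "((\<lambda>n. Bint a v w t m n) has_sum S) UNIV \<longleftrightarrow> ((\<lambda>n. Bint a w v t m n) has_sum S) UNIV"
proof -
  have "bij (\<lambda>n. m - n)" by (rule bij_betw_byWitness[where f'="\<lambda>n. m - n"]) auto
  from has_sum_reindex_bij_betw[OF this, of "Bint a w v t m" S]
  show ?thesis unfolding Bint_swap[of a v w] by simp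
qed

lemma bilinear:
  assumes v: "REP \<eta> \<delta> N1 a b v" and w: "REP \<eta> \<delta> N2 a b w"
    and ab: "a \<le> b" "b - a \<le> 1" and \<eta>: "0 < \<eta>" "\<eta> \<le> 1" and R: "1 \<le> R" and \<delta>: "0 < \<delta>"
  shows "\<exists>z. REP \<eta> \<delta> (Ebil \<eta> \<delta> R (b - a) * (N1 * N2)) a b z \<and>
     (\<forall>t\<in>{a..b}. \<forall>m. ((\<lambda>n. Bint a v w t m n) has_sum z t m) UNIV)"
proof -
  obtain f1 g1 where 1: "frep \<eta> N1 f1" "grep \<eta> \<delta> N1 g1" and v': "\<And>t m. t \<in> {a..b} \<Longrightarrow> v t m = Vf f1 t m + Vg g1 t m"
    using v unfolding REP_def by blast
  obtain f2 g2 where 2: "frep \<eta> N2 f2" "grep \<eta> \<delta> N2 g2" and w': "\<And>t m. t \<in> {a..b} \<Longrightarrow> w t m = Vf f2 t m + Vg g2 t m"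
    using w unfolding REP_def by blast
  define N where "N = N1 * N2"
  define T where "T = (b - a) powr ex"
  have N0: "0 \<le> N" using 1(1) 2(1) l2_nonneg(2) unfolding N_def frep_def by (metis mult_nonneg_nonneg)
  have T0: "0 \<le> T" unfolding T_def by simp
  obtain F1 G where F1: "frep \<eta> (3 * CFF * eps0 \<eta> R (b - a) * Zinv * N) F1" and G: "grep \<eta> \<delta> (4 * \<delta> * N) G"
    and s1: "\<And>t m. t \<in> {a..b} \<Longrightarrow> ((\<lambda>n. Bint a (Vf f1) (Vf f2) t m n) has_sum (F1 m t + Vg G t m)) UNIV"
    using bilinear_FF[OF 1(1) 2(1) ab \<eta> R \<delta>] unfolding N_def by blast
  define cGF where "cGF = eps1 \<eta> R (b - a) / \<delta> * CKF + T / \<delta> * inverse c0 * 2"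
  obtain F2 where F2: "frep \<eta> (cGF * N) F2"
    and s2: "\<And>t m. t \<in> {a..b} \<Longrightarrow> ((\<lambda>n. Bint a (Vg g1) (Vf f2) t m n) has_sum F2 m t) UNIV"
    using bilinear_GF[OF 1(2) 2(1) ab \<eta> R \<delta> CKF(2)] unfolding N_def cGF_def T_def by blast
  obtain F3 where F3: "frep \<eta> (cGF * N) F3"
    and s3: "\<And>t m. t \<in> {a..b} \<Longrightarrow> ((\<lambda>n. Bint a (Vg g2) (Vf f1) t m n) has_sum F3 m t) UNIV"
    using bilinear_GF[OF 2(2) 1(1) ab \<eta> R \<delta> CKF(2)] unfolding N_def cGF_def T_def mult.commute[of N2 N1] by blast
  obtain F4 where F4: "frep \<eta> (T / \<delta>\<^sup>2 * CKG * N) F4"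
    and s4: "\<And>t m. t \<in> {a..b} \<Longrightarrow> ((\<lambda>n. Bint a (Vg g1) (Vg g2) t m n) has_sum F4 m t) UNIV"
    using bilinear_GG[OF 1(2) 2(2) ab \<eta> \<delta> CKG(2)] unfolding N_def T_def by blast
  define F where "F m t = F1 m t + (F2 m t + F3 m t) + F4 m t" for m t
  have Fr: "frep \<eta> (3 * CFF * eps0 \<eta> R (b - a) * Zinv * N + (cGF * N + cGF * N) + T / \<delta>\<^sup>2 * CKG * N) F"
    unfolding F_def using \<eta> by (intro frep_add F1 F2 F3 F4) auto
  have l2n: "0 \<le> N'" if "frep \<eta> N' f" for N' f using that l2_nonneg(2) unfolding frep_def by blast
  have E: "Ebil \<eta> \<delta> R (b - a) * N = (3 * CFF * eps0 \<eta> R (b - a) * Zinv * N + (cGF * N + cGF * N) + T / \<delta>\<^sup>2 * CKG * N) + 4 * \<delta> * N"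
    unfolding Ebil_def cGF_def T_def by (simp add: algebra_simps)
  have "0 \<le> 4 * \<delta> * N" using \<delta> N0 by simp
  then have "REP \<eta> \<delta> (Ebil \<eta> \<delta> R (b - a) * N) a b (\<lambda>t m. Vf F t m + Vg G t m)"
    unfolding REP_def E using l2n[OF Fr] by (intro exI[of _ F] exI[of _ G] conjI frep_mono[OF Fr] grep_mono[OF G]) auto
  moreover have "((\<lambda>n. Bint a v w t m n) has_sum (Vf F t m + Vg G t m)) UNIV" if t: "t \<in> {a..b}" for t m
  proof -
    note cf1 = frep_continuous[OF 1(1) \<eta>(1)] and cf2 = frep_continuous[OF 2(1) \<eta>(1)]
      and cg1 = grep_summable(2)[OF 1(2) \<eta>(1) \<delta>] and cg2 = grep_summable(2)[OF 2(2) \<eta>(1) \<delta>]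
    have "Bint a v w t m n = Bint a (Vf f1) (Vf f2) t m n + (Bint a (Vg g1) (Vf f2) t m n + Bint a (Vf f1) (Vg g2) t m n) + Bint a (Vg g1) (Vg g2) t m n" for n
    proof -
      have "osc_int a (- Om m n) (\<lambda>r. v r n * w r (m - n)) t
        = osc_int a (- Om m n) (\<lambda>r. Vf f1 r n * Vf f2 r (m - n) + (Vg g1 r n * Vf f2 r (m - n) + Vf f1 r n * Vg g2 r (m - n)) + Vg g1 r n * Vg g2 r (m - n)) t"
        by (rule osc_int_cong) (use t v' w' in \<open>auto simp: algebra_simps\<close>)
      also have "\<dots> = osc_int a (- Om m n) (\<lambda>r. Vf f1 r n * Vf f2 r (m - n)) t + (osc_int a (- Om m n) (\<lambda>r. Vg g1 r n * Vf f2 r (m - n)) t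
          + osc_int a (- Om m n) (\<lambda>r. Vf f1 r n * Vg g2 r (m - n)) t) + osc_int a (- Om m n) (\<lambda>r. Vg g1 r n * Vg g2 r (m - n)) t"
        by (subst osc_int_add, intro continuous_intros cf1 cf2 cg1 cg2, intro continuous_intros cf1 cf2 cg1 cg2)+ simp
      finally show ?thesis unfolding Bint_def by (simp add: distrib_left)
    qed
    moreover have "((\<lambda>n. Bint a (Vf f1) (Vf f2) t m n + (Bint a (Vg g1) (Vf f2) t m n + Bint a (Vf f1) (Vg g2) t m n) + Bint a (Vg g1) (Vg g2) t m n)
       has_sum (F1 m t + Vg G t m) + (F2 m t + F3 m t) + F4 m t) UNIV"
      using s1[OF t] s2[OF t] s3[OF t] s4[OF t] by (intro has_sum_add) (simp_all add: has_sum_Bint_swap[of a "Vf f1" "Vg g2"])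
    ultimately show ?thesis unfolding F_def Vf_def by (simp add: algebra_simps)
  qed
  ultimately show ?thesis unfolding N_def by blast
qed

text \<open>The order of choice matters: \<open>\<delta>\<close> controls the new modulated part,
  \<open>\<eta>\<close> has to be small against \<open>\<delta>\<close>, \<open>R\<close> large
  against \<open>1 / \<delta>\<close>, and the time comes last because it multiplies positive powers
  of \<open>R\<close> and negative powers of \<open>\<eta>\<close> and
  \<open>\<delta>\<close>.\<close>

lemma Ebil_small:
  assumes "0 < \<epsilon>"
  shows "\<exists>\<eta> \<delta> R \<tau>0. 0 < \<eta> \<and> \<eta> \<le> 1 \<and> 0 < \<delta> \<and> \<delta> \<le> 1 \<and> 1 \<le> R \<and> 0 < \<tau>0 \<and> \<tau>0 \<le> 1 \<and>
    (\<forall>\<tau>. 0 < \<tau> \<longrightarrow> \<tau> \<le> \<tau>0 \<longrightarrow> Ebil \<eta> \<delta> R \<tau> \<le> \<epsilon>)"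
proof -
  define \<delta> where "\<delta> = min 1 (\<epsilon> / 16)"
  have \<delta>: "0 < \<delta>" "\<delta> \<le> 1" "4 * \<delta> \<le> \<epsilon> / 4" using assms unfolding \<delta>_def by auto
  define \<eta> where "\<eta> = min 1 (\<epsilon> * \<delta> / (16 * CKF))"
  have \<eta>: "0 < \<eta>" "\<eta> \<le> 1" using assms \<delta> CKF(1) unfolding \<eta>_def by auto
  have "\<eta> \<le> \<epsilon> * \<delta> / (16 * CKF)" unfolding \<eta>_def by simp
  then have \<eta>3: "4 * \<eta> / \<delta> * CKF \<le> \<epsilon> / 4" using \<delta> CKF(1) by (simp add: field_simps)
  define H where "H R = 3 * CFF * R powr (-ex) * Zinv + 2 * (CT * (2 * R powr (-(1/2))) / \<delta> * CKF)" for R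
  have "(H \<longlongrightarrow> 3 * CFF * 0 * Zinv + 2 * (CT * (2 * 0) / \<delta> * CKF)) at_top"
    unfolding H_def using ex_pos \<delta> by (intro tendsto_intros tendsto_neg_powr filterlim_ident) auto
  then have "eventually (\<lambda>R. H R < \<epsilon> / 8) at_top" using order_tendstoD(2)[of H 0 at_top "\<epsilon>/8"] assms by simp
  then have "eventually (\<lambda>R. H R < \<epsilon> / 8 \<and> 1 \<le> R) at_top" using eventually_ge_at_top[of 1] by (rule eventually_conj)
  then obtain R where R: "H R < \<epsilon> / 8" "1 \<le> R" unfolding eventually_at_top_linorder by blast
  define G where "G \<tau> = \<tau> powr ex * (3 * CFF * (R powr bet + 4 / \<eta>) * Zinv + 2 * (CT * (6 / \<eta> + R powr (1/2)) / \<delta> * CKF + 2 * inverse c0 / \<delta>) + CKG / \<delta>\<^sup>2)" for \<tau>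
  have "(G \<longlongrightarrow> 0 * (3 * CFF * (R powr bet + 4 / \<eta>) * Zinv + 2 * (CT * (6 / \<eta> + R powr (1/2)) / \<delta> * CKF + 2 * inverse c0 / \<delta>) + CKG / \<delta>\<^sup>2)) (at_right 0)"
    unfolding G_def using ex_pos by (intro tendsto_mult_right powr_tendsto_0_right)
  then have "eventually (\<lambda>\<tau>. G \<tau> < \<epsilon> / 8) (at_right 0)" using order_tendstoD(2)[of G 0 "at_right 0" "\<epsilon>/8"] assms by simp
  then obtain \<tau>1 where \<tau>1: "\<tau>1 > 0" "\<And>\<tau>. 0 < \<tau> \<Longrightarrow> \<tau> < \<tau>1 \<Longrightarrow> G \<tau> < \<epsilon> / 8" unfolding eventually_at_right_field by auto
  have E: "Ebil \<eta> \<delta> R \<tau> = H R + G \<tau> + 4 * \<eta> / \<delta> * CKF + 4 * \<delta>" for \<tau>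
    unfolding Ebil_def H_def G_def eps0_def eps1_def by (simp add: algebra_simps add_divide_distrib)
  have "Ebil \<eta> \<delta> R \<tau> \<le> \<epsilon>" if "0 < \<tau>" "\<tau> \<le> min 1 (\<tau>1 / 2)" for \<tau>
  proof -
    have "G \<tau> < \<epsilon> / 8" using that \<tau>1 by (intro \<tau>1(2)) auto
    then show ?thesis unfolding E using R(1) \<eta>3 \<delta>(3) assms by linarith
  qed
  moreover have "0 < min 1 (\<tau>1/2)" using \<tau>1 by simp
  ultimately show ?thesis using \<eta> \<delta> R(2)
    by (intro exI[of _ \<eta>] exI[of _ \<delta>] exI[of _ R] exI[of _ "min 1 (\<tau>1/2)"]) auto
qed

end

section \<open>Solutions in Fourier space\<close>

context hkdv
begin

lemma frep_nonneg: "frep \<eta> N f \<Longrightarrow> 0 \<le> N"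
  unfolding frep_def using l2_nonneg(2) by blast

lemma REP_nonneg: "REP \<eta> \<delta> N a b v \<Longrightarrow> 0 \<le> N"
  unfolding REP_def using frep_nonneg by blast

lemma REP_mono: "REP \<eta> \<delta> N a b v \<Longrightarrow> N \<le> M \<Longrightarrow> REP \<eta> \<delta> M a b v"
  unfolding REP_def using frep_mono grep_mono by blast

lemma REP_sub: "REP \<eta> \<delta> N a b v \<Longrightarrow> a \<le> a' \<Longrightarrow> b' \<le> b \<Longrightarrow> REP \<eta> \<delta> N a' b' v"
  unfolding REP_def by (meson atLeastAtMost_iff order_trans)

lemma REP_cong: "REP \<eta> \<delta> N a b v \<Longrightarrow> (\<And>t m. t \<in> {a..b} \<Longrightarrow> w t m = v t m) \<Longrightarrow> REP \<eta> \<delta> N a b w"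
  unfolding REP_def by metis

lemma REP_add:
  assumes "REP \<eta> \<delta> N a b v" "REP \<eta> \<delta> M a b w" "0 < \<eta>" "0 < \<delta>"
  shows "REP \<eta> \<delta> (N + M) a b (\<lambda>t m. v t m + w t m)"
proof -
  obtain f g where 1: "frep \<eta> N f" "grep \<eta> \<delta> N g" "\<And>t m. t \<in> {a..b} \<Longrightarrow> v t m = Vf f t m + Vg g t m"
    using assms unfolding REP_def by blast
  obtain f' g' where 2: "frep \<eta> M f'" "grep \<eta> \<delta> M g'" "\<And>t m. t \<in> {a..b} \<Longrightarrow> w t m = Vf f' t m + Vg g' t m"
    using assms unfolding REP_def by blast
  obtain c where c: "l2 c N" "\<And>m n. hold \<eta> mug (A m n * c (m, n) / \<delta>) (g m n)" using 1(2) unfolding grep_def by blast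
  obtain d where d: "l2 d M" "\<And>m n. hold \<eta> mug (A m n * d (m, n) / \<delta>) (g' m n)" using 2(2) unfolding grep_def by blast
  have "hold \<eta> mug (A m n * (c (m, n) + d (m, n)) / \<delta>) (\<lambda>t. g m n t + g' m n t)" for m n
    using hold_add[OF c(2)[of m n] d(2)[of m n]] assms(3) by (simp add: distrib_left add_divide_distrib)
  then have G: "grep \<eta> \<delta> (N + M) (\<lambda>m n t. g m n t + g' m n t)"
    unfolding grep_def using l2_add[OF c(1) d(1)] by (intro exI[of _ "\<lambda>p. c p + d p"]) auto
  have V: "Vg (\<lambda>m n t. g m n t + g' m n t) t m = Vg g t m + Vg g' t m" for t m
    using has_sum_add[OF grep_summable(1)[OF 1(2) assms(3,4), of m t] grep_summable(1)[OF 2(2) assms(3,4), of m t]]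
    unfolding Vg_def[of "\<lambda>m n t. g m n t + g' m n t"] by (intro infsumI) (simp add: distrib_right)
  show ?thesis unfolding REP_def
    using frep_add[OF 1(1) 2(1)] assms(3) G 1(3) 2(3)
    by (intro exI[of _ "\<lambda>m t. f m t + f' m t"] exI[of _ "\<lambda>m n t. g m n t + g' m n t"]) (auto simp: V Vf_def)
qed

lemma REP_cmult:
  assumes "REP \<eta> \<delta> N a b v"
  shows "REP \<eta> \<delta> (norm k * N) a b (\<lambda>t m. k * v t m)"
proof -
  obtain f g where 1: "frep \<eta> N f" "grep \<eta> \<delta> N g" "\<And>t m. t \<in> {a..b} \<Longrightarrow> v t m = Vf f t m + Vg g t m"
    using assms unfolding REP_def by blast
  obtain c where c: "l2 c N" "\<And>m n. hold \<eta> mug (A m n * c (m, n) / \<delta>) (g m n)" using 1(2) unfolding grep_def by blast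
  obtain d where d: "l2 d N" "\<And>m. hold \<eta> (mu m) (wt m * d m) (f m)" using 1(1) unfolding frep_def by blast
  have "hold \<eta> mug (A m n * (norm k * c (m, n)) / \<delta>) (\<lambda>t. k * g m n t)" for m n
    using hold_cmult[OF c(2)[of m n], of k] by (simp add: mult_ac)
  then have G: "grep \<eta> \<delta> (norm k * N) (\<lambda>m n t. k * g m n t)"
    unfolding grep_def using l2_cmult[OF c(1), of "norm k"] by (intro exI[of _ "\<lambda>p. norm k * c p"]) auto
  have "hold \<eta> (mu m) (wt m * (norm k * d m)) (\<lambda>t. k * f m t)" for m
    using hold_cmult[OF d(2)[of m], of k] by (simp add: mult_ac)
  then have F: "frep \<eta> (norm k * N) (\<lambda>m t. k * f m t)"
    unfolding frep_def using l2_cmult[OF d(1), of "norm k"] by (intro exI[of _ "\<lambda>p. norm k * d p"]) auto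
  have V: "Vg (\<lambda>m n t. k * g m n t) t m = k * Vg g t m" for t m
    unfolding Vg_def by (simp add: mult.assoc infsum_cmult_right')
  show ?thesis unfolding REP_def using F G 1(3)
    by (intro exI[of _ "\<lambda>m t. k * f m t"] exI[of _ "\<lambda>m n t. k * g m n t"]) (auto simp: V Vf_def distrib_left)
qed

lemma REP_diff:
  assumes "REP \<eta> \<delta> N a b v" "REP \<eta> \<delta> M a b w" "0 < \<eta>" "0 < \<delta>"
  shows "REP \<eta> \<delta> (N + M) a b (\<lambda>t m. v t m - w t m)"
  using REP_add[OF assms(1) REP_cmult[OF assms(2), of "-1"] assms(3,4)] by simp

text \<open>Together with \<open>REP_strengthen\<close> this shows that the parameters change the
  norm only up to equivalence: the solution space is defined with
  \<open>\<eta> = \<delta> = 1\<close>, while the estimates run with small values.\<close>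

lemma REP_weaken:
  assumes "REP 1 1 N a b v" "\<eta> \<le> 1" "0 < \<delta>" "\<delta> \<le> 1"
  shows "REP \<eta> \<delta> N a b v"
proof -
  obtain f g where 1: "frep 1 N f" "grep 1 1 N g" "\<And>t m. t \<in> {a..b} \<Longrightarrow> v t m = Vf f t m + Vg g t m"
    using assms unfolding REP_def by blast
  have "frep \<eta> N f" using 1(1) assms(2) unfolding frep_def using hold_weaken by blast
  moreover have "grep \<eta> \<delta> N g"
  proof -
    obtain c where c: "l2 c N" "\<And>m n. hold 1 mug (A m n * c (m, n)) (g m n)" using 1(2) unfolding grep_def by auto
    have "A m n * c (m, n) \<le> A m n * c (m, n) / \<delta>" for m n
      using assms(3,4) A_nonneg[of m n] l2_nonneg(1)[OF c(1), of "(m, n)"] mult_left_mono[of \<delta> 1 "A m n * c (m, n)"]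
      by (simp add: field_simps)
    then have "hold \<eta> mug (A m n * c (m, n) / \<delta>) (g m n)" for m n
      by (rule hold_mono[OF hold_weaken[OF c(2) assms(2)] _ mug_nonneg])
    then show ?thesis unfolding grep_def using c(1) by blast
  qed
  ultimately show ?thesis unfolding REP_def using 1(3) by blast
qed

lemma REP_strengthen:
  assumes "REP \<eta> \<delta> N a b v" "0 < \<eta>" "\<eta> \<le> 1" "0 < \<delta>" "\<delta> \<le> 1"
  shows "REP 1 1 (N / (\<eta> * \<delta>)) a b v"
proof -
  obtain f g where 1: "frep \<eta> N f" "grep \<eta> \<delta> N g" "\<And>t m. t \<in> {a..b} \<Longrightarrow> v t m = Vf f t m + Vg g t m"
    using assms unfolding REP_def by blast
  obtain c where c: "l2 c N" "\<And>m n. hold \<eta> mug (A m n * c (m, n) / \<delta>) (g m n)" using 1(2) unfolding grep_def by blast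
  obtain d where d: "l2 d N" "\<And>m. hold \<eta> (mu m) (wt m * d m) (f m)" using 1(1) unfolding frep_def by blast
  have "hold 1 mug (A m n * (1 / (\<eta> * \<delta>) * c (m, n)) / 1) (g m n)" for m n
    using hold_strengthen[OF c(2)[of m n] assms(2,3) mug_nonneg] by (simp add: field_simps)
  then have "grep 1 1 (1 / (\<eta> * \<delta>) * N) g" unfolding grep_def
    using l2_cmult[OF c(1), of "1 / (\<eta> * \<delta>)"] assms by (intro exI[of _ "\<lambda>p. 1 / (\<eta> * \<delta>) * c p"]) auto
  moreover have "frep 1 (1 / \<eta> * N) f" unfolding frep_def
  proof (intro exI conjI allI)
    show "l2 (\<lambda>p. 1 / \<eta> * d p) (1 / \<eta> * N)" using assms by (intro l2_cmult d) auto
    show "hold 1 (mu m) (wt m * (1 / \<eta> * d m)) (f m)" for m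
      using hold_strengthen[OF d(2)[of m] assms(2,3) mu_nonneg] by simp
  qed
  moreover have "1 / \<eta> * N \<le> 1 / (\<eta> * \<delta>) * N"
    using assms l2_nonneg(2)[OF c(1)] by (intro mult_right_mono) (auto simp: field_simps)
  ultimately show ?thesis unfolding REP_def using 1(3) frep_mono by fastforce
qed

definition CS :: "real \<Rightarrow> real" where "CS \<delta> = 1 + CG * Zinv / \<delta>"

lemma CS_pos: "0 < \<delta> \<Longrightarrow> 0 < CS \<delta>"
  unfolding CS_def using CG_pos Zinv(1) by (simp add: add_pos_pos)

lemma REP_sup:
  assumes "REP \<eta> \<delta> N a b v" "0 < \<delta>"
  shows "\<exists>e. l2 e (CS \<delta> * N) \<and> (\<forall>t\<in>{a..b}. \<forall>m. norm (v t m) \<le> wt m * e m)"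
proof -
  obtain f g where 1: "frep \<eta> N f" "grep \<eta> \<delta> N g" "\<And>t m. t \<in> {a..b} \<Longrightarrow> v t m = Vf f t m + Vg g t m"
    using assms unfolding REP_def by blast
  obtain c where c: "l2 c N" "\<And>m n. hold \<eta> mug (A m n * c (m, n) / \<delta>) (g m n)" using 1(2) unfolding grep_def by blast
  obtain d where d: "l2 d N" "\<And>m. hold \<eta> (mu m) (wt m * d m) (f m)" using 1(1) unfolding frep_def by blast
  obtain d' where d': "l2 d' (CG * Zinv / \<delta> * N)" "\<And>m. infsum (\<lambda>n. A m n * c (m, n) / \<delta>) UNIV \<le> wt m * d' m"
    using grep_row(2)[OF c(1) assms(2)] by blast
  have "norm (Vg g t m) \<le> wt m * d' m" for t m
  proof (rule order_trans[OF _ d'(2)])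
    show "norm (Vg g t m) \<le> infsum (\<lambda>n. A m n * c (m, n) / \<delta>) UNIV" unfolding Vg_def
      by (rule summable_of_bound(2)[OF _ grep_row(1)[OF c(1) assms(2)]]) (use hold_norm[OF c(2)] in \<open>auto simp: norm_mult\<close>)
  qed
  moreover have "norm (Vf f t m) \<le> wt m * d m" for t m unfolding Vf_def by (rule hold_norm[OF d(2)])
  ultimately have "norm (v t m) \<le> wt m * (d m + d' m)" if "t \<in> {a..b}" for t m
    unfolding 1(3)[OF that] distrib_left by (meson add_mono norm_triangle_le)
  moreover have "l2 (\<lambda>m. d m + d' m) (CS \<delta> * N)"
    using l2_add[OF d(1) d'(1)] unfolding CS_def by (simp add: distrib_right)
  ultimately show ?thesis by blast
qed

lemma REP_continuous:
  assumes "REP \<eta> \<delta> N a b v" "0 < \<eta>" "0 < \<delta>"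
  shows "continuous_on {a..b} (\<lambda>t. v t m)"
proof -
  obtain f g where 1: "frep \<eta> N f" "grep \<eta> \<delta> N g" "\<And>t m. t \<in> {a..b} \<Longrightarrow> v t m = Vf f t m + Vg g t m"
    using assms unfolding REP_def by blast
  show ?thesis
    using continuous_on_add[OF frep_continuous[OF 1(1) assms(2), of "{a..b}" m] grep_summable(2)[OF 1(2) assms(2,3), of "{a..b}" m]]
    by (rule continuous_on_eq) (simp add: 1(3))
qed

lemma REP_const:
  assumes "l2 e N" "\<And>m. norm (v0 m) = wt m * e m"
  shows "REP \<eta> \<delta> N a b (\<lambda>t m. v0 m)"
proof -
  have N: "0 \<le> N" by (rule l2_nonneg(2)[OF assms(1)])
  have "frep \<eta> N (\<lambda>m t. v0 m)" unfolding frep_def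
    using assms(1) by (intro exI[of _ e]) (auto simp: assms(2)[symmetric] intro!: hold_const mu_nonneg)
  moreover have "grep \<eta> \<delta> N (\<lambda>m n t. 0)" unfolding grep_def
    by (intro exI[of _ "\<lambda>_. 0"]) (auto intro: l2_0 N)
  ultimately show ?thesis unfolding REP_def
    by (intro exI[of _ "\<lambda>m t. v0 m"] exI[of _ "\<lambda>m n t. 0"]) (auto simp: Vf_def Vg_def)
qed

text \<open>For time differences up to 1, Lipschitz continuity is stronger than order
  \<open>bet < 1\<close>, so the first term of \<open>mu\<close> suffices. Smooth functions enter
  the solution space through this criterion.\<close>

lemma REP_lipschitz:
  assumes e: "l2 e N" and ab: "a \<le> b"
    and b: "\<And>t m. t \<in> {a..b} \<Longrightarrow> norm (v t m) \<le> wt m * e m"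
    and l: "\<And>t u m. t \<in> {a..b} \<Longrightarrow> u \<in> {a..b} \<Longrightarrow> norm (v t m - v u m) \<le> wt m * e m * \<bar>t - u\<bar>"
  shows "REP 1 1 N a b v"
proof -
  have N: "0 \<le> N" by (rule l2_nonneg(2)[OF e])
  have "hold 1 (mu m) (wt m * e m) (\<lambda>t. v (cl a b t) m)" for m
    unfolding hold_def
  proof (intro conjI allI impI)
    show "norm (v (cl a b t) m) \<le> wt m * e m" for t by (intro b cl_in ab)
    fix t u :: real assume tu: "\<bar>t - u\<bar> \<le> 1"
    have we: "0 \<le> wt m * e m" using wt_nonneg l2_nonneg(1)[OF e] by simp
    have "\<bar>t - u\<bar> \<le> \<bar>t - u\<bar> powr bet"
      using powr_mono'[of bet 1 "\<bar>t - u\<bar>"] tu bet_bounds by (cases "t = u") auto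
    also have "\<dots> \<le> mu m \<bar>t - u\<bar>" unfolding mu_def by simp
    finally have h: "\<bar>t - u\<bar> \<le> mu m \<bar>t - u\<bar>" .
    have "norm (v (cl a b t) m - v (cl a b u) m) \<le> wt m * e m * \<bar>cl a b t - cl a b u\<bar>" by (intro l cl_in ab)
    also have "\<dots> \<le> wt m * e m * mu m \<bar>t - u\<bar>"
      using cl_diff[OF ab, of t u] h by (intro mult_left_mono we) linarith
    finally show "1 * norm (v (cl a b t) m - v (cl a b u) m) \<le> wt m * e m * mu m \<bar>t - u\<bar>" by simp
  qed
  then have "frep 1 N (\<lambda>m t. v (cl a b t) m)" unfolding frep_def using e by blast
  moreover have "grep 1 1 N (\<lambda>m n t. 0)" unfolding grep_def
    by (intro exI[of _ "\<lambda>_. 0"]) (auto intro: l2_0 N)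
  ultimately show ?thesis unfolding REP_def
    by (intro exI[of _ "\<lambda>m t. v (cl a b t) m"] exI[of _ "\<lambda>m n t. 0"]) (auto simp: Vf_def Vg_def cl_id)
qed

lemma has_sum_of_nat_summable:
  fixes c :: "nat \<Rightarrow> real"
  assumes "summable c" "\<And>i. 0 \<le> c i"
  shows "(c has_sum suminf c) UNIV"
  using sums_nonneg_imp_has_sum[OF summable_sums[OF assms(1)] assms(2)] .

text \<open>The splitting into two types is not unique, so representations of the partial sums need
  not converge. Summing chosen representations of the terms avoids this; it serves both the
  iteration and the completeness of the solution space.\<close>

lemma REP_series:
  assumes R: "\<And>i. REP \<eta> \<delta> (N i) a b (v i)" and N: "summable N" and \<eta>: "0 < \<eta>" and \<delta>: "0 < \<delta>"
  shows "\<exists>w. REP \<eta> \<delta> (suminf N) a b w \<and> (\<forall>t\<in>{a..b}. \<forall>m. (\<lambda>i. v i t m) sums w t m)"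
proof -
  have "\<forall>i. \<exists>f g c d. l2 c (N i) \<and> l2 d (N i) \<and> (\<forall>m n. hold \<eta> mug (A m n * c (m, n) / \<delta>) (g m n)) \<and>
     (\<forall>m. hold \<eta> (mu m) (wt m * d m) (f m)) \<and> (\<forall>t\<in>{a..b}. \<forall>m. v i t m = Vf f t m + Vg g t m)"
    using R unfolding REP_def frep_def grep_def by blast
  then obtain f g c d where c: "\<And>i. l2 (c i) (N i)" and d: "\<And>i. l2 (d i) (N i)"
    and g: "\<And>i m n. hold \<eta> mug (A m n * c i (m, n) / \<delta>) (g i m n)"
    and f: "\<And>i m. hold \<eta> (mu m) (wt m * d i m) (f i m)"
    and v: "\<And>i t m. t \<in> {a..b} \<Longrightarrow> v i t m = Vf (f i) t m + Vg (g i) t m"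
    by metis
  have \<eta>0: "0 \<le> \<eta>" using \<eta> by simp
  define F where "F m t = infsum (\<lambda>i. f i m t) UNIV" for m t
  define G where "G m n t = infsum (\<lambda>i. g i m n t) UNIV" for m n t
  note Sc = l2_series[OF c N] and Sd = l2_series[OF d N]
  have hd: "((\<lambda>i. wt m * d i m) has_sum wt m * (\<Sum>i. d i m)) UNIV" for m
    by (intro has_sum_cmult_right has_sum_of_nat_summable Sd(1) l2_nonneg(1)[OF d])
  have hc: "((\<lambda>i. A m n * c i (m, n) / \<delta>) has_sum A m n * (\<Sum>i. c i (m, n)) / \<delta>) UNIV" for m n
    unfolding divide_inverse
    by (intro has_sum_cmult_left has_sum_cmult_right has_sum_of_nat_summable Sc(1) l2_nonneg(1)[OF c])
  have Fr: "frep \<eta> (suminf N) F" unfolding frep_def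
  proof (intro exI conjI allI)
    show "l2 (\<lambda>m. \<Sum>i. d i m) (suminf N)" by (rule Sd(2))
    show "hold \<eta> (mu m) (wt m * (\<Sum>i. d i m)) (F m)" for m
      using hold_infsum(1)[OF f has_sum_imp_summable[OF hd] \<eta>0, of m] unfolding F_def infsumI[OF hd] .
  qed
  have Gr: "grep \<eta> \<delta> (suminf N) G" unfolding grep_def
  proof (intro exI conjI allI)
    show "l2 (\<lambda>p. \<Sum>i. c i p) (suminf N)" by (rule Sc(2))
    show "hold \<eta> mug (A m n * (\<Sum>i. c i (m, n)) / \<delta>) (G m n)" for m n
      using hold_infsum(1)[OF g has_sum_imp_summable[OF hc] \<eta>0, of m n] unfolding G_def infsumI[OF hc] .
  qed
  have V1: "((\<lambda>i. Vf (f i) t m) has_sum Vf F t m) UNIV" for t m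
    unfolding Vf_def F_def by (intro has_sum_infsum summable_of_bound(1)[OF hold_norm[OF f] has_sum_imp_summable[OF hd]])
  \<comment> \<open>The sum over the terms has to be interchanged with the sum over
    \<open>n\<close>; the row bound of \<open>grep_row\<close> makes the double series absolutely
    convergent.\<close>
  have V2: "((\<lambda>i. Vg (g i) t m) has_sum Vg G t m) UNIV" for t m
  proof -
    define Bd where "Bd i n = A m n * c i (m, n) / \<delta>" for i n
    have Bd0: "0 \<le> Bd i n" for i n unfolding Bd_def using A_nonneg \<delta> l2_nonneg(1)[OF c] by simp
    have b: "norm (g i m n t * ph (- Om m n) t) \<le> Bd i n" for i n
      unfolding Bd_def using hold_norm[OF g, of i m n t] by (simp add: norm_mult)
    have row: "infsum (Bd i) UNIV \<le> wt m * (CG * Zinv / \<delta>) * N i" for i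
    proof -
      obtain d' where d': "l2 d' (CG * Zinv / \<delta> * N i)" "infsum (Bd i) UNIV \<le> wt m * d' m"
        using grep_row(2)[OF c[of i] \<delta>] unfolding Bd_def by blast
      have "wt m * d' m \<le> wt m * (CG * Zinv / \<delta> * N i)" by (intro mult_left_mono l2_le[OF d'(1)] wt_nonneg)
      then show ?thesis using d'(2) by (simp add: mult.assoc)
    qed
    have rs: "Bd i summable_on UNIV" for i unfolding Bd_def by (rule grep_row(1)[OF c \<delta>])
    have sN: "(\<lambda>i. wt m * (CG * Zinv / \<delta>) * N i) summable_on UNIV"
      by (intro summable_on_cmult_right has_sum_imp_summable[OF has_sum_of_nat_summable[OF N]] l2_nonneg(2)[OF c])
    have "(\<lambda>i. infsum (Bd i) UNIV) summable_on UNIV"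
      by (rule summable_on_comparison_test[OF sN]) (use row Bd0 in \<open>auto intro: infsum_nonneg\<close>)
    then have "(\<lambda>p. Bd (fst p) (snd p)) summable_on Sigma UNIV (\<lambda>_. UNIV)"
      by (intro summable_on_SigmaI[where g="\<lambda>i. infsum (Bd i) UNIV"]) (use rs Bd0 in auto)
    then have s2: "(\<lambda>p. Bd (fst p) (snd p)) summable_on UNIV" by simp
    have "(\<lambda>p. g (fst p) m (snd p) t * ph (- Om m (snd p)) t) summable_on UNIV"
      by (rule summable_of_bound(1)[OF b s2])
    then have pr: "(\<lambda>(i, n). g i m n t * ph (- Om m n) t) summable_on UNIV \<times> UNIV" by (simp add: case_prod_unfold)
    have "infsum (\<lambda>i. Vg (g i) t m) UNIV = infsum (\<lambda>n. infsum (\<lambda>i. g i m n t * ph (- Om m n) t) UNIV) UNIV"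
      unfolding Vg_def by (rule infsum_swap_banach[OF pr])
    also have "\<dots> = Vg G t m" unfolding Vg_def G_def by (simp add: infsum_cmult_left')
    finally have e: "infsum (\<lambda>i. Vg (g i) t m) UNIV = Vg G t m" .
    have "norm (Vg (g i) t m) \<le> wt m * (CG * Zinv / \<delta>) * N i" for i
      by (rule order_trans[OF _ row]) (auto simp: Vg_def intro!: summable_of_bound(2)[OF b rs])
    then have "(\<lambda>i. Vg (g i) t m) summable_on UNIV" by (rule summable_of_bound(1)[OF _ sN])
    then show ?thesis unfolding e[symmetric] by (rule has_sum_infsum)
  qed
  have "(\<lambda>i. v i t m) sums (Vf F t m + Vg G t m)" if "t \<in> {a..b}" for t m
    using has_sum_imp_sums[OF has_sum_add[OF V1[of t m] V2[of t m]]] v[OF that] by simp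
  then show ?thesis using Fr Gr unfolding REP_def
    by (intro exI[of _ "\<lambda>t m. Vf F t m + Vg G t m"]) blast
qed

section \<open>Difference estimates and contraction\<close>

definition Bil :: "real \<Rightarrow> (real \<Rightarrow> int \<Rightarrow> complex) \<Rightarrow> (real \<Rightarrow> int \<Rightarrow> complex) \<Rightarrow> real \<Rightarrow> int \<Rightarrow> complex" where
  "Bil a v w t m = infsum (Bint a v w t m) UNIV"

text \<open>The difference of squares and the product of \<open>v - w\<close> and
  \<open>v + w\<close> differ by the cross terms of \<open>v\<close> with \<open>w\<close> in either
  order. These cancel only after summation over \<open>n\<close>, by the reflection that sends
  \<open>n\<close> to \<open>m - n\<close>.\<close>

lemma Bil_diff_squares:
  assumes v: "REP \<eta> \<delta> N1 a b v" and w: "REP \<eta> \<delta> N2 a b w"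
    and ab: "a \<le> b" "b - a \<le> 1" and \<eta>: "0 < \<eta>" "\<eta> \<le> 1" and \<delta>: "0 < \<delta>" and t: "t \<in> {a..b}"
  shows "((\<lambda>n. Bint a v v t m n - Bint a w w t m n) has_sum Bil a (\<lambda>t m. v t m - w t m) (\<lambda>t m. v t m + w t m) t m) UNIV"
proof -
  have H: "((\<lambda>n. Bint a x y t m n) has_sum Bil a x y t m) UNIV" if "REP \<eta> \<delta> M a b x" "REP \<eta> \<delta> M' a b y" for x y M M'
    using bilinear[OF that ab \<eta> order_refl \<delta>] t unfolding Bil_def by (metis has_sum_infsum has_sum_imp_summable)
  have cv: "continuous_on {a..t} (\<lambda>r. v r n)" "continuous_on {a..t} (\<lambda>r. w r n)" for n
    by (rule continuous_on_subset[OF REP_continuous[OF v \<eta>(1) \<delta>]], use t in auto)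
      (rule continuous_on_subset[OF REP_continuous[OF w \<eta>(1) \<delta>]], use t in auto)
  have e: "Bint a (\<lambda>t m. v t m - w t m) (\<lambda>t m. v t m + w t m) t m n
      = (Bint a v v t m n - Bint a w w t m n) + (Bint a v w t m n - Bint a w v t m n)" for n
  proof -
    have i: "(\<lambda>r. ph (- Om m n) r * (x r n * y r (m - n))) integrable_on {a..t}"
      if "x = v \<or> x = w" "y = v \<or> y = w" for x y
      using that by (intro integrable_continuous_real continuous_intros) (use cv in auto)
    have "integral {a..t} (\<lambda>r. ph (- Om m n) r * ((v r n - w r n) * (v r (m - n) + w r (m - n))))
       = integral {a..t} (\<lambda>r. (ph (- Om m n) r * (v r n * v r (m - n)) - ph (- Om m n) r * (w r n * w r (m - n)))
          + (ph (- Om m n) r * (v r n * w r (m - n)) - ph (- Om m n) r * (w r n * v r (m - n))))"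
      by (intro integral_cong) (simp add: algebra_simps)
    also have "\<dots> = (integral {a..t} (\<lambda>r. ph (- Om m n) r * (v r n * v r (m - n))) - integral {a..t} (\<lambda>r. ph (- Om m n) r * (w r n * w r (m - n))))
       + (integral {a..t} (\<lambda>r. ph (- Om m n) r * (v r n * w r (m - n))) - integral {a..t} (\<lambda>r. ph (- Om m n) r * (w r n * v r (m - n))))"
      using i[of v v] i[of w w] i[of v w] i[of w v]
      by (simp add: Henstock_Kurzweil_Integration.integral_add Henstock_Kurzweil_Integration.integral_diff integrable_diff)
    finally have F: "integral {a..t} (\<lambda>r. ph (- Om m n) r * ((v r n - w r n) * (v r (m - n) + w r (m - n)))) = \<dots>" .
    show ?thesis unfolding Bint_def osc_int_def F by (simp only: right_diff_distrib distrib_left)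
  qed
  have "Bil a v w t m = Bil a w v t m"
    using H[OF v w] H[OF w v] has_sum_Bint_swap has_sum_unique by blast
  then have "((\<lambda>n. Bint a v w t m n - Bint a w v t m n) has_sum 0) UNIV"
    using has_sum_minus[OF H[OF v w] H[OF w v]] by simp
  from has_sum_minus[OF H[OF REP_diff[OF v w \<eta>(1) \<delta>] REP_add[OF v w \<eta>(1) \<delta>]] this]
  show ?thesis unfolding e by simp
qed

lemma REP_Bil:
  assumes v: "REP \<eta> \<delta> N1 a b v" and w: "REP \<eta> \<delta> N2 a b w"
    and ab: "a \<le> b" "b - a \<le> 1" and \<eta>: "0 < \<eta>" "\<eta> \<le> 1" and R: "1 \<le> R" and \<delta>: "0 < \<delta>"
  shows "REP \<eta> \<delta> (Ebil \<eta> \<delta> R (b - a) * (N1 * N2)) a b (Bil a v w)"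
    and "t \<in> {a..b} \<Longrightarrow> ((\<lambda>n. Bint a v w t m n) has_sum Bil a v w t m) UNIV"
proof -
  obtain z where z: "REP \<eta> \<delta> (Ebil \<eta> \<delta> R (b - a) * (N1 * N2)) a b z"
    and s: "\<And>t m. t \<in> {a..b} \<Longrightarrow> ((\<lambda>n. Bint a v w t m n) has_sum z t m) UNIV"
    using bilinear[OF v w ab \<eta> R \<delta>] by blast
  have e: "Bil a v w t m = z t m" if "t \<in> {a..b}" for t m
    unfolding Bil_def by (rule infsumI[OF s[OF that]])
  show "REP \<eta> \<delta> (Ebil \<eta> \<delta> R (b - a) * (N1 * N2)) a b (Bil a v w)" by (rule REP_cong[OF z e])
  show "((\<lambda>n. Bint a v w t m n) has_sum Bil a v w t m) UNIV" if "t \<in> {a..b}" using s[OF that] e[OF that] by simp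
qed

lemma Bil_diff_eq:
  assumes v: "REP \<eta> \<delta> N1 a b v" and w: "REP \<eta> \<delta> N2 a b w"
    and ab: "a \<le> b" "b - a \<le> 1" and \<eta>: "0 < \<eta>" "\<eta> \<le> 1" and \<delta>: "0 < \<delta>" and t: "t \<in> {a..b}"
  shows "Bil a v v t m - Bil a w w t m = Bil a (\<lambda>t m. v t m - w t m) (\<lambda>t m. v t m + w t m) t m"
  by (rule has_sum_unique[OF has_sum_minus[OF REP_Bil(2)[OF v v ab \<eta> order_refl \<delta> t] REP_Bil(2)[OF w w ab \<eta> order_refl \<delta> t]]
      Bil_diff_squares[OF v w ab \<eta> \<delta> t]])

text \<open>As \<open>0 powr s = 0\<close>, the weighted sum does not see the coefficient at 0,
  whence the second clause.\<close>

definition HS :: "(int \<Rightarrow> complex) \<Rightarrow> real \<Rightarrow> bool" where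
  "HS v Q \<longleftrightarrow> l2 (\<lambda>m. \<bar>of_int m\<bar> powr s * norm (v m)) Q \<and> v 0 = 0"

lemma HS_bound:
  assumes "l2 e Q" "\<And>m. norm (v m) \<le> wt m * e m"
  shows "HS v Q"
  unfolding HS_def
proof
  show "v 0 = 0" using assms(2)[of 0] by simp
  show "l2 (\<lambda>m. \<bar>of_int m\<bar> powr s * norm (v m)) Q"
  proof (rule l2_mono[OF assms(1) _ _ order_refl])
    show "\<bar>of_int m\<bar> powr s * norm (v m) \<le> e m" for m
    proof (cases "m = 0")
      case False
      have "\<bar>of_int m\<bar> powr s * norm (v m) \<le> \<bar>of_int m\<bar> powr s * (wt m * e m)" by (intro mult_left_mono assms) auto
      also have "\<dots> = (wt m * \<bar>of_int m\<bar> powr s) * e m" by (simp only: mult_ac)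
      finally show ?thesis unfolding wt_cancel[OF False] by simp
    qed (use l2_nonneg(1)[OF assms(1)] in simp)
  qed auto
qed

lemma HS_eq: "HS v Q \<Longrightarrow> norm (v m) = wt m * (\<bar>of_int m\<bar> powr s * norm (v m))"
  unfolding HS_def by (cases "m = 0") (auto simp: wt_cancel mult.assoc[symmetric])

lemma HS_0D: "HS v 0 \<Longrightarrow> v m = 0"
  using l2_le[of "\<lambda>m. \<bar>of_int m\<bar> powr s * norm (v m)" 0 m] l2_nonneg(1)[of "\<lambda>m. \<bar>of_int m\<bar> powr s * norm (v m)" 0 m]
  unfolding HS_def by (cases "m = 0") (auto simp: mult_le_0_iff)

lemma HS_0: "HS (\<lambda>m. 0) 0" unfolding HS_def by (simp add: l2_0)

lemma HS_lim:
  assumes "\<And>i::nat. HS v (Q i)" "Q \<longlonglongrightarrow> L"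
  shows "HS v L"
  using assms unfolding HS_def l2_def by (auto intro: LIMSEQ_le_const)

lemma REP_HS:
  assumes "REP \<eta> \<delta> N a b v" "0 < \<delta>" "t \<in> {a..b}"
  shows "HS (v t) (CS \<delta> * N)"
  using REP_sup[OF assms(1,2)] assms(3) HS_bound by blast

lemma REP_init: "HS v0 N \<Longrightarrow> REP \<eta> \<delta> N a b (\<lambda>t m. v0 m)"
  using HS_eq unfolding HS_def by (intro REP_const[of "\<lambda>m. \<bar>of_int m\<bar> powr s * norm (v0 m)"]) (auto simp: HS_def)

text \<open>The constant in the equation for the coefficients: \<open>1/2 * \<i> k\<close> with \<open>k = m / lam\<close>, divided by the
  period \<open>2 * pi * lam\<close>, is \<open>kap * m\<close>.\<close>

definition kap :: complex where "kap = \<i> / of_real (4 * pi * lam\<^sup>2)"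

lemma norm_kap: "norm kap \<le> 1"
proof -
  have "1 * 1 \<le> 4 * pi * lam\<^sup>2" using pi_gt3 lam1 by (intro mult_mono) auto
  then have "1 \<le> norm (of_real (4 * pi * lam\<^sup>2) :: complex)" unfolding norm_of_real by simp
  then show ?thesis unfolding kap_def norm_divide norm_ii by (simp add: divide_le_eq_1 del: of_real_mult)
qed

lemma REP_kap: "REP \<eta> \<delta> N a b v \<Longrightarrow> REP \<eta> \<delta> N a b (\<lambda>t m. kap * v t m)"
  using REP_mono[OF REP_cmult[of \<eta> \<delta> N a b v kap], of N] mult_right_mono[OF norm_kap, of N] REP_nonneg by fastforce

text \<open>The difference of two solutions satisfies a linear equation with small coefficient, so its
  norm can be halved up to the norm of the data.\<close>

lemma contract:
  assumes d: "REP \<eta> \<delta> N a b d" and w: "REP \<eta> \<delta> S a b w"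
    and ab: "a \<le> b" "b - a \<le> 1" and \<eta>: "0 < \<eta>" "\<eta> \<le> 1" and R: "1 \<le> R" and \<delta>: "0 < \<delta>"
    and small: "Ebil \<eta> \<delta> R (b - a) * S \<le> 1/2" and d0: "HS d0 Q"
    and eq: "\<And>t m. t \<in> {a..b} \<Longrightarrow> d t m = d0 m - kap * Bil a d w t m"
    and t: "t \<in> {a..b}"
  shows "HS (d t) (CS \<delta> * (2 * Q))"
proof -
  have step: "REP \<eta> \<delta> (Q + M / 2) a b d" if M: "REP \<eta> \<delta> M a b d" for M
  proof -
    have "REP \<eta> \<delta> (Q + Ebil \<eta> \<delta> R (b - a) * (M * S)) a b (\<lambda>t m. d0 m - kap * Bil a d w t m)"
      by (intro REP_diff REP_init REP_kap REP_Bil(1) d0 M w ab \<eta> R \<delta>)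
    then have "REP \<eta> \<delta> (Q + Ebil \<eta> \<delta> R (b - a) * (M * S)) a b d" by (rule REP_cong) (rule eq)
    moreover have "Ebil \<eta> \<delta> R (b - a) * (M * S) \<le> M / 2"
      using mult_right_mono[OF small REP_nonneg[OF M]] by (simp add: mult_ac)
    ultimately show ?thesis by (rule REP_mono[OF _ add_left_mono])
  qed
  have Q: "0 \<le> Q" using d0 l2_nonneg(2) unfolding HS_def by blast
  have "REP \<eta> \<delta> (2 * Q + N * (1/2)^i) a b d" for i
  proof (induction i)
    case 0
    show ?case by (rule REP_mono[OF d]) (use Q in simp)
  next
    case (Suc i)
    from step[OF Suc] show ?case by (rule REP_mono) simp
  qed
  then have "HS (d t) (CS \<delta> * (2 * Q + N * (1/2)^i))" for i by (rule REP_HS[OF _ \<delta> t])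
  moreover have "(\<lambda>i. CS \<delta> * (2 * Q + N * (1/2)^i)) \<longlonglongrightarrow> CS \<delta> * (2 * Q + N * 0)"
    by (intro tendsto_intros LIMSEQ_power_zero) simp
  ultimately have "HS (d t) (CS \<delta> * (2 * Q + N * 0))" by (rule HS_lim)
  then show ?thesis by simp
qed

section \<open>Existence, continuous dependence and uniqueness for the coefficients\<close>

definition Tr :: "nat \<Rightarrow> int \<Rightarrow> int set" where
  "Tr N m = {n. \<bar>of_int n\<bar> \<le> lam * real N \<and> \<bar>of_int (m - n)\<bar> \<le> lam * real N}"

lemma finite_Tr: "finite (Tr N m)"
proof (rule finite_subset)
  show "Tr N m \<subseteq> {- \<lceil>lam * real N\<rceil>..\<lceil>lam * real N\<rceil>}" unfolding Tr_def by (auto simp: abs_le_iff) linarith+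
qed simp

text \<open>An unordered sum may be taken along any exhausting family of finite sets.
  \<open>Tr N m\<close> holds the pairs with both frequencies inside the truncation, as they occur
  in the square of a truncated function.\<close>

lemma Tr_lim:
  fixes f :: "int \<Rightarrow> complex"
  assumes "(f has_sum S) UNIV"
  shows "(\<lambda>N. sum f (Tr N m)) \<longlonglongrightarrow> S"
proof -
  have "filterlim (\<lambda>N. Tr N m) (finite_subsets_at_top UNIV) sequentially"
    unfolding filterlim_finite_subsets_at_top
  proof (intro allI impI)
    fix X :: "int set" assume X: "finite X \<and> X \<subseteq> UNIV"
    have "eventually (\<lambda>N. c \<le> lam * real N) sequentially" for c
    proof -
      have "filterlim (\<lambda>N. lam * real N) at_top sequentially"
        using lam1 by (intro filterlim_tendsto_pos_mult_at_top[OF tendsto_const] filterlim_real_sequentially) auto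
      then show ?thesis unfolding filterlim_at_top by blast
    qed
    then have "\<forall>x\<in>X. eventually (\<lambda>N. x \<in> Tr N m) sequentially" unfolding Tr_def by (auto intro: eventually_conj)
    then have "eventually (\<lambda>N. \<forall>x\<in>X. x \<in> Tr N m) sequentially" using X by (intro eventually_ball_finite) auto
    then show "\<forall>\<^sub>F N in sequentially. finite (Tr N m) \<and> X \<subseteq> Tr N m \<and> Tr N m \<subseteq> UNIV"
      by (auto simp: finite_Tr subset_iff elim: eventually_mono)
  qed
  from filterlim_compose[OF assms[unfolded has_sum_def] this] show ?thesis .
qed

text \<open>Kept as a limit of truncated sums in order to mirror \<open>duhamel_solution\<close>.
  For sums of both types on an interval of length at most 1, \<open>dsol_iff\<close> replaces the
  limit by \<open>Bil\<close>.\<close>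

definition dsol :: "real \<Rightarrow> (int \<Rightarrow> complex) \<Rightarrow> (real \<Rightarrow> int \<Rightarrow> complex) \<Rightarrow> bool" where
  "dsol T v0 v \<longleftrightarrow> (\<forall>t\<in>{0..T}. \<forall>m. (\<lambda>N. v0 m - kap * (\<Sum>n\<in>Tr N m. Bint 0 v v t m n)) \<longlonglongrightarrow> v t m)"

lemma dsol_iff:
  assumes v: "REP \<eta> \<delta> N 0 T v" and T: "0 \<le> T" "T \<le> 1" and \<eta>: "0 < \<eta>" "\<eta> \<le> 1" and \<delta>: "0 < \<delta>"
  shows "dsol T v0 v \<longleftrightarrow> (\<forall>t\<in>{0..T}. \<forall>m. v t m = v0 m - kap * Bil 0 v v t m)"
proof -
  have "(\<lambda>N. v0 m - kap * (\<Sum>n\<in>Tr N m. Bint 0 v v t m n)) \<longlonglongrightarrow> v0 m - kap * Bil 0 v v t m" if "t \<in> {0..T}" for t m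
    by (intro tendsto_intros Tr_lim REP_Bil(2)[OF v v T(1) _ \<eta> order_refl \<delta> that]) (use T in simp)
  then show ?thesis unfolding dsol_def by (metis LIMSEQ_unique)
qed

lemma picard:
  assumes \<tau>: "0 < \<tau>" "\<tau> \<le> 1" and \<eta>: "0 < \<eta>" "\<eta> \<le> 1" and R: "1 \<le> R" and \<delta>: "0 < \<delta>"
    and small: "Ebil \<eta> \<delta> R \<tau> * (8 * M) \<le> 1" and v0: "HS v0 M"
  shows "\<exists>v. REP \<eta> \<delta> (3 * M) 0 \<tau> v \<and> dsol \<tau> v0 v"
proof -
  have ab: "0 \<le> \<tau>" "\<tau> - 0 \<le> 1" using \<tau> by auto
  have M: "0 \<le> M" using v0 l2_nonneg(2) unfolding HS_def by blast
  define E where "E = Ebil \<eta> \<delta> R \<tau>"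
  \<comment> \<open>\<open>4 * M\<close> bounds the sum of two iterates, so the iteration halves
    differences. The case distinction covers either sign of \<open>E\<close>.\<close>
  have small': "E * (c * N) \<le> N / 2" if "c \<le> 4 * M" "0 \<le> c" "0 \<le> N" for c N
  proof (cases "E \<le> 0")
    case True
    then have "E * (c * N) \<le> 0" using that by (intro mult_nonpos_nonneg) auto
    then show ?thesis using that by simp
  next
    case False
    then have "E * c \<le> E * (4 * M)" using that by (intro mult_left_mono) auto
    then have "E * c \<le> 1/2" using small unfolding E_def by simp
    from mult_right_mono[OF this that(3)] show ?thesis by simp
  qed
  note B = REP_Bil(1)[OF _ _ ab \<eta> R \<delta>, unfolded diff_zero, folded E_def]
  define p where "p = rec_nat (\<lambda>(t::real) m. v0 m) (\<lambda>i q t m. v0 m - kap * Bil 0 q q t m)"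
  have p0: "p 0 = (\<lambda>t m. v0 m)" and pS: "p (Suc i) = (\<lambda>t m. v0 m - kap * Bil 0 (p i) (p i) t m)" for i
    unfolding p_def by simp_all
  \<comment> \<open>The ball of radius \<open>2 * M\<close> is invariant: the data contribute
    \<open>M\<close>, and \<open>small'\<close> with both arguments \<open>2 * M\<close> bounds the
    quadratic term by \<open>M\<close>.\<close>
  have p: "REP \<eta> \<delta> (2 * M) 0 \<tau> (p i)" for i
  proof (induction i)
    case 0
    show ?case unfolding p0 by (rule REP_mono[OF REP_init[OF v0]]) (use M in simp)
  next
    case (Suc i)
    have "REP \<eta> \<delta> (M + E * (2 * M * (2 * M))) 0 \<tau> (p (Suc i))"
      unfolding pS by (intro REP_diff REP_init REP_kap B v0 Suc \<eta> \<delta>)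
    then show ?case by (rule REP_mono) (use small'[of "2 * M" "2 * M"] M in simp)
  qed
  have diff: "REP \<eta> \<delta> (M * (1/2)^i) 0 \<tau> (\<lambda>t m. p (Suc i) t m - p i t m)" for i
  proof (induction i)
    case 0
    have "REP \<eta> \<delta> (norm (-1::complex) * (E * (M * M))) 0 \<tau> (\<lambda>t m. -1 * (kap * Bil 0 (p 0) (p 0) t m))"
      unfolding p0 by (intro REP_cmult REP_kap B REP_init v0)
    then have "REP \<eta> \<delta> (norm (-1::complex) * (E * (M * M))) 0 \<tau> (\<lambda>t m. p (Suc 0) t m - p 0 t m)"
      by (rule REP_cong) (simp add: pS p0)
    then show ?case by (rule REP_mono) (use small'[of M M] M in simp)
  next
    case (Suc i)
    have "REP \<eta> \<delta> (norm (-1::complex) * (E * (M * (1/2)^i * (2 * M + 2 * M)))) 0 \<tau>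
       (\<lambda>t m. -1 * (kap * Bil 0 (\<lambda>t m. p (Suc i) t m - p i t m) (\<lambda>t m. p (Suc i) t m + p i t m) t m))"
      by (intro REP_cmult REP_kap B REP_add p Suc \<eta> \<delta>)
    then have "REP \<eta> \<delta> (norm (-1::complex) * (E * (M * (1/2)^i * (2 * M + 2 * M)))) 0 \<tau> (\<lambda>t m. p (Suc (Suc i)) t m - p (Suc i) t m)"
    proof (rule REP_cong)
      fix t m assume t: "t \<in> {0..\<tau>}"
      show "p (Suc (Suc i)) t m - p (Suc i) t m = -1 * (kap * Bil 0 (\<lambda>t m. p (Suc i) t m - p i t m) (\<lambda>t m. p (Suc i) t m + p i t m) t m)"
        unfolding Bil_diff_eq[OF p[of "Suc i"] p[of i] ab \<eta> \<delta> t, symmetric] by (simp add: pS[of "Suc i"] pS[of i] algebra_simps)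
    qed
    then show ?case by (rule REP_mono) (use small'[of "2 * M + 2 * M" "M * (1/2)^i"] M in \<open>simp add: mult_ac\<close>)
  qed
  have tail: "\<exists>w. REP \<eta> \<delta> (2 * M * (1/2)^k) 0 \<tau> w \<and> (\<forall>t\<in>{0..\<tau>}. \<forall>m. (\<lambda>i. p (Suc (i + k)) t m - p (i + k) t m) sums w t m)" for k
  proof -
    have "(\<lambda>i. M * (1/2)^k * (1/2)^i) sums (M * (1/2)^k * (1 / (1 - 1/2)))" by (intro sums_mult geometric_sums) simp
    then have g: "(\<lambda>i. M * (1/2)^(i + k)) sums (2 * M * (1/2)^k)" by (simp add: power_add mult_ac)
    show ?thesis
      using REP_series[where v="\<lambda>i t m. p (Suc (i + k)) t m - p (i + k) t m", OF diff[of "_ + k"] sums_summable[OF g] \<eta>(1) \<delta>]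
      unfolding sums_unique[OF g, symmetric] .
  qed
  obtain w where w: "REP \<eta> \<delta> (2 * M) 0 \<tau> w" and ws: "\<And>t m. t \<in> {0..\<tau>} \<Longrightarrow> (\<lambda>i. p (Suc i) t m - p i t m) sums w t m"
    using tail[of 0] by auto
  define v where "v t m = v0 m + w t m" for t m
  \<comment> \<open>\<open>M\<close> for the data plus \<open>2 * M\<close>, the sum of the
    geometric series that bounds the increments.\<close>
  have v: "REP \<eta> \<delta> (3 * M) 0 \<tau> v" unfolding v_def
    by (rule REP_mono[OF REP_add[OF REP_init[OF v0] w \<eta>(1) \<delta>]]) simp
  have lim: "(\<lambda>i. p i t m) \<longlonglongrightarrow> v t m" if t: "t \<in> {0..\<tau>}" for t m
  proof -
    have "(\<lambda>k. \<Sum>i<k. p (Suc i) t m - p i t m) \<longlonglongrightarrow> w t m" using ws[OF t] unfolding sums_def .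
    then have "(\<lambda>k. p k t m - p 0 t m) \<longlonglongrightarrow> w t m" unfolding sum_lessThan_telescope[of "\<lambda>i. p i t m"] .
    from tendsto_add[OF tendsto_const[of "p 0 t m"] this] show ?thesis unfolding v_def p0 by simp
  qed
  have vp: "REP \<eta> \<delta> (2 * M * (1/2)^k) 0 \<tau> (\<lambda>t m. v t m - p k t m)" for k
  proof -
    obtain u where u: "REP \<eta> \<delta> (2 * M * (1/2)^k) 0 \<tau> u" and us: "\<And>t m. t \<in> {0..\<tau>} \<Longrightarrow> (\<lambda>i. p (Suc (i + k)) t m - p (i + k) t m) sums u t m"
      using tail[of k] by auto
    show ?thesis
    proof (rule REP_cong[OF u])
      fix t m assume t: "t \<in> {0..\<tau>}"
      have d: "(\<lambda>i. p (Suc (i + k)) t m - p (i + k) t m) sums (v t m - p (0 + k) t m)"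
        using telescope_sums[OF LIMSEQ_ignore_initial_segment[OF lim[OF t], of k]] by simp
      show "v t m - p k t m = u t m" using sums_unique2[OF d us[OF t]] by simp
    qed
  qed
  \<comment> \<open>The equation is stated coefficient by coefficient, so pointwise convergence
    suffices; it passes through the quadratic term by the difference of squares.\<close>
  have "v t m = v0 m - kap * Bil 0 v v t m" if t: "t \<in> {0..\<tau>}" for t m
  proof -
    have "(\<lambda>i. Bil 0 v v t m - Bil 0 (p i) (p i) t m) \<longlonglongrightarrow> 0"
    proof (rule Lim_null_comparison)
      have "norm (Bil 0 v v t m - Bil 0 (p i) (p i) t m) \<le> wt m * (CS \<delta> * (E * (2 * M * (1/2)^i * (3 * M + 2 * M))))" for i
      proof -
        obtain e where e: "l2 e (CS \<delta> * (E * (2 * M * (1/2)^i * (3 * M + 2 * M))))"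
          "norm (Bil 0 (\<lambda>t m. v t m - p i t m) (\<lambda>t m. v t m + p i t m) t m) \<le> wt m * e m"
          using REP_sup[OF B[OF vp[of i] REP_add[OF v p[of i] \<eta>(1) \<delta>]] \<delta>] t by blast
        have "wt m * e m \<le> wt m * (CS \<delta> * (E * (2 * M * (1/2)^i * (3 * M + 2 * M))))"
          by (intro mult_left_mono l2_le[OF e(1)] wt_nonneg)
        then show ?thesis using e(2) unfolding Bil_diff_eq[OF v p[of i] ab \<eta> \<delta> t] by linarith
      qed
      then show "\<forall>\<^sub>F i in sequentially. norm (Bil 0 v v t m - Bil 0 (p i) (p i) t m) \<le> wt m * (CS \<delta> * (E * (2 * M * (1/2)^i * (3 * M + 2 * M))))" by simp
      have "(\<lambda>i. wt m * (CS \<delta> * (E * (2 * M * (1/2)^i * (3 * M + 2 * M))))) \<longlonglongrightarrow> wt m * (CS \<delta> * (E * (2 * M * 0 * (3 * M + 2 * M))))"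
        by (intro tendsto_intros LIMSEQ_power_zero) simp
      then show "(\<lambda>i. wt m * (CS \<delta> * (E * (2 * M * (1/2)^i * (3 * M + 2 * M))))) \<longlonglongrightarrow> 0" by simp
    qed
    from tendsto_diff[OF tendsto_const[of "Bil 0 v v t m"] this]
    have "(\<lambda>i. Bil 0 (p i) (p i) t m) \<longlonglongrightarrow> Bil 0 v v t m" by simp
    then have "(\<lambda>i. p (Suc i) t m) \<longlonglongrightarrow> v0 m - kap * Bil 0 v v t m" unfolding pS by (intro tendsto_intros)
    then show ?thesis using LIMSEQ_Suc[OF lim[OF t]] LIMSEQ_unique by blast
  qed
  then have "dsol \<tau> v0 v" using dsol_iff[OF v _ _ \<eta> \<delta>] \<tau> by simp
  then show ?thesis using v by blast
qed

lemma solution_map: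
  assumes M: "M > 0"
  shows "\<exists>\<tau> C L \<Psi>. 0 < \<tau> \<and> 0 < L \<and> (\<forall>v0. HS v0 M \<longrightarrow> REP 1 1 C 0 \<tau> (\<Psi> v0) \<and> dsol \<tau> v0 (\<Psi> v0)) \<and>
     (\<forall>v0 w0 Q. HS v0 M \<longrightarrow> HS w0 M \<longrightarrow> HS (\<lambda>m. v0 m - w0 m) Q \<longrightarrow>
        (\<forall>t\<in>{0..\<tau>}. HS (\<lambda>m. \<Psi> v0 t m - \<Psi> w0 t m) (L * Q)))"
proof -
  obtain \<eta> \<delta> R \<tau> where \<eta>: "0 < \<eta>" "\<eta> \<le> 1" and \<delta>: "0 < \<delta>" "\<delta> \<le> 1" and R: "1 \<le> R" and \<tau>: "0 < \<tau>" "\<tau> \<le> 1"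
    and E: "Ebil \<eta> \<delta> R \<tau> \<le> 1 / (16 * M)"
    using Ebil_small[of "1 / (16 * M)"] M by auto
  \<comment> \<open>The same smallness serves twice: with \<open>8 * M\<close> for the iteration,
    and with \<open>3 * M + 3 * M\<close>, the bound for the sum of two solutions, for the
    contraction.\<close>
  have E': "Ebil \<eta> \<delta> R \<tau> * (8 * M) \<le> 1" "Ebil \<eta> \<delta> R (\<tau> - 0) * (3 * M + 3 * M) \<le> 1/2"
    using mult_right_mono[OF E, of "8 * M"] mult_right_mono[OF E, of "6 * M"] M by simp_all
  obtain \<Psi> where \<Psi>: "\<And>v0. HS v0 M \<Longrightarrow> REP \<eta> \<delta> (3 * M) 0 \<tau> (\<Psi> v0)" "\<And>v0. HS v0 M \<Longrightarrow> dsol \<tau> v0 (\<Psi> v0)"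
    using picard[OF \<tau> \<eta> R \<delta>(1) E'(1)] by metis
  have ab: "0 \<le> \<tau>" "\<tau> - 0 \<le> 1" using \<tau> by auto
  have "HS (\<lambda>m. \<Psi> v0 t m - \<Psi> w0 t m) (2 * CS \<delta> * Q)"
    if v0: "HS v0 M" and w0: "HS w0 M" and d: "HS (\<lambda>m. v0 m - w0 m) Q" and t: "t \<in> {0..\<tau>}" for v0 w0 Q t
  proof -
    note Rv = \<Psi>(1)[OF v0] and Rw = \<Psi>(1)[OF w0]
    have eqs: "\<Psi> v0 t m = v0 m - kap * Bil 0 (\<Psi> v0) (\<Psi> v0) t m" "\<Psi> w0 t m = w0 m - kap * Bil 0 (\<Psi> w0) (\<Psi> w0) t m"
      if "t \<in> {0..\<tau>}" for t m
      using \<Psi>(2)[OF v0] \<Psi>(2)[OF w0] that unfolding dsol_iff[OF Rv ab(1) \<tau>(2) \<eta> \<delta>(1)] dsol_iff[OF Rw ab(1) \<tau>(2) \<eta> \<delta>(1)] by blast+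
    have "HS ((\<lambda>t m. \<Psi> v0 t m - \<Psi> w0 t m) t) (CS \<delta> * (2 * Q))"
    proof (rule contract[OF REP_diff[OF Rv Rw \<eta>(1) \<delta>(1)] REP_add[OF Rv Rw \<eta>(1) \<delta>(1)] ab \<eta> R \<delta>(1) E'(2) d _ t])
      fix t m assume t: "t \<in> {0..\<tau>}"
      show "\<Psi> v0 t m - \<Psi> w0 t m = v0 m - w0 m - kap * Bil 0 (\<lambda>t m. \<Psi> v0 t m - \<Psi> w0 t m) (\<lambda>t m. \<Psi> v0 t m + \<Psi> w0 t m) t m"
        unfolding Bil_diff_eq[OF Rv Rw ab \<eta> \<delta>(1) t, symmetric] using eqs[OF t, of m] by (simp add: algebra_simps)
    qed
    then show ?thesis by (simp add: mult_ac)
  qed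
  moreover have "REP 1 1 (3 * M / (\<eta> * \<delta>)) 0 \<tau> (\<Psi> v0)" if "HS v0 M" for v0
    by (rule REP_strengthen[OF \<Psi>(1)[OF that] \<eta> \<delta>])
  moreover have "0 < 2 * CS \<delta>" using CS_pos \<delta> by simp
  ultimately show ?thesis using \<Psi>(2) \<tau>(1)
    by (intro exI[of _ \<tau>] exI[of _ "3 * M / (\<eta> * \<delta>)"] exI[of _ "2 * CS \<delta>"] exI[of _ \<Psi>]) blast
qed

text \<open>The norms may be large and \<open>T\<close> long, but \<open>Ebil\<close> becomes small
  against any given \<open>N1 + N2\<close> on short steps. On each step the difference starts from
  zero data and is zero by \<open>contract\<close>.\<close>

lemma solution_unique:
  assumes v: "REP 1 1 N1 0 T v" and w: "REP 1 1 N2 0 T w"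
    and sv: "dsol T v0 v" and sw: "dsol T v0 w" and t: "t \<in> {0..T}"
  shows "v t m = w t m"
proof -
  define S where "S = N1 + N2"
  have S: "0 \<le> S" unfolding S_def using REP_nonneg[OF v] REP_nonneg[OF w] by simp
  obtain \<eta> \<delta> R \<tau> where \<eta>: "0 < \<eta>" "\<eta> \<le> 1" and \<delta>: "0 < \<delta>" "\<delta> \<le> 1" and R: "1 \<le> R" and \<tau>: "0 < \<tau>" "\<tau> \<le> 1"
    and E: "\<And>\<sigma>. 0 < \<sigma> \<Longrightarrow> \<sigma> \<le> \<tau> \<Longrightarrow> Ebil \<eta> \<delta> R \<sigma> \<le> 1 / (2 * (S + 1))"
    using Ebil_small[of "1 / (2 * (S + 1))"] S by auto
  have cont: "continuous_on A (\<lambda>r. v r n)" "continuous_on A (\<lambda>r. w r n)" if "A \<subseteq> {0..T}" for n A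
    using REP_continuous[OF v] REP_continuous[OF w] that by (auto intro: continuous_on_subset)
  have "\<forall>t\<in>{0..T}. t \<le> real k * \<tau> \<longrightarrow> (\<forall>m. v t m = w t m)" for k
  proof (induction k)
    case 0
    have "v 0 m = w 0 m" if "0 \<le> T" for m
    proof -
      have B0: "Bint 0 u u 0 m n = 0" for u n unfolding Bint_def osc_int_def by simp
      have "v0 m = u 0 m" if "dsol T v0 u" for u
      proof -
        have "(\<lambda>N. v0 m - kap * (\<Sum>n\<in>Tr N m. Bint 0 u u 0 m n)) \<longlonglongrightarrow> u 0 m"
          using that \<open>0 \<le> T\<close> unfolding dsol_def by simp
        then show ?thesis unfolding B0 by (simp add: LIMSEQ_const_iff)
      qed
      from this[OF sv] this[OF sw] show ?thesis by simp
    qed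
    then show ?case by (auto intro: antisym)
  next
    case (Suc k)
    show ?case
    proof (intro ballI impI allI)
      fix t m assume t: "t \<in> {0..T}" "t \<le> real (Suc k) * \<tau>"
      show "v t m = w t m"
      proof (cases "t \<le> real k * \<tau>")
        case True
        then show ?thesis using Suc t by blast
      next
        case False
        define a where "a = real k * \<tau>"
        have a: "0 \<le> a" "a < t" "t - a \<le> \<tau>" unfolding a_def using False t \<tau> by (auto simp: algebra_simps)
        have ab: "a \<le> t" "t - a \<le> 1" using a \<tau> by auto
        have va: "REP \<eta> \<delta> N1 a t v" by (rule REP_weaken[OF REP_sub[OF v] \<eta>(2) \<delta>]) (use a t in auto)
        have wa: "REP \<eta> \<delta> N2 a t w" by (rule REP_weaken[OF REP_sub[OF w] \<eta>(2) \<delta>]) (use a t in auto)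
        have eq: "v r n = w r n" if "0 \<le> r" "r \<le> a" for r n using Suc that a t unfolding a_def by auto
        have "HS ((\<lambda>t m. v t m - w t m) t) (CS \<delta> * (2 * 0))"
        proof (rule contract[OF REP_diff[OF va wa \<eta>(1) \<delta>(1)] REP_add[OF va wa \<eta>(1) \<delta>(1)] ab \<eta> R \<delta>(1) _ HS_0])
          have "Ebil \<eta> \<delta> R (t - a) * S \<le> 1 / (2 * (S + 1)) * S" using a S by (intro mult_right_mono E) auto
          also have "\<dots> \<le> 1/2" using S by (simp add: field_simps)
          finally show "Ebil \<eta> \<delta> R (t - a) * (N1 + N2) \<le> 1/2" unfolding S_def .
          show "t \<in> {a..t}" using a by simp
          fix r m assume r: "r \<in> {a..t}"
          \<comment> \<open>The integrals over \<open>[0, a]\<close> agree for \<open>v\<close> and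
            \<open>w\<close>, so starting at \<open>a\<close> leaves the difference unchanged. Only
            differences of summands are used: the interval \<open>[0, r]\<close> may be longer than
            the bilinear estimate permits.\<close>
          have B: "Bint 0 v v r m n - Bint 0 w w r m n = Bint a v v r m n - Bint a w w r m n" for n
          proof -
            have comb: "osc_int 0 \<theta> (\<lambda>q. u q n * u q (m - n)) r = osc_int 0 \<theta> (\<lambda>q. u q n * u q (m - n)) a + osc_int a \<theta> (\<lambda>q. u q n * u q (m - n)) r"
              if "u = v \<or> u = w" for u \<theta>
            proof -
              have "continuous_on {0..r} (\<lambda>q. ph \<theta> q * (u q n * u q (m - n)))"
                using that r t by (intro continuous_intros) (auto intro!: cont)
              then have i: "(\<lambda>q. ph \<theta> q * (u q n * u q (m - n))) integrable_on {0..r}" by (rule integrable_continuous_real)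
              show ?thesis unfolding osc_int_def
                by (rule Henstock_Kurzweil_Integration.integral_combine[OF _ _ i, symmetric]) (use a r in auto)
            qed
            have "osc_int 0 \<theta> (\<lambda>q. v q n * v q (m - n)) a = osc_int 0 \<theta> (\<lambda>q. w q n * w q (m - n)) a" for \<theta>
              by (rule osc_int_cong) (auto simp: eq)
            then show ?thesis unfolding Bint_def using comb[of v] comb[of w] by (simp add: algebra_simps)
          qed
          have rT: "r \<in> {0..T}" using r a t by auto
          have "(\<lambda>N. (v0 m - kap * (\<Sum>n\<in>Tr N m. Bint 0 v v r m n)) - (v0 m - kap * (\<Sum>n\<in>Tr N m. Bint 0 w w r m n))) \<longlonglongrightarrow> v r m - w r m"
            using sv sw rT unfolding dsol_def by (intro tendsto_diff) auto
          moreover have "(v0 m - kap * (\<Sum>n\<in>Tr N m. Bint 0 v v r m n)) - (v0 m - kap * (\<Sum>n\<in>Tr N m. Bint 0 w w r m n))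
             = 0 - kap * (\<Sum>n\<in>Tr N m. Bint a v v r m n - Bint a w w r m n)" for N
          proof -
            have "(\<Sum>n\<in>Tr N m. Bint a v v r m n - Bint a w w r m n) = (\<Sum>n\<in>Tr N m. Bint 0 v v r m n) - (\<Sum>n\<in>Tr N m. Bint 0 w w r m n)"
              by (simp add: B[symmetric] sum_subtractf)
            then show ?thesis by (simp only:) (simp add: right_diff_distrib)
          qed
          ultimately have "(\<lambda>N. 0 - kap * (\<Sum>n\<in>Tr N m. Bint a v v r m n - Bint a w w r m n)) \<longlonglongrightarrow> v r m - w r m" by simp
          moreover have "(\<lambda>N. 0 - kap * (\<Sum>n\<in>Tr N m. Bint a v v r m n - Bint a w w r m n)) \<longlonglongrightarrow> 0 - kap * Bil a (\<lambda>t m. v t m - w t m) (\<lambda>t m. v t m + w t m) r m"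
            by (intro tendsto_intros Tr_lim Bil_diff_squares[OF va wa ab \<eta> \<delta>(1) r])
          ultimately show "v r m - w r m = 0 - kap * Bil a (\<lambda>t m. v t m - w t m) (\<lambda>t m. v t m + w t m) r m"
            by (rule LIMSEQ_unique)
        qed
        then have "HS (\<lambda>m. v t m - w t m) 0" by simp
        from HS_0D[OF this, of m] show ?thesis by simp
      qed
    qed
  qed
  moreover obtain k :: nat where "t / \<tau> \<le> real k" using real_arch_simple by blast
  then have "t \<le> real k * \<tau>" using \<tau> by (simp add: field_simps)
  ultimately show ?thesis using t by blast
qed

end

section \<open>Fourier series of test functions and distributions\<close>

lemma exp_ph: "exp (- \<i> * of_real k * of_real x) = ph (- k) x"
  unfolding ph_def cis_conv_exp by (simp add: mult_ac)

lemma exp_ph': "exp (\<i> * of_real k * of_real x) = ph k x"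
  unfolding ph_def cis_conv_exp by (simp add: mult_ac)

lemma fourier_ph: "fourier f k = f (ph (- k))"
  unfolding fourier_def exp_ph ..

lemma fourier_fun_ph: "fourier_fun lam g k = integral {0..2 * pi * lam} (\<lambda>x. ph (- k) x * g x)"
  unfolding fourier_fun_def exp_ph ..

section \<open>Derivatives of test functions and linearity of distributions\<close>

lemma vderiv_iter:
  assumes "\<And>n x. (F n has_vector_derivative F (Suc n) x) (at x)"
  shows "(vderiv ^^ n) (F 0) = F n"
proof (induction n)
  case (Suc n)
  have "vderiv (F n) = F (Suc n)" unfolding vderiv_def by (intro ext vector_derivative_at assms)
  then show ?case using Suc by simp
qed simp

lemma test_funI:
  assumes "\<And>n x. (F n has_vector_derivative F (Suc n) x) (at x)" "\<And>x. F 0 (x + 2 * pi * lam) = F 0 x"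
  shows "test_fun lam (F 0)"
  unfolding test_fun_def vderiv_iter[of F, OF assms(1)] differentiable_on_def
  using assms by (auto intro: differentiableI_vector)

lemma test_fun_deriv:
  assumes "test_fun lam \<phi>"
  shows "((vderiv ^^ n) \<phi> has_vector_derivative (vderiv ^^ Suc n) \<phi> x) (at x)"
proof -
  have "(vderiv ^^ n) \<phi> differentiable (at x)" using assms unfolding test_fun_def differentiable_on_def by auto
  then show ?thesis unfolding vector_derivative_works by (simp add: vderiv_def)
qed

lemma test_fun_periodic: "test_fun lam \<phi> \<Longrightarrow> \<phi> (x + 2 * pi * lam) = \<phi> x"
  unfolding test_fun_def by simp

lemma test_fun_continuous: "test_fun lam \<phi> \<Longrightarrow> continuous_on S ((vderiv ^^ n) \<phi>)"
  using test_fun_deriv[of lam \<phi> n]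
  by (auto intro!: continuous_at_imp_continuous_on has_vector_derivative_continuous)

lemma test_fun_continuous': "test_fun lam \<phi> \<Longrightarrow> continuous_on S \<phi>"
  using test_fun_continuous[of lam \<phi> S 0] by simp

lemma test_fun_vderiv:
  assumes "test_fun lam \<phi>"
  shows "test_fun lam ((vderiv ^^ n) \<phi>)"
proof (induction n)
  case (Suc n)
  let ?\<psi> = "(vderiv ^^ n) \<phi>"
  have d: "((\<lambda>x. ?\<psi> x) has_vector_derivative vderiv ?\<psi> x) (at x)" for x
    using test_fun_deriv[OF Suc, of 0] by simp
  have "vderiv ?\<psi> (x + 2 * pi * lam) = vderiv ?\<psi> x" for x
  proof -
    have "((\<lambda>x. x + 2 * pi * lam) has_vector_derivative 1) (at x)" by (auto intro!: derivative_eq_intros)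
    from vector_diff_chain_at[OF this d] have "(?\<psi> has_vector_derivative vderiv ?\<psi> (x + 2 * pi * lam)) (at x)"
      by (simp add: o_def test_fun_periodic[OF Suc])
    then show ?thesis using d vector_derivative_unique_at by blast
  qed
  then have "test_fun lam ((\<lambda>k. (vderiv ^^ Suc k) ?\<psi>) 0)"
    by (intro test_funI) (rule test_fun_deriv[OF Suc], simp)
  then show ?case by simp
qed (use assms in simp)

lemma vderiv_ph: "(vderiv ^^ n) (ph \<theta>) = (\<lambda>x. (\<i> * of_real \<theta>)^n * ph \<theta> x)"
proof -
  have "((\<lambda>x. (\<i> * of_real \<theta>)^n * ph \<theta> x) has_vector_derivative (\<i> * of_real \<theta>)^Suc n * ph \<theta> x) (at x)" for n x
    by (rule has_vector_derivative_eq_rhs[OF has_vector_derivative_mult_right[OF ph_deriv]]) (simp add: mult_ac)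
  from vderiv_iter[of "\<lambda>n x. (\<i> * of_real \<theta>)^n * ph \<theta> x", OF this] show ?thesis by simp
qed

lemma ph_periodic:
  assumes "lam > 0"
  shows "ph (of_int m / lam) (x + 2 * pi * lam) = ph (of_int m / lam) x"
proof -
  have "of_int m / lam * (x + 2 * pi * lam) = of_int m / lam * x + 2 * pi * of_int m"
    using assms by (simp add: field_simps)
  then show ?thesis unfolding ph_def by (simp add: cis_mult[symmetric])
qed

lemma test_fun_ph:
  assumes "lam > 0"
  shows "test_fun lam (ph (of_int m / lam))"
proof -
  let ?F = "\<lambda>n x. (\<i> * of_real (of_int m / lam))^n * ph (of_int m / lam) x"
  have "test_fun lam (?F 0)"
  proof (rule test_funI)
    show "(?F n has_vector_derivative ?F (Suc n) x) (at x)" for n x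
      by (rule has_vector_derivative_eq_rhs[OF has_vector_derivative_mult_right[OF ph_deriv]]) (simp add: mult_ac)
  qed (simp add: ph_periodic[OF assms])
  then show ?thesis by simp
qed

lemma vderiv_add:
  assumes "test_fun lam \<phi>" "test_fun lam \<psi>"
  shows "(vderiv ^^ n) (\<lambda>x. \<phi> x + \<psi> x) = (\<lambda>x. (vderiv ^^ n) \<phi> x + (vderiv ^^ n) \<psi> x)"
    and "test_fun lam (\<lambda>x. \<phi> x + \<psi> x)"
proof -
  let ?F = "\<lambda>n x. (vderiv ^^ n) \<phi> x + (vderiv ^^ n) \<psi> x"
  have d: "(?F n has_vector_derivative ?F (Suc n) x) (at x)" for n x
    by (intro has_vector_derivative_add test_fun_deriv[OF assms(1)] test_fun_deriv[OF assms(2)])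
  show "(vderiv ^^ n) (\<lambda>x. \<phi> x + \<psi> x) = ?F n" using vderiv_iter[of ?F, OF d] by simp
  show "test_fun lam (\<lambda>x. \<phi> x + \<psi> x)"
    using test_funI[of ?F, OF d] by (simp add: test_fun_periodic[OF assms(1)] test_fun_periodic[OF assms(2)])
qed

lemma vderiv_cmult:
  assumes "test_fun lam \<phi>"
  shows "(vderiv ^^ n) (\<lambda>x. c * \<phi> x) = (\<lambda>x. c * (vderiv ^^ n) \<phi> x)"
    and "test_fun lam (\<lambda>x. c * \<phi> x)"
proof -
  let ?F = "\<lambda>n x. c * (vderiv ^^ n) \<phi> x"
  have d: "(?F n has_vector_derivative ?F (Suc n) x) (at x)" for n x
    by (intro has_vector_derivative_mult_right test_fun_deriv[OF assms(1)])
  show "(vderiv ^^ n) (\<lambda>x. c * \<phi> x) = ?F n" using vderiv_iter[of ?F, OF d] by simp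
  show "test_fun lam (\<lambda>x. c * \<phi> x)"
    using test_funI[of ?F, OF d] by (simp add: test_fun_periodic[OF assms(1)])
qed

lemma test_fun_0: "test_fun lam (\<lambda>x. 0)" and vderiv_0: "(vderiv ^^ n) (\<lambda>x. 0) = (\<lambda>x. 0)"
  using test_funI[of "\<lambda>n x. 0" lam] vderiv_iter[of "\<lambda>n x. 0" n] by simp_all

lemma vderiv_sum:
  assumes "\<And>i. test_fun lam (\<phi> i)"
  shows "test_fun lam (\<lambda>x. \<Sum>i\<in>F. \<phi> i x) \<and>
    (vderiv ^^ n) (\<lambda>x. \<Sum>i\<in>F. \<phi> i x) = (\<lambda>x. \<Sum>i\<in>F. (vderiv ^^ n) (\<phi> i) x)"
proof (induction F rule: infinite_finite_induct)
  case (insert i F)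
  then show ?case using vderiv_add[OF assms[of i], of "\<lambda>x. \<Sum>i\<in>F. \<phi> i x"] by simp
qed (simp_all add: test_fun_0 vderiv_0)

lemma periodic_distr_lin:
  assumes "periodic_distr lam f"
  shows "test_fun lam \<phi> \<Longrightarrow> test_fun lam \<psi> \<Longrightarrow> f (\<lambda>x. \<phi> x + \<psi> x) = f \<phi> + f \<psi>"
    and "test_fun lam \<phi> \<Longrightarrow> f (\<lambda>x. c * \<phi> x) = c * f \<phi>"
    and "\<not> test_fun lam \<phi> \<Longrightarrow> f \<phi> = 0"
  using assms unfolding periodic_distr_def by blast+

lemma periodic_distr_sum:
  assumes f: "periodic_distr lam f" and t: "\<And>i. test_fun lam (\<phi> i)"
  shows "f (\<lambda>x. \<Sum>i\<in>F. \<phi> i x) = (\<Sum>i\<in>F. f (\<phi> i))"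
proof (induction F rule: infinite_finite_induct)
  case (insert i F)
  then show ?case using periodic_distr_lin(1)[OF f t[of i], of "\<lambda>x. \<Sum>i\<in>F. \<phi> i x"] vderiv_sum[of lam \<phi>, OF t] by simp
qed (use periodic_distr_lin(2)[OF f test_fun_0, of 0] in simp_all)

lemma periodic_distr_comb:
  assumes f: "periodic_distr lam f" and g: "periodic_distr lam g"
  shows "periodic_distr lam (\<lambda>\<phi>. c * f \<phi> + d * g \<phi>)"
proof -
  obtain A N where A: "\<And>\<phi> B. test_fun lam \<phi> \<Longrightarrow> (\<forall>n\<le>N. \<forall>x. norm ((vderiv ^^ n) \<phi> x) \<le> B) \<Longrightarrow> norm (f \<phi>) \<le> A * B"
    using f unfolding periodic_distr_def by blast
  obtain A' N' where A': "\<And>\<phi> B. test_fun lam \<phi> \<Longrightarrow> (\<forall>n\<le>N'. \<forall>x. norm ((vderiv ^^ n) \<phi> x) \<le> B) \<Longrightarrow> norm (g \<phi>) \<le> A' * B"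
    using g unfolding periodic_distr_def by blast
  have "norm (c * f \<phi> + d * g \<phi>) \<le> (norm c * A + norm d * A') * B"
    if "test_fun lam \<phi>" "\<forall>n\<le>max N N'. \<forall>x. norm ((vderiv ^^ n) \<phi> x) \<le> B" for \<phi> B
  proof -
    have "norm (c * f \<phi> + d * g \<phi>) \<le> norm c * norm (f \<phi>) + norm d * norm (g \<phi>)"
      using norm_triangle_ineq[of "c * f \<phi>" "d * g \<phi>"] by (simp add: norm_mult)
    also have "\<dots> \<le> norm c * (A * B) + norm d * (A' * B)"
      by (intro add_mono mult_left_mono A A') (use that in auto)
    finally show ?thesis by (simp add: algebra_simps)
  qed
  then show ?thesis
    using periodic_distr_lin[OF f] periodic_distr_lin[OF g] unfolding periodic_distr_def
    by (intro conjI exI[of _ "norm c * A + norm d * A'"] exI[of _ "max N N'"]) (auto simp: algebra_simps)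
qed

lemma periodic_distr_add: "periodic_distr lam f \<Longrightarrow> periodic_distr lam g \<Longrightarrow> periodic_distr lam (distr_add f g)"
  using periodic_distr_comb[of lam f g 1 1] by (simp add: distr_add_def)

lemma periodic_distr_diff: "periodic_distr lam f \<Longrightarrow> periodic_distr lam g \<Longrightarrow> periodic_distr lam (distr_diff f g)"
  using periodic_distr_comb[of lam f g 1 "-1"] by (simp add: distr_diff_def)

lemma periodic_distr_scale: "periodic_distr lam f \<Longrightarrow> periodic_distr lam (distr_scale c f)"
  using periodic_distr_comb[of lam f f c 0] by (simp add: distr_scale_def)

lemma periodic_distr_0: "periodic_distr lam (\<lambda>\<phi>. 0)"
  unfolding periodic_distr_def by (auto intro!: exI[of _ 0])

section \<open>Fourier coefficients of test functions and their decay\<close>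

lemma fourier_fun_bound:
  assumes "lam > 0" "continuous_on {0..2 * pi * lam} g" "\<And>x. x \<in> {0..2 * pi * lam} \<Longrightarrow> norm (g x) \<le> B"
  shows "norm (fourier_fun lam g k) \<le> 2 * pi * lam * B"
proof -
  have "norm (integral {0..2 * pi * lam} (\<lambda>x. ph (- k) x * g x)) \<le> B * (2 * pi * lam - 0)"
    using assms by (intro integral_bound) (auto intro!: continuous_intros simp: norm_mult)
  then show ?thesis unfolding fourier_fun_ph by (simp add: mult_ac)
qed

lemma fourier_fun_add:
  assumes "continuous_on {0..2 * pi * lam} g" "continuous_on {0..2 * pi * lam} h"
  shows "fourier_fun lam (\<lambda>x. g x + h x) k = fourier_fun lam g k + fourier_fun lam h k"
  unfolding fourier_fun_ph distrib_left
  by (intro Henstock_Kurzweil_Integration.integral_add integrable_continuous_real continuous_intros assms)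

lemma fourier_fun_cmult: "fourier_fun lam (\<lambda>x. c * g x) k = c * fourier_fun lam g k"
proof -
  have "(\<lambda>x. ph (- k) x * (c * g x)) = (\<lambda>x. c * (ph (- k) x * g x))" by (simp add: mult_ac)
  then show ?thesis unfolding fourier_fun_ph by (simp only: integral_mult_right)
qed

lemma fourier_fun_derivative:
  assumes lam: "lam > 0" and d: "\<And>x. (g has_vector_derivative g' x) (at x)" and c: "continuous_on UNIV g'"
    and p: "\<And>x. g (x + 2 * pi * lam) = g x"
  shows "fourier_fun lam g' (of_int m / lam) = \<i> * of_real (of_int m / lam) * fourier_fun lam g (of_int m / lam)"
proof -
  define k where "k = of_int m / lam"
  have cg: "continuous_on A g" for A
    using d by (auto intro!: continuous_at_imp_continuous_on has_vector_derivative_continuous)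
  have cg': "continuous_on A g'" for A using c continuous_on_subset by blast
  have "((\<lambda>x. ph (- k) x * g x) has_vector_derivative (ph (- k) x * g' x - \<i> * of_real k * (ph (- k) x * g x))) (at x within S)" for x S
    using has_vector_derivative_mult[OF ph_deriv[of "- k" x S] has_vector_derivative_at_within[OF d[of x], of S]]
    by (simp add: algebra_simps)
  then have "((\<lambda>x. ph (- k) x * g' x - \<i> * of_real k * (ph (- k) x * g x)) has_integral
      ph (- k) (2 * pi * lam) * g (2 * pi * lam) - ph (- k) 0 * g 0) {0..2 * pi * lam}"
    using lam by (intro fundamental_theorem_of_calculus) auto
  moreover have "ph (- k) (2 * pi * lam) * g (2 * pi * lam) - ph (- k) 0 * g 0 = 0"
    using ph_periodic[OF lam, of "- m" 0] p[of 0] unfolding k_def by simp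
  ultimately have "integral {0..2 * pi * lam} (\<lambda>x. ph (- k) x * g' x - \<i> * of_real k * (ph (- k) x * g x)) = 0"
    by (simp add: integral_unique)
  moreover have "integral {0..2 * pi * lam} (\<lambda>x. ph (- k) x * g' x - \<i> * of_real k * (ph (- k) x * g x))
     = integral {0..2 * pi * lam} (\<lambda>x. ph (- k) x * g' x) - integral {0..2 * pi * lam} (\<lambda>x. \<i> * of_real k * (ph (- k) x * g x))"
    by (intro Henstock_Kurzweil_Integration.integral_diff integrable_continuous_real continuous_intros cg cg')
  ultimately show ?thesis unfolding fourier_fun_ph k_def[symmetric] integral_mult_right by simp
qed

lemma fourier_fun_vderiv:
  assumes "lam > 0" "test_fun lam \<phi>"
  shows "fourier_fun lam ((vderiv ^^ n) \<phi>) (of_int m / lam) = (\<i> * of_real (of_int m / lam))^n * fourier_fun lam \<phi> (of_int m / lam)"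
proof (induction n)
  case (Suc n)
  have "fourier_fun lam ((vderiv ^^ Suc n) \<phi>) (of_int m / lam) = \<i> * of_real (of_int m / lam) * fourier_fun lam ((vderiv ^^ n) \<phi>) (of_int m / lam)"
    by (rule fourier_fun_derivative[OF assms(1) test_fun_deriv[OF assms(2)] test_fun_continuous[OF assms(2)]
          test_fun_periodic[OF test_fun_vderiv[OF assms(2)]]])
  then show ?case unfolding Suc by simp
qed simp

text \<open>A summable majorant. As \<open>0 powr -2 = 0\<close>, the frequency 0 gets its value
  separately.\<close>

definition zw :: "int \<Rightarrow> real" where "zw m = \<bar>of_int m\<bar> powr -2 + (if m = 0 then 1 else 0)"

lemma zw_nonneg: "0 \<le> zw m" unfolding zw_def by simp

lemma zw_summable: "zw summable_on UNIV"
proof -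
  have "(\<lambda>m::int. if m = 0 then 1 else 0 :: real) summable_on UNIV"
    by (rule summable_on_cong_neutral[THEN iffD1, of _ "{0}"]) auto
  from summable_on_add[OF summable_int_powr[of "-2"] this] show ?thesis unfolding zw_def by simp
qed

lemma decay_zw:
  assumes q: "0 \<le> q" and c0: "m = 0 \<Longrightarrow> q \<le> Q" and cn: "\<bar>of_int m\<bar>^(p + 2) * q \<le> L * Q" and LQ: "0 \<le> L * Q" "0 \<le> Q"
  shows "(1 + \<bar>of_int m\<bar>)^p * q \<le> 2^p * ((1 + L) * Q) * zw m"
proof (cases "m = 0")
  case True
  have "q \<le> 1 * ((1 + L) * Q)" using c0[OF True] LQ by (simp add: algebra_simps)
  also have "\<dots> \<le> 2^p * ((1 + L) * Q)" using LQ by (intro mult_right_mono) (auto simp: algebra_simps)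
  finally show ?thesis using True by (simp add: zw_def)
next
  case False
  define r :: real where "r = \<bar>of_int m\<bar>"
  have r: "1 \<le> r" unfolding r_def using False by linarith
  have zw: "zw m = 1 / r^2" unfolding zw_def r_def using False by (simp add: powr_minus_divide powr_numeral)
  have "(1 + r)^p * q \<le> (2 * r)^p * q" using r q by (intro mult_right_mono power_mono) auto
  also have "\<dots> = 2^p * (r^(p+2) * q) / r^2" using r by (simp add: power_add power_mult_distrib power2_eq_square)
  also have "\<dots> \<le> 2^p * ((1 + L) * Q) / r^2"
    using cn LQ unfolding r_def[symmetric] by (intro divide_right_mono mult_left_mono) (auto simp: algebra_simps)
  finally show ?thesis unfolding zw r_def[symmetric] by simp
qed

text \<open>Of \<open>p + 2\<close> integrations by parts, \<open>p\<close> pay for the polynomial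
  weight and two make the bound summable.\<close>

lemma fourier_fun_decay:
  assumes lam: "lam > 0" and t: "test_fun lam \<phi>" and B: "\<And>n x. n \<le> p + 2 \<Longrightarrow> x \<in> {0..2 * pi * lam} \<Longrightarrow> norm ((vderiv ^^ n) \<phi> x) \<le> B"
  shows "(1 + \<bar>of_int m\<bar>)^p * norm (fourier_fun lam \<phi> (of_int m / lam)) \<le> 2^p * ((1 + lam^(p + 2)) * (2 * pi * lam * B)) * zw m"
proof (rule decay_zw)
  have "0 \<le> B" using order_trans[OF norm_ge_zero B[of 0 0]] lam by simp
  then show "0 \<le> lam ^ (p + 2) * (2 * pi * lam * B)" "0 \<le> 2 * pi * lam * B" using lam by auto
  show "norm (fourier_fun lam \<phi> (of_int m / lam)) \<le> 2 * pi * lam * B"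
    using B[of 0] by (intro fourier_fun_bound lam test_fun_continuous'[OF t]) auto
  have "norm (fourier_fun lam ((vderiv ^^ (p + 2)) \<phi>) (of_int m / lam)) \<le> 2 * pi * lam * B"
    by (intro fourier_fun_bound lam test_fun_continuous[OF t] B) auto
  then have "(\<bar>of_int m\<bar> / lam)^(p + 2) * norm (fourier_fun lam \<phi> (of_int m / lam)) \<le> 2 * pi * lam * B"
    unfolding fourier_fun_vderiv[OF lam t] norm_mult norm_power using lam by (simp add: norm_divide del: power_Suc power_Suc2 add_2_eq_Suc')
  from mult_left_mono[OF this, of "lam^(p + 2)"]
  show "\<bar>of_int m\<bar>^(p + 2) * norm (fourier_fun lam \<phi> (of_int m / lam)) \<le> lam ^ (p + 2) * (2 * pi * lam * B)"
    using lam by (simp add: power_divide del: power_Suc power_Suc2 add_2_eq_Suc')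
qed simp

lemma test_fun_bounded:
  assumes "lam > 0" "test_fun lam \<phi>"
  shows "\<exists>B. \<forall>n\<le>N. \<forall>x. norm ((vderiv ^^ n) \<phi> x) \<le> B"
proof -
  have "\<exists>B. \<forall>x. norm (\<psi> x) \<le> B" if \<psi>: "test_fun lam \<psi>" for \<psi>
  proof -
    have "compact (\<psi> ` {0..2 * pi * lam})" by (intro compact_continuous_image test_fun_continuous'[OF \<psi>]) simp
    then obtain B where B: "\<And>x. x \<in> {0..2 * pi * lam} \<Longrightarrow> norm (\<psi> x) \<le> B"
      using compact_imp_bounded bounded_iff by (metis image_eqI)
    interpret periodic_fun_simple \<psi> "2 * pi * lam" by standard (rule test_fun_periodic[OF \<psi>])
    have "norm (\<psi> x) \<le> B" for x
    proof -
      define z where "z = \<lfloor>x / (2 * pi * lam)\<rfloor>"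
      have "x - of_int z * (2 * pi * lam) \<in> {0..2 * pi * lam}"
        using floor_correct[of "x / (2 * pi * lam)"] assms(1) unfolding z_def[symmetric] by (auto simp: field_simps)
      from B[OF this] show ?thesis by (simp add: minus_of_int)
    qed
    then show ?thesis by blast
  qed
  then have "\<forall>n. \<exists>B. \<forall>x. norm ((vderiv ^^ n) \<phi> x) \<le> B" using test_fun_vderiv[OF assms(2)] by blast
  then obtain B where B: "\<And>n x. norm ((vderiv ^^ n) \<phi> x) \<le> B n" by metis
  have "norm ((vderiv ^^ n) \<phi> x) \<le> (\<Sum>i\<le>N. B i)" if "n \<le> N" for n x
  proof -
    have "0 \<le> B i" for i using B norm_ge_zero order_trans by blast
    then have "B n \<le> (\<Sum>i\<le>N. B i)" using that by (intro member_le_sum) auto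
    then show ?thesis using B[of n x] by linarith
  qed
  then show ?thesis by blast
qed

lemma integral_ph:
  assumes lam: "lam > 0"
  shows "integral {0..2 * pi * lam} (ph (of_int m / lam)) = (if m = 0 then of_real (2 * pi * lam) else 0)"
proof (cases "m = 0")
  case True
  then have "ph (of_int m / lam) = (\<lambda>x. 1)" by auto
  then show ?thesis using True lam by (simp add: scaleR_conv_of_real)
next
  case False
  have "fourier_fun lam (\<lambda>x. 0) (of_int (- m) / lam) = \<i> * of_real (of_int (- m) / lam) * fourier_fun lam (\<lambda>x. 1) (of_int (- m) / lam)"
    by (rule fourier_fun_derivative) (use lam in auto)
  then have "fourier_fun lam (\<lambda>x. 1) (of_int (- m) / lam) = 0" using False lam by (simp add: fourier_fun_ph)
  then show ?thesis using False by (simp add: fourier_fun_ph)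
qed

lemma ph_quot: "ph (of_int m / lam) x * ph (of_int n / lam) x = ph (of_int (m + n) / lam) x"
  by (simp add: ph_add[symmetric] add_divide_distrib)

lemma fourier_fun_ph_ph:
  assumes lam: "lam > 0"
  shows "fourier_fun lam (ph (of_int n / lam)) (of_int m / lam) = (if m = n then of_real (2 * pi * lam) else 0)"
proof -
  have "(\<lambda>x. ph (- (of_int m / lam)) x * ph (of_int n / lam) x) = ph (of_int (n - m) / lam)"
    using ph_quot[of "- m" lam _ n] by (auto simp: algebra_simps)
  then show ?thesis unfolding fourier_fun_ph using integral_ph[OF lam, of "n - m"] by auto
qed

section \<open>Uniqueness of Fourier coefficients\<close>

lemma cis_eq_periodic:
  assumes p: "\<And>x. g (x + 2 * pi * lam) = g x" and e: "cis a = cis b"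
  shows "g (lam * a) = g (lam * b)"
proof -
  interpret periodic_fun_simple g "2 * pi * lam" by standard (rule p)
  have "sin a = sin b \<and> cos a = cos b" using e by (simp add: complex_eq_iff)
  then obtain n :: int where n: "a = b + 2 * pi * of_int n" unfolding sin_cos_eq_iff by blast
  have "lam * a = lam * b + of_int n * (2 * pi * lam)" unfolding n by (simp add: algebra_simps)
  then show ?thesis by (simp only: plus_of_int)
qed

text \<open>On the negative real axis, where \<open>Arg\<close> jumps, \<open>Arg (- z) + pi\<close>
  is continuous and differs from \<open>Arg z\<close> by a multiple of \<open>2 * pi\<close>, which
  the period of \<open>g\<close> absorbs.\<close>

lemma continuous_on_circle:
  fixes g :: "real \<Rightarrow> complex"
  assumes p: "\<And>x. g (x + 2 * pi * lam) = g x" and c: "continuous_on UNIV g"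
  shows "continuous_on (sphere 0 1) (\<lambda>z. g (lam * Arg z))"
  unfolding continuous_on_eq_continuous_within
proof
  fix z :: complex assume z: "z \<in> sphere 0 1"
  have gc: "isCont g x" for x using c by (simp add: continuous_on_eq_continuous_at)
  show "continuous (at z within sphere 0 1) (\<lambda>z. g (lam * Arg z))"
  proof (cases "z \<in> \<real>\<^sub>\<le>\<^sub>0")
    case False
    have "isCont (\<lambda>z. lam * Arg z) z" by (intro continuous_intros continuous_at_Arg False)
    from isCont_o2[OF this gc] show ?thesis by (rule continuous_at_imp_continuous_at_within)
  next
    case True
    have "- z \<notin> \<real>\<^sub>\<le>\<^sub>0" using True z by (auto simp: complex_nonpos_Reals_iff cmod_def)
    then have "isCont (\<lambda>z. Arg (- z)) z" by (intro isCont_o2[of z uminus Arg] continuous_at_Arg continuous_intros)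
    then have "isCont (\<lambda>z. lam * (Arg (- z) + pi)) z" by (intro continuous_intros)
    from isCont_o2[OF this gc] have h: "continuous (at z within sphere 0 1) (\<lambda>z. g (lam * (Arg (- z) + pi)))"
      by (rule continuous_at_imp_continuous_at_within)
    have "cis (Arg (- w) + pi) = cis (Arg w)" if "w \<in> sphere 0 1" for w
    proof -
      have w: "norm w = 1" "w \<noteq> 0" using that by auto
      then show ?thesis using cis_Arg[of w] cis_Arg[of "- w"] by (simp add: cis_mult[symmetric] sgn_div_norm)
    qed
    then show ?thesis
      by (intro continuous_transform_within[OF h zero_less_one z] cis_eq_periodic p)
  qed
qed

text \<open>By Stone--Weierstrass on the unit circle, the conjugate of the function is a uniform limit of
  trigonometric polynomials, to which the function is orthogonal.\<close>

lemma fourier_fun_zero: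
  assumes lam: "lam > 0" and c: "continuous_on UNIV g" and p: "\<And>x. g (x + 2 * pi * lam) = g x"
    and z: "\<And>m::int. fourier_fun lam g (of_int m / lam) = 0"
  shows "g x = 0"
proof -
  let ?P = "{0..2 * pi * lam}" and ?w = "ph (1 / lam)"
  \<comment> \<open>\<open>E\<close> collects the continuous factors \<open>h\<close> for which the
    product with \<open>g\<close> still has vanishing coefficients. It contains 1 and is closed
    under sums, scalars and multiplication by the real and imaginary part of \<open>?w x\<close>,
    hence under multiplication by real polynomials in \<open>?w x\<close>.\<close>
  define E where "E = {h. continuous_on UNIV h \<and> (\<forall>m::int. integral ?P (\<lambda>x. ph (of_int m / lam) x * (g x * h x)) = 0)}"
  have cP: "continuous_on ?P h" if "continuous_on UNIV h" for h :: "real \<Rightarrow> complex"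
    using that continuous_on_subset by blast
  have E1: "(\<lambda>x. 1) \<in> E"
    unfolding E_def using z[of "- m" for m] by (auto simp: fourier_fun_ph)
  have Eadd: "(\<lambda>x. h x + h' x) \<in> E" if "h \<in> E" "h' \<in> E" for h h'
  proof -
    have hc: "continuous_on UNIV h" "continuous_on UNIV h'" using that unfolding E_def by auto
    have "integral ?P (\<lambda>x. ph (of_int m / lam) x * (g x * h x) + ph (of_int m / lam) x * (g x * h' x))
      = integral ?P (\<lambda>x. ph (of_int m / lam) x * (g x * h x)) + integral ?P (\<lambda>x. ph (of_int m / lam) x * (g x * h' x))" for m :: int
      by (intro Henstock_Kurzweil_Integration.integral_add integrable_continuous_real continuous_intros cP c hc)
    then show ?thesis using that hc unfolding E_def by (auto simp: distrib_left intro!: continuous_intros)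
  qed
  have Ec: "(\<lambda>x. a * h x) \<in> E" if "h \<in> E" for a h
  proof -
    have "(\<lambda>x. ph (of_int m / lam) x * (g x * (a * h x))) = (\<lambda>x. a * (ph (of_int m / lam) x * (g x * h x)))" for m :: int
      by (simp add: mult_ac)
    then show ?thesis using that unfolding E_def by (auto intro!: continuous_intros)
  qed
  have Eph: "(\<lambda>x. ph (of_int n / lam) x * h x) \<in> E" if "h \<in> E" for h and n :: int
  proof -
    have "ph (of_int m / lam) x * (g x * (ph (of_int n / lam) x * h x)) = ph (of_int (m + n) / lam) x * (g x * h x)" for m :: int and x
      using ph_quot[of m lam x n] by (simp add: mult_ac)
    then have "(\<lambda>x. ph (of_int m / lam) x * (g x * (ph (of_int n / lam) x * h x))) = (\<lambda>x. ph (of_int (m + n) / lam) x * (g x * h x))" for m :: int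
      by blast
    then show ?thesis using that unfolding E_def by (auto intro!: continuous_intros simp del: of_int_add)
  qed
  have Eph1: "(\<lambda>x. ?w x * h x) \<in> E" "(\<lambda>x. cnj (?w x) * h x) \<in> E" if "h \<in> E" for h
    using Eph[OF that, of 1] Eph[OF that, of "- 1"] by (simp_all add: ph_def cis_cnj)
  have Ere: "(\<lambda>x. of_real (Re (?w x)) * h x) \<in> E" if "h \<in> E" for h
  proof -
    have r: "of_real (Re v) * y = (1/2) * (v * y + cnj v * y)" for v y :: complex
      by (simp add: distrib_right[symmetric] complex_add_cnj)
    show ?thesis unfolding r by (intro Ec Eadd Eph1 that)
  qed
  have Eim: "(\<lambda>x. of_real (Im (?w x)) * h x) \<in> E" if "h \<in> E" for h
  proof -
    have r: "of_real (Im v) * y = (- \<i> / 2) * (v * y + (- 1) * (cnj v * y))" for v y :: complex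
    proof -
      have "v * y + (- 1) * (cnj v * y) = (v - cnj v) * y" by (simp add: algebra_simps)
      then show ?thesis by (simp add: complex_eq_iff)
    qed
    show ?thesis unfolding r by (intro Ec Eadd Eph1 that)
  qed
  have pol: "\<forall>h\<in>E. (\<lambda>x. of_real (q (?w x)) * h x) \<in> E" if "real_polynomial_function q" for q :: "complex \<Rightarrow> real"
    using that
  proof (induction rule: real_polynomial_function.induct)
    case (linear q)
    have q: "q v = Re v * q 1 + Im v * q \<i>" for v
    proof -
      interpret bounded_linear q by fact
      have "q v = q (Re v *\<^sub>R 1 + Im v *\<^sub>R \<i>)" by (rule arg_cong[of _ _ q]) (simp add: complex_eq_iff)
      then show ?thesis by (simp only: add scaleR real_scaleR_def)
    qed
    show ?case
    proof
      fix h assume h: "h \<in> E"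
      have "(\<lambda>x. of_real (q (?w x)) * h x) = (\<lambda>x. of_real (q 1) * (of_real (Re (?w x)) * h x) + of_real (q \<i>) * (of_real (Im (?w x)) * h x))"
        by (subst q) (simp add: algebra_simps)
      then show "(\<lambda>x. of_real (q (?w x)) * h x) \<in> E" using Eadd[OF Ec[OF Ere[OF h]] Ec[OF Eim[OF h]]] by simp
    qed
  next
    case (const a)
    then show ?case using Ec by simp
  next
    case (add q r)
    then show ?case using Eadd[of "\<lambda>x. of_real (q (?w x)) * h x" "\<lambda>x. of_real (r (?w x)) * h x" for h] by (simp add: distrib_right)
  next
    case (mult q r)
    then show ?case by (simp add: mult.assoc)
  qed
  have "bounded (g ` ?P)" by (intro compact_imp_bounded compact_continuous_image cP c) simp
  then obtain G where G: "\<And>x. x \<in> ?P \<Longrightarrow> norm (g x) \<le> G" unfolding bounded_iff by blast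
  have G0: "0 \<le> G" using order_trans[OF norm_ge_zero G[of 0]] lam by simp
  have b: "norm (integral ?P (\<lambda>x. g x * cnj (g x))) \<le> G * e * (2 * pi * lam)" if e: "e > 0" for e
  proof -
    have "continuous_on (sphere 0 1) (\<lambda>z. cnj (g (lam * Arg z)))"
      by (intro continuous_on_cnj continuous_on_circle[OF p c])
    from Stone_Weierstrass_polynomial_function[OF _ this e] obtain q where
      q: "polynomial_function q" "\<And>z. z \<in> sphere 0 1 \<Longrightarrow> norm (cnj (g (lam * Arg z)) - q z) < e" by auto
    have gw: "g (lam * Arg (?w x)) = g x" for x
    proof -
      have "cis (Arg (?w x)) = cis (x / lam)" using cis_Arg[of "?w x"] norm_ph[of "1/lam" x]
        by (metis norm_zero sgn_div_norm ph_def inverse_1 mult.commute scaleR_one times_divide_eq_right mult.right_neutral zero_neq_one)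
      from cis_eq_periodic[of g lam, OF p this] show ?thesis using lam by simp
    qed
    have r: "real_polynomial_function (\<lambda>z. q z \<bullet> 1)" "real_polynomial_function (\<lambda>z. q z \<bullet> \<i>)"
      using q(1) unfolding polynomial_function_iff_Basis_inner by (auto simp: Basis_complex_def)
    have "q z = of_real (q z \<bullet> 1) * 1 + \<i> * (of_real (q z \<bullet> \<i>) * 1)" for z
      by (simp add: complex_eq_iff inner_complex_def)
    then have qE: "(\<lambda>x. q (?w x)) \<in> E"
      using Eadd[OF pol[OF r(1), rule_format, OF E1] Ec[OF pol[OF r(2), rule_format, OF E1], of \<i>]] by simp
    then have qc: "continuous_on UNIV (\<lambda>x. q (?w x))" and q0: "integral ?P (\<lambda>x. g x * q (?w x)) = 0"
      unfolding E_def by (auto dest: spec[of _ 0])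
    have "integral ?P (\<lambda>x. g x * cnj (g x) - g x * q (?w x)) = integral ?P (\<lambda>x. g x * cnj (g x)) - integral ?P (\<lambda>x. g x * q (?w x))"
      by (intro Henstock_Kurzweil_Integration.integral_diff integrable_continuous_real continuous_intros cP c qc)
    moreover have "norm (integral ?P (\<lambda>x. g x * cnj (g x) - g x * q (?w x))) \<le> G * e * (2 * pi * lam - 0)"
    proof (rule integral_bound)
      show "continuous_on ?P (\<lambda>x. g x * cnj (g x) - g x * q (?w x))" by (intro continuous_intros cP c qc)
      fix x assume x: "x \<in> ?P"
      have "norm (g x * (cnj (g x) - q (?w x))) \<le> G * e"
        unfolding norm_mult using q(2)[of "?w x"] gw[of x] by (intro mult_mono G x G0) auto
      then show "norm (g x * cnj (g x) - g x * q (?w x)) \<le> G * e" by (simp add: right_diff_distrib)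
    qed (use lam in simp)
    ultimately show ?thesis using q0 by simp
  qed
  have "norm (integral ?P (\<lambda>x. g x * cnj (g x))) \<le> 0"
  proof (rule field_le_epsilon)
    fix e :: real assume e: "e > 0"
    have "norm (integral ?P (\<lambda>x. g x * cnj (g x))) \<le> G * (e / (G + 1) / (2 * pi * lam)) * (2 * pi * lam)"
      using e G0 lam by (intro b) (auto intro!: divide_pos_pos mult_pos_pos)
    also have "\<dots> = e * (G / (G + 1))" using lam by simp
    also have "\<dots> \<le> e * 1" using e G0 by (intro mult_left_mono) auto
    finally show "norm (integral ?P (\<lambda>x. g x * cnj (g x))) \<le> 0 + e" by simp
  qed
  then have i0: "integral ?P (\<lambda>x. g x * cnj (g x)) = 0" by simp
  have "(\<lambda>x. g x * cnj (g x)) integrable_on ?P" by (intro integrable_continuous_real continuous_intros cP c)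
  from integrable_integral[OF this] have "((\<lambda>x. g x * cnj (g x)) has_integral 0) ?P" unfolding i0 .
  have sq: "Re (z * cnj z) = (norm z)\<^sup>2" for z unfolding cmod_power2 by (simp add: power2_eq_square)
  from has_integral_linear[OF \<open>((\<lambda>x. g x * cnj (g x)) has_integral 0) ?P\<close> bounded_linear_Re]
  have "((\<lambda>x. (norm (g x))\<^sup>2) has_integral 0) ?P" unfolding o_def sq by simp
  then have i2: "((\<lambda>x. (norm (g x))\<^sup>2) has_integral 0) (cbox 0 (2 * pi * lam))" by simp
  have 0: "g x = 0" if "x \<in> ?P" for x
  proof -
    have "(norm (g x))\<^sup>2 = 0"
      by (rule has_integral_0_cbox_imp_0[OF _ _ i2])
        (use that mult_pos_pos[OF pi_gt_zero lam] in \<open>auto intro!: continuous_intros continuous_on_subset[OF c]\<close>)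
    then show ?thesis by simp
  qed
  interpret periodic_fun_simple g "2 * pi * lam" by standard (rule p)
  define k where "k = \<lfloor>x / (2 * pi * lam)\<rfloor>"
  have "x - of_int k * (2 * pi * lam) \<in> ?P"
    using floor_correct[of "x / (2 * pi * lam)"] lam unfolding k_def[symmetric] by (auto simp: field_simps)
  from 0[OF this] show ?thesis by (simp add: minus_of_int)
qed

lemma has_sum_single:
  assumes "\<And>i. i \<noteq> n \<Longrightarrow> f i = 0"
  shows "(f has_sum f n) UNIV"
proof -
  have "(f has_sum f n) {n}" using has_sum_finite[of "{n}" f] by simp
  then show ?thesis using assms by (subst has_sum_cong_neutral[of "{n}" UNIV f f]) auto
qed

lemma fourier_fun_summable:
  assumes "lam > 0" "test_fun lam \<phi>"
  shows "(\<lambda>m::int. norm (fourier_fun lam \<phi> (of_int m / lam))) summable_on UNIV"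
proof -
  obtain B where "\<forall>n\<le>0 + 2. \<forall>x. norm ((vderiv ^^ n) \<phi> x) \<le> B" using test_fun_bounded[OF assms] by blast
  then have "norm (norm (fourier_fun lam \<phi> (of_int m / lam))) \<le> 2^0 * ((1 + lam^(0 + 2)) * (2 * pi * lam * B)) * zw m" for m
    using fourier_fun_decay[OF assms, of 0 B m] by simp
  then show ?thesis by (rule summable_of_bound(1)) (intro summable_on_cmult_right zw_summable)
qed

text \<open>The series converges uniformly and has the coefficients of the right-hand side, so
  \<open>fourier_fun_zero\<close> identifies the two. The period remains as a factor because the
  coefficients are not normalized.\<close>

lemma fourier_inversion:
  assumes lam: "lam > 0" and t: "test_fun lam \<phi>"
  shows "infsum (\<lambda>m::int. fourier_fun lam \<phi> (of_int m / lam) * ph (of_int m / lam) x) UNIV = of_real (2 * pi * lam) * \<phi> x"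
proof -
  define c where "c m = fourier_fun lam \<phi> (of_int m / lam)" for m :: int
  define \<psi> where "\<psi> x = infsum (\<lambda>m::int. c m * ph (of_int m / lam) x) UNIV" for x
  note s = fourier_fun_summable[OF lam t, folded c_def]
  have \<psi>c: "continuous_on UNIV \<psi>" unfolding \<psi>_def
    by (rule continuous_on_infsum[OF _ s]) (auto simp: norm_mult intro!: continuous_intros)
  have \<psi>p: "\<psi> (x + 2 * pi * lam) = \<psi> x" for x unfolding \<psi>_def ph_periodic[OF lam] ..
  have "fourier_fun lam \<psi> (of_int n / lam) = c n * of_real (2 * pi * lam)" for n
  proof -
    have e: "osc_int 0 (- (of_int n / lam) + of_int i / lam) (\<lambda>r. c i) (2 * pi * lam) = (if i = n then c n * of_real (2 * pi * lam) else 0)" for i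
    proof -
      have "- (of_int n / lam) + of_int i / lam = of_int (i - n) / lam" by (simp add: diff_divide_distrib)
      then show ?thesis unfolding osc_int_def by (simp only: integral_mult_left integral_ph[OF lam]) simp
    qed
    have "((\<lambda>i. osc_int 0 (- (of_int n / lam) + of_int i / lam) (\<lambda>r. c i) (2 * pi * lam)) has_sum
        osc_int 0 (- (of_int n / lam)) \<psi> (2 * pi * lam)) UNIV"
      unfolding \<psi>_def by (rule osc_int_infsum[OF _ s]) auto
    moreover have "((\<lambda>i. osc_int 0 (- (of_int n / lam) + of_int i / lam) (\<lambda>r. c i) (2 * pi * lam)) has_sum c n * of_real (2 * pi * lam)) UNIV"
      unfolding e using has_sum_single[of n "\<lambda>i. if i = n then c n * of_real (2 * pi * lam) else 0"] by simp
    ultimately show ?thesis using has_sum_unique unfolding fourier_fun_ph osc_int_def by blast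
  qed
  moreover have "fourier_fun lam (\<lambda>x. \<psi> x + (- of_real (2 * pi * lam)) * \<phi> x) k = fourier_fun lam \<psi> k + fourier_fun lam (\<lambda>x. (- of_real (2 * pi * lam)) * \<phi> x) k" for k
    by (rule fourier_fun_add) (auto intro!: continuous_intros continuous_on_subset[OF \<psi>c] test_fun_continuous'[OF t])
  ultimately have "fourier_fun lam (\<lambda>x. \<psi> x + (- of_real (2 * pi * lam)) * \<phi> x) (of_int n / lam) = 0" for n
    by (simp only: fourier_fun_cmult c_def) simp
  then have "\<psi> x + (- of_real (2 * pi * lam)) * \<phi> x = 0"
    by (intro fourier_fun_zero[OF lam, of "\<lambda>x. \<psi> x + (- of_real (2 * pi * lam)) * \<phi> x"])
      (auto intro!: continuous_intros \<psi>c test_fun_continuous'[OF t] simp: \<psi>p test_fun_periodic[OF t])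
  then show ?thesis unfolding \<psi>_def c_def by (simp add: add_eq_0_iff)
qed

lemma periodic_distr_zero:
  assumes lam: "lam > 0" and f: "periodic_distr lam f" and z: "\<And>m::int. fourier f (of_int m / lam) = 0"
  shows "f \<phi> = 0"
proof (cases "test_fun lam \<phi>")
  case True
  note t = True
  obtain A N where A: "\<And>\<phi> B. test_fun lam \<phi> \<Longrightarrow> (\<forall>n\<le>N. \<forall>x. norm ((vderiv ^^ n) \<phi> x) \<le> B) \<Longrightarrow> norm (f \<phi>) \<le> A * B"
    using f unfolding periodic_distr_def by blast
  define P where "P = 2 * pi * lam"
  have P: "P > 0" unfolding P_def using lam by simp
  define c where "c m = fourier_fun lam \<phi> (of_int m / lam)" for m :: int
  have b: "norm (f \<phi>) \<le> A * (e / P)" if e: "e > 0" for e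
  proof -
    have u: "uniform_limit UNIV (\<lambda>F x. \<Sum>m\<in>F. fourier_fun lam ((vderiv ^^ n) \<phi>) (of_int m / lam) * ph (of_int m / lam) x)
      (\<lambda>x. infsum (\<lambda>m::int. fourier_fun lam ((vderiv ^^ n) \<phi>) (of_int m / lam) * ph (of_int m / lam) x) UNIV) (finite_subsets_at_top UNIV)" for n
      by (rule uniform_limit_infsum[OF _ fourier_fun_summable[OF lam test_fun_vderiv[OF t, of n]]]) (simp add: norm_mult)
    have "\<forall>\<^sub>F F in finite_subsets_at_top UNIV. \<forall>n\<in>{..N}. \<forall>x\<in>UNIV. dist (\<Sum>m\<in>F. fourier_fun lam ((vderiv ^^ n) \<phi>) (of_int m / lam) * ph (of_int m / lam) x)
      (infsum (\<lambda>m::int. fourier_fun lam ((vderiv ^^ n) \<phi>) (of_int m / lam) * ph (of_int m / lam) x) UNIV) < e"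
      by (intro eventually_ball_finite ballI uniform_limitD[OF u e]) simp
    \<comment> \<open>The continuity bound of \<open>f\<close> involves only the finitely many
      orders up to \<open>N\<close>, so one finite set \<open>F\<close> approximates all of them at
      once.\<close>
    from eventually_happens[OF this] obtain F where
      F: "\<And>n x. n \<le> N \<Longrightarrow> norm ((\<Sum>m\<in>F. fourier_fun lam ((vderiv ^^ n) \<phi>) (of_int m / lam) * ph (of_int m / lam) x) - of_real P * (vderiv ^^ n) \<phi> x) < e"
      unfolding fourier_inversion[OF lam test_fun_vderiv[OF t]] dist_norm P_def by auto
    \<comment> \<open>Minus the normalized partial sum. \<open>f\<close> vanishes on it, while its
      sum with \<open>\<phi>\<close> is small together with its derivatives up to order
      \<open>N\<close>.\<close>
    define \<sigma> where "\<sigma> = (\<lambda>x. \<Sum>m\<in>F. (- c m / of_real P) * ph (of_int m / lam) x)"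
    have \<sigma>t: "test_fun lam (\<lambda>x. (- c m / of_real P) * ph (of_int m / lam) x)" for m
      by (rule vderiv_cmult(2)[OF test_fun_ph[OF lam]])
    have t\<sigma>: "test_fun lam \<sigma>" unfolding \<sigma>_def using vderiv_sum[of lam "\<lambda>m x. (- c m / of_real P) * ph (of_int m / lam) x", OF \<sigma>t] by blast
    have "f \<sigma> = (\<Sum>m\<in>F. (- c m / of_real P) * f (ph (of_int m / lam)))"
      unfolding \<sigma>_def by (subst periodic_distr_sum[OF f \<sigma>t], subst periodic_distr_lin(2)[OF f test_fun_ph[OF lam]]) simp
    moreover have "f (ph (of_int m / lam)) = 0" for m using z[of "- m"] unfolding fourier_ph by simp
    ultimately have "f \<phi> = f (\<lambda>x. \<phi> x + \<sigma> x)" using periodic_distr_lin(1)[OF f t t\<sigma>] by simp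
    also have "norm \<dots> \<le> A * (e / P)"
    proof (rule A[OF vderiv_add(2)[OF t t\<sigma>]], intro allI impI)
      fix n x assume n: "n \<le> N"
      have "(vderiv ^^ n) \<sigma> x = (\<Sum>m\<in>F. (- c m / of_real P) * ((\<i> * of_real (of_int m / lam))^n * ph (of_int m / lam) x))"
        unfolding \<sigma>_def using vderiv_sum[of lam "\<lambda>m x. (- c m / of_real P) * ph (of_int m / lam) x", OF \<sigma>t] vderiv_cmult(1)[OF test_fun_ph[OF lam]] by (simp only: vderiv_ph)
      also have "\<dots> = - (\<Sum>m\<in>F. fourier_fun lam ((vderiv ^^ n) \<phi>) (of_int m / lam) * ph (of_int m / lam) x) / of_real P"
        unfolding fourier_fun_vderiv[OF lam t] c_def sum_negf[symmetric] sum_divide_distrib by (intro sum.cong) (auto simp: mult_ac)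
      finally have s: "(vderiv ^^ n) \<sigma> x = - (\<Sum>m\<in>F. fourier_fun lam ((vderiv ^^ n) \<phi>) (of_int m / lam) * ph (of_int m / lam) x) / of_real P" .
      have "(vderiv ^^ n) \<phi> x + (vderiv ^^ n) \<sigma> x
        = - ((\<Sum>m\<in>F. fourier_fun lam ((vderiv ^^ n) \<phi>) (of_int m / lam) * ph (of_int m / lam) x) - of_real P * (vderiv ^^ n) \<phi> x) / of_real P"
        unfolding s using P by (simp add: field_simps)
      then have "norm ((vderiv ^^ n) \<phi> x + (vderiv ^^ n) \<sigma> x)
        = norm ((\<Sum>m\<in>F. fourier_fun lam ((vderiv ^^ n) \<phi>) (of_int m / lam) * ph (of_int m / lam) x) - of_real P * (vderiv ^^ n) \<phi> x) / P"
        using P by (simp only: norm_divide norm_minus_cancel norm_of_real abs_of_pos)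
      also have "\<dots> \<le> e / P" using F[OF n, of x] P by (intro divide_right_mono) auto
      finally show "norm ((vderiv ^^ n) (\<lambda>x. \<phi> x + \<sigma> x) x) \<le> e / P" unfolding vderiv_add(1)[OF t t\<sigma>] .
    qed
    finally show ?thesis .
  qed
  have "norm (f \<phi>) \<le> 0"
  proof (rule field_le_epsilon)
    fix e :: real assume e: "e > 0"
    have "norm (f \<phi>) \<le> A * (e * P / (\<bar>A\<bar> + 1) / P)" using e P by (intro b) auto
    also have "\<dots> = e * (A / (\<bar>A\<bar> + 1))" using P by simp
    also have "\<dots> \<le> e * 1" using e by (intro mult_left_mono) auto
    finally show "norm (f \<phi>) \<le> 0 + e" by simp
  qed
  then show ?thesis by simp
qed (rule periodic_distr_lin(3)[OF f])

lemma periodic_distr_eqI: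
  assumes "lam > 0" "periodic_distr lam f" "periodic_distr lam g"
    and "\<And>m::int. fourier f (of_int m / lam) = fourier g (of_int m / lam)"
  shows "f = g"
proof
  fix \<phi>
  have "distr_diff f g \<phi> = 0"
    using assms(4) by (intro periodic_distr_zero[OF assms(1) periodic_distr_diff[OF assms(2,3)]]) (simp add: fourier_def distr_diff_def)
  then show "f \<phi> = g \<phi>" by (simp add: distr_diff_def)
qed

text \<open>The Parseval pairing. Since \<open>fourier\<close> tests against exponentials without
  conjugation, the coefficient at \<open>m\<close> is paired with that of the test function at
  \<open>- m\<close>.\<close>

definition synth :: "real \<Rightarrow> (int \<Rightarrow> complex) \<Rightarrow> distr" where
  "synth lam c \<phi> = (if test_fun lam \<phi>
     then infsum (\<lambda>m. c m * fourier_fun lam \<phi> (of_int (- m) / lam)) UNIV / of_real (2 * pi * lam) else 0)"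

lemma synth:
  assumes lam: "lam > 0" and c: "\<And>m::int. norm (c m) \<le> A * (1 + \<bar>of_int m\<bar>)^p"
  shows "periodic_distr lam (synth lam c)" and "fourier (synth lam c) (of_int m / lam) = c m"
proof -
  define C where "C = A * 2^p * (1 + lam^(p + 2)) * infsum zw UNIV"
  have A: "0 \<le> A" using order_trans[OF norm_ge_zero c[of 0]] by simp
  have zw_minus: "zw (- m) = zw m" for m unfolding zw_def by simp
  have bd: "norm (c m * fourier_fun lam \<phi> (of_int (- m) / lam)) \<le> A * (2^p * ((1 + lam^(p + 2)) * (2 * pi * lam * B))) * zw m"
    if "test_fun lam \<phi>" "\<And>n x. n \<le> p + 2 \<Longrightarrow> norm ((vderiv ^^ n) \<phi> x) \<le> B" for \<phi> B m
  proof -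
    have "norm (c m * fourier_fun lam \<phi> (of_int (- m) / lam)) \<le> A * (1 + \<bar>of_int m\<bar>)^p * norm (fourier_fun lam \<phi> (of_int (- m) / lam))"
      unfolding norm_mult by (intro mult_right_mono c) auto
    also have "\<dots> = A * ((1 + \<bar>of_int (- m)\<bar>)^p * norm (fourier_fun lam \<phi> (of_int (- m) / lam)))" by simp
    also have "\<dots> \<le> A * (2^p * ((1 + lam^(p + 2)) * (2 * pi * lam * B)) * zw (- m))"
      by (intro mult_left_mono fourier_fun_decay lam that A)
    finally show ?thesis unfolding zw_minus by (simp only: mult.assoc)
  qed
  have sm: "(\<lambda>m. c m * fourier_fun lam \<phi> (of_int (- m) / lam)) summable_on UNIV" if t: "test_fun lam \<phi>" for \<phi>
  proof -
    obtain B where "\<forall>n\<le>p + 2. \<forall>x. norm ((vderiv ^^ n) \<phi> x) \<le> B" using test_fun_bounded[OF lam t] by blast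
    then show ?thesis using summable_of_bound(1)[OF bd[OF t] summable_on_cmult_right[OF zw_summable]] by blast
  qed
  have "norm (synth lam c \<phi>) \<le> C * B"
    if t: "test_fun lam \<phi>" and B: "\<forall>n\<le>p + 2. \<forall>x. norm ((vderiv ^^ n) \<phi> x) \<le> B" for \<phi> B
  proof -
    have "norm (infsum (\<lambda>m. c m * fourier_fun lam \<phi> (of_int (- m) / lam)) UNIV)
      \<le> infsum (\<lambda>m. A * (2^p * ((1 + lam^(p + 2)) * (2 * pi * lam * B))) * zw m) UNIV"
      by (rule summable_of_bound(2)[OF bd[OF t] summable_on_cmult_right[OF zw_summable]]) (use B in blast)
    also have "\<dots> = C * B * (2 * pi * lam)" unfolding infsum_cmult_right' C_def by (simp only: mult_ac)
    finally have "norm (infsum (\<lambda>m. c m * fourier_fun lam \<phi> (of_int (- m) / lam)) UNIV) / (2 * pi * lam) \<le> C * B"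
      using lam by (simp add: pos_divide_le_eq mult_ac)
    then show ?thesis using t lam unfolding synth_def by (simp add: norm_divide norm_mult)
  qed
  moreover have "synth lam c (\<lambda>x. \<phi> x + \<psi> x) = synth lam c \<phi> + synth lam c \<psi>" if "test_fun lam \<phi>" "test_fun lam \<psi>" for \<phi> \<psi>
  proof -
    have "fourier_fun lam (\<lambda>x. \<phi> x + \<psi> x) k = fourier_fun lam \<phi> k + fourier_fun lam \<psi> k" for k
      by (intro fourier_fun_add test_fun_continuous'[OF that(1)] test_fun_continuous'[OF that(2)])
    then have "infsum (\<lambda>m. c m * fourier_fun lam (\<lambda>x. \<phi> x + \<psi> x) (of_int (- m) / lam)) UNIV
      = infsum (\<lambda>m. c m * fourier_fun lam \<phi> (of_int (- m) / lam)) UNIV + infsum (\<lambda>m. c m * fourier_fun lam \<psi> (of_int (- m) / lam)) UNIV"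
      using infsum_add[OF sm[OF that(1)] sm[OF that(2)]] by (simp only: distrib_left)
    then show ?thesis unfolding synth_def using that vderiv_add(2)[OF that] by (simp add: add_divide_distrib)
  qed
  moreover have "synth lam c (\<lambda>x. a * \<phi> x) = a * synth lam c \<phi>" if "test_fun lam \<phi>" for a \<phi>
  proof -
    have "(\<lambda>m. c m * fourier_fun lam (\<lambda>x. a * \<phi> x) (of_int (- m) / lam)) = (\<lambda>m. a * (c m * fourier_fun lam \<phi> (of_int (- m) / lam)))"
      unfolding fourier_fun_cmult by (simp only: mult_ac)
    then show ?thesis unfolding synth_def using that vderiv_cmult(2)[OF that] by (simp add: infsum_cmult_right')
  qed
  ultimately show "periodic_distr lam (synth lam c)"
    unfolding periodic_distr_def by (intro conjI exI[of _ C] exI[of _ "p + 2"]) (auto simp: synth_def)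
  have "fourier (synth lam c) (of_int m / lam) = synth lam c (ph (of_int (- m) / lam))" unfolding fourier_ph by simp
  also have "\<dots> = c m"
  proof -
    have "(\<lambda>i. c i * fourier_fun lam (ph (of_int (- m) / lam)) (of_int (- i) / lam)) = (\<lambda>i. if i = m then c m * of_real (2 * pi * lam) else 0)"
      by (simp only: fourier_fun_ph_ph[OF lam]) auto
    moreover have "infsum (\<lambda>i. if i = m then c m * of_real (2 * pi * lam) else 0) UNIV = c m * of_real (2 * pi * lam)"
      using has_sum_single[of m "\<lambda>i. if i = m then c m * of_real (2 * pi * lam) else 0"] by (intro infsumI) simp
    ultimately show ?thesis unfolding synth_def using test_fun_ph[OF lam, of "- m"] lam by simp
  qed
  finally show "fourier (synth lam c) (of_int m / lam) = c m" .
qed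

section \<open>Sobolev norms and the Duhamel equation in Fourier variables\<close>

lemma lipschitz_of_vderiv:
  fixes f :: "real \<Rightarrow> complex"
  assumes d: "\<And>r. (f has_vector_derivative f' r) (at r)" and B: "\<And>r. r \<in> {a..b} \<Longrightarrow> norm (f' r) \<le> B"
    and t: "t \<in> {a..b}" "u \<in> {a..b}"
  shows "norm (f t - f u) \<le> B * \<bar>t - u\<bar>"
proof -
  have "norm (f t - f u) \<le> B * norm (t - u)"
  proof (rule differentiable_bound[of "{a..b}" f "\<lambda>r h. h *\<^sub>R f' r"])
    fix r assume r: "r \<in> {a..b}"
    show "(f has_derivative (\<lambda>h. h *\<^sub>R f' r)) (at r within {a..b})"
      using has_vector_derivative_at_within[OF d] unfolding has_vector_derivative_def .
    have "0 \<le> B" using B[OF r] norm_ge_zero order_trans by blast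
    then show "onorm (\<lambda>h. h *\<^sub>R f' r) \<le> B"
      by (rule onorm_bound) (use mult_right_mono[OF B[OF r] abs_ge_zero] in \<open>simp add: mult.commute\<close>)
  qed (use t in auto)
  then show ?thesis by simp
qed

lemma ph_lipschitz: "norm (ph \<theta> t - ph \<theta> u) \<le> \<bar>\<theta>\<bar> * \<bar>t - u\<bar>"
  by (rule lipschitz_of_vderiv[OF ph_deriv, of "min t u" "max t u"]) (auto simp: norm_mult)

lemma fourier_fun_sum:
  assumes "\<And>i. continuous_on {0..2 * pi * lam} (h i)"
  shows "fourier_fun lam (\<lambda>x. \<Sum>i\<in>F. h i x) k = (\<Sum>i\<in>F. fourier_fun lam (h i) k)"
proof (induction F rule: infinite_finite_induct)
  case (insert i F)
  then show ?case
    using fourier_fun_add[OF assms[of i], of "\<lambda>x. \<Sum>i\<in>F. h i x" k] assms by (simp add: continuous_on_sum)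
qed (simp_all add: fourier_fun_ph)

context hkdv
begin

lemma lam_pos: "lam > 0" using lam1 by simp

definition fc :: "distr \<Rightarrow> int \<Rightarrow> complex" where "fc f m = fourier f (of_int m / lam)"

lemma fc_diff: "fc (distr_diff f g) m = fc f m - fc g m"
  and fc_add: "fc (distr_add f g) m = fc f m + fc g m"
  and fc_scale: "fc (distr_scale c f) m = c * fc f m"
  by (simp_all add: fc_def fourier_def distr_diff_def distr_add_def distr_scale_def)

lemma fc_eqI: "periodic_distr lam f \<Longrightarrow> periodic_distr lam g \<Longrightarrow> (\<And>m. fc f m = fc g m) \<Longrightarrow> f = g"
  using periodic_distr_eqI[OF lam_pos] unfolding fc_def by blast

text \<open>On nonzero frequencies \<open>jbracket (m / lam)\<close> and
  \<open>\<bar>m\<bar>\<close> lie within a factor \<open>2 * lam\<close> of each other. This is the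
  price, for either sign of \<open>s\<close>, of working with pure powers of
  \<open>\<bar>m\<bar>\<close>.\<close>

definition kpp :: real where "kpp = (2 * lam) powr \<bar>s\<bar>"

lemma kpp_pos: "kpp > 0" using lam1 unfolding kpp_def by simp

lemma powr_compare:
  assumes "0 < x" "0 < y" "x \<le> 2 * lam * y" "y \<le> 2 * lam * x"
  shows "x powr s \<le> kpp * y powr s"
proof (cases "0 \<le> s")
  case True
  have "x powr s \<le> (2 * lam * y) powr s" using assms True by (intro powr_mono2) auto
  then show ?thesis using True lam1 assms by (simp add: kpp_def powr_mult)
next
  case False
  have "y powr (- s) \<le> (2 * lam * x) powr (- s)" using assms False by (intro powr_mono2) auto
  then show ?thesis using False lam1 assms by (simp add: kpp_def powr_mult powr_minus field_simps)
qed

lemma jbracket_compare: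
  assumes "m \<noteq> 0"
  shows "jbracket (of_int m / lam) powr s \<le> kpp * \<bar>of_int m\<bar> powr s"
    and "\<bar>of_int m\<bar> powr s \<le> kpp * jbracket (of_int m / lam) powr s"
proof -
  define r :: real where "r = \<bar>of_int m\<bar>"
  have r: "1 \<le> r" unfolding r_def using assms by linarith
  let ?b = "jbracket (of_int m / lam)"
  have b: "?b = sqrt (1 + (r / lam)\<^sup>2)" unfolding jbracket_def r_def using lam1 by (simp add: abs_divide)
  have "?b \<le> 1 + r / lam" unfolding b using r lam1 by (intro real_le_lsqrt) (auto simp: power2_eq_square algebra_simps)
  also have "\<dots> \<le> r + r" using r lam1 by (intro add_mono) (auto simp: field_simps)
  also have "\<dots> \<le> 2 * lam * r" using lam1 r by simp
  finally have 1: "?b \<le> 2 * lam * r" .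
  have "r / lam \<le> ?b" unfolding b by (rule real_le_rsqrt) simp
  then have "r \<le> lam * ?b" using lam1 by (simp add: field_simps)
  also have "lam * ?b \<le> 2 * lam * ?b" using lam1 by (simp add: b)
  finally have 2: "r \<le> 2 * lam * ?b" .
  have 3: "0 < ?b" unfolding b by (simp add: add_pos_nonneg)
  show "?b powr s \<le> kpp * \<bar>of_int m\<bar> powr s" "\<bar>of_int m\<bar> powr s \<le> kpp * ?b powr s"
    using powr_compare[of ?b r] powr_compare[of r ?b] 1 2 3 r unfolding r_def by auto
qed

definition jw :: "distr \<Rightarrow> int \<Rightarrow> real" where
  "jw f m = (if m = 0 then 0 else jbracket (of_int m / lam) powr s * norm (fc f m))"

lemma freqs_eq: "freqs lam = (\<lambda>m. of_int m / lam) ` (UNIV - {0})"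
  unfolding freqs_def by auto

lemma inj_freq: "inj_on (\<lambda>m::int. of_int m / lam) X"
  using lam1 by (auto simp: inj_on_def)

lemma Hs_iff: "f \<in> Hs lam s \<longleftrightarrow> periodic_distr lam f \<and> fc f 0 = 0 \<and> (\<lambda>m. (jw f m)\<^sup>2) summable_on UNIV"
proof -
  have "(\<lambda>k. (jbracket k powr s * norm (fourier f k))\<^sup>2) summable_on freqs lam \<longleftrightarrow>
     (\<lambda>m. (jbracket (of_int m / lam) powr s * norm (fc f m))\<^sup>2) summable_on (UNIV - {0})"
    unfolding freqs_eq by (subst summable_on_reindex[OF inj_freq]) (simp add: o_def fc_def)
  also have "\<dots> \<longleftrightarrow> (\<lambda>m. (jw f m)\<^sup>2) summable_on UNIV"
    by (rule summable_on_cong_neutral) (auto simp: jw_def)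
  finally show ?thesis unfolding Hs_def by (auto simp: fc_def)
qed

lemma Hs_norm_eq: "Hs_norm lam s f = sqrt (1 / lam * infsum (\<lambda>m. (jw f m)\<^sup>2) UNIV)"
proof -
  have "infsum (\<lambda>k. (jbracket k powr s * norm (fourier f k))\<^sup>2) (freqs lam) =
     infsum (\<lambda>m. (jbracket (of_int m / lam) powr s * norm (fc f m))\<^sup>2) (UNIV - {0})"
    unfolding freqs_eq by (subst infsum_reindex[OF inj_freq]) (simp add: o_def fc_def)
  also have "\<dots> = infsum (\<lambda>m. (jw f m)\<^sup>2) UNIV"
    by (rule infsum_cong_neutral) (auto simp: jw_def)
  finally show ?thesis unfolding Hs_norm_def by simp
qed

lemma jw_nonneg: "0 \<le> jw f m" unfolding jw_def by simp

lemma Hs_norm_nonneg: "0 \<le> Hs_norm lam s f"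
  unfolding Hs_norm_eq using lam1 by (intro real_sqrt_ge_zero mult_nonneg_nonneg infsum_nonneg) auto

lemma Hs_HS:
  assumes "f \<in> Hs lam s"
  shows "HS (fc f) (kpp * sqrt lam * Hs_norm lam s f)"
proof -
  let ?I = "infsum (\<lambda>m. (jw f m)\<^sup>2) UNIV"
  have I: "0 \<le> ?I" by (intro infsum_nonneg) auto
  have "l2 (jw f) (sqrt ?I)"
    by (rule l2I_infsum) (use assms I in \<open>auto simp: Hs_iff jw_nonneg\<close>)
  from l2_cmult[OF this, of kpp] have l: "l2 (\<lambda>m. kpp * jw f m) (kpp * sqrt ?I)" using kpp_pos by simp
  have "sqrt lam * Hs_norm lam s f = sqrt ?I" unfolding Hs_norm_eq real_sqrt_mult[symmetric] using lam1 by simp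
  moreover have "l2 (\<lambda>m. \<bar>of_int m\<bar> powr s * norm (fc f m)) (kpp * sqrt ?I)"
  proof (rule l2_mono[OF l _ _ order_refl])
    show "\<bar>of_int m\<bar> powr s * norm (fc f m) \<le> kpp * jw f m" for m
      using mult_right_mono[OF jbracket_compare(2)[of m], of "norm (fc f m)"] by (simp add: jw_def mult_ac)
  qed simp
  ultimately show ?thesis using assms unfolding HS_def Hs_iff by (simp add: mult.assoc)
qed

lemma HS_Hs:
  assumes f: "periodic_distr lam f" and h: "HS (fc f) Q"
  shows "f \<in> Hs lam s" "Hs_norm lam s f \<le> kpp * Q"
proof -
  have "l2 (\<lambda>m. \<bar>of_int m\<bar> powr s * norm (fc f m)) Q" using h unfolding HS_def by blast
  from l2_cmult[OF this, of kpp] have l: "l2 (\<lambda>m. kpp * (\<bar>of_int m\<bar> powr s * norm (fc f m))) (kpp * Q)" using kpp_pos by simp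
  have l': "l2 (jw f) (kpp * Q)"
  proof (rule l2_mono[OF l jw_nonneg _ order_refl])
    show "jw f m \<le> kpp * (\<bar>of_int m\<bar> powr s * norm (fc f m))" for m
      using mult_right_mono[OF jbracket_compare(1)[of m], of "norm (fc f m)"] by (simp add: jw_def mult_ac)
  qed
  show "f \<in> Hs lam s" unfolding Hs_iff using f h l2_summable[OF l'] unfolding HS_def by blast
  have "1 / lam * infsum (\<lambda>m. (jw f m)\<^sup>2) UNIV \<le> 1 * infsum (\<lambda>m. (jw f m)\<^sup>2) UNIV"
    using lam1 by (intro mult_right_mono infsum_nonneg) auto
  then have "1 / lam * infsum (\<lambda>m. (jw f m)\<^sup>2) UNIV \<le> (kpp * Q)\<^sup>2" using l2_infsum[OF l'] by simp
  then show "Hs_norm lam s f \<le> kpp * Q"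
    unfolding Hs_norm_eq by (rule real_le_lsqrt[rotated -1]) (use l2_nonneg(2)[OF l'] lam1 in \<open>auto intro!: divide_nonneg_nonneg infsum_nonneg\<close>)
qed

lemma HS_norm_cong:
  assumes "HS v Q" and n: "\<And>m. norm (w m) = norm (v m)"
  shows "HS w Q"
proof -
  have "w 0 = 0" using assms(1) n[of 0] unfolding HS_def by simp
  then show ?thesis using assms(1) unfolding HS_def n by simp
qed

text \<open>The interaction representation \<open>e^(-i t K m) F u(t)(m / lam)\<close>.\<close>

definition vof :: "(real \<Rightarrow> distr) \<Rightarrow> real \<Rightarrow> int \<Rightarrow> complex" where
  "vof u t m = ph (- K m) t * fc (u t) m"

lemma norm_vof: "norm (vof u t m) = norm (fc (u t) m)" unfolding vof_def by (simp add: norm_mult)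

lemma fc_vof: "fc (u t) m = ph (K m) t * vof u t m"
  unfolding vof_def using ph_minus[of "K m" t] by (simp add: mult.assoc[symmetric])

text \<open>Dominated convergence: each coefficient is continuous in time, and all are dominated by
  one square summable sequence, so the sum of the squared differences is continuous in time.\<close>

lemma REP_CHs:
  assumes pd: "\<And>t. t \<in> {0..T} \<Longrightarrow> periodic_distr lam (u t)" and R: "REP 1 1 N 0 T (vof u)"
  shows "u \<in> CHs lam s T" and "t \<in> {0..T} \<Longrightarrow> Hs_norm lam s (u t) \<le> kpp * (CS 1 * N)"
proof -
  obtain e where e: "l2 e (CS 1 * N)" and ve: "\<And>t m. t \<in> {0..T} \<Longrightarrow> norm (fc (u t) m) \<le> wt m * e m"
    using REP_sup[OF R] unfolding norm_vof by auto
  have hs: "HS (fc (u t)) (CS 1 * N)" if "t \<in> {0..T}" for t by (rule HS_bound[OF e ve[OF that]])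
  show "t \<in> {0..T} \<Longrightarrow> Hs_norm lam s (u t) \<le> kpp * (CS 1 * N)" by (rule HS_Hs(2)[OF pd hs])
  have lim: "((\<lambda>r. Hs_norm lam s (distr_diff (u r) (u t))) \<longlongrightarrow> 0) (at t within {0..T})" if t: "t \<in> {0..T}" for t
  proof -
    have T: "0 \<le> T" using t by simp
    define a where "a r m = \<bar>of_int m\<bar> powr s * norm (fc (u (cl 0 T r)) m - fc (u t) m)" for r m
    have a0: "0 \<le> a r m" for r m unfolding a_def by simp
    have ab: "a r m \<le> 2 * e m" for r m
    proof (cases "m = 0")
      case True
      then show ?thesis unfolding a_def using l2_nonneg(1)[OF e] by simp
    next
      case False
      have "norm (fc (u (cl 0 T r)) m - fc (u t) m) \<le> wt m * e m + wt m * e m"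
        using norm_triangle_ineq4 ve[OF cl_in[OF T]] ve[OF t] add_mono order_trans by blast
      then have "a r m \<le> \<bar>of_int m\<bar> powr s * (wt m * e m + wt m * e m)" unfolding a_def by (intro mult_left_mono) auto
      also have "\<dots> = (wt m * \<bar>of_int m\<bar> powr s) * (2 * e m)" by (simp add: algebra_simps)
      finally show ?thesis unfolding wt_cancel[OF False] by simp
    qed
    \<comment> \<open>The squares are viewed as complex numbers because
      \<open>continuous_on_infsum\<close> is stated for complex summands.\<close>
    have B: "norm (complex_of_real ((a r m)\<^sup>2)) \<le> (2 * e m)\<^sup>2" for m r
      unfolding norm_of_real using power_mono[OF ab[of r m] a0, of 2] by (simp only: abs_power2)
    have s: "(\<lambda>m. (2 * e m)\<^sup>2) summable_on UNIV" using l2_summable[OF l2_cmult[OF e, of 2]] by simp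
    have fcc: "continuous_on UNIV (\<lambda>r. fc (u (cl 0 T r)) m)" for m
    proof -
      have "continuous_on {0..T} (\<lambda>r. fc (u r) m)" unfolding fc_vof
        by (intro continuous_intros REP_continuous[OF R]) auto
      then show ?thesis
        by (rule continuous_on_compose2) (use T in \<open>auto simp: cl_def intro!: continuous_intros\<close>)
    qed
    have as: "(\<lambda>m. (a r m)\<^sup>2) summable_on UNIV" for r
      by (rule summable_of_bound(1)[OF _ s]) (use power_mono[OF ab a0, of _ _ 2] in \<open>simp only: real_norm_def abs_power2\<close>)
    define X where "X r = infsum (\<lambda>m. (a r m)\<^sup>2) UNIV" for r
    have X0: "0 \<le> X r" for r unfolding X_def by (intro infsum_nonneg) auto
    have Xe: "infsum (\<lambda>m. complex_of_real ((a r m)\<^sup>2)) UNIV = of_real (X r)" for r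
      unfolding X_def by (intro infsumI has_sum_of_real has_sum_infsum as)
    have "continuous_on UNIV (\<lambda>r. infsum (\<lambda>m. complex_of_real ((a r m)\<^sup>2)) UNIV)"
      by (rule continuous_on_infsum[OF B s]) (auto simp: a_def intro!: continuous_intros fcc)
    then have "continuous_on UNIV (\<lambda>r. Re (of_real (X r)))" unfolding Xe by (rule continuous_on_Re)
    then have "isCont X t" by (simp add: continuous_on_eq_continuous_at)
    moreover have "X t = 0" unfolding X_def a_def using cl_id[OF t] by simp
    ultimately have "(X \<longlongrightarrow> 0) (at t)" by (simp add: isCont_def)
    then have "((\<lambda>r. kpp * sqrt (X r)) \<longlongrightarrow> kpp * sqrt 0) (at t within {0..T})"
      by (intro tendsto_intros) (rule tendsto_within_subset[of _ _ _ UNIV], auto)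
    then have l: "((\<lambda>r. kpp * sqrt (X r)) \<longlongrightarrow> 0) (at t within {0..T})" by simp
    have "\<forall>\<^sub>F r in at t within {0..T}. norm (Hs_norm lam s (distr_diff (u r) (u t))) \<le> kpp * sqrt (X r)"
      unfolding eventually_at_filter
    proof (intro always_eventually allI impI)
      fix r assume r: "r \<in> {0..T}"
      have "l2 (a r) (sqrt (X r))" by (rule l2I_infsum) (auto simp: a0 X0 as X_def[symmetric])
      then have "HS (fc (distr_diff (u r) (u t))) (sqrt (X r))"
        unfolding HS_def a_def fc_diff cl_id[OF r] using hs[OF r] hs[OF t] unfolding HS_def by simp
      from HS_Hs(2)[OF periodic_distr_diff[OF pd[OF r] pd[OF t]] this]
      show "norm (Hs_norm lam s (distr_diff (u r) (u t))) \<le> kpp * sqrt (X r)" using Hs_norm_nonneg by simp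
    qed
    then show ?thesis by (rule Lim_null_comparison[OF _ l])
  qed
  show "u \<in> CHs lam s T" unfolding CHs_def using HS_Hs(1)[OF pd hs] lim by blast
qed

section \<open>From coefficients to distributions, and smooth functions\<close>

lemma powr_le_pow:
  assumes "m \<noteq> 0" "\<bar>r\<bar> \<le> \<bar>s\<bar>"
  shows "\<bar>real_of_int m\<bar> powr r \<le> (1 + \<bar>of_int m\<bar>)^nat \<lceil>\<bar>s\<bar>\<rceil>"
proof -
  have m: "1 \<le> \<bar>real_of_int m\<bar>" using assms by linarith
  have "\<bar>real_of_int m\<bar> powr r \<le> \<bar>real_of_int m\<bar> powr real (nat \<lceil>\<bar>s\<bar>\<rceil>)"
    using m assms(2) by (intro powr_mono) linarith+
  also have "\<dots> \<le> (1 + \<bar>of_int m\<bar>) powr real (nat \<lceil>\<bar>s\<bar>\<rceil>)" using m by (intro powr_mono2) auto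
  also have "\<dots> = (1 + \<bar>of_int m\<bar>)^nat \<lceil>\<bar>s\<bar>\<rceil>" using m by (intro powr_realpow) auto
  finally show ?thesis .
qed

text \<open>Polynomial growth is the condition under which \<open>synth\<close> returns a
  distribution.\<close>

lemma HS_poly:
  assumes "HS v Q"
  shows "norm (v m) \<le> Q * (1 + \<bar>of_int m\<bar>)^nat \<lceil>\<bar>s\<bar>\<rceil>"
proof (cases "m = 0")
  case True
  then show ?thesis using assms l2_nonneg(2) unfolding HS_def by fastforce
next
  case False
  have l: "l2 (\<lambda>m. \<bar>of_int m\<bar> powr s * norm (v m)) Q" using assms unfolding HS_def by blast
  have "norm (v m) = wt m * (\<bar>of_int m\<bar> powr s * norm (v m))" by (rule HS_eq[OF assms])
  also have "\<dots> \<le> (1 + \<bar>of_int m\<bar>)^nat \<lceil>\<bar>s\<bar>\<rceil> * Q"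
    unfolding wt_def by (intro mult_mono powr_le_pow False l2_le[OF l]) auto
  finally show ?thesis by (simp only: mult.commute)
qed

text \<open>Inverse of \<open>vof\<close>: it restores the linear evolution and then the
  distribution.\<close>

definition ush :: "(real \<Rightarrow> int \<Rightarrow> complex) \<Rightarrow> real \<Rightarrow> distr" where
  "ush v t = synth lam (\<lambda>m. ph (K m) t * v t m)"

lemma ush:
  assumes "HS (v t) Q"
  shows "periodic_distr lam (ush v t)" "fc (ush v t) m = ph (K m) t * v t m" "vof (ush v) t m = v t m"
proof -
  have "norm (ph (K m) t * v t m) \<le> Q * (1 + \<bar>of_int m\<bar>)^nat \<lceil>\<bar>s\<bar>\<rceil>" for m
    using HS_poly[OF assms, of m] by (simp add: norm_mult)
  note S = synth[OF lam_pos this]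
  show "periodic_distr lam (ush v t)" unfolding ush_def by (rule S(1))
  show f: "fc (ush v t) m = ph (K m) t * v t m" for m unfolding ush_def fc_def by (rule S(2))
  show "vof (ush v) t m = v t m" unfolding vof_def f using ph_minus[of "K m" t] by (simp add: mult_ac)
qed

lemma distr_of_fun:
  assumes h: "continuous_on UNIV h"
  shows "periodic_distr lam (distr_of_fun lam h)" "fc (distr_of_fun lam h) m = fourier_fun lam h (of_int m / lam)"
proof -
  let ?P = "{0..2 * pi * lam}"
  have hc: "continuous_on ?P h" using h continuous_on_subset by blast
  have "bounded (h ` ?P)" by (intro compact_imp_bounded compact_continuous_image hc) simp
  then obtain H where H: "\<And>x. x \<in> ?P \<Longrightarrow> norm (h x) \<le> H" unfolding bounded_iff by blast
  have H0: "0 \<le> H" using order_trans[OF norm_ge_zero H[of 0]] lam_pos by simp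
  have "norm (distr_of_fun lam h \<phi>) \<le> (H * (2 * pi * lam)) * B"
    if t: "test_fun lam \<phi>" and B: "\<forall>n\<le>0. \<forall>x. norm ((vderiv ^^ n) \<phi> x) \<le> B" for \<phi> B
  proof -
    have "norm (integral ?P (\<lambda>x. h x * \<phi> x)) \<le> (H * B) * (2 * pi * lam - 0)"
    proof (rule integral_bound)
      show "continuous_on ?P (\<lambda>x. h x * \<phi> x)" by (intro continuous_intros hc test_fun_continuous'[OF t])
      show "norm (h x * \<phi> x) \<le> H * B" if "x \<in> ?P" for x
        unfolding norm_mult using B by (intro mult_mono H that H0) auto
    qed (use lam_pos in simp)
    then show ?thesis unfolding distr_of_fun_def using t by (simp add: mult_ac)
  qed
  moreover have "distr_of_fun lam h (\<lambda>x. \<phi> x + \<psi> x) = distr_of_fun lam h \<phi> + distr_of_fun lam h \<psi>"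
    if "test_fun lam \<phi>" "test_fun lam \<psi>" for \<phi> \<psi>
    unfolding distr_of_fun_def using that vderiv_add(2)[OF that] unfolding distrib_left
    by (auto intro!: Henstock_Kurzweil_Integration.integral_add integrable_continuous_real continuous_intros hc test_fun_continuous'[OF that(1)] test_fun_continuous'[OF that(2)])
  moreover have "distr_of_fun lam h (\<lambda>x. c * \<phi> x) = c * distr_of_fun lam h \<phi>" if "test_fun lam \<phi>" for c \<phi>
  proof -
    have "(\<lambda>x. h x * (c * \<phi> x)) = (\<lambda>x. c * (h x * \<phi> x))" by (simp add: mult_ac)
    then show ?thesis unfolding distr_of_fun_def using that vderiv_cmult(2)[OF that] by simp
  qed
  ultimately show "periodic_distr lam (distr_of_fun lam h)"
    unfolding periodic_distr_def by (intro conjI exI[of _ "H * (2 * pi * lam)"] exI[of _ 0]) (auto simp: distr_of_fun_def)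
  show "fc (distr_of_fun lam h) m = fourier_fun lam h (of_int m / lam)"
    unfolding fc_def fourier_ph distr_of_fun_def fourier_fun_ph using test_fun_ph[OF lam_pos, of "- m"] by (simp add: mult.commute)
qed

lemma smooth_REP:
  assumes g: "smooth_spacetime lam g" and T: "0 \<le> T"
  shows "periodic_distr lam (distr_of_fun lam (g t))" "\<exists>N. REP 1 1 N 0 T (vof (\<lambda>t. distr_of_fun lam (g t)))"
proof -
  obtain D' :: "nat \<Rightarrow> nat \<Rightarrow> real \<Rightarrow> real \<Rightarrow> complex" where D0: "D' 0 0 = g"
    and Dc: "\<And>m l. continuous_on UNIV (\<lambda>(t, x). D' m l t x)"
    and Dt: "\<And>m l t x. ((\<lambda>r. D' m l r x) has_vector_derivative D' (Suc m) l t x) (at t)"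
    and Dx: "\<And>m l t x. (D' m l t has_vector_derivative D' m (Suc l) t x) (at x)"
    and per: "\<And>t x. g t (x + 2 * pi * lam) = g t x" and mean: "\<And>t. integral {0..2 * pi * lam} (g t) = 0"
    using g unfolding smooth_spacetime_def by blast
  let ?P = "{0..2 * pi * lam}"
  have tf: "test_fun lam (g t)" and vd: "(vderiv ^^ n) (g t) = D' 0 n t" for t n
    using test_funI[of "\<lambda>n. D' 0 n t" lam, OF Dx] vderiv_iter[of "\<lambda>n. D' 0 n t" n, OF Dx] per by (simp_all add: D0)
  have gc: "continuous_on X (g t)" for X t by (rule test_fun_continuous'[OF tf])
  show "periodic_distr lam (distr_of_fun lam (g t))" by (rule distr_of_fun(1)[OF gc])
  define q where "q = nat \<lceil>\<bar>s\<bar>\<rceil>"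
  \<comment> \<open>\<open>2 * j + 1\<close> powers pay for the time derivative of
    \<open>ph (- K m) t\<close> and \<open>q\<close> powers for the weight; the decay
    \<open>zw\<close> is left over.\<close>
  define p where "p = 2 * j + 1 + q"
  have "\<exists>B. \<forall>t\<in>{0..T}. \<forall>x\<in>?P. norm (D' a n t x) \<le> B" for a n
  proof -
    have "compact ((\<lambda>(t, x). D' a n t x) ` ({0..T} \<times> ?P))"
      by (intro compact_continuous_image continuous_on_subset[OF Dc] compact_Times) auto
    then obtain B where "\<forall>y\<in>(\<lambda>(t, x). D' a n t x) ` ({0..T} \<times> ?P). norm y \<le> B"
      using compact_imp_bounded bounded_iff by meson
    then show ?thesis by fastforce
  qed
  then obtain B' where B': "\<And>a n t x. t \<in> {0..T} \<Longrightarrow> x \<in> ?P \<Longrightarrow> norm (D' a n t x) \<le> B' a n" by metis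
  \<comment> \<open>Orders \<open>a \<le> 1\<close> in time: the function itself, and its time
    derivative for the Lipschitz bound.\<close>
  define B where "B = (\<Sum>a\<le>1. \<Sum>n\<le>p+2. B' a n)"
  have B'0: "0 \<le> B' a n" for a n using order_trans[OF norm_ge_zero B'[of 0 0 a n]] T lam_pos by simp
  have BB: "norm (D' a n t x) \<le> B" if "t \<in> {0..T}" "x \<in> ?P" "a \<le> 1" "n \<le> p + 2" for a n t x
  proof -
    have "B' a n \<le> (\<Sum>n\<le>p+2. B' a n)" using that B'0 by (intro member_le_sum) auto
    also have "\<dots> \<le> B" unfolding B_def using that B'0
      by (intro member_le_sum[of a "{..1}" "\<lambda>a. \<Sum>n\<le>p+2. B' a n"]) (auto intro!: sum_nonneg simp del: sum.atMost_Suc)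
    finally show ?thesis using B'[OF that(1,2), of a n] by linarith
  qed
  have B0: "0 \<le> B" unfolding B_def using B'0 by (intro sum_nonneg) auto
  define C where "C = 2^p * ((1 + lam^(p + 2)) * (2 * pi * lam * B))"
  have C: "0 \<le> C" unfolding C_def using lam_pos B0 by simp
  let ?h = "\<lambda>t m. fourier_fun lam (g t) (of_int m / lam)"
  have h1: "(1 + \<bar>of_int m\<bar>)^p * norm (?h t m) \<le> C * zw m" if "t \<in> {0..T}" for t m
    unfolding C_def using that by (intro fourier_fun_decay lam_pos tf) (auto simp: vd intro!: BB)
  have h2: "(1 + \<bar>of_int m\<bar>)^p * norm (?h t m - ?h u m) \<le> C * \<bar>t - u\<bar> * zw m" if t: "t \<in> {0..T}" "u \<in> {0..T}" for t u m
  proof -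
    note tu = vderiv_cmult[OF tf[of u], where c = "- 1"]
    have "(1 + \<bar>of_int m\<bar>)^p * norm (fourier_fun lam (\<lambda>x. g t x + (- 1) * g u x) (of_int m / lam))
      \<le> 2^p * ((1 + lam^(p + 2)) * (2 * pi * lam * (B * \<bar>t - u\<bar>))) * zw m"
    proof (intro fourier_fun_decay lam_pos vderiv_add(2)[OF tf tu(2)])
      fix n x assume n: "n \<le> p + 2" and x: "x \<in> ?P"
      have "norm (D' 0 n t x - D' 0 n u x) \<le> B * \<bar>t - u\<bar>"
        by (rule lipschitz_of_vderiv[OF Dt _ t]) (use n x in \<open>auto intro!: BB\<close>)
      then show "norm ((vderiv ^^ n) (\<lambda>x. g t x + (- 1) * g u x) x) \<le> B * \<bar>t - u\<bar>"
        unfolding vderiv_add(1)[OF tf tu(2)] tu(1) vd by simp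
    qed
    moreover have "fourier_fun lam (\<lambda>x. g t x + (- 1) * g u x) (of_int m / lam) = ?h t m - ?h u m"
      by (subst fourier_fun_add) (auto simp only: fourier_fun_cmult intro!: continuous_intros gc, simp)
    ultimately show ?thesis unfolding C_def by (simp only: mult_ac)
  qed
  let ?v = "vof (\<lambda>t. distr_of_fun lam (g t))"
  have v: "?v t m = ph (- K m) t * ?h t m" for t m unfolding vof_def distr_of_fun(2)[OF gc] ..
  have key: "(1 + \<bar>of_int m\<bar>)^(2 * j + 1) * y \<le> wt m * Z" if "(1 + \<bar>of_int m\<bar>)^p * y \<le> Z" "m \<noteq> 0" "0 \<le> y" for m :: int and y Z
  proof -
    have "1 = wt m * \<bar>of_int m\<bar> powr s" using wt_cancel[OF that(2)] by simp
    also have "\<dots> \<le> wt m * (1 + \<bar>of_int m\<bar>)^q" unfolding q_def by (intro mult_left_mono powr_le_pow that wt_nonneg) auto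
    finally have "((1 + \<bar>of_int m\<bar>)^(2 * j + 1) * y) * 1 \<le> ((1 + \<bar>of_int m\<bar>)^(2 * j + 1) * y) * (wt m * (1 + \<bar>of_int m\<bar>)^q)"
      using that by (intro mult_left_mono) auto
    also have "\<dots> = wt m * ((1 + \<bar>of_int m\<bar>)^p * y)" unfolding p_def power_add[of _ "2 * j + 1" q] by (simp only: mult_ac)
    also have "\<dots> \<le> wt m * Z" by (intro mult_left_mono that wt_nonneg)
    finally show ?thesis by simp
  qed
  have X: "1 \<le> (1 + \<bar>real_of_int m\<bar>)^(2 * j + 1)" for m by (intro one_le_power) simp
  have small: "y \<le> wt m * Z" if "(1 + \<bar>of_int m\<bar>)^p * y \<le> Z" "m \<noteq> 0" "0 \<le> y" for m :: int and y Z
    using mult_right_mono[OF X that(3), of m] key[OF that] by simp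
  have v0: "?v t 0 = 0" for t unfolding v using mean by (simp add: fourier_fun_ph)
  have Kb: "\<bar>K m\<bar> \<le> (1 + \<bar>of_int m\<bar>)^(2 * j + 1)" for m
  proof -
    have "\<bar>of_int m\<bar> / lam \<le> 1 + \<bar>real_of_int m\<bar>" using divide_left_mono[of 1 lam "\<bar>real_of_int m\<bar>"] lam1 by simp
    then show ?thesis unfolding K_def power_abs abs_divide using lam1 by (intro power_mono) auto
  qed
  \<comment> \<open>The Lipschitz bound has one contribution from the phase and one from the
    coefficient, hence the factor 2.\<close>
  define e where "e m = 2 * C * zw m" for m
  have z1: "zw m \<le> infsum zw UNIV" for m using finite_sum_le_infsum[OF zw_summable, of "{m}"] zw_nonneg by simp
  have Z0: "0 \<le> infsum zw UNIV" by (intro infsum_nonneg zw_nonneg)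
  have "l2 zw (infsum zw UNIV)"
  proof (rule l2I_sq[OF zw_nonneg Z0])
    fix F :: "int set" assume F: "finite F"
    have "(\<Sum>i\<in>F. (zw i)\<^sup>2) \<le> (\<Sum>i\<in>F. infsum zw UNIV * zw i)"
      unfolding power2_eq_square by (intro sum_mono mult_right_mono z1 zw_nonneg)
    also have "\<dots> \<le> infsum zw UNIV * infsum zw UNIV" unfolding sum_distrib_left[symmetric]
      by (intro mult_left_mono Z0 finite_sum_le_infsum[OF zw_summable F]) (auto simp: zw_nonneg)
    finally show "(\<Sum>i\<in>F. (zw i)\<^sup>2) \<le> (infsum zw UNIV)\<^sup>2" by (simp add: power2_eq_square)
  qed
  from l2_cmult[OF this, of "2 * C"] have e: "l2 e (2 * C * infsum zw UNIV)" unfolding e_def using C by simp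
  have "REP 1 1 (2 * C * infsum zw UNIV) 0 T ?v"
  proof (rule REP_lipschitz[OF e T])
    fix t m assume t: "t \<in> {0..T}"
    show "norm (?v t m) \<le> wt m * e m"
    proof (cases "m = 0")
      case False
      have "norm (?h t m) \<le> wt m * (C * zw m)" by (rule small[OF h1[OF t] False]) simp
      also have "\<dots> \<le> wt m * e m" unfolding e_def using C zw_nonneg by (intro mult_left_mono wt_nonneg) (auto simp: mult_right_mono)
      finally show ?thesis unfolding v norm_mult by simp
    qed (simp add: v0)
    fix u assume u: "u \<in> {0..T}"
    show "norm (?v t m - ?v u m) \<le> wt m * e m * \<bar>t - u\<bar>"
    proof (cases "m = 0")
      case False
      have "?v t m - ?v u m = (ph (- K m) t - ph (- K m) u) * ?h t m + ph (- K m) u * (?h t m - ?h u m)"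
        unfolding v by (simp add: algebra_simps)
      then have "norm (?v t m - ?v u m) \<le> norm (ph (- K m) t - ph (- K m) u) * norm (?h t m) + norm (?h t m - ?h u m)"
        using norm_triangle_ineq by (metis norm_mult norm_ph mult_1)
      also have "\<dots> \<le> \<bar>t - u\<bar> * (wt m * (C * zw m)) + wt m * (C * \<bar>t - u\<bar> * zw m)"
      proof (rule add_mono)
        have "norm (ph (- K m) t - ph (- K m) u) * norm (?h t m) \<le> (\<bar>K m\<bar> * \<bar>t - u\<bar>) * norm (?h t m)"
          using ph_lipschitz[of "- K m" t u] by (intro mult_right_mono) auto
        also have "\<dots> \<le> ((1 + \<bar>of_int m\<bar>)^(2 * j + 1) * \<bar>t - u\<bar>) * norm (?h t m)"
          by (intro mult_right_mono Kb) auto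
        also have "\<dots> = \<bar>t - u\<bar> * ((1 + \<bar>of_int m\<bar>)^(2 * j + 1) * norm (?h t m))" by (simp only: mult_ac)
        also have "\<dots> \<le> \<bar>t - u\<bar> * (wt m * (C * zw m))" by (intro mult_left_mono key[OF h1[OF t] False]) auto
        finally show "norm (ph (- K m) t - ph (- K m) u) * norm (?h t m) \<le> \<bar>t - u\<bar> * (wt m * (C * zw m))" .
        show "norm (?h t m - ?h u m) \<le> wt m * (C * \<bar>t - u\<bar> * zw m)" by (rule small[OF h2[OF t u] False]) simp
      qed
      also have "\<dots> = wt m * e m * \<bar>t - u\<bar>" unfolding e_def by (simp add: algebra_simps)
      finally show ?thesis .
    qed (simp add: v0)
  qed
  then show "\<exists>N. REP 1 1 N 0 T ?v" by blast
qed

section \<open>Fourier truncation and the Duhamel equation\<close>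

definition Mn :: "nat \<Rightarrow> int set" where "Mn N = {n. \<bar>of_int n\<bar> \<le> lam * real N}"

lemma finite_Mn: "finite (Mn N)"
  using finite_Tr[of N 0] unfolding Tr_def Mn_def by simp

text \<open>\<open>Mn N\<close> contains 0, which \<open>freqs\<close> omits; the vanishing mean
  makes up for it, and the square becomes a convolution over all integers.\<close>

lemma trunc_eq:
  assumes "fc f 0 = 0"
  shows "trunc lam N f x = of_real (1 / (2 * pi * lam)) * (\<Sum>n\<in>Mn N. fc f n * ph (of_int n / lam) x)"
proof -
  have "{k \<in> freqs lam. \<bar>k\<bar> \<le> real N} = (\<lambda>m. of_int m / lam) ` (Mn N - {0})"
    unfolding freqs_eq Mn_def using lam_pos by (auto simp: field_simps abs_divide)
  then have "(\<Sum>k\<in>{k \<in> freqs lam. \<bar>k\<bar> \<le> real N}. fourier f k * exp (\<i> * of_real k * of_real x))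
     = (\<Sum>n\<in>Mn N - {0}. fc f n * ph (of_int n / lam) x)"
    by (simp only: exp_ph') (subst sum.reindex[OF inj_freq], simp add: fc_def)
  also have "\<dots> = (\<Sum>n\<in>Mn N. fc f n * ph (of_int n / lam) x)"
    by (rule sum.mono_neutral_left) (use assms finite_Mn in auto)
  finally show ?thesis unfolding trunc_def by simp
qed

lemma fourier_trunc_sq:
  assumes f: "fc f 0 = 0"
  shows "fourier_fun lam (\<lambda>x. (trunc lam N f x)\<^sup>2) (of_int m / lam) = of_real (1 / (2 * pi * lam)) * (\<Sum>n\<in>Tr N m. fc f n * fc f (m - n))"
proof -
  define c where "c = complex_of_real (1 / (2 * pi * lam))"
  \<comment> \<open>Two factors \<open>c\<close> from the inversion formula meet one period from the
    orthogonality of exponentials, so one \<open>c\<close> remains.\<close>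
  have c: "c * of_real (2 * pi * lam) = 1" unfolding c_def using lam_pos by (simp add: of_real_mult[symmetric] del: of_real_mult)
  have "(\<lambda>x. (trunc lam N f x)\<^sup>2) = (\<lambda>x. \<Sum>n\<in>Mn N. \<Sum>l\<in>Mn N. (c * c * fc f n * fc f l) * ph (of_int (n + l) / lam) x)"
    unfolding trunc_eq[OF f] c_def[symmetric] power2_eq_square
    by (simp only: ph_quot[symmetric] sum_distrib_left sum_product sum_distrib_right) (simp add: mult_ac)
  then have "fourier_fun lam (\<lambda>x. (trunc lam N f x)\<^sup>2) (of_int m / lam)
    = (\<Sum>n\<in>Mn N. \<Sum>l\<in>Mn N. (c * c * fc f n * fc f l) * (if m = n + l then of_real (2 * pi * lam) else 0))"
    by (simp only: fourier_fun_sum[OF continuous_on_sum[OF continuous_on_mult[OF continuous_on_const continuous_on_ph]]]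
        fourier_fun_sum[OF continuous_on_mult[OF continuous_on_const continuous_on_ph]] fourier_fun_cmult fourier_fun_ph_ph[OF lam_pos])
  also have "\<dots> = (\<Sum>n\<in>Mn N. if m - n \<in> Mn N then c * (fc f n * fc f (m - n)) else 0)"
  proof (rule sum.cong[OF refl])
    fix n assume "n \<in> Mn N"
    have "(\<Sum>l\<in>Mn N. (c * c * fc f n * fc f l) * (if m = n + l then of_real (2 * pi * lam) else 0))
      = (\<Sum>l\<in>Mn N. if m - n = l then c * (fc f n * fc f l) else 0)"
    proof (rule sum.cong[OF refl])
      fix l
      have "(c * c * fc f n * fc f l) * of_real (2 * pi * lam) = (c * of_real (2 * pi * lam)) * (c * (fc f n * fc f l))" by (simp only: mult_ac)
      then show "(c * c * fc f n * fc f l) * (if m = n + l then of_real (2 * pi * lam) else 0) = (if m - n = l then c * (fc f n * fc f l) else 0)"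
        unfolding c by auto
    qed
    then show "(\<Sum>l\<in>Mn N. (c * c * fc f n * fc f l) * (if m = n + l then of_real (2 * pi * lam) else 0)) = (if m - n \<in> Mn N then c * (fc f n * fc f (m - n)) else 0)"
      by (simp add: sum.delta'[OF finite_Mn])
  qed
  also have "\<dots> = (\<Sum>n\<in>Tr N m. c * (fc f n * fc f (m - n)))"
  proof -
    have "Tr N m = {n \<in> Mn N. m - n \<in> Mn N}" unfolding Tr_def Mn_def by auto
    then show ?thesis by (simp add: sum.inter_filter[OF finite_Mn])
  qed
  finally show ?thesis unfolding c_def sum_distrib_left .
qed

text \<open>The factor \<open>(-1)^j\<close> from \<open>\<i>^(2 * j + 1)\<close> and the sign in
  the equation combine to the same symbol \<open>- \<i> * k^(2 * j + 1)\<close> for every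
  \<open>j\<close>.\<close>

lemma exp_lin_symbol: "exp (- of_real t * lin_symbol j (of_int m / lam)) = ph (K m) t"
proof -
  define k where "k = of_int m / lam"
  have "(\<i> * of_real k)^(2 * j + 1) = \<i> * (-1)^j * of_real (k^(2 * j + 1))"
  proof -
    have "\<i>^(2 * j + 1) = \<i> * (-1)^j" by (simp add: power_mult)
    then show ?thesis unfolding power_mult_distrib by simp
  qed
  then have "lin_symbol j k = ((-1)^j * (-1)^j) * (- \<i> * of_real (k^(2 * j + 1)))"
    unfolding lin_symbol_def by (simp only: power_add power_one_right mult_ac) simp
  also have "(-1)^j * (-1)^j = (1 :: complex)" by (simp add: power_mult_distrib[symmetric])
  finally have "lin_symbol j k = - \<i> * of_real (k^(2 * j + 1))" by simp
  then show ?thesis unfolding ph_def K_def k_def[symmetric] cis_conv_exp by (simp add: mult_ac)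
qed

text \<open>Both sides of the equation at the frequency \<open>m / lam\<close> carry the unimodular
  factor \<open>ph (K m) t\<close>. Removing it turns the convolution of coefficients into
  \<open>Bint\<close> with the phase \<open>- Om m n\<close>.\<close>

lemma duhamel_iff:
  assumes u: "u \<in> CHs lam s T" and u0: "fc u0 0 = 0" and c: "\<And>m. continuous_on {0..T} (\<lambda>t. vof u t m)"
  shows "duhamel_solution j lam s T u0 u \<longleftrightarrow> dsol T (fc u0) (vof u)"
proof -
  have f0: "fc (u t) 0 = 0" if "t \<in> {0..T}" for t using u that unfolding CHs_def Hs_iff by blast
  let ?E = "\<lambda>t k N. exp (- of_real t * lin_symbol j k) * fourier u0 k
             - 1 / 2 * integral {0..t} (\<lambda>r. exp (- of_real (t - r) * lin_symbol j k) *
                 (\<i> * of_real k) * fourier_fun lam (\<lambda>x. (trunc lam N (u r) x)\<^sup>2) k)"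
  let ?G = "\<lambda>t m N. fc u0 m - kap * (\<Sum>n\<in>Tr N m. Bint 0 (vof u) (vof u) t m n)"
  have E: "?E t (of_int m / lam) N = ph (K m) t * ?G t m N" if t: "t \<in> {0..T}" for t m N
  proof -
    define k where "k = of_int m / lam"
    define a where "a = ph (K m) t * (\<i> * of_real k) * of_real (1 / (2 * pi * lam))"
    have "integral {0..t} (\<lambda>r. exp (- of_real (t - r) * lin_symbol j k) * (\<i> * of_real k) * fourier_fun lam (\<lambda>x. (trunc lam N (u r) x)\<^sup>2) k)
      = integral {0..t} (\<lambda>r. a * (\<Sum>n\<in>Tr N m. ph (- Om m n) r * (vof u r n * vof u r (m - n))))"
    proof (rule integral_cong)
      fix r assume r: "r \<in> {0..t}"
      have "ph (K m) (t - r) = ph (K m) t * ph (- K m) r" unfolding ph_def cis_mult by (simp add: algebra_simps)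
      moreover have "ph (- K m) r * (fc (u r) n * fc (u r) (m - n)) = ph (- Om m n) r * (vof u r n * vof u r (m - n))" for n
      proof -
        have "ph (- Om m n) r = ph (- K m) r * ph (K n) r * ph (K (m - n)) r"
          unfolding ph_add[symmetric] Om_def by (simp add: algebra_simps)
        then show ?thesis unfolding fc_vof[of u r] by (simp only: mult_ac)
      qed
      then have "(\<Sum>n\<in>Tr N m. ph (- Om m n) r * (vof u r n * vof u r (m - n))) = ph (- K m) r * (\<Sum>n\<in>Tr N m. fc (u r) n * fc (u r) (m - n))"
        unfolding sum_distrib_left by simp
      ultimately show "exp (- of_real (t - r) * lin_symbol j k) * (\<i> * of_real k) * fourier_fun lam (\<lambda>x. (trunc lam N (u r) x)\<^sup>2) k
        = a * (\<Sum>n\<in>Tr N m. ph (- Om m n) r * (vof u r n * vof u r (m - n)))"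
        using fourier_trunc_sq[OF f0, of r N m] r t unfolding k_def a_def exp_lin_symbol by (simp only: mult_ac) simp
    qed
    also have "\<dots> = a * (\<Sum>n\<in>Tr N m. osc_int 0 (- Om m n) (\<lambda>r. vof u r n * vof u r (m - n)) t)"
    proof -
      have ct: "continuous_on {0..t} (\<lambda>r. vof u r n)" for n by (rule continuous_on_subset[OF c]) (use t in auto)
      show ?thesis unfolding integral_mult_right osc_int_def
        by (subst Henstock_Kurzweil_Integration.integral_sum)
          (auto simp: finite_Tr intro!: integrable_continuous_real continuous_intros ct)
    qed
    finally have i: "integral {0..t} (\<lambda>r. exp (- of_real (t - r) * lin_symbol j k) * (\<i> * of_real k) * fourier_fun lam (\<lambda>x. (trunc lam N (u r) x)\<^sup>2) k)
      = a * (\<Sum>n\<in>Tr N m. osc_int 0 (- Om m n) (\<lambda>r. vof u r n * vof u r (m - n)) t)" .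
    have "1 / 2 * a = ph (K m) t * (kap * of_int m)"
      unfolding a_def kap_def k_def using lam_pos by (simp add: power2_eq_square)
    then have "1 / 2 * (a * S) = ph (K m) t * (kap * (of_int m * S))" for S by (simp add: mult.assoc[symmetric])
    then show ?thesis unfolding i[unfolded k_def] unfolding exp_lin_symbol Bint_def sum_distrib_left[symmetric]
      unfolding fc_def by (simp only: right_diff_distrib)
  qed
  have iff: "(?E t (of_int m / lam) \<longlonglongrightarrow> fourier (u t) (of_int m / lam)) \<longleftrightarrow> (?G t m \<longlonglongrightarrow> vof u t m)" if t: "t \<in> {0..T}" for t m
  proof -
    have 1: "ph (- K m) t * (ph (K m) t * z) = z" for z
    proof -
      have "ph (- K m) t * (ph (K m) t * z) = (ph (K m) t * ph (- K m) t) * z" by (simp only: mult_ac)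
      then show ?thesis unfolding ph_minus by simp
    qed
    have "(\<lambda>N. ph (K m) t * ?G t m N) \<longlonglongrightarrow> ph (K m) t * vof u t m" if "?G t m \<longlonglongrightarrow> vof u t m"
      by (intro tendsto_intros that)
    moreover have "?G t m \<longlonglongrightarrow> vof u t m" if "(\<lambda>N. ph (K m) t * ?G t m N) \<longlonglongrightarrow> ph (K m) t * vof u t m"
      using tendsto_mult[OF tendsto_const[of "ph (- K m) t"] that] unfolding 1 .
    ultimately show ?thesis unfolding E[OF t] fc_vof[of u t m, unfolded fc_def] by blast
  qed
  \<comment> \<open>\<open>dsol\<close> also asks for \<open>m = 0\<close>, which
    \<open>freqs\<close> leaves out; there both sides vanish.\<close>
  have z: "?G t 0 \<longlonglongrightarrow> vof u t 0" if "t \<in> {0..T}" for t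
    unfolding Bint_def vof_def f0[OF that] u0 by simp
  have "duhamel_solution j lam s T u0 u \<longleftrightarrow> (\<forall>t\<in>{0..T}. \<forall>m\<in>UNIV - {0}. ?E t (of_int m / lam) \<longlonglongrightarrow> fourier (u t) (of_int m / lam))"
    unfolding duhamel_solution_def freqs_eq using u by blast
  also have "\<dots> \<longleftrightarrow> (\<forall>t\<in>{0..T}. \<forall>m\<in>UNIV - {0}. ?G t m \<longlonglongrightarrow> vof u t m)" using iff by blast
  also have "\<dots> \<longleftrightarrow> dsol T (fc u0) (vof u)" unfolding dsol_def using z by (metis Diff_iff UNIV_I singletonD)
  finally show ?thesis .
qed

end

section \<open>The solution space and well-posedness\<close>

context hkdv
begin

definition Y :: "real \<Rightarrow> (real \<Rightarrow> distr) set" where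
  "Y T = {u. (\<forall>t\<in>{0..T}. periodic_distr lam (u t)) \<and> (\<exists>N. REP 1 1 N 0 T (vof u))}"

text \<open>A quotient norm over all splittings, as these are not unique. The infimum is not known
  to be attained, whence the strict inequality in \<open>nrm_REP\<close> and the additional
  \<open>e\<close> in the estimates.\<close>

definition nrm :: "real \<Rightarrow> (real \<Rightarrow> distr) \<Rightarrow> real" where
  "nrm T u = Inf {N. REP 1 1 N 0 T (vof u)}"

lemma bdd_REP: "bdd_below {N. REP 1 1 N 0 T v}"
  by (rule bdd_belowI[of _ 0]) (auto intro: REP_nonneg)

lemma nrm_le: "REP 1 1 N 0 T (vof u) \<Longrightarrow> nrm T u \<le> N"
  unfolding nrm_def by (rule cInf_lower[OF _ bdd_REP]) simp

lemma nrm_nonneg: "u \<in> Y T \<Longrightarrow> 0 \<le> nrm T u"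
  unfolding nrm_def Y_def by (rule cInf_greatest) (auto intro: REP_nonneg)

lemma nrm_REP:
  assumes "u \<in> Y T" "nrm T u < N"
  shows "REP 1 1 N 0 T (vof u)"
proof -
  have "{N. REP 1 1 N 0 T (vof u)} \<noteq> {}" using assms(1) unfolding Y_def by blast
  from cInf_lessD[OF this, of N] assms(2) obtain N' where "REP 1 1 N' 0 T (vof u)" "N' < N"
    unfolding nrm_def by blast
  then show ?thesis using REP_mono less_imp_le by blast
qed

lemma Y_I: "(\<And>t. t \<in> {0..T} \<Longrightarrow> periodic_distr lam (u t)) \<Longrightarrow> REP 1 1 N 0 T (vof u) \<Longrightarrow> u \<in> Y T"
  unfolding Y_def by blast

lemma Y_pd: "u \<in> Y T \<Longrightarrow> t \<in> {0..T} \<Longrightarrow> periodic_distr lam (u t)"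
  unfolding Y_def by blast

lemma Y_REP: "u \<in> Y T \<Longrightarrow> \<exists>N. REP 1 1 N 0 T (vof u)"
  unfolding Y_def by blast

lemma vof_add: "vof (\<lambda>t. distr_add (u t) (v t)) = (\<lambda>t m. vof u t m + vof v t m)"
  unfolding vof_def fc_add by (simp add: distrib_left)

lemma vof_diff: "vof (\<lambda>t. distr_diff (u t) (v t)) = (\<lambda>t m. vof u t m - vof v t m)"
  unfolding vof_def fc_diff by (simp add: right_diff_distrib)

lemma vof_scale: "vof (\<lambda>t. distr_scale c (u t)) = (\<lambda>t m. c * vof u t m)"
  unfolding vof_def fc_scale by (simp add: mult.left_commute)

lemma fc_zero: "fc (\<lambda>\<phi>. 0) m = 0" unfolding fc_def fourier_def ..

lemma REP_zero: "REP 1 1 0 0 T (\<lambda>t m. 0)"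
  using REP_const[OF l2_0[of 0], of "\<lambda>m. 0"] by simp

lemma Y_cong:
  assumes u: "u \<in> Y T" and e: "\<forall>t\<in>{0..T}. v t = u t"
  shows "v \<in> Y T" "nrm T v = nrm T u"
proof -
  have "REP 1 1 N 0 T (vof v) \<longleftrightarrow> REP 1 1 N 0 T (vof u)" for N
    using e by (auto elim!: REP_cong simp: vof_def)
  then show "v \<in> Y T" "nrm T v = nrm T u" using u e unfolding Y_def nrm_def by auto
qed

lemma Y_zero: "(\<lambda>t \<phi>. 0) \<in> Y T" "nrm T (\<lambda>t \<phi>. 0) = 0"
proof -
  have R: "REP 1 1 0 0 T (vof (\<lambda>t \<phi>. 0))" using REP_zero unfolding vof_def fc_zero by simp
  show z: "(\<lambda>t \<phi>. 0) \<in> Y T" by (rule Y_I[OF periodic_distr_0 R])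
  show "nrm T (\<lambda>t \<phi>. 0) = 0" using nrm_le[OF R] nrm_nonneg[OF z] by simp
qed

lemma Y_add:
  assumes "u \<in> Y T" "v \<in> Y T"
  shows "(\<lambda>t. distr_add (u t) (v t)) \<in> Y T" "nrm T (\<lambda>t. distr_add (u t) (v t)) \<le> nrm T u + nrm T v"
proof -
  have R: "REP 1 1 (N + M) 0 T (vof (\<lambda>t. distr_add (u t) (v t)))" if "nrm T u < N" "nrm T v < M" for N M
    unfolding vof_add by (intro REP_add nrm_REP assms that) auto
  show "(\<lambda>t. distr_add (u t) (v t)) \<in> Y T"
    by (rule Y_I[OF periodic_distr_add R[of "nrm T u + 1" "nrm T v + 1"]]) (use assms in \<open>auto intro: Y_pd\<close>)
  show "nrm T (\<lambda>t. distr_add (u t) (v t)) \<le> nrm T u + nrm T v"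
  proof (rule field_le_epsilon)
    fix e :: real assume "e > 0"
    then show "nrm T (\<lambda>t. distr_add (u t) (v t)) \<le> nrm T u + nrm T v + e"
      using nrm_le[OF R[of "nrm T u + e/2" "nrm T v + e/2"]] by simp
  qed
qed

lemma Y_scale:
  assumes "u \<in> Y T"
  shows "(\<lambda>t. distr_scale c (u t)) \<in> Y T" "nrm T (\<lambda>t. distr_scale c (u t)) = norm c * nrm T u"
proof -
  have R: "REP 1 1 (norm c * N) 0 T (vof (\<lambda>t. distr_scale c (u t)))" if "nrm T u < N" "u \<in> Y T" for N c u
    unfolding vof_scale by (intro REP_cmult nrm_REP that)
  have Yc: "(\<lambda>t. distr_scale c (u t)) \<in> Y T" if "u \<in> Y T" for c u
    by (rule Y_I[OF periodic_distr_scale R[of u "nrm T u + 1"]]) (use that in \<open>auto intro: Y_pd\<close>)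
  then show "(\<lambda>t. distr_scale c (u t)) \<in> Y T" using assms .
  have le: "nrm T (\<lambda>t. distr_scale c (u t)) \<le> norm c * nrm T u" if u: "u \<in> Y T" for c u
  proof (rule field_le_epsilon)
    fix e :: real assume e: "e > 0"
    have "nrm T (\<lambda>t. distr_scale c (u t)) \<le> norm c * (nrm T u + e / (norm c + 1))"
      using e by (intro nrm_le R u) (auto intro!: divide_pos_pos add_nonneg_pos)
    also have "\<dots> = norm c * nrm T u + e * (norm c / (norm c + 1))" by (simp add: distrib_left mult.commute)
    also have "\<dots> \<le> norm c * nrm T u + e * 1" using e by (intro add_left_mono mult_left_mono) (auto simp: divide_le_eq_1 add_nonneg_pos)
    finally show "nrm T (\<lambda>t. distr_scale c (u t)) \<le> norm c * nrm T u + e" by simp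
  qed
  show "nrm T (\<lambda>t. distr_scale c (u t)) = norm c * nrm T u"
  proof (cases "c = 0")
    case True
    then have "(\<lambda>t. distr_scale c (u t)) = (\<lambda>t \<phi>. 0)" by (simp add: distr_scale_def)
    then show ?thesis using True Y_zero(2) by simp
  next
    case False
    have "(\<lambda>t. distr_scale (1 / c) (distr_scale c (u t))) = u" using False by (simp add: distr_scale_def)
    then have "nrm T u \<le> norm (1 / c) * nrm T (\<lambda>t. distr_scale c (u t))" using le[OF Yc[OF assms, of c], of "1 / c"] by simp
    then have "norm c * nrm T u \<le> nrm T (\<lambda>t. distr_scale c (u t))" using False by (simp add: norm_divide field_simps)
    then show ?thesis using le[OF assms, of c] by simp
  qed
qed

lemma Y_Hs_norm:
  assumes u: "u \<in> Y T" and t: "t \<in> {0..T}"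
  shows "Hs_norm lam s (u t) \<le> kpp * CS 1 * nrm T u"
proof (rule field_le_epsilon)
  fix e :: real assume e: "e > 0"
  have k: "0 < kpp * CS 1" using kpp_pos CS_pos by simp
  have "REP 1 1 (nrm T u + e / (kpp * CS 1)) 0 T (vof u)" using e k by (intro nrm_REP u) simp
  from REP_CHs(2)[OF Y_pd[OF u] this t]
  have "Hs_norm lam s (u t) \<le> (kpp * CS 1) * (nrm T u + e / (kpp * CS 1))" by (simp add: mult.assoc)
  also have "\<dots> = kpp * CS 1 * nrm T u + e" using kpp_pos CS_pos[of 1] by (simp add: distrib_left)
  finally show "Hs_norm lam s (u t) \<le> kpp * CS 1 * nrm T u + e" .
qed

lemma Y_CHs: "u \<in> Y T \<Longrightarrow> u \<in> CHs lam s T"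
  using REP_CHs(1) Y_pd Y_REP by blast

lemma Y_Hs: "u \<in> Y T \<Longrightarrow> t \<in> {0..T} \<Longrightarrow> u t \<in> Hs lam s"
  using Y_CHs unfolding CHs_def by blast

lemma nrm_eq_0:
  assumes u: "u \<in> Y T"
  shows "nrm T u = 0 \<longleftrightarrow> (\<forall>t\<in>{0..T}. u t = (\<lambda>\<phi>. 0))"
proof
  assume z: "nrm T u = 0"
  show "\<forall>t\<in>{0..T}. u t = (\<lambda>\<phi>. 0)"
  proof
    fix t assume t: "t \<in> {0..T}"
    have "Hs_norm lam s (u t) = 0" using Y_Hs_norm[OF u t] Hs_norm_nonneg[of "u t"] unfolding z by simp
    then have "HS (fc (u t)) 0" using Hs_HS[OF Y_Hs[OF u t]] by simp
    then show "u t = (\<lambda>\<phi>. 0)" by (intro fc_eqI[OF Y_pd[OF u t] periodic_distr_0]) (simp add: HS_0D fc_zero)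
  qed
next
  assume "\<forall>t\<in>{0..T}. u t = (\<lambda>\<phi>. 0)"
  then show "nrm T u = 0" using Y_cong(2)[OF Y_zero(1), of T u] Y_zero(2) by simp
qed

lemma Y_complete:
  assumes U: "\<And>n::nat. U n \<in> Y T"
    and cauchy: "\<And>e. e > 0 \<Longrightarrow> \<exists>M. \<forall>m\<ge>M. \<forall>n\<ge>M. nrm T (\<lambda>t. distr_diff (U m t) (U n t)) < e"
  shows "\<exists>u\<in>Y T. (\<lambda>n. nrm T (\<lambda>t. distr_diff (U n t) (u t))) \<longlonglongrightarrow> 0"
proof -
  let ?r = "\<lambda>k::nat. (1/2 :: real)^k"
  have diffY: "(\<lambda>t. distr_diff (v t) (w t)) \<in> Y T" if "v \<in> Y T" "w \<in> Y T" for v w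
  proof -
    have "(\<lambda>t. distr_diff (v t) (w t)) = (\<lambda>t. distr_add (v t) (distr_scale (- 1) (w t)))"
      by (simp add: distr_diff_def distr_add_def distr_scale_def)
    then show ?thesis using Y_add(1)[OF that(1) Y_scale(1)[OF that(2)]] by simp
  qed
  have "\<forall>k. \<exists>M. \<forall>m\<ge>M. \<forall>n\<ge>M. nrm T (\<lambda>t. distr_diff (U m t) (U n t)) < ?r k" using cauchy by simp
  then obtain M where M: "\<And>k m n. m \<ge> M k \<Longrightarrow> n \<ge> M k \<Longrightarrow> nrm T (\<lambda>t. distr_diff (U m t) (U n t)) < ?r k" by metis
  \<comment> \<open>Sums of thresholds are indices above every \<open>M l\<close> with
    \<open>l \<le> k\<close>, so consecutive members of the subsequence are within
    \<open>(1/2)^k\<close> of each other.\<close>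
  define sub where "sub k = (\<Sum>i\<le>k. M i)" for k
  have "M k \<le> sub l" if "k \<le> l" for k l unfolding sub_def using that by (intro member_le_sum) auto
  then have sub: "M k \<le> sub k" "M k \<le> sub (Suc k)" for k by simp_all
  have RU: "REP 1 1 (?r k) 0 T (\<lambda>t m. vof (U a) t m - vof (U b) t m)" if "a \<ge> M k" "b \<ge> M k" for a b k
    using nrm_REP[OF diffY[OF U U] M[OF that]] unfolding vof_diff .
  let ?V = "\<lambda>k t m. vof (U (sub k)) t m"
  have tail: "\<exists>w. REP 1 1 (2 * ?r k) 0 T w \<and> (\<forall>t\<in>{0..T}. \<forall>m. (\<lambda>i. ?V (Suc (i + k)) t m - ?V (i + k) t m) sums w t m)" for k
  proof -
    have g: "(\<lambda>i. ?r (i + k)) sums (2 * ?r k)"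
      using sums_mult2[OF geometric_sums[of "1/2 :: real"], of "?r k"] by (simp add: power_add)
    show ?thesis
      using REP_series[of 1 1 "\<lambda>i. ?r (i + k)" 0 T "\<lambda>i t m. ?V (Suc (i + k)) t m - ?V (i + k) t m"] RU[OF sub(2) sub(1)]
        sums_summable[OF g] sums_unique[OF g] by simp
  qed
  obtain w where w: "REP 1 1 (2 * ?r 0) 0 T w" "\<And>t m. t \<in> {0..T} \<Longrightarrow> (\<lambda>i. ?V (Suc (i + 0)) t m - ?V (i + 0) t m) sums w t m"
    using tail[of 0] by blast
  define v where "v t m = ?V 0 t m + w t m" for t m
  have lim: "(\<lambda>i. ?V i t m) \<longlonglongrightarrow> v t m" if t: "t \<in> {0..T}" for t m
  proof -
    have "(\<lambda>n. \<Sum>i<n. ?V (Suc i) t m - ?V i t m) \<longlonglongrightarrow> w t m" using w(2)[OF t] unfolding sums_def by simp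
    then have "(\<lambda>n. ?V n t m - ?V 0 t m) \<longlonglongrightarrow> w t m" unfolding sum_lessThan_telescope[of "\<lambda>i. ?V i t m"] .
    from tendsto_add[OF tendsto_const[of "?V 0 t m"] this] show ?thesis unfolding v_def by simp
  qed
  obtain N0 where "REP 1 1 N0 0 T (vof (U (sub 0)))" using Y_REP[OF U] by blast
  from REP_add[OF this w(1)] have Rv: "REP 1 1 (N0 + 2 * ?r 0) 0 T v" unfolding v_def by simp
  \<comment> \<open>The limit is formed on the side of the coefficients, and \<open>ush\<close>
    turns it into distributions.\<close>
  have uv: "periodic_distr lam (ush v t)" "vof (ush v) t m = v t m" if "t \<in> {0..T}" for t m
    by (rule ush[of v t, OF REP_HS[OF Rv zero_less_one that]])+
  have Ru: "REP 1 1 (N0 + 2 * ?r 0) 0 T (vof (ush v))" by (rule REP_cong[OF Rv]) (rule uv(2))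
  have uY: "ush v \<in> Y T" by (rule Y_I[OF uv(1) Ru])
  have Rk: "REP 1 1 (2 * ?r k) 0 T (\<lambda>t m. vof (U (sub k)) t m - vof (ush v) t m)" for k
  proof -
    obtain z where z: "REP 1 1 (2 * ?r k) 0 T z" "\<And>t m. t \<in> {0..T} \<Longrightarrow> (\<lambda>i. ?V (Suc (i + k)) t m - ?V (i + k) t m) sums z t m"
      using tail[of k] by blast
    have "REP 1 1 (norm (- 1 :: complex) * (2 * ?r k)) 0 T (\<lambda>t m. - 1 * z t m)" by (rule REP_cmult[OF z(1)])
    then have "REP 1 1 (2 * ?r k) 0 T (\<lambda>t m. - z t m)" by simp
    then show ?thesis
    proof (rule REP_cong)
      fix t m assume t: "t \<in> {0..T}"
      have d: "(\<lambda>i. ?V (Suc (i + k)) t m - ?V (i + k) t m) sums (v t m - ?V (0 + k) t m)"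
        using telescope_sums[OF LIMSEQ_ignore_initial_segment[OF lim[OF t], of k]] by simp
      show "vof (U (sub k)) t m - vof (ush v) t m = - z t m"
        using sums_unique2[OF d z(2)[OF t]] uv(2)[OF t, of m] by (simp add: algebra_simps)
    qed
  qed
  have fin: "nrm T (\<lambda>t. distr_diff (U n t) (ush v t)) \<le> 3 * ?r k" if "n \<ge> M k" for n k
    using nrm_le[of "?r k + 2 * ?r k" T "\<lambda>t. distr_diff (U n t) (ush v t)"] REP_add[OF RU[OF that sub(1)] Rk[of k]]
    unfolding vof_diff by simp
  have "(\<lambda>n. nrm T (\<lambda>t. distr_diff (U n t) (ush v t))) \<longlonglongrightarrow> 0"
  proof (rule LIMSEQ_I)
    fix e :: real assume e: "e > 0"
    obtain k where k: "?r k < e / 3" using real_arch_pow_inv[of "e / 3" "1/2"] e by auto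
    have "norm (nrm T (\<lambda>t. distr_diff (U n t) (ush v t)) - 0) < e" if "n \<ge> M k" for n
      using fin[OF that] nrm_nonneg[OF diffY[OF U uY], of n] k by simp
    then show "\<exists>n0. \<forall>n\<ge>n0. norm (nrm T (\<lambda>t. distr_diff (U n t) (ush v t)) - 0) < e" by blast
  qed
  then show ?thesis using uY by blast
qed

lemma solution_space_Y:
  assumes T: "T > 0"
  shows "solution_space lam s T (Y T) (nrm T)"
  unfolding solution_space_def
proof (intro conjI)
  show "\<forall>u\<in>Y T. \<forall>v. (\<forall>t\<in>{0..T}. v t = u t) \<longrightarrow> v \<in> Y T \<and> nrm T v = nrm T u" using Y_cong by blast
  show "(\<lambda>t \<phi>. 0) \<in> Y T" by (rule Y_zero)
  show "\<forall>u\<in>Y T. \<forall>v\<in>Y T. (\<lambda>t. distr_add (u t) (v t)) \<in> Y T \<and> nrm T (\<lambda>t. distr_add (u t) (v t)) \<le> nrm T u + nrm T v"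
    using Y_add by blast
  show "\<forall>c. \<forall>u\<in>Y T. (\<lambda>t. distr_scale c (u t)) \<in> Y T \<and> nrm T (\<lambda>t. distr_scale c (u t)) = norm c * nrm T u"
    using Y_scale by blast
  show "\<forall>u\<in>Y T. 0 \<le> nrm T u \<and> (nrm T u = 0 \<longleftrightarrow> (\<forall>t\<in>{0..T}. u t = (\<lambda>\<phi>. 0)))"
    using nrm_nonneg nrm_eq_0 by blast
  show "\<forall>U :: nat \<Rightarrow> real \<Rightarrow> distr. (\<forall>n. U n \<in> Y T) \<longrightarrow>
        (\<forall>e>0. \<exists>M. \<forall>m\<ge>M. \<forall>n\<ge>M. nrm T (\<lambda>t. distr_diff (U m t) (U n t)) < e) \<longrightarrow>
        (\<exists>u\<in>Y T. (\<lambda>n. nrm T (\<lambda>t. distr_diff (U n t) (u t))) \<longlonglongrightarrow> 0)"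
    by (intro allI impI Y_complete) blast+
  show "Y T \<subseteq> CHs lam s T" using Y_CHs by blast
  show "\<exists>C. \<forall>u\<in>Y T. \<forall>t\<in>{0..T}. Hs_norm lam s (u t) \<le> C * nrm T u" using Y_Hs_norm by blast
  show "\<forall>g. smooth_spacetime lam g \<longrightarrow> (\<lambda>t. distr_of_fun lam (g t)) \<in> Y T"
    using smooth_REP[of _ T] T unfolding Y_def by auto
qed

lemma HS_add:
  assumes "HS v P" "HS w Q"
  shows "HS (\<lambda>m. v m + w m) (P + Q)"
proof -
  have l: "l2 (\<lambda>m. \<bar>of_int m\<bar> powr s * norm (v m) + \<bar>of_int m\<bar> powr s * norm (w m)) (P + Q)"
    using assms unfolding HS_def by (intro l2_add) auto
  have "l2 (\<lambda>m. \<bar>of_int m\<bar> powr s * norm (v m + w m)) (P + Q)"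
  proof (rule l2_mono[OF l _ _ order_refl])
    show "\<bar>of_int m\<bar> powr s * norm (v m + w m) \<le> \<bar>of_int m\<bar> powr s * norm (v m) + \<bar>of_int m\<bar> powr s * norm (w m)" for m
      unfolding distrib_left[symmetric] by (intro mult_left_mono norm_triangle_ineq) auto
  qed simp
  then show ?thesis using assms unfolding HS_def by simp
qed

lemma HS_mono: "HS v P \<Longrightarrow> P \<le> Q \<Longrightarrow> HS v Q"
  unfolding HS_def by (auto elim: l2_mono)

lemma Hs_diff:
  assumes "f \<in> Hs lam s" "g \<in> Hs lam s"
  shows "distr_diff f g \<in> Hs lam s"
proof -
  have "HS (\<lambda>m. - fc g m) (kpp * sqrt lam * Hs_norm lam s g)" by (rule HS_norm_cong[OF Hs_HS[OF assms(2)]]) simp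
  from HS_add[OF Hs_HS[OF assms(1)] this] have "HS (fc (distr_diff f g)) (kpp * sqrt lam * Hs_norm lam s f + kpp * sqrt lam * Hs_norm lam s g)"
    unfolding fc_diff by simp
  then show ?thesis using HS_Hs(1) periodic_distr_diff assms unfolding Hs_iff by blast
qed

lemma dsol_cong:
  assumes d: "dsol T v0 v" and e: "\<And>t m. t \<in> {0..T} \<Longrightarrow> w t m = v t m"
  shows "dsol T v0 w"
proof -
  have "Bint 0 w w t m n = Bint 0 v v t m n" if "t \<in> {0..T}" for t m n
  proof -
    have "osc_int 0 (- Om m n) (\<lambda>r. w r n * w r (m - n)) t = osc_int 0 (- Om m n) (\<lambda>r. v r n * v r (m - n)) t"
      by (rule osc_int_cong) (use that e in auto)
    then show ?thesis unfolding Bint_def by simp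
  qed
  then show ?thesis using d e unfolding dsol_def by simp
qed

lemma well_posed: "locally_well_posed j lam s"
  unfolding locally_well_posed_def
proof (intro exI[of _ Y] exI[of _ nrm] conjI allI impI ballI)
  show "solution_space lam s T (Y T) (nrm T)" if "T > 0" for T by (rule solution_space_Y[OF that])
  fix u0 assume u0: "u0 \<in> Hs lam s"
  define c where "c = kpp * sqrt lam"
  have c: "0 < c" unfolding c_def using kpp_pos lam1 by simp
  \<comment> \<open>The \<open>+ 1\<close> accounts for the radius 1 of the neighbourhood, so that
    one existence time serves all data in it; \<open>c\<close> converts Sobolev norms into bounds on
    coefficients.\<close>
  define M where "M = c * (Hs_norm lam s u0 + 1)"
  have M: "0 < M" unfolding M_def using c Hs_norm_nonneg[of u0] by (intro mult_pos_pos) auto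
  define V where "V = {v0 \<in> Hs lam s. Hs_norm lam s (distr_diff v0 u0) < 1}"
  obtain \<tau> C L \<Psi> where \<tau>: "0 < \<tau>" and L: "0 < L"
    and \<Psi>: "\<And>v0. HS v0 M \<Longrightarrow> REP 1 1 C 0 \<tau> (\<Psi> v0)" "\<And>v0. HS v0 M \<Longrightarrow> dsol \<tau> v0 (\<Psi> v0)"
    and lip: "\<And>v0 w0 Q t. HS v0 M \<Longrightarrow> HS w0 M \<Longrightarrow> HS (\<lambda>m. v0 m - w0 m) Q \<Longrightarrow> t \<in> {0..\<tau>} \<Longrightarrow> HS (\<lambda>m. \<Psi> v0 t m - \<Psi> w0 t m) (L * Q)"
    using solution_map[OF M] by blast
  define \<Phi> where "\<Phi> v0 = ush (\<Psi> (fc v0))" for v0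
  have VM: "HS (fc v0) M" if v0: "v0 \<in> V" for v0
  proof -
    have h: "v0 \<in> Hs lam s" "Hs_norm lam s (distr_diff v0 u0) < 1" using v0 unfolding V_def by auto
    have "HS (\<lambda>m. fc (distr_diff v0 u0) m + fc u0 m) (c * Hs_norm lam s (distr_diff v0 u0) + c * Hs_norm lam s u0)"
      unfolding c_def by (intro HS_add Hs_HS Hs_diff h u0)
    then have "HS (fc v0) (c * Hs_norm lam s (distr_diff v0 u0) + c * Hs_norm lam s u0)" unfolding fc_diff by simp
    then show ?thesis
    proof (rule HS_mono)
      show "c * Hs_norm lam s (distr_diff v0 u0) + c * Hs_norm lam s u0 \<le> M"
        unfolding M_def distrib_left[symmetric] using h c by (intro mult_left_mono) auto
    qed
  qed
  have HS\<Psi>: "HS (\<Psi> (fc v0) t) (CS 1 * C)" if "v0 \<in> V" "t \<in> {0..\<tau>}" for v0 t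
    by (rule REP_HS[OF \<Psi>(1)[OF VM[OF that(1)]] zero_less_one that(2)])
  have pd\<Phi>: "periodic_distr lam (\<Phi> v0 t)" and fc\<Phi>: "fc (\<Phi> v0 t) m = ph (K m) t * \<Psi> (fc v0) t m"
    and vof\<Phi>: "vof (\<Phi> v0) t m = \<Psi> (fc v0) t m" if "v0 \<in> V" "t \<in> {0..\<tau>}" for v0 t m
    unfolding \<Phi>_def by (rule ush[of "\<Psi> (fc v0)" t, OF HS\<Psi>[OF that]])+
  have R\<Phi>: "REP 1 1 C 0 \<tau> (vof (\<Phi> v0))" if "v0 \<in> V" for v0
    by (rule REP_cong[OF \<Psi>(1)[OF VM[OF that]]]) (rule vof\<Phi>[OF that])
  have Y\<Phi>: "\<Phi> v0 \<in> Y \<tau>" if "v0 \<in> V" for v0 by (rule Y_I[OF pd\<Phi>[OF that] R\<Phi>[OF that]])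
  have duh: "duhamel_solution j lam s \<tau> v0 w \<longleftrightarrow> dsol \<tau> (fc v0) (vof w)" if v0: "v0 \<in> V" and w: "w \<in> Y \<tau>" for v0 w
  proof -
    obtain N where N: "REP 1 1 N 0 \<tau> (vof w)" using Y_REP[OF w] by blast
    have "fc v0 0 = 0" using v0 unfolding V_def Hs_iff by blast
    then show ?thesis by (rule duhamel_iff[OF Y_CHs[OF w]]) (rule REP_continuous[OF N], auto)
  qed
  have dsol\<Phi>: "dsol \<tau> (fc v0) (vof (\<Phi> v0))" if "v0 \<in> V" for v0
    by (rule dsol_cong[OF \<Psi>(2)[OF VM[OF that]]]) (rule vof\<Phi>[OF that])
  have uniq: "w t = \<Phi> v0 t" if v0: "v0 \<in> V" and w: "w \<in> Y \<tau>" and d: "duhamel_solution j lam s \<tau> v0 w" and t: "t \<in> {0..\<tau>}" for v0 w t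
  proof (rule fc_eqI[OF Y_pd[OF w t] pd\<Phi>[OF v0 t]])
    fix m
    obtain N where N: "REP 1 1 N 0 \<tau> (vof w)" using Y_REP[OF w] by blast
    have "dsol \<tau> (fc v0) (vof w)" using d duh[OF v0 w] by blast
    from solution_unique[OF N R\<Phi>[OF v0] this dsol\<Phi>[OF v0] t, of m]
    show "fc (w t) m = fc (\<Phi> v0 t) m" unfolding fc_vof[of w] fc_vof[of "\<Phi> v0"] by simp
  qed
  have cont: "Hs_norm lam s (distr_diff (\<Phi> w0 t) (\<Phi> v0 t)) \<le> kpp * L * c * Hs_norm lam s (distr_diff w0 v0)"
    if v0: "v0 \<in> V" and w0: "w0 \<in> V" and t: "t \<in> {0..\<tau>}" for v0 w0 t
  proof -
    have "distr_diff w0 v0 \<in> Hs lam s" using v0 w0 Hs_diff unfolding V_def by blast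
    from Hs_HS[OF this] have "HS (\<lambda>m. fc w0 m - fc v0 m) (c * Hs_norm lam s (distr_diff w0 v0))" unfolding fc_diff c_def .
    from lip[OF VM[OF w0] VM[OF v0] this t]
    have "HS (fc (distr_diff (\<Phi> w0 t) (\<Phi> v0 t))) (L * (c * Hs_norm lam s (distr_diff w0 v0)))"
      by (rule HS_norm_cong) (simp add: fc_diff fc\<Phi>[OF v0 t] fc\<Phi>[OF w0 t] right_diff_distrib[symmetric] norm_mult)
    from HS_Hs(2)[OF periodic_distr_diff[OF pd\<Phi>[OF w0 t] pd\<Phi>[OF v0 t]] this] show ?thesis by (simp only: mult.assoc)
  qed
  have cont': "\<exists>d>0. \<forall>w0\<in>V. Hs_norm lam s (distr_diff w0 v0) < d \<longrightarrow> (\<forall>t\<in>{0..\<tau>}. Hs_norm lam s (distr_diff (\<Phi> w0 t) (\<Phi> v0 t)) < e)"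
    if v0: "v0 \<in> V" and e: "e > 0" for v0 e
  proof -
    define B where "B = kpp * L * c"
    have B: "0 < B" unfolding B_def using kpp_pos L c by simp
    have "Hs_norm lam s (distr_diff (\<Phi> w0 t) (\<Phi> v0 t)) < e"
      if w0: "w0 \<in> V" and d: "Hs_norm lam s (distr_diff w0 v0) < e / B" and t: "t \<in> {0..\<tau>}" for w0 t
    proof -
      have "B * Hs_norm lam s (distr_diff w0 v0) < e" using d B by (simp add: pos_less_divide_eq mult.commute)
      then show ?thesis using cont[OF v0 w0 t] unfolding B_def by linarith
    qed
    then show ?thesis using e B by (intro exI[of _ "e / B"]) auto
  qed
  show "\<exists>T>0. \<exists>R>0. \<exists>\<Phi> :: distr \<Rightarrow> real \<Rightarrow> distr.
           let V = {v0 \<in> Hs lam s. Hs_norm lam s (distr_diff v0 u0) < R} in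
           (\<forall>v0\<in>V. \<Phi> v0 \<in> Y T \<and> duhamel_solution j lam s T v0 (\<Phi> v0) \<and>
              (\<forall>w\<in>Y T. duhamel_solution j lam s T v0 w \<longrightarrow> (\<forall>t\<in>{0..T}. w t = \<Phi> v0 t))) \<and>
           (\<forall>v0\<in>V. \<forall>e>0. \<exists>d>0. \<forall>w0\<in>V. Hs_norm lam s (distr_diff w0 v0) < d \<longrightarrow>
              (\<forall>t\<in>{0..T}. Hs_norm lam s (distr_diff (\<Phi> w0 t) (\<Phi> v0 t)) < e))"
  proof (rule exI[of _ \<tau>], rule conjI[OF \<tau>], rule exI[of _ 1], rule conjI[OF zero_less_one], rule exI[of _ \<Phi>],
      unfold Let_def V_def[symmetric], intro conjI ballI allI impI)
    fix v0 assume v0: "v0 \<in> V"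
    show "\<Phi> v0 \<in> Y \<tau>" by (rule Y\<Phi>[OF v0])
    show "duhamel_solution j lam s \<tau> v0 (\<Phi> v0)" using duh[OF v0 Y\<Phi>[OF v0]] dsol\<Phi>[OF v0] by blast
    show "w t = \<Phi> v0 t" if "w \<in> Y \<tau>" "duhamel_solution j lam s \<tau> v0 w" "t \<in> {0..\<tau>}" for w t
      by (rule uniq[OF v0 that])
    show "\<exists>d>0. \<forall>w0\<in>V. Hs_norm lam s (distr_diff w0 v0) < d \<longrightarrow> (\<forall>t\<in>{0..\<tau>}. Hs_norm lam s (distr_diff (\<Phi> w0 t) (\<Phi> v0 t)) < e)"
      if "e > 0" for e by (rule cont'[OF v0 that])
  qed
qed

end

theorem theorem1p1:
  fixes j :: nat and lam s :: real
  assumes "j \<ge> 2" and "lam \<ge> 1" and "s \<ge> - real j + 1 / 2"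
  shows "locally_well_posed j lam s"
proof -
  interpret hkdv j lam s by unfold_locales (rule assms)+
  show ?thesis by (rule well_posed)
qed

end
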